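(* Let $P_U,P_V$ be probability distributions on $\mathbb{R}$ with finite second moments and strictly positive variances. Let $\alpha>0$ and let $m=m_n$ be positive integers with $m/n\to\alpha$ as $n\to\infty$. Then for every $\lambda>0$, the free energy $F_n(\lambda)$ (defined in the context) satisfies $$F_n(\lambda)\xrightarrow[n\to\infty]{}\ \sup_{(q_u,q_v)\in\Gamma(\lambda,\alpha)}\mathcal{F}(\lambda,\alpha,q_u,q_v)\;=\;\sup_{q_v\ge 0}\ \inf_{q_u\ge 0}\ \mathcal{F}(\lambda,\alpha,q_u,q_v).$$ Moreover, these extrema are achieved over the same couples $(q_u,q_v)\in\Gamma(\lambda,\alpha)$: a couple $(q_u,q_v)\in\mathbb{R}_+^2$ belongs to $\Gamma(\lambda,\alpha)$ and attains the supremum over $\Gamma(\lambda,\alpha)$ if and only if $q_v$ attains the supremum over $q_v\geq 0$ of $\inf_{q_u'\ge0}\mathcal{F}(\lambda,\alpha,q_u',q_v)$ and $q_u$ attains the infimum $\inf_{q_u'\ge 0}\mathcal{F}(\lambda,\alpha,q_u',q_v)$.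
   Context: Let $(U_i)_{1\le i\le n}$ be i.i.d. from $P_U$, $(V_j)_{1\le j\le m}$ i.i.d. from $P_V$, and $(Z_{i,j})$ i.i.d. standard normal, all independent. The observations are $Y_{i,j}=\sqrt{\lambda/n}\,U_iV_j+Z_{i,j}$, $1\le i\le n$, $1\le j\le m$. Define the Hamiltonian, for $(\mathbf{u},\mathbf{v})\in\mathbb{R}^n\times\mathbb{R}^m$, $$H_n(\mathbf{u},\mathbf{v})=\sum_{i=1}^n\sum_{j=1}^m \sqrt{\tfrac{\lambda}{n}}\,u_iv_jZ_{i,j}+\tfrac{\lambda}{n}u_iU_iv_jV_j-\tfrac{\lambda}{2n}u_i^2v_j^2,$$ and the free energy $$F_n(\lambda)=\frac1n\,\mathbb{E}\log\left(\int dP_U^{\otimes n}(\mathbf{u})\,dP_V^{\otimes m}(\mathbf{v})\,e^{H_n(\mathbf{u},\mathbf{v})}\right),$$ where $\mathbb{E}$ is with respect to $(\mathbf{U},\mathbf{V},\mathbf{Z})$. For a probability distribution $P_X$ on $\mathbb{R}$ with finite second moment, let $X\sim P_X$ and $Z\sim\mathcal{N}(0,1)$ be independent, and for $\gamma\ge0$ let $Y=\sqrt{\gamma}X+Z$. Define $$F_{P_X}(\gamma)=\mathbb{E}\big[X\,\mathbb{E}[X|Y]\big],\qquad \psi_{P_X}(\gamma)=\mathbb{E}\log\left(\int dP_X(x)\exp\big(\sqrt{\gamma}xZ+\gamma xX-\tfrac{\gamma}{2}x^2\big)\right).$$ Define $$\Gamma(\lambda,\alpha)=\{(q_u,q_v)\in\mathbb{R}_+^2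 : q_u=F_{P_U}(\lambda\alpha q_v),\ q_v=F_{P_V}(\lambda q_u)\},$$ $$\mathcal{F}(\lambda,\alpha,q_u,q_v)=\psi_{P_U}(\lambda\alpha q_v)+\alpha\,\psi_{P_V}(\lambda q_u)-\tfrac{\lambda\alpha}{2}q_uq_v.$$ *)

theory Defs
  imports "HOL-Probability.Probability"
begin

text \<open>Vectors indexed by \<open>1..n\<close> are rendered as functions on \<open>{..<n}\<close>; the noise matrix \<open>Z\<close> is a
  function on \<open>{..<n} \<times> {..<m}\<close>.\<close>

text \<open>The Hamiltonian also depends on the signal vectors \<open>U\<close>, \<open>V\<close> and on the noise \<open>Z\<close>.
  Its arguments \<open>u\<close>, \<open>v\<close> are the integration variables.\<close>

definition hamiltonian ::
  "nat \<Rightarrow> nat \<Rightarrow> real \<Rightarrow> (nat \<Rightarrow> real) \<Rightarrow> (nat \<Rightarrow> real) \<Rightarrow> (nat \<times> nat \<Rightarrow> real)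
    \<Rightarrow> (nat \<Rightarrow> real) \<Rightarrow> (nat \<Rightarrow> real) \<Rightarrow> real"
  where "hamiltonian n m lam U V Z u v =
    (\<Sum>i<n. \<Sum>j<m. sqrt (lam / real n) * u i * v j * Z (i, j)
        + lam / real n * u i * U i * v j * V j
        - lam / (2 * real n) * (u i)\<^sup>2 * (v j)\<^sup>2)"

text \<open>The joint law of \<open>(\<^bold>U, \<^bold>V, \<^bold>Z)\<close>: all entries independent, with
  \<open>U\<^sub>i \<sim> PU\<close>, \<open>V\<^sub>j \<sim> PV\<close> and standard normal \<open>Z\<^sub>i\<^sub>j\<close>.\<close>

definition disorder ::
  "real measure \<Rightarrow> real measure \<Rightarrow> nat \<Rightarrow> nat
    \<Rightarrow> ((nat \<Rightarrow> real) \<times> (nat \<Rightarrow> real) \<times> (nat \<times> nat \<Rightarrow> real)) measure"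
  where "disorder PU PV n m =
    (\<Pi>\<^sub>M i\<in>{..<n}. PU) \<Otimes>\<^sub>M (\<Pi>\<^sub>M j\<in>{..<m}. PV) \<Otimes>\<^sub>M
      (\<Pi>\<^sub>M p\<in>{..<n} \<times> {..<m}. std_normal_distribution)"

definition free_energy ::
  "real measure \<Rightarrow> real measure \<Rightarrow> nat \<Rightarrow> nat \<Rightarrow> real \<Rightarrow> real"
  where "free_energy PU PV n m lam =
    1 / real n *
    (\<integral>(U, V, Z). ln (\<integral>(u, v). exp (hamiltonian n m lam U V Z u v)
         \<partial>((\<Pi>\<^sub>M i\<in>{..<n}. PU) \<Otimes>\<^sub>M (\<Pi>\<^sub>M j\<in>{..<m}. PV)))
      \<partial>(disorder PU PV n m))"

text \<open>The scalar channel \<open>Y = sqrt \<gamma> * X + Z\<close> lives on the space \<open>P \<Otimes>\<^sub>M N(0,1)\<close> of pairs \<open>(X, Z)\<close>;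
  conditioning on \<open>Y\<close> is conditioning on the \<open>\<sigma>\<close>-algebra that \<open>Y\<close> generates.\<close>

definition scalar_space :: "real measure \<Rightarrow> (real \<times> real) measure"
  where "scalar_space P = P \<Otimes>\<^sub>M std_normal_distribution"

definition scalar_obs :: "real \<Rightarrow> real \<times> real \<Rightarrow> real"
  where "scalar_obs g = (\<lambda>(x, z). sqrt g * x + z)"

definition overlap :: "real measure \<Rightarrow> real \<Rightarrow> real"
  where "overlap P g =
    (\<integral>w. fst w * real_cond_exp (scalar_space P)
                (vimage_algebra (space (scalar_space P)) (scalar_obs g) borel) fst w
      \<partial>(scalar_space P))"

definition psi :: "real measure \<Rightarrow> real \<Rightarrow> real"
  where "psi P g =
    (\<integral>(X, Z). ln (\<integral>x. exp (sqrt g * x * Z + g * x * X - g / 2 * x\<^sup>2) \<partial>P)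
      \<partial>(scalar_space P))"

definition Gamma_set :: "real measure \<Rightarrow> real measure \<Rightarrow> real \<Rightarrow> real \<Rightarrow> (real \<times> real) set"
  where "Gamma_set PU PV lam alpha =
    {(qu, qv). qu \<ge> 0 \<and> qv \<ge> 0 \<and>
       qu = overlap PU (lam * alpha * qv) \<and> qv = overlap PV (lam * qu)}"

definition rs_potential ::
  "real measure \<Rightarrow> real measure \<Rightarrow> real \<Rightarrow> real \<Rightarrow> real \<Rightarrow> real \<Rightarrow> real"
  where "rs_potential PU PV lam alpha qu qv =
    psi PU (lam * alpha * qv) + alpha * psi PV (lam * qu) - lam * alpha / 2 * qu * qv"

text \<open>The extrema are taken in \<^typ>\<open>ereal\<close>: the infimum over \<open>qu\<close> is \<open>-\<infinity>\<close> for large \<open>qv\<close>,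
  where the infimum on \<^typ>\<open>real\<close> would be unspecified.\<close>

definition sup_Gamma :: "real measure \<Rightarrow> real measure \<Rightarrow> real \<Rightarrow> real \<Rightarrow> ereal"
  where "sup_Gamma PU PV lam alpha =
    (SUP (qu, qv) \<in> Gamma_set PU PV lam alpha. ereal (rs_potential PU PV lam alpha qu qv))"

definition inf_potential :: "real measure \<Rightarrow> real measure \<Rightarrow> real \<Rightarrow> real \<Rightarrow> real \<Rightarrow> ereal"
  where "inf_potential PU PV lam alpha qv =
    (INF qu \<in> {0..}. ereal (rs_potential PU PV lam alpha qu qv))"

definition sup_inf :: "real measure \<Rightarrow> real measure \<Rightarrow> real \<Rightarrow> real \<Rightarrow> ereal"
  where "sup_inf PU PV lam alpha = (SUP qv \<in> {0..}. inf_potential PU PV lam alpha qv)"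

end

theory Submission
 imports Defs "HOL-Probability.Probability"
begin

text \<open>Add to the observation side channels of signal-to-noise ratio \<open>a\<close> for each \<open>U\<^sub>i\<close> and \<open>b\<close> for each \<open>V\<^sub>j\<close>,
 and clip the signals (not the priors) at a level \<open>K\<close>. By the chain rule for Gaussian channels the free
 energy \<open>F t a b\<close> is convex and increasing in each ratio, with half the overlaps as derivatives, and the second
 order term in the chain rule controls the fluctuations of the overlaps. Hence \<open>F\<close> is an approximate
 solution of the Hamilton-Jacobi equation \<open>F\<^sub>t = 2 F\<^sub>a F\<^sub>b\<close>, whose initial value is a pair of scalar
 channels. Doubling of variables bounds \<open>F\<close> from above by \<open>sup inf\<close> of the potential; an energy estimate
 along the characteristics bounds it from below. Comparing two signals along a path that moves the
 signal-to-noise ratio from one to the other removes the clipping. Convexity of the scalar free energies and strict monotonicity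
 of their overlaps then identify the optimal couples.\<close>

text \<open>The obstacle is that the overlap is not known to concentrate at a given point. The
  defect of the equation is bounded only by the convexity remainder of \<open>F\<close> in
  \<open>a\<close> at two step sizes: one of order \<open>1 / n\<close>, which controls posterior
  covariances, and a fixed one, which controls the fluctuation of the \<open>U\<close>-overlap over
  the observations. For the upper bound these remainders are small at the maximum of the doubled
  function, since a parabola touches \<open>F\<close> from above there; this is why \<open>a\<close>
  alone is doubled. For the lower bound they telescope over a grid of starting values of
  \<open>a\<close>, so the energies are averaged over that grid. The Hamiltonian
  \<open>2 p q\<close> is neither convex nor concave. What replaces convexity is that
  \<open>p x + q y - x y / 2 = 2 p q\<close> holds for every \<open>x\<close> once
  \<open>y = 2 p\<close>: in the upper bound the velocity \<open>x\<close> may be any function of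
  \<open>y\<close>, and the choice made in the end turns the value along each line into the
  potential on the curve of inner minimisers. Clipping the signals leaves the probability space
  unchanged, so that two truncations can be observed side by side and compared.\<close>

abbreviation std_gauss :: "'i set => ('i => real) measure"
 where "std_gauss I \<equiv> \<Pi>\<^sub>M i\<in>I. std_normal_distribution"

section \<open>Shifts and rotations of Gaussian product measures\<close>

lemma prob_space_std_normal: "prob_space std_normal_distribution"
 using real_dist_normal_dist by (simp add: real_distribution_def)

lemma product_prob_space_std_normal: "product_prob_space (%i. std_normal_distribution)"
 by (rule product_prob_spaceI) (rule prob_space_std_normal)

lemma product_sigma_finite_std_normal: "product_sigma_finite (%i. std_normal_distribution)"
 by (simp add: product_sigma_finite_def prob_space_imp_sigma_finite prob_space_std_normal)

lemma prob_space_std_gauss: "prob_space (std_gauss I)"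
 by (intro prob_space_PiM prob_space_std_normal)

text \<open>The Cameron-Martin formula in dimension one, by completing the square in the density.
  The weight \<open>exp (c * y - c^2 / 2)\<close> later becomes the likelihood of a signal
  \<open>c\<close>.\<close>

lemma std_normal_shift_nn:
 assumes [measurable]: "f \<in> borel_measurable borel"
 shows "(\<integral>\<^sup>+z. f (z + c) \<partial>std_normal_distribution)
  = (\<integral>\<^sup>+y. f y * ennreal (exp (c * y - c^2 / 2)) \<partial>std_normal_distribution)"
proof -
 have dens: "std_normal_density (c + x) * exp (c * (c + x) - c^2 / 2) = std_normal_density x" for x
  by (simp add: std_normal_density_def exp_add[symmetric] mult.assoc field_simps power2_eq_square)
 have "(\<integral>\<^sup>+y. f y * ennreal (exp (c * y - c^2 / 2)) \<partial>std_normal_distribution)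
   = (\<integral>\<^sup>+y. ennreal (std_normal_density y) * (f y * ennreal (exp (c * y - c^2 / 2))) \<partial>lborel)"
  by (subst nn_integral_density) auto
 also have "... = (\<integral>\<^sup>+x. ennreal (std_normal_density (c + x)) *
   (f (c + x) * ennreal (exp (c * (c + x) - c^2 / 2))) \<partial>lborel)"
  by (subst nn_integral_real_affine[where c=1 and t=c]) auto
 also have "... = (\<integral>\<^sup>+x. ennreal (std_normal_density x) * f (x + c) \<partial>lborel)"
 proof (intro nn_integral_cong)
  fix x
  have "ennreal (std_normal_density (c + x)) * (f (c + x) * ennreal (exp (c * (c + x) - c^2 / 2)))
   = ennreal (std_normal_density (c + x) * exp (c * (c + x) - c^2 / 2)) * f (c + x)"
   by (simp add: ennreal_mult mult_ac)
  thus "ennreal (std_normal_density (c + x)) * (f (c + x) * ennreal (exp (c * (c + x) - c^2 / 2)))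
   = ennreal (std_normal_density x) * f (x + c)" by (simp only: dens add.commute)
 qed
 also have "... = (\<integral>\<^sup>+z. f (z + c) \<partial>std_normal_distribution)"
  by (subst nn_integral_density) auto
 finally show ?thesis by simp
qed

lemma measurable_shift_PiM [measurable]:
 "(%z. \<lambda>i\<in>I. z i + c i) \<in> measurable (std_gauss I) (std_gauss I)"
 by (rule measurable_restrict) auto

text \<open>Both sides are product measures: the shift acts coordinate by coordinate, and the
  exponential of a sum is a product of weights. The common factor is the tilted law
  \<open>Q i\<close>, and boxes determine a finite product measure.\<close>

lemma distr_std_gauss_shift:
 assumes I: "finite I"
 shows "distr (std_gauss I) (std_gauss I) (%z. \<lambda>i\<in>I. z i + c i)
  = density (std_gauss I) (%y. ennreal (exp (\<Sum>i\<in>I. c i * y i - (c i)^2 / 2)))"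
proof -
 interpret N: product_sigma_finite "%i. std_normal_distribution" by (rule product_sigma_finite_std_normal)
 define Q where "Q = (%i. density std_normal_distribution (%y. ennreal (exp (c i * y - (c i)^2 / 2))))"
 have setsQ: "sets (Q i) = sets borel" "space (Q i) = UNIV" for i by (auto simp: Q_def)
 have emQ: "emeasure (Q i) A = emeasure std_normal_distribution {z. z + c i \<in> A}"
  if A[measurable]: "A \<in> sets borel" for A i
 proof -
  have "emeasure (Q i) A = (\<integral>\<^sup>+y. indicator A y * ennreal (exp (c i * y - (c i)^2 / 2)) \<partial>std_normal_distribution)"
   unfolding Q_def by (subst emeasure_density) (auto simp: mult.commute)
  also have "... = (\<integral>\<^sup>+z. indicator A (z + c i) \<partial>std_normal_distribution)"
   by (subst std_normal_shift_nn) auto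
  also have "... = (\<integral>\<^sup>+z. indicator {z. z + c i \<in> A} z \<partial>std_normal_distribution)"
   by (intro nn_integral_cong) (auto split: split_indicator)
  also have "... = emeasure std_normal_distribution {z. z + c i \<in> A}"
  proof (subst nn_integral_indicator)
   have "(%z. z + c i) -` A \<inter> space borel \<in> sets borel" by measurable
   thus "{z. z + c i \<in> A} \<in> sets std_normal_distribution" by (simp add: vimage_def)
  qed simp
  finally show ?thesis .
 qed
 have "prob_space (Q i)" for i
  by standard (use emQ[of UNIV i] prob_space.emeasure_space_1[OF prob_space_std_normal] setsQ in auto)
 then interpret Q: product_sigma_finite Q
  by (auto simp: product_sigma_finite_def prob_space_imp_sigma_finite)
 have sQ: "sets (PiM I Q) = sets (std_gauss I)" by (rule sets_PiM_cong) (auto simp: setsQ)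
 have pre: "{z. z + c i \<in> A} \<in> sets borel" if "A \<in> sets borel" for A :: "real set" and i
 proof -
  have "(%z. z + c i) -` A \<inter> space borel \<in> sets borel" using that by measurable
  thus ?thesis by (simp add: vimage_def)
 qed
 have "distr (std_gauss I) (std_gauss I) (%z. \<lambda>i\<in>I. z i + c i) = PiM I Q"
 proof (rule Q.PiM_eqI[OF I])
  show "sets (distr (std_gauss I) (std_gauss I) (%z. \<lambda>i\<in>I. z i + c i)) = sets (PiM I Q)" using sQ by simp
 next
  fix A assume "!!i. i \<in> I ==> A i \<in> sets (Q i)"
  hence A: "!!i. i \<in> I ==> A i \<in> sets borel" by (simp add: setsQ)
  have "emeasure (distr (std_gauss I) (std_gauss I) (%z. \<lambda>i\<in>I. z i + c i)) (Pi\<^sub>E I A)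
   = emeasure (std_gauss I) (Pi\<^sub>E I (%i. {z. z + c i \<in> A i}))"
  proof (subst emeasure_distr)
   show "Pi\<^sub>E I A \<in> sets (std_gauss I)" using A by (intro sets_PiM_I_finite[OF I]) simp
   have "(%z. \<lambda>i\<in>I. z i + c i) -` Pi\<^sub>E I A \<inter> space (std_gauss I) = Pi\<^sub>E I (%i. {z. z + c i \<in> A i})"
    by (auto simp: space_PiM PiE_iff)
   thus "emeasure (std_gauss I) ((%z. \<lambda>i\<in>I. z i + c i) -` Pi\<^sub>E I A \<inter> space (std_gauss I))
    = emeasure (std_gauss I) (Pi\<^sub>E I (%i. {z. z + c i \<in> A i}))" by simp
  qed auto
  also have "... = (\<Prod>i\<in>I. emeasure std_normal_distribution {z. z + c i \<in> A i})"
   by (rule N.emeasure_PiM[OF I]) (auto intro: pre A)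
  also have "... = (\<Prod>i\<in>I. emeasure (Q i) (A i))" by (intro prod.cong) (auto simp: emQ A)
  finally show "emeasure (distr (std_gauss I) (std_gauss I) (%z. \<lambda>i\<in>I. z i + c i)) (Pi\<^sub>E I A)
   = (\<Prod>i\<in>I. emeasure (Q i) (A i))" .
 qed
 also have "PiM I Q = density (std_gauss I) (%y. ennreal (exp (\<Sum>i\<in>I. c i * y i - (c i)^2 / 2)))"
 proof (rule Q.PiM_eqI[OF I, symmetric])
  show "sets (density (std_gauss I) (%y. ennreal (exp (\<Sum>i\<in>I. c i * y i - (c i)^2 / 2)))) = sets (PiM I Q)"
   using sQ by simp
 next
  fix A assume "!!i. i \<in> I ==> A i \<in> sets (Q i)"
  hence A: "!!i. i \<in> I ==> A i \<in> sets borel" by (simp add: setsQ)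
  have [measurable]: "Pi\<^sub>E I A \<in> sets (std_gauss I)" using A by (intro sets_PiM_I_finite[OF I]) simp
  have "emeasure (density (std_gauss I) (%y. ennreal (exp (\<Sum>i\<in>I. c i * y i - (c i)^2 / 2)))) (Pi\<^sub>E I A)
   = (\<integral>\<^sup>+y. ennreal (exp (\<Sum>i\<in>I. c i * y i - (c i)^2 / 2)) * indicator (Pi\<^sub>E I A) y \<partial>std_gauss I)"
   by (rule emeasure_density) measurable
  also have "... = (\<integral>\<^sup>+y. (\<Prod>i\<in>I. ennreal (exp (c i * y i - (c i)^2 / 2)) * indicator (A i) (y i)) \<partial>std_gauss I)"
  proof (intro nn_integral_cong)
   fix y assume y: "y \<in> space (std_gauss I)"
   have "indicator (Pi\<^sub>E I A) y = (\<Prod>i\<in>I. indicator (A i) (y i) :: ennreal)"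
   proof (cases "y \<in> Pi\<^sub>E I A")
    case True thus ?thesis by (auto simp: PiE_iff)
   next
    case False
    then obtain i where "i \<in> I" "y i \<notin> A i" using y by (auto simp: PiE_iff space_PiM)
    hence "(\<Prod>i\<in>I. indicator (A i) (y i) :: ennreal) = 0"
     using I by (intro prod_zero bexI[of _ i]) auto
    thus ?thesis using False by simp
   qed
   thus "ennreal (exp (\<Sum>i\<in>I. c i * y i - (c i)^2 / 2)) * indicator (Pi\<^sub>E I A) y
    = (\<Prod>i\<in>I. ennreal (exp (c i * y i - (c i)^2 / 2)) * indicator (A i) (y i))"
    by (simp add: exp_sum I prod_ennreal prod.distrib)
  qed
  also have "... = (\<Prod>i\<in>I. \<integral>\<^sup>+y. ennreal (exp (c i * y - (c i)^2 / 2)) * indicator (A i) y \<partial>std_normal_distribution)"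
   by (rule N.product_nn_integral_prod[OF I]) (use A in measurable)
  also have "... = (\<Prod>i\<in>I. emeasure (Q i) (A i))"
   unfolding Q_def by (intro prod.cong refl, subst emeasure_density) (use A in auto)
  finally show "emeasure (density (std_gauss I) (%y. ennreal (exp (\<Sum>i\<in>I. c i * y i - (c i)^2 / 2)))) (Pi\<^sub>E I A)
   = (\<Prod>i\<in>I. emeasure (Q i) (A i))" .
 qed
 finally show ?thesis .
qed

lemma std_gauss_shift_nn:
 assumes I: "finite I" and f[measurable]: "f \<in> borel_measurable (std_gauss I)"
 shows "(\<integral>\<^sup>+z. f (\<lambda>i\<in>I. z i + c i) \<partial>std_gauss I)
  = (\<integral>\<^sup>+y. f y * ennreal (exp (\<Sum>i\<in>I. c i * y i - (c i)^2 / 2)) \<partial>std_gauss I)"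
proof -
 have "(\<integral>\<^sup>+z. f (\<lambda>i\<in>I. z i + c i) \<partial>std_gauss I)
  = (\<integral>\<^sup>+y. f y \<partial>distr (std_gauss I) (std_gauss I) (%z. \<lambda>i\<in>I. z i + c i))"
  by (subst nn_integral_distr) auto
 also have "... = (\<integral>\<^sup>+y. f y * ennreal (exp (\<Sum>i\<in>I. c i * y i - (c i)^2 / 2)) \<partial>std_gauss I)"
  unfolding distr_std_gauss_shift[OF I] by (subst nn_integral_density) (use I in \<open>auto simp: mult.commute\<close>)
 finally show ?thesis .
qed

text \<open>Characteristic functions: independence makes them multiply, and the exponents add up to
  \<open>t^2 * (c^2 + s^2) / 2\<close>.\<close>

lemma distr_std_normal_rotate:
 assumes "c^2 + s^2 = 1"
 shows "distr (std_normal_distribution \<Otimes>\<^sub>M std_normal_distribution) borel (%(x, y). c * x + s * y)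
  = std_normal_distribution"
proof -
 interpret N: prob_space std_normal_distribution by (rule prob_space_std_normal)
 interpret NN: pair_prob_space std_normal_distribution std_normal_distribution ..
 let ?P = "std_normal_distribution \<Otimes>\<^sub>M std_normal_distribution"
 let ?D = "distr ?P borel (%(x, y). c * x + s * y)"
 have "char ?D t = char std_normal_distribution t" for t
 proof -
  have int: "integrable std_normal_distribution (%x. iexp (u * x))" for u
   by (rule N.integrable_iexp) auto
  have "char ?D t = (LINT p|?P. iexp (t * (c * fst p + s * snd p)))"
   unfolding char_def by (subst integral_distr) (auto simp: case_prod_beta)
  also have "... = (LINT p|?P. iexp ((t * c) * fst p) * iexp ((t * s) * snd p))"
   by (intro Bochner_Integration.integral_cong) (auto simp: exp_add[symmetric] algebra_simps)
  also have "... = (LINT x|std_normal_distribution. iexp ((t * c) * x)) * (LINT y|std_normal_distribution. iexp ((t * s) * y))"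
  proof -
   have "integrable ?P (%p. iexp ((t * c) * fst p) * iexp ((t * s) * snd p))"
    by (rule NN.integrable_const_bound[where B=1]) (auto simp: norm_mult norm_exp_i_times)
   from NN.integral_fst'[OF this] show ?thesis by simp
  qed
  also have "... = char std_normal_distribution (t * c) * char std_normal_distribution (t * s)"
   by (simp add: char_def)
  also have "... = complex_of_real (exp (- ((t * c)^2 / 2) - (t * s)^2 / 2))"
   unfolding char_std_normal_distribution by (simp add: exp_add[symmetric] exp_diff exp_minus field_simps flip: of_real_mult)
  also have "- ((t * c)^2 / 2) - (t * s)^2 / 2 = - (t^2 * (c^2 + s^2)) / 2" by (simp add: field_simps power_mult_distrib)
  finally show ?thesis using assms by (simp add: char_std_normal_distribution)
 qed
 hence "char ?D = char std_normal_distribution" by (rule ext)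
 moreover have "real_distribution ?D"
  by (intro real_distribution.intro NN.prob_space_distr) (auto simp: real_distribution_axioms_def)
 ultimately show ?thesis using Levy_uniqueness real_dist_normal_dist by blast
qed

text \<open>The angle may vary with the coordinate, as it will depend on the two signal-to-noise
  ratios there. Boxes reduce the claim to dimension one.\<close>

lemma distr_std_gauss_rotate:
 assumes I: "finite I" and cs: "!!i. i \<in> I ==> (c i)^2 + (s i)^2 = 1"
 shows "distr (std_gauss I \<Otimes>\<^sub>M std_gauss I) (std_gauss I) (%(x, y). \<lambda>i\<in>I. c i * x i + s i * y i)
  = std_gauss I"
proof -
 interpret N: product_sigma_finite "%i. std_normal_distribution" by (rule product_sigma_finite_std_normal)
 interpret N1: prob_space "std_normal_distribution" by (rule prob_space_std_normal)
 interpret G: prob_space "std_gauss I" by (rule prob_space_std_gauss)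
 let ?S = "%(x, y). \<lambda>i\<in>I. c i * x i + s i * y i"
 have S[measurable]: "?S \<in> measurable (std_gauss I \<Otimes>\<^sub>M std_gauss I) (std_gauss I)"
  by (auto simp: case_prod_beta intro!: measurable_restrict)
 show ?thesis
 proof (rule N.PiM_eqI[OF I])
  show "sets (distr (std_gauss I \<Otimes>\<^sub>M std_gauss I) (std_gauss I) ?S) = sets (std_gauss I)" by simp
 next
  fix A assume "!!i. i \<in> I ==> A i \<in> sets std_normal_distribution"
  hence A[measurable]: "!!i. i \<in> I ==> A i \<in> sets borel" by simp
  have box[measurable]: "Pi\<^sub>E I A \<in> sets (std_gauss I)" using A by (intro sets_PiM_I_finite[OF I]) simp
  have ind: "indicator (Pi\<^sub>E I A) (?S (x, y)) = (\<Prod>i\<in>I. indicator (A i) (c i * x i + s i * y i) :: ennreal)" for x y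
  proof (cases "?S (x, y) \<in> Pi\<^sub>E I A")
   case True thus ?thesis by (auto simp: PiE_iff)
  next
   case False
   then obtain i where "i \<in> I" "c i * x i + s i * y i \<notin> A i" by (auto simp: PiE_iff)
   hence "(\<Prod>i\<in>I. indicator (A i) (c i * x i + s i * y i) :: ennreal) = 0"
    using I \<open>i \<in> I\<close> by (intro prod_zero bexI[of _ i]) auto
   thus ?thesis using False by simp
  qed
  have "emeasure (distr (std_gauss I \<Otimes>\<^sub>M std_gauss I) (std_gauss I) ?S) (Pi\<^sub>E I A)
   = (\<integral>\<^sup>+p. indicator (Pi\<^sub>E I A) (?S p) \<partial>(std_gauss I \<Otimes>\<^sub>M std_gauss I))"
   by (subst nn_integral_indicator[symmetric], simp, subst nn_integral_distr) auto
  also have "... = (\<integral>\<^sup>+x. \<integral>\<^sup>+y. indicator (Pi\<^sub>E I A) (?S (x, y)) \<partial>std_gauss I \<partial>std_gauss I)"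
   by (rule G.nn_integral_fst[symmetric]) measurable
  also have "... = (\<integral>\<^sup>+x. \<integral>\<^sup>+y. (\<Prod>i\<in>I. indicator (A i) (c i * x i + s i * y i)) \<partial>std_gauss I \<partial>std_gauss I)"
   by (simp only: ind)
  also have "... = (\<integral>\<^sup>+x. (\<Prod>i\<in>I. \<integral>\<^sup>+v. indicator (A i) (c i * x i + s i * v) \<partial>std_normal_distribution) \<partial>std_gauss I)"
   by (intro nn_integral_cong N.product_nn_integral_prod[OF I]) measurable
  also have "... = (\<Prod>i\<in>I. \<integral>\<^sup>+t. \<integral>\<^sup>+v. indicator (A i) (c i * t + s i * v) \<partial>std_normal_distribution \<partial>std_normal_distribution)"
   by (rule N.product_nn_integral_prod[OF I]) measurable
  also have "... = (\<Prod>i\<in>I. emeasure std_normal_distribution (A i))"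
  proof (rule prod.cong[OF refl])
   fix i assume i: "i \<in> I"
   note [measurable] = A[OF i]
   have "(\<integral>\<^sup>+t. \<integral>\<^sup>+v. indicator (A i) (c i * t + s i * v) \<partial>std_normal_distribution \<partial>std_normal_distribution)
    = (\<integral>\<^sup>+p. indicator (A i) ((%(t, v). c i * t + s i * v) p) \<partial>(std_normal_distribution \<Otimes>\<^sub>M std_normal_distribution))"
    by (subst sigma_finite_measure.nn_integral_fst[OF prob_space_imp_sigma_finite[OF prob_space_std_normal], symmetric]) auto
   also have "... = (\<integral>\<^sup>+u. indicator (A i) u \<partial>std_normal_distribution)"
    by (subst distr_std_normal_rotate[OF cs[OF i], symmetric], subst nn_integral_distr) auto
   also have "... = emeasure std_normal_distribution (A i)" by (simp add: A[OF i])
   finally show "(\<integral>\<^sup>+t. \<integral>\<^sup>+v. indicator (A i) (c i * t + s i * v) \<partial>std_normal_distribution \<partial>std_normal_distribution)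
    = emeasure std_normal_distribution (A i)" .
  qed
  finally show "emeasure (distr (std_gauss I \<Otimes>\<^sub>M std_gauss I) (std_gauss I) ?S) (Pi\<^sub>E I A)
   = (\<Prod>i\<in>I. emeasure std_normal_distribution (A i))" .
 qed
qed

text \<open>By Cameron-Martin, the density at \<open>y\<close> of the law of signal plus noise with
  respect to pure noise, when the signal is \<open>f i w\<close>.\<close>

definition lik :: "'i set => ('i => 'a => real) => ('i => real) => 'a => real"
 where "lik I f y w = exp (\<Sum>i\<in>I. f i w * y i - (f i w)^2 / 2)"

definition partf :: "'a measure => 'i set => ('i => 'a => real) => ('i => real) => real"
 where "partf M I f y = (LINT w|M. lik I f y w)"

text \<open>The posterior mean of \<open>g\<close> given the observation \<open>y\<close>, written
  with respect to the prior so that it can be studied before the measure \<open>post\<close> is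
  available.\<close>

definition gavg :: "'a measure => 'i set => ('i => 'a => real) => ('a => real) => ('i => real) => real"
 where "gavg M I f g y = (LINT w|M. g w * lik I f y w) / partf M I f y"

definition post :: "'a measure => 'i set => ('i => 'a => real) => ('i => real) => 'a measure"
 where "post M I f y = density M (%w. ennreal (lik I f y w / partf M I f y))"

definition obs_law :: "'a measure => 'i set => ('i => 'a => real) => ('i => real) measure"
 where "obs_law M I f = density (std_gauss I) (%y. ennreal (partf M I f y))"

text \<open>Relative entropy of the law of the observation with respect to pure noise. For the full
  matrix channel it is \<open>n\<close> times the free energy, see
  \<open>free_energy_eq\<close>.\<close>

definition ent :: "'a measure => 'i set => ('i => 'a => real) => real"
 where "ent M I f = (LINT y|obs_law M I f. ln (partf M I f y))"

lemma lik_pos: "0 < lik I f y w"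
 by (simp add: lik_def)

text \<open>Completing the square. The bound does not involve the signal, so the likelihood is
  integrable under any prior, bounded or not.\<close>

lemma lik_le: "lik I f y w <= exp (\<Sum>i\<in>I. (y i)^2 / 2)"
proof -
 have "f i w * y i - (f i w)^2 / 2 <= (y i)^2 / 2" for i
  using zero_le_power2[of "f i w - y i"] by (simp add: power2_eq_square field_simps)
 thus ?thesis unfolding lik_def by (auto intro: sum_mono)
qed

lemma integrable_pair_fst:
 fixes g :: "'a => real"
 assumes "prob_space B" "integrable A g"
 shows "integrable (A \<Otimes>\<^sub>M B) (%p. g (fst p))" (is ?C1) "(LINT p|(A \<Otimes>\<^sub>M B). g (fst p)) = (LINT x|A. g x)" (is ?C2)
proof -
 interpret B: prob_space B by fact
 have [measurable]: "g \<in> borel_measurable A" using assms by auto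
 show ?C1
  using assms(2) B.distr_pair_fst[of A] integrable_distr_eq[of fst "A \<Otimes>\<^sub>M B" A g] by simp
 show ?C2
  using B.distr_pair_fst[of A] integral_distr[of fst "A \<Otimes>\<^sub>M B" A g] by simp
qed

lemma integrable_pair_snd:
 fixes g :: "'a => real"
 assumes "prob_space A" "prob_space B" "integrable B g"
 shows "integrable (A \<Otimes>\<^sub>M B) (%p. g (snd p))" (is ?C1) "(LINT p|(A \<Otimes>\<^sub>M B). g (snd p)) = (LINT x|B. g x)" (is ?C2)
proof -
 interpret A: prob_space A by fact
 interpret B: prob_space B by fact
 interpret BA: pair_prob_space B A ..
 have [measurable]: "g \<in> borel_measurable B" using assms by auto
 note i = integrable_pair_fst[OF assms(1,3)]
 show ?C1
  using BA.integrable_product_swap[OF i(1)] by (simp add: case_prod_unfold)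
 have "(LINT p|(A \<Otimes>\<^sub>M B). g (snd p)) = (LINT p|(A \<Otimes>\<^sub>M B). (%p. g (fst p)) ((%(x, y). (y, x)) p))"
  by (simp add: case_prod_beta)
 also have "... = (LINT p|(B \<Otimes>\<^sub>M A). g (fst p))"
  using BA.integral_product_swap[of "%p. g (fst p)"] by (simp add: case_prod_unfold)
 finally show ?C2 using i(2) by simp
qed

section \<open>Gaussian channels\<close>

locale channel = prob_space M for M :: "'a measure" +
 fixes I :: "'i set" and f :: "'i => 'a => real"
 assumes fin: "finite I" and meas: "!!i. i \<in> I ==> f i \<in> borel_measurable M"
begin

abbreviation "G \<equiv> std_gauss I"

sublocale G: prob_space "std_gauss I" by (rule prob_space_std_gauss)

sublocale GM: pair_prob_space "std_gauss I" M ..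

sublocale MG: pair_prob_space M "std_gauss I" ..

lemma lik_meas [measurable]: "(%p. lik I f (fst p) (snd p)) \<in> borel_measurable (G \<Otimes>\<^sub>M M)"
 unfolding lik_def using meas by measurable

lemma lik_meas1 [measurable]: "lik I f y \<in> borel_measurable M"
 unfolding lik_def using meas by measurable

lemma lik_meas2 [measurable]: "(%y. lik I f y w) \<in> borel_measurable G"
 unfolding lik_def by measurable

lemma lik_integrable: "integrable M (lik I f y)"
 by (rule integrable_const_bound[where B="exp (\<Sum>i\<in>I. (y i)^2 / 2)"])
  (auto simp: lik_le less_imp_le[OF lik_pos] abs_of_pos[OF lik_pos])

lemma mult_lik_integrable: "integrable M g ==> integrable M (%w. g w * lik I f y w)"
 by (rule Bochner_Integration.integrable_bound[where f="%w. exp (\<Sum>i\<in>I. (y i)^2 / 2) * g w"])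
  (auto simp: abs_mult mult.commute abs_of_pos[OF lik_pos] intro!: mult_left_mono lik_le AE_I2)

lemma part_pos: "0 < partf M I f y"
proof -
 have "0 <= partf M I f y" unfolding partf_def by (intro integral_nonneg_AE AE_I2) (simp add: less_imp_le lik_pos)
 moreover have "partf M I f y \<noteq> 0"
 proof
  assume "partf M I f y = 0"
  hence "AE w in M. lik I f y w = 0"
   unfolding partf_def by (subst (asm) integral_nonneg_eq_0_iff_AE) (auto simp: lik_integrable less_imp_le lik_pos)
  hence "AE w in M. False" by eventually_elim (metis lik_pos less_irrefl)
  thus False by simp
 qed
 ultimately show ?thesis by simp
qed

lemma part_le: "partf M I f y <= exp (\<Sum>i\<in>I. (y i)^2 / 2)"
proof -
 have "partf M I f y <= (LINT w|M. exp (\<Sum>i\<in>I. (y i)^2 / 2))"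
  unfolding partf_def by (intro integral_mono lik_integrable) (auto simp: lik_le)
 thus ?thesis by (simp add: prob_space)
qed

lemma part_meas [measurable]: "partf M I f \<in> borel_measurable G"
 unfolding partf_def[abs_def] by (rule borel_measurable_lebesgue_integral) (auto simp: case_prod_beta)

lemma gavg_meas [measurable]:
 assumes [measurable]: "g \<in> borel_measurable M"
 shows "gavg M I f g \<in> borel_measurable G"
proof -
 have "(%y. LINT w|M. g w * lik I f y w) \<in> borel_measurable G"
  by (rule borel_measurable_lebesgue_integral) (auto simp: case_prod_beta)
 thus ?thesis unfolding gavg_def[abs_def] by measurable
qed

lemma nn_part: "ennreal (partf M I f y) = (\<integral>\<^sup>+w. ennreal (lik I f y w) \<partial>M)"
 unfolding partf_def by (rule nn_integral_eq_integral[symmetric]) (auto simp: lik_integrable less_imp_le lik_pos)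

lemma shift_meas [measurable]:
 "(%p. \<lambda>i\<in>I. snd p i + f i (fst p)) \<in> measurable (M \<Otimes>\<^sub>M G) G"
 using meas by (intro measurable_restrict) auto

text \<open>Fubini, then Cameron-Martin for each fixed \<open>w\<close>: weighting pure noise with
  the likelihood of \<open>w\<close> amounts to adding the signal of \<open>w\<close> to it. This is
  Bayes' rule: a sample from the posterior may be exchanged with the planted signal.\<close>

lemma nishimori_nn:
 assumes phi[measurable]: "(%p. ph (fst p) (snd p)) \<in> borel_measurable (G \<Otimes>\<^sub>M M)"
 shows "(\<integral>\<^sup>+y. \<integral>\<^sup>+w. ph y w * ennreal (lik I f y w) \<partial>M \<partial>G)
  = (\<integral>\<^sup>+w. \<integral>\<^sup>+z. ph (\<lambda>i\<in>I. z i + f i w) w \<partial>G \<partial>M)"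
proof -
 have "(\<integral>\<^sup>+y. \<integral>\<^sup>+w. ph y w * ennreal (lik I f y w) \<partial>M \<partial>G)
  = (\<integral>\<^sup>+w. \<integral>\<^sup>+y. ph y w * ennreal (lik I f y w) \<partial>G \<partial>M)"
  by (rule GM.Fubini'[symmetric]) (auto simp: case_prod_beta)
 also have "... = (\<integral>\<^sup>+w. \<integral>\<^sup>+z. ph (\<lambda>i\<in>I. z i + f i w) w \<partial>G \<partial>M)"
 proof (rule nn_integral_cong)
  fix w assume w: "w \<in> space M"
  have [measurable]: "(%y. ph y w) \<in> borel_measurable G"
   using measurable_compose[OF measurable_Pair2'[OF w] phi] by simp
  show "(\<integral>\<^sup>+y. ph y w * ennreal (lik I f y w) \<partial>G) = (\<integral>\<^sup>+z. ph (\<lambda>i\<in>I. z i + f i w) w \<partial>G)"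
   unfolding lik_def using std_gauss_shift_nn[OF fin, of "%y. ph y w" "%i. f i w"] by simp
 qed
 finally show ?thesis .
qed

text \<open>Test functions of \<open>y\<close> alone in \<open>nishimori_nn\<close>. The density
  form allows pointwise work in \<open>y\<close>; the planted form puts observations of different
  channels on one space.\<close>

lemma distr_planted:
 "distr (M \<Otimes>\<^sub>M G) G (%p. \<lambda>i\<in>I. snd p i + f i (fst p)) = obs_law M I f"
proof (rule measure_eqI)
 fix A assume "A \<in> sets (distr (M \<Otimes>\<^sub>M G) G (%p. \<lambda>i\<in>I. snd p i + f i (fst p)))"
 hence [measurable]: "A \<in> sets G" by simp
 have "emeasure (distr (M \<Otimes>\<^sub>M G) G (%p. \<lambda>i\<in>I. snd p i + f i (fst p))) A
  = (\<integral>\<^sup>+p. indicator A (\<lambda>i\<in>I. snd p i + f i (fst p)) \<partial>(M \<Otimes>\<^sub>M G))"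
  by (subst nn_integral_indicator[symmetric], simp, subst nn_integral_distr) auto
 also have "... = (\<integral>\<^sup>+w. \<integral>\<^sup>+z. indicator A (\<lambda>i\<in>I. z i + f i w) \<partial>G \<partial>M)"
  by (subst G.nn_integral_fst[symmetric]) auto
 also have "... = (\<integral>\<^sup>+y. \<integral>\<^sup>+w. indicator A y * ennreal (lik I f y w) \<partial>M \<partial>G)"
  by (rule nishimori_nn[symmetric]) measurable
 also have "... = (\<integral>\<^sup>+y. ennreal (partf M I f y) * indicator A y \<partial>G)"
  by (intro nn_integral_cong) (simp add: nn_integral_cmult nn_part mult.commute)
 also have "... = emeasure (obs_law M I f) A"
  unfolding obs_law_def by (subst emeasure_density) auto
 finally show "emeasure (distr (M \<Otimes>\<^sub>M G) G (%p. \<lambda>i\<in>I. snd p i + f i (fst p))) A = emeasure (obs_law M I f) A" .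
qed (simp add: obs_law_def)

lemma prob_obs_law: "prob_space (obs_law M I f)"
 unfolding distr_planted[symmetric] by (rule MG.prob_space_distr) simp

lemma sets_obs_law [simp, measurable_cong]: "sets (obs_law M I f) = sets G" and space_obs_law [simp]: "space (obs_law M I f) = space G"
 by (auto simp: obs_law_def)

lemma nn_integral_obs_law:
 assumes [measurable]: "ph \<in> borel_measurable G"
 shows "(\<integral>\<^sup>+y. ph y \<partial>obs_law M I f) = (\<integral>\<^sup>+y. ennreal (partf M I f y) * ph y \<partial>G)"
 unfolding obs_law_def by (rule nn_integral_density) auto

lemma integral_obs_law:
 fixes ph :: "_ => real"
 assumes [measurable]: "ph \<in> borel_measurable G"
 shows "(LINT y|obs_law M I f. ph y) = (LINT y|G. partf M I f y * ph y)"
  and "integrable (obs_law M I f) ph \<longleftrightarrow> integrable G (%y. partf M I f y * ph y)"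
 unfolding obs_law_def
 by (subst integral_density integrable_density; auto simp: less_imp_le[OF part_pos])+

lemma integral_planted:
 fixes ph :: "_ => real"
 assumes [measurable]: "ph \<in> borel_measurable G"
 shows "(LINT y|obs_law M I f. ph y) = (LINT p|(M \<Otimes>\<^sub>M G). ph (\<lambda>i\<in>I. snd p i + f i (fst p)))"
  and "integrable (obs_law M I f) ph \<longleftrightarrow> integrable (M \<Otimes>\<^sub>M G) (%p. ph (\<lambda>i\<in>I. snd p i + f i (fst p)))"
 unfolding distr_planted[symmetric] by (subst integral_distr integrable_distr_eq; auto)+

lemma prob_post: "prob_space (post M I f y)"
proof
 have "emeasure (post M I f y) (space (post M I f y)) = (\<integral>\<^sup>+w. ennreal (lik I f y w / partf M I f y) \<partial>M)"
  unfolding post_def by (subst emeasure_density) (auto intro!: nn_integral_cong)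
 also have "... = ennreal (LINT w|M. lik I f y w / partf M I f y)"
  by (rule nn_integral_eq_integral) (auto intro!: AE_I2 divide_nonneg_pos integrable_divide lik_integrable part_pos simp: less_imp_le[OF lik_pos])
 also have "(LINT w|M. lik I f y w / partf M I f y) = 1"
  using part_pos[of y] by (simp add: partf_def)
 finally show "emeasure (post M I f y) (space (post M I f y)) = 1" by simp
qed

lemma sets_post [simp, measurable_cong]: "sets (post M I f y) = sets M" and space_post [simp]: "space (post M I f y) = space M"
 by (auto simp: post_def)

lemma integral_post:
 fixes g :: "'a => real"
 assumes [measurable]: "g \<in> borel_measurable M"
 shows "(LINT w|post M I f y. g w) = gavg M I f g y"
proof -
 have "(LINT w|post M I f y. g w) = (LINT w|M. (lik I f y w / partf M I f y) * g w)"
  unfolding post_def by (subst integral_density) (auto simp: divide_nonneg_pos less_imp_le lik_pos part_pos)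
 also have "... = gavg M I f g y" unfolding gavg_def by (simp add: mult.commute)
 finally show ?thesis .
qed

lemma integrable_post:
 fixes g :: "'a => real"
 assumes "integrable M g"
 shows "integrable (post M I f y) g"
proof -
 have [measurable]: "g \<in> borel_measurable M" using assms by auto
 have "integrable M (%w. (lik I f y w / partf M I f y) * g w)"
  using mult_lik_integrable[OF assms, of y] by (simp add: mult.commute)
 thus ?thesis unfolding post_def
  by (subst integrable_density) (auto simp: divide_nonneg_pos less_imp_le lik_pos part_pos)
qed

text \<open>The tower property: the normalisation in the posterior mean cancels against the density
  of the observation.\<close>

lemma gavg_integral_nn:
 assumes g: "integrable M g" "!!w. 0 <= g w"
 shows "(\<integral>\<^sup>+y. ennreal (gavg M I f g y) \<partial>obs_law M I f) = (\<integral>\<^sup>+w. ennreal (g w) \<partial>M)"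
proof -
 have [measurable]: "g \<in> borel_measurable M" using g by auto
 have "(\<integral>\<^sup>+y. ennreal (gavg M I f g y) \<partial>obs_law M I f)
  = (\<integral>\<^sup>+y. ennreal (partf M I f y) * ennreal (gavg M I f g y) \<partial>G)"
  by (subst nn_integral_obs_law) auto
 also have "... = (\<integral>\<^sup>+y. \<integral>\<^sup>+w. ennreal (g w) * ennreal (lik I f y w) \<partial>M \<partial>G)"
 proof (intro nn_integral_cong)
  fix y
  have "ennreal (partf M I f y) * ennreal (gavg M I f g y) = ennreal (LINT w|M. g w * lik I f y w)"
   using part_pos[of y] unfolding gavg_def by (subst ennreal_mult'[symmetric]) (auto simp: less_imp_le)
  also have "... = (\<integral>\<^sup>+w. ennreal (g w * lik I f y w) \<partial>M)"
   by (rule nn_integral_eq_integral[symmetric]) (auto simp: mult_lik_integrable g less_imp_le[OF lik_pos])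
  finally show "ennreal (partf M I f y) * ennreal (gavg M I f g y) = (\<integral>\<^sup>+w. ennreal (g w) * ennreal (lik I f y w) \<partial>M)"
   by (simp add: ennreal_mult g less_imp_le[OF lik_pos])
 qed
 also have "... = (\<integral>\<^sup>+w. \<integral>\<^sup>+z. ennreal (g w) \<partial>G \<partial>M)" by (rule nishimori_nn) measurable
 finally show ?thesis by (simp add: G.emeasure_space_1)
qed

lemma gavg_integral_nonneg:
 assumes g: "integrable M g" "!!w. 0 <= g w"
 shows "integrable (obs_law M I f) (gavg M I f g)" (is ?C1) "(LINT y|obs_law M I f. gavg M I f g y) = (LINT w|M. g w)" (is ?C2)
proof -
 have [measurable]: "g \<in> borel_measurable M" using g by auto
 have nn: "0 <= gavg M I f g y" for y
  unfolding gavg_def by (intro divide_nonneg_pos part_pos integral_nonneg_AE AE_I2) (simp add: g less_imp_le[OF lik_pos])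
 have eq: "(\<integral>\<^sup>+y. ennreal (gavg M I f g y) \<partial>obs_law M I f) = ennreal (LINT w|M. g w)"
  unfolding gavg_integral_nn[OF g] by (rule nn_integral_eq_integral) (auto simp: g)
 show i: ?C1
  by (rule integrableI_nonneg) (auto simp: nn eq)
 show ?C2
  using eq by (subst (asm) nn_integral_eq_integral[OF i]) (auto simp: nn g integral_nonneg_AE)
qed

lemma gavg_diff:
 assumes "integrable M g" "integrable M h"
 shows "gavg M I f (%w. g w - h w) y = gavg M I f g y - gavg M I f h y"
 unfolding gavg_def by (simp add: left_diff_distrib mult_lik_integrable assms diff_divide_distrib)

lemma gavg_integral:
 assumes g: "integrable M g"
 shows "integrable (obs_law M I f) (gavg M I f g)" (is ?C1) "(LINT y|obs_law M I f. gavg M I f g y) = (LINT w|M. g w)" (is ?C2)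
proof -
 have p: "integrable M (%w. max 0 (g w))" and m: "integrable M (%w. max 0 (- g w))" using g by auto
 have eq: "gavg M I f g = (%y. gavg M I f (%w. max 0 (g w)) y - gavg M I f (%w. max 0 (- g w)) y)"
  by (subst gavg_diff[OF p m, symmetric]) (intro ext arg_cong[where f="%g. gavg M I f g _"], auto)
 note P = gavg_integral_nonneg[OF p] and N = gavg_integral_nonneg[OF m]
 show ?C1 unfolding eq using P(1) N(1) by auto
 have "(LINT y|obs_law M I f. gavg M I f g y) = (LINT w|M. max 0 (g w)) - (LINT w|M. max 0 (- g w))"
  unfolding eq using P N by auto
 also have "... = (LINT w|M. max 0 (g w) - max 0 (- g w))" using p m by simp
 also have "... = (LINT w|M. g w)" by (intro Bochner_Integration.integral_cong) auto
 finally show ?C2 .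
qed

lemma gavg_sq_le:
 assumes [measurable]: "g \<in> borel_measurable M" and g: "integrable M (%w. (g w)^2)"
 shows "(gavg M I f g y)^2 <= gavg M I f (%w. (g w)^2) y"
proof -
 interpret P: prob_space "post M I f y" by (rule prob_post)
 have "integrable M g" by (rule square_integrable_imp_integrable) (auto simp: g)
 hence "(LINT w|post M I f y. g w)^2 <= (LINT w|post M I f y. (g w)^2)"
  using P.variance_positive[of g] P.variance_eq[of g] integrable_post[of g y] integrable_post[OF g, of y] by auto
 thus ?thesis by (simp add: integral_post)
qed

lemma gavg_sq_integrable:
 assumes [measurable]: "g \<in> borel_measurable M" and g: "integrable M (%w. (g w)^2)"
 shows "integrable (obs_law M I f) (%y. (gavg M I f g y)^2)"
 by (rule Bochner_Integration.integrable_bound[OF gavg_integral(1)[OF g]])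
  (use gavg_sq_le[OF assms] in \<open>auto intro!: AE_I2 order_trans[OF _ abs_ge_self]\<close>)

text \<open>Below, the variance of the posterior mean is nonnegative; above, Jensen's inequality
  under the posterior and the tower property.\<close>

lemma gavg_sq_integral_bounds:
 assumes [measurable]: "g \<in> borel_measurable M" and g: "integrable M (%w. (g w)^2)"
 shows "(LINT w|M. g w)^2 <= (LINT y|obs_law M I f. (gavg M I f g y)^2)" (is ?C1)
  and "(LINT y|obs_law M I f. (gavg M I f g y)^2) <= (LINT w|M. (g w)^2)" (is ?C2)
proof -
 interpret P: prob_space "obs_law M I f" by (rule prob_obs_law)
 have gi: "integrable M g" by (rule square_integrable_imp_integrable) (auto simp: g)
 show ?C1
  using P.variance_eq[OF gavg_integral(1)[OF gi] gavg_sq_integrable[OF assms]] gavg_integral(2)[OF gi]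
   integral_nonneg_AE[of "%y. (gavg M I f g y - (LINT w|M. g w))^2" "obs_law M I f"] by simp
 have "(LINT y|obs_law M I f. (gavg M I f g y)^2) <= (LINT y|obs_law M I f. gavg M I f (%w. (g w)^2) y)"
  by (rule integral_mono[OF gavg_sq_integrable[OF assms] gavg_integral(1)[OF g]]) (rule gavg_sq_le[OF assms])
 thus ?C2
  using gavg_integral(2)[OF g] by simp
qed

end

section \<open>Relative entropy of a weak signal, up to third order\<close>

lemma exp_taylor2_error:
 fixes x :: real assumes "\<bar>x\<bar> <= 1"
 shows "\<bar>exp x - (1 + x + x^2 / 2)\<bar> <= \<bar>x\<bar> ^ 3"
proof -
 obtain t where t: "\<bar>t\<bar> <= \<bar>x\<bar>" "exp x = (\<Sum>m<3. x ^ m / fact m) + exp t / fact 3 * x ^ 3"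
  using Maclaurin_exp_le[of x 3] by auto
 have "exp x - (1 + x + x^2 / 2) = exp t / 6 * x ^ 3"
 proof -
  have "(\<Sum>m<3. x ^ m / fact m) = 1 + x + x^2 / 2"
  proof -
   have "{..<3::nat} = {0, 1, 2}" by auto
   thus ?thesis by (simp add: fact_2)
  qed
  moreover have "fact 3 = (6::real)" by (simp add: fact_numeral)
  ultimately show ?thesis unfolding t(2) by simp
 qed
 moreover have "exp t <= 6"
 proof -
  have "exp t <= exp 1" using t(1) assms by auto
  also have "... <= 3" using exp_le by auto
  finally show ?thesis by simp
 qed
 ultimately have "\<bar>exp x - (1 + x + x^2 / 2)\<bar> = exp t / 6 * \<bar>x\<bar> ^ 3" by (simp only: abs_mult power_abs) simp
 also have "... <= 1 * \<bar>x\<bar> ^ 3" using \<open>exp t <= 6\<close> by (intro mult_right_mono) auto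
 finally show ?thesis by simp
qed

text \<open>The left side is the cubic Taylor polynomial of \<open>r * ln r\<close> at
  \<open>1\<close>. After division by \<open>r\<close> the difference \<open>h\<close> has
  derivative \<open>(x - 1) ^ 3 / (3 * x^2)\<close>, whose only change of sign is at
  \<open>1\<close>, where \<open>h\<close> vanishes.\<close>

lemma mult_ln_ge_cubic:
 fixes r :: real assumes r: "0 < r"
 shows "(r - 1) + (r - 1)^2 / 2 - (r - 1) ^ 3 / 6 <= r * ln r"
proof -
 define h where "h = (%r::real. ln r + r^2 / 6 - r + 1 / 2 + inverse r / 3)"
 have D: "(h has_real_derivative ((x - 1) ^ 3 * (inverse x)^2 / 3)) (at x)" if "0 < x" for x
 proof -
  have "(h has_real_derivative (inverse x + x / 3 - 1 - (inverse x)^2 / 3)) (at x)"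
   unfolding h_def using that by (auto intro!: derivative_eq_intros simp: power2_eq_square inverse_eq_divide)
  moreover have "inverse x + x / 3 - 1 - (inverse x)^2 / 3 = (x - 1) ^ 3 * (inverse x)^2 / 3"
  proof -
   have "x * inverse x = 1" using that by simp
   hence "3 * inverse x + x - 3 - (inverse x)^2 = (x - 1) ^ 3 * (inverse x)^2" by algebra
   thus ?thesis by simp
  qed
  ultimately show ?thesis by simp
 qed
 have h1: "h 1 = 0" by (simp add: h_def)
 have "h 1 <= h r"
 proof (cases "r <= 1")
  case True
  have "\<exists>y. (h has_real_derivative y) (at x) \<and> y <= 0" if "r <= x" "x <= 1" for x
  proof (rule exI[of _ "(x - 1) ^ 3 * (inverse x)^2 / 3"], rule conjI)
   show "(h has_real_derivative (x - 1) ^ 3 * (inverse x)^2 / 3) (at x)" using that r by (intro D) simp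
   have "(x - 1) ^ 3 <= 0" using that by (simp add: power3_eq_cube mult_nonneg_nonpos mult_nonpos_nonpos)
   thus "(x - 1) ^ 3 * (inverse x)^2 / 3 <= 0" by (simp add: mult_nonpos_nonneg)
  qed
  with True show ?thesis by (rule DERIV_nonpos_imp_nonincreasing)
 next
  case False
  hence "1 <= r" by simp
  moreover have "\<exists>y. (h has_real_derivative y) (at x) \<and> 0 <= y" if "1 <= x" "x <= r" for x
  proof (rule exI[of _ "(x - 1) ^ 3 * (inverse x)^2 / 3"], rule conjI)
   show "(h has_real_derivative (x - 1) ^ 3 * (inverse x)^2 / 3) (at x)" using that by (intro D) simp
   show "0 <= (x - 1) ^ 3 * (inverse x)^2 / 3" using that by simp
  qed
  ultimately show ?thesis by (rule DERIV_nonneg_imp_nondecreasing)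
 qed
 hence "0 <= r * h r" using r h1 by simp
 also have "r * h r = r * ln r - ((r - 1) + (r - 1)^2 / 2 - (r - 1) ^ 3 / 6)"
 proof -
  have "r * h r = r * ln r + r ^ 3 / 6 - r^2 + r / 2 + (r * inverse r) / 3"
   by (simp add: h_def algebra_simps power2_eq_square power3_eq_cube)
  thus ?thesis using r by (simp add: power2_eq_square power3_eq_cube field_simps)
 qed
 finally show ?thesis by simp
qed

context channel
begin

text \<open>Inner product of the signals of two replicas. The moments of \<open>partf\<close> under
  pure noise are exponential moments of it.\<close>

definition kern :: "'a => 'a => real" where "kern w w' = (\<Sum>i\<in>I. f i w * f i w')"

lemma kern_meas [measurable]: "(%p. kern (fst p) (snd p)) \<in> borel_measurable (M \<Otimes>\<^sub>M M)"
 unfolding kern_def using meas by measurable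

lemma kern_meas1 [measurable]: "w \<in> space M ==> kern w \<in> borel_measurable M"
 unfolding kern_def using meas by measurable

lemma part_integrable: "integrable G (partf M I f)" (is ?C1) and part_integral: "(LINT y|G. partf M I f y) = 1" (is ?C2)
proof -
 have "(\<integral>\<^sup>+y. ennreal (partf M I f y) \<partial>G) = emeasure (obs_law M I f) (space (obs_law M I f))"
  unfolding obs_law_def by (subst emeasure_density) (auto intro!: nn_integral_cong)
 hence eq: "(\<integral>\<^sup>+y. ennreal (partf M I f y) \<partial>G) = 1"
  using prob_space.emeasure_space_1[OF prob_obs_law] by simp
 show i: ?C1
  by (rule integrableI_nonneg) (auto simp: eq less_imp_le[OF part_pos])
 show ?C2
  using eq unfolding nn_integral_eq_integral[OF i AE_I2[OF less_imp_le[OF part_pos]]] by simp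
qed

text \<open>Posterior average without its normalisation, with values in \<open>ennreal\<close> so
  that products of averages expand over replicas without integrability conditions.\<close>

definition nnW :: "('a => ennreal) => ('i => real) => ennreal"
 where "nnW a y = (\<integral>\<^sup>+w. a w * ennreal (lik I f y w) \<partial>M)"

lemma nnW_meas [measurable]:
 assumes [measurable]: "a \<in> borel_measurable M" shows "nnW a \<in> borel_measurable G"
 unfolding nnW_def[abs_def] by (rule borel_measurable_nn_integral) (auto simp: case_prod_beta)

lemma nnW_one: "nnW (%_. 1) y = ennreal (partf M I f y)"
 by (simp add: nnW_def nn_part)

lemma lik_shift: "lik I f (\<lambda>i\<in>I. z i + f i w) w' = exp (kern w w') * lik I f z w'"
 by (simp add: lik_def kern_def exp_add[symmetric] sum.distrib[symmetric] algebra_simps)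

lemma nnW_shift:
 assumes [measurable]: "b \<in> borel_measurable M" and [measurable]: "w \<in> space M"
 shows "nnW b (\<lambda>i\<in>I. z i + f i w) = nnW (%w'. b w' * ennreal (exp (kern w w'))) z"
 unfolding nnW_def lik_shift by (simp add: ennreal_mult less_imp_le[OF lik_pos] mult.assoc)

lemma nnW_integral:
 assumes [measurable]: "a \<in> borel_measurable M"
 shows "(\<integral>\<^sup>+y. nnW a y \<partial>G) = (\<integral>\<^sup>+w. a w \<partial>M)"
proof -
 have "(\<integral>\<^sup>+y. nnW a y \<partial>G) = (\<integral>\<^sup>+w. \<integral>\<^sup>+z. a w \<partial>G \<partial>M)"
  unfolding nnW_def by (rule nishimori_nn) measurable
 thus ?thesis by (simp add: G.emeasure_space_1)
qed

text \<open>One factor is expanded and its replica becomes the planted signal by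
  \<open>nishimori_nn\<close>; the shift tilts the other factor by \<open>exp (kern w w')\<close>,
  after which the noise integrates out.\<close>

lemma nnW_prod:
 assumes [measurable]: "a \<in> borel_measurable M" "b \<in> borel_measurable M"
 shows "(\<integral>\<^sup>+y. nnW b y * nnW a y \<partial>G) = (\<integral>\<^sup>+w. \<integral>\<^sup>+w'. a w * b w' * ennreal (exp (kern w w')) \<partial>M \<partial>M)"
proof -
 have "(\<integral>\<^sup>+y. nnW b y * nnW a y \<partial>G) = (\<integral>\<^sup>+y. \<integral>\<^sup>+w. (a w * nnW b y) * ennreal (lik I f y w) \<partial>M \<partial>G)"
  by (subst (2) nnW_def) (simp add: nn_integral_cmult[symmetric] mult_ac)
 also have "... = (\<integral>\<^sup>+w. \<integral>\<^sup>+z. a w * nnW b (\<lambda>i\<in>I. z i + f i w) \<partial>G \<partial>M)"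
  by (rule nishimori_nn) measurable
 also have "... = (\<integral>\<^sup>+w. \<integral>\<^sup>+w'. a w * b w' * ennreal (exp (kern w w')) \<partial>M \<partial>M)"
 proof (intro nn_integral_cong)
  fix w assume w[measurable]: "w \<in> space M"
  have "(\<integral>\<^sup>+z. a w * nnW b (\<lambda>i\<in>I. z i + f i w) \<partial>G) = (\<integral>\<^sup>+z. a w * nnW (%w'. b w' * ennreal (exp (kern w w'))) z \<partial>G)"
   using nnW_shift[OF assms(2) w] by simp
  also have "... = a w * (\<integral>\<^sup>+w'. b w' * ennreal (exp (kern w w')) \<partial>M)"
   by (subst nn_integral_cmult) (auto simp: nnW_integral)
  finally show "(\<integral>\<^sup>+z. a w * nnW b (\<lambda>i\<in>I. z i + f i w) \<partial>G) = (\<integral>\<^sup>+w'. a w * b w' * ennreal (exp (kern w w')) \<partial>M)"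
   by (simp add: nn_integral_cmult mult.assoc)
 qed
 finally show ?thesis .
qed

lemma part_moment2:
 "(\<integral>\<^sup>+y. ennreal ((partf M I f y)^2) \<partial>G) = (\<integral>\<^sup>+w. \<integral>\<^sup>+w'. ennreal (exp (kern w w')) \<partial>M \<partial>M)"
proof -
 have "(\<integral>\<^sup>+y. ennreal ((partf M I f y)^2) \<partial>G) = (\<integral>\<^sup>+y. nnW (%_. 1) y * nnW (%_. 1) y \<partial>G)"
  by (simp add: nnW_one power2_eq_square ennreal_mult less_imp_le[OF part_pos])
 thus ?thesis by (simp add: nnW_prod)
qed

text \<open>The first replica is planted and tilts the other two factors; \<open>nnW_prod\<close>
  then treats these. Each of the three pairs of replicas contributes its kernel.\<close>

lemma part_moment3:
 "(\<integral>\<^sup>+y. ennreal ((partf M I f y) ^ 3) \<partial>G)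
  = (\<integral>\<^sup>+w. \<integral>\<^sup>+w'. \<integral>\<^sup>+w''. ennreal (exp (kern w w' + kern w w'' + kern w' w'')) \<partial>M \<partial>M \<partial>M)"
proof -
 have "(\<integral>\<^sup>+y. ennreal ((partf M I f y) ^ 3) \<partial>G) = (\<integral>\<^sup>+y. \<integral>\<^sup>+w. (nnW (%_. 1) y * nnW (%_. 1) y) * ennreal (lik I f y w) \<partial>M \<partial>G)"
  by (subst nn_integral_cmult) (auto simp: nn_part[symmetric] nnW_one power3_eq_cube ennreal_mult less_imp_le[OF part_pos])
 also have "... = (\<integral>\<^sup>+w. \<integral>\<^sup>+z. nnW (%_. 1) (\<lambda>i\<in>I. z i + f i w) * nnW (%_. 1) (\<lambda>i\<in>I. z i + f i w) \<partial>G \<partial>M)"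
  by (rule nishimori_nn) measurable
 also have "... = (\<integral>\<^sup>+w. \<integral>\<^sup>+w'. \<integral>\<^sup>+w''. ennreal (exp (kern w w' + kern w w'' + kern w' w'')) \<partial>M \<partial>M \<partial>M)"
 proof (intro nn_integral_cong)
  fix w assume w[measurable]: "w \<in> space M"
  show "(\<integral>\<^sup>+z. nnW (%_. 1) (\<lambda>i\<in>I. z i + f i w) * nnW (%_. 1) (\<lambda>i\<in>I. z i + f i w) \<partial>G)
   = (\<integral>\<^sup>+w'. \<integral>\<^sup>+w''. ennreal (exp (kern w w' + kern w w'' + kern w' w'')) \<partial>M \<partial>M)"
  proof -
   let ?a = "%w'. ennreal (exp (kern w w'))"
   have sh: "nnW (%_. 1) (\<lambda>i\<in>I. z i + f i w) = nnW ?a z" for z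
    using nnW_shift[OF _ w, of "%_. 1" z] by simp
   have "(\<integral>\<^sup>+z. nnW ?a z * nnW ?a z \<partial>G) = (\<integral>\<^sup>+w'. \<integral>\<^sup>+w''. ?a w' * ?a w'' * ennreal (exp (kern w' w'')) \<partial>M \<partial>M)"
    by (rule nnW_prod) measurable
   moreover have e: "?a w' * ?a w'' * ennreal (exp (kern w' w'')) = ennreal (exp (kern w w' + kern w w'' + kern w' w''))" for w' w''
    by (simp only: exp_add ennreal_mult[symmetric] exp_ge_zero mult_nonneg_nonneg)
   ultimately show ?thesis by (simp only: sh e)
  qed
 qed
 finally show ?thesis .
qed

end

locale bounded_channel = channel +
 fixes b :: real
 assumes bound: "!!i w. i \<in> I ==> \<bar>f i w\<bar> <= b" and b0: "0 <= b"
begin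

lemma f_integrable: "i \<in> I ==> integrable M (f i)"
 by (rule integrable_const_bound[where B=b]) (auto simp: bound meas)

lemma ln_part_bound: "\<bar>ln (partf M I f y)\<bar> <= (\<Sum>i\<in>I. b * \<bar>y i\<bar> + b^2 / 2)"
proof -
 define S where "S = (\<Sum>i\<in>I. b * \<bar>y i\<bar> + b^2 / 2)"
 have abs: "\<bar>\<Sum>i\<in>I. f i w * y i - (f i w)^2 / 2\<bar> <= S" for w
 proof -
  have "\<bar>f i w * y i - (f i w)^2 / 2\<bar> <= b * \<bar>y i\<bar> + b^2 / 2" if i: "i \<in> I" for i
  proof -
   have "\<bar>f i w * y i\<bar> <= b * \<bar>y i\<bar>" using bound[OF i, of w] by (simp add: abs_mult mult_right_mono)
   moreover have "(f i w)^2 <= b^2" using bound[OF i, of w] by (simp add: abs_le_square_iff[symmetric] b0)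
   moreover have "0 <= (f i w)^2" by simp
   ultimately show ?thesis by linarith
  qed
  thus ?thesis unfolding S_def by (intro order_trans[OF sum_abs] sum_mono)
 qed
 have lo: "exp (- S) <= lik I f y w" and up: "lik I f y w <= exp S" for w
  using abs[of w] unfolding lik_def by auto
 have "(LINT w|M. exp (- S)) <= partf M I f y" unfolding partf_def
  by (rule integral_mono) (auto simp: lik_integrable lo)
 hence "- S <= ln (partf M I f y)" by (subst ln_ge_iff) (auto simp: prob_space part_pos)
 moreover have "partf M I f y <= (LINT w|M. exp S)" unfolding partf_def
  by (rule integral_mono) (auto simp: lik_integrable up)
 hence "ln (partf M I f y) <= ln (exp S)" by (subst ln_le_cancel_iff) (auto simp: prob_space part_pos)
 ultimately show ?thesis unfolding S_def[symmetric] by auto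
qed

lemma obs_law_coord:
 assumes i: "i \<in> I"
 shows "integrable (obs_law M I f) (%y. y i)" (is ?C1) "(LINT y|obs_law M I f. y i) = (LINT w|M. f i w)" (is ?C2)
proof -
 note [measurable] = meas[OF i] i
 interpret N: product_prob_space "%i. std_normal_distribution" by (rule product_prob_space_std_normal)
 have dN: "distr G std_normal_distribution (%z. z i) = std_normal_distribution"
  by (rule distr_PiM_component) (auto simp: i prob_space_std_normal)
 have zi: "integrable G (%z. z i)" and z0: "(LINT z|G. z i) = 0"
 proof -
  have "integrable (distr G std_normal_distribution (%z. z i)) (%x. x)"
   unfolding dN using integrable_std_normal_distribution_moment[of 1] by simp
  thus "integrable G (%z. z i)" by (subst (asm) integrable_distr_eq) auto
  have "(LINT x|distr G std_normal_distribution (%z. z i). x) = 0"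
   unfolding dN using integral_std_normal_distribution_moment_odd[of 1] by simp
  thus "(LINT z|G. z i) = 0" by (subst (asm) integral_distr) auto
 qed
 note 1 = integrable_pair_snd[OF prob_space_axioms prob_space_std_gauss zi]
 note 2 = integrable_pair_fst[OF prob_space_std_gauss f_integrable[OF i], of I]
 show ?C1
  using 1(1) 2(1) i by (subst integral_planted) auto
 show ?C2
  using 1 2 i z0 by (subst integral_planted) auto
qed

lemma ln_part_integrable: "integrable (obs_law M I f) (%y. ln (partf M I f y))"
proof -
 interpret P: prob_space "obs_law M I f" by (rule prob_obs_law)
 have "integrable (obs_law M I f) (%y. \<Sum>i\<in>I. b * \<bar>y i\<bar> + b^2 / 2)"
  using obs_law_coord(1) by auto
 thus ?thesis
  by (rule Bochner_Integration.integrable_bound) (auto intro!: AE_I2 order_trans[OF ln_part_bound abs_ge_self])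
qed

text \<open>Gibbs' inequality: \<open>r - 1 <= r * ln r\<close>, and \<open>partf\<close> has mean
  \<open>1\<close> under pure noise.\<close>

lemma ent_ge_0: "0 <= ent M I f"
proof -
 note Zi = part_integrable and Z1 = part_integral
 have "ent M I f = (LINT y|G. partf M I f y * ln (partf M I f y))"
  unfolding ent_def by (subst integral_obs_law) auto
 moreover have "(LINT y|G. partf M I f y - 1) <= (LINT y|G. partf M I f y * ln (partf M I f y))"
 proof (rule integral_mono)
  show "integrable G (%y. partf M I f y * ln (partf M I f y))"
   using ln_part_integrable by (subst (asm) integral_obs_law) auto
  show "partf M I f y - 1 <= partf M I f y * ln (partf M I f y)" for y
  proof -
   have "ln (1 / partf M I f y) <= 1 / partf M I f y - 1" using part_pos[of y] by (intro ln_le_minus_one) auto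
   hence "1 - 1 / partf M I f y <= ln (partf M I f y)" using part_pos[of y] by (simp add: ln_div)
   hence "partf M I f y * (1 - 1 / partf M I f y) <= partf M I f y * ln (partf M I f y)"
    using part_pos[of y] by (intro mult_left_mono) auto
   thus ?thesis using part_pos[of y] by (simp add: right_diff_distrib)
  qed
 qed (use Zi in auto)
 ultimately show ?thesis using Zi Z1 by (simp add: G.prob_space)
qed

end

text \<open>The exponent of three replicas is a sum of three kernels, so \<open>X <= 1 / 3\<close>
  is what keeps it within the range of \<open>exp_taylor2_error\<close>.\<close>

locale centered_channel = bounded_channel +
 fixes X :: real
 assumes centered: "!!i. i \<in> I ==> (LINT w|M. f i w) = 0"
  and kern_bound: "!!w w'. \<bar>kern w w'\<bar> <= X" and X: "X <= 1 / 3"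
begin

lemma X0: "0 <= X" using kern_bound[of undefined undefined] by linarith

sublocale MM: pair_prob_space M M ..

lemma kern_centered: "(LINT w'|M. kern w w') = 0" "(LINT w'|M. kern w' w) = 0"
 unfolding kern_def using f_integrable centered by (auto simp: Bochner_Integration.integral_sum)

lemma kern_integrable: "w \<in> space M ==> integrable M (kern w)"
 by (rule integrable_const_bound[where B=X]) (auto simp: kern_bound)

lemma kern_integrable2: "integrable (M \<Otimes>\<^sub>M M) (%p. kern (fst p) (snd p))"
 by (rule MM.integrable_const_bound[where B=X]) (auto simp: kern_bound)

lemma kern_sq_le: "(kern w w')^2 <= X^2"
 using kern_bound[of w w'] X0 by (simp add: abs_le_square_iff[symmetric])

lemma kern_sq_integrable: "integrable (M \<Otimes>\<^sub>M M) (%p. (kern (fst p) (snd p))^2)"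
 by (rule MM.integrable_const_bound[where B="X^2"]) (auto simp: kern_sq_le)

lemma kern_mean: "(LINT p|(M \<Otimes>\<^sub>M M). kern (fst p) (snd p)) = 0"
 using MM.integral_fst'[OF kern_integrable2] by (simp add: kern_centered)

text \<open>By \<open>replica_square\<close> this is the sum of the squared covariances of the
  signal coordinates; it carries the second order term of the entropy.\<close>

definition "S2 = (LINT p|(M \<Otimes>\<^sub>M M). (kern (fst p) (snd p))^2)"

lemma part_moment2_real:
 "integrable G (%y. (partf M I f y)^2)" (is ?C1)
 "(LINT y|G. (partf M I f y)^2) = (LINT p|(M \<Otimes>\<^sub>M M). exp (kern (fst p) (snd p)))" (is ?C2)
proof -
 have i: "integrable (M \<Otimes>\<^sub>M M) (%p. exp (kern (fst p) (snd p)))"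
  by (rule MM.integrable_const_bound[where B="exp X"]) (auto intro: order_trans[OF abs_ge_self kern_bound])
 have "(\<integral>\<^sup>+y. ennreal ((partf M I f y)^2) \<partial>G) = (\<integral>\<^sup>+p. ennreal (exp (kern (fst p) (snd p))) \<partial>(M \<Otimes>\<^sub>M M))"
  unfolding part_moment2 by (subst nn_integral_fst[symmetric]) auto
 also have "... = ennreal (LINT p|(M \<Otimes>\<^sub>M M). exp (kern (fst p) (snd p)))"
  by (rule nn_integral_eq_integral[OF i]) auto
 finally have eq: "(\<integral>\<^sup>+y. ennreal ((partf M I f y)^2) \<partial>G) = ennreal (LINT p|(M \<Otimes>\<^sub>M M). exp (kern (fst p) (snd p)))" .
 show ?C1 by (rule integrableI_nonneg) (auto simp: eq)
 thus ?C2
  using eq by (subst (asm) nn_integral_eq_integral) (auto intro!: integral_nonneg_AE)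
qed

lemma exp_kern_bounds:
 "1 + S2 / 2 - X ^ 3 <= (LINT p|(M \<Otimes>\<^sub>M M). exp (kern (fst p) (snd p)))"
 "(LINT p|(M \<Otimes>\<^sub>M M). exp (kern (fst p) (snd p))) <= 1 + X^2"
proof -
 let ?k = "%p. kern (fst p) (snd p)"
 have i: "integrable (M \<Otimes>\<^sub>M M) (%p. exp (?k p))"
  by (rule MM.integrable_const_bound[where B="exp X"]) (auto intro: order_trans[OF abs_ge_self kern_bound])
 have T: "\<bar>exp (?k p) - (1 + ?k p + (?k p)^2 / 2)\<bar> <= X ^ 3" for p
 proof -
  have "\<bar>?k p\<bar> <= 1" using kern_bound[of "fst p" "snd p"] X by linarith
  from exp_taylor2_error[OF this] show ?thesis
   using power_mono[OF kern_bound[of "fst p" "snd p"], of 3] by linarith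
 qed
 have "(LINT p|(M \<Otimes>\<^sub>M M). 1 + ?k p + (?k p)^2 / 2 - X ^ 3) <= (LINT p|(M \<Otimes>\<^sub>M M). exp (?k p))"
  using kern_integrable2 kern_sq_integrable i T by (intro integral_mono) (auto simp: abs_le_iff algebra_simps)
 thus "1 + S2 / 2 - X ^ 3 <= (LINT p|(M \<Otimes>\<^sub>M M). exp (?k p))"
  using kern_integrable2 kern_sq_integrable by (simp add: S2_def kern_mean MM.prob_space)
 have "exp (?k p) <= 1 + ?k p + X^2" for p
 proof -
  have "X ^ 3 <= X^2 / 2"
   using mult_right_mono[of X "1/2" "X^2"] X by (simp add: power3_eq_cube power2_eq_square)
  thus ?thesis using T[of p] kern_sq_le[of "fst p" "snd p"] by (simp add: abs_le_iff)
 qed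
 hence "(LINT p|(M \<Otimes>\<^sub>M M). exp (?k p)) <= (LINT p|(M \<Otimes>\<^sub>M M). 1 + ?k p + X^2)"
  using kern_integrable2 i by (intro integral_mono) auto
 thus "(LINT p|(M \<Otimes>\<^sub>M M). exp (?k p)) <= 1 + X^2"
  using kern_integrable2 by (simp add: kern_mean MM.prob_space)
qed

text \<open>The exponential is expanded to second order. The linear terms vanish by centring, and so
  does the product of two different kernels, because it has a replica that occurs in one of them
  only. Three squares remain, each worth \<open>S2 / 2\<close>, and the error is
  \<open>(3 * X) ^ 3\<close>.\<close>

lemma part_moment3_real:
 "integrable G (%y. (partf M I f y) ^ 3)" (is ?C1)
 "(LINT y|G. (partf M I f y) ^ 3) <= 1 + 3 * S2 / 2 + 27 * X ^ 3" (is ?C2)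
proof -
 have "(\<integral>\<^sup>+w''. ennreal (exp (kern w w' + kern w w'' + kern w' w'')) \<partial>M)
   <= ennreal (1 + kern w w' + 27 * X ^ 3 + (LINT w''|M. (kern w w' + kern w w'' + kern w' w'')^2 / 2))"
  if w[measurable]: "w \<in> space M" and w'[measurable]: "w' \<in> space M" for w w'
 proof -
  let ?s = "%w''. kern w w' + kern w w'' + kern w' w''"
  have s: "\<bar>?s w''\<bar> <= 3 * X" for w''
   using kern_bound[of w w'] kern_bound[of w w''] kern_bound[of w' w''] by linarith
  have T: "exp (?s w'') <= 1 + ?s w'' + (?s w'')^2 / 2 + 27 * X ^ 3" for w''
  proof -
   have "\<bar>?s w''\<bar> <= 1" using s[of w''] X by linarith
   from exp_taylor2_error[OF this] show ?thesis
    using power_mono[OF s[of w''], of 3] by (simp add: power_mult_distrib abs_le_iff)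
  qed
  have "(?s w'')^2 <= (3 * X)^2" for w'' using power_mono[OF s[of w''], of 2] by simp
  hence i2: "integrable M (%w''. (?s w'')^2)"
   by (intro integrable_const_bound[where B="(3*X)^2"] AE_I2) auto
  have i: "integrable M (%w''. 1 + ?s w'' + (?s w'')^2 / 2 + 27 * X ^ 3)"
   using i2 kern_integrable w w' by auto
  have "(\<integral>\<^sup>+w''. ennreal (exp (?s w'')) \<partial>M) <= (\<integral>\<^sup>+w''. ennreal (1 + ?s w'' + (?s w'')^2 / 2 + 27 * X ^ 3) \<partial>M)"
   by (intro nn_integral_mono ennreal_leI T)
  also have "... = ennreal (LINT w''|M. 1 + ?s w'' + (?s w'')^2 / 2 + 27 * X ^ 3)"
   by (rule nn_integral_eq_integral[OF i]) (use T in \<open>auto intro!: AE_I2 order_trans[OF less_imp_le[OF exp_gt_zero]]\<close>)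
  also have "(LINT w''|M. 1 + ?s w'' + (?s w'')^2 / 2 + 27 * X ^ 3) = 1 + kern w w' + 27 * X ^ 3 + (LINT w''|M. (?s w'')^2 / 2)"
   using i2 kern_integrable w w' by (simp add: kern_centered prob_space)
  finally show ?thesis .
 qed
 note step1 = this
 define q where "q = (%w. LINT w'|M. (kern w w')^2)"
 have sqi: "integrable M (%w'. (kern w w')^2)" if [measurable]: "w \<in> space M" for w
  by (rule integrable_const_bound[where B="X^2"]) (auto simp: kern_sq_le)
 have q_le: "0 <= q w" "q w <= X^2" if "w \<in> space M" for w
 proof -
  show "0 <= q w" unfolding q_def by simp
  have "q w <= (LINT w'|M. X^2)" unfolding q_def by (intro integral_mono sqi that) (auto simp: kern_sq_le)
  thus "q w <= X^2" by (simp add: prob_space)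
 qed
 have qm[measurable]: "q \<in> borel_measurable M"
  unfolding q_def by (rule borel_measurable_lebesgue_integral) (auto simp: case_prod_beta)
 have qi: "integrable M q" by (rule integrable_const_bound[where B="X^2"]) (use q_le in auto)
 have qS: "(LINT w|M. q w) = S2"
  unfolding q_def S2_def using MM.integral_fst'[OF kern_sq_integrable] by simp
 have cross_i: "integrable M (%w''. kern w w'' * kern w' w'')" if [measurable]: "w \<in> space M" "w' \<in> space M" for w w'
  by (rule integrable_const_bound[where B="X * X"]) (auto simp: abs_mult kern_bound intro!: mult_mono' AE_I2)
 have sq: "(LINT w''|M. (kern w w' + kern w w'' + kern w' w'')^2 / 2)
   = (kern w w')^2 / 2 + q w / 2 + q w' / 2 + (LINT w''|M. kern w w'' * kern w' w'')"
  if w: "w \<in> space M" and w': "w' \<in> space M" for w w'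
 proof -
  have "(LINT w''|M. (kern w w' + kern w w'' + kern w' w'')^2 / 2)
   = (LINT w''|M. (kern w w')^2 / 2 + (kern w w'')^2 / 2 + (kern w' w'')^2 / 2 + kern w w' * kern w w'' + kern w w' * kern w' w'' + kern w w'' * kern w' w'')"
   by (intro Bochner_Integration.integral_cong refl) (simp add: power2_eq_square field_simps)
  thus ?thesis using sqi[OF w] sqi[OF w'] kern_integrable[OF w] kern_integrable[OF w'] cross_i[OF w w']
   by (simp add: kern_centered q_def prob_space)
 qed
 define c where "c = (%w w'. LINT w''|M. kern w w'' * kern w' w'')"
 have c_le: "\<bar>c w w'\<bar> <= X * X" if w: "w \<in> space M" and w': "w' \<in> space M" for w w'
 proof -
  have "\<bar>c w w'\<bar> <= (LINT w''|M. \<bar>kern w w'' * kern w' w''\<bar>)" unfolding c_def by (rule integral_abs_bound)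
  also have "... <= (LINT w''|M. X * X)"
  proof (rule integral_mono)
   show "integrable M (%w''. \<bar>kern w w'' * kern w' w''\<bar>)" using cross_i[OF w w'] by (rule integrable_abs)
  qed (auto simp: abs_mult kern_bound intro!: mult_mono')
  finally show ?thesis by (simp add: prob_space)
 qed
 have cm: "c w \<in> borel_measurable M" if w[measurable]: "w \<in> space M" for w
  unfolding c_def by (rule borel_measurable_lebesgue_integral) (auto simp: case_prod_beta)
 have ci: "integrable M (c w)" if w: "w \<in> space M" for w
  by (rule integrable_const_bound[where B="X*X"]) (use c_le w cm in auto)
 have c0: "(LINT w'|M. c w w') = 0" if w[measurable]: "w \<in> space M" for w
 proof -
  have "integrable (M \<Otimes>\<^sub>M M) (%(w', w''). kern w w'' * kern w' w'')"
   by (rule MM.integrable_const_bound[where B="X * X"]) (auto simp: abs_mult kern_bound case_prod_beta intro!: mult_mono' AE_I2)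
  from MM.Fubini_integral[OF this]
  have "(LINT w'|M. c w w') = (LINT w''|M. LINT w'|M. kern w w'' * kern w' w'')" unfolding c_def by simp
  thus ?thesis by (simp add: kern_centered)
 qed
 have step2: "(\<integral>\<^sup>+w'. \<integral>\<^sup>+w''. ennreal (exp (kern w w' + kern w w'' + kern w' w'')) \<partial>M \<partial>M)
  <= ennreal (1 + 27 * X ^ 3 + q w + S2 / 2)" if w: "w \<in> space M" for w
 proof -
  let ?h = "%w'. 1 + kern w w' + 27 * X ^ 3 + ((kern w w')^2 / 2 + q w / 2 + q w' / 2 + c w w')"
  have hi: "integrable M ?h" using kern_integrable[OF w] sqi[OF w] qi ci[OF w] by auto
  have "(\<integral>\<^sup>+w'. \<integral>\<^sup>+w''. ennreal (exp (kern w w' + kern w w'' + kern w' w'')) \<partial>M \<partial>M) <= (\<integral>\<^sup>+w'. ennreal (?h w') \<partial>M)"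
  proof (rule nn_integral_mono)
   fix w' assume w': "w' \<in> space M"
   show "(\<integral>\<^sup>+w''. ennreal (exp (kern w w' + kern w w'' + kern w' w'')) \<partial>M) <= ennreal (?h w')"
    using step1[OF w w'] unfolding sq[OF w w'] c_def .
  qed
  also have "... = ennreal (LINT w'|M. ?h w')"
  proof (rule nn_integral_eq_integral[OF hi], rule AE_I2)
   fix w' assume w': "w' \<in> space M"
   have "0 <= (LINT w''|M. (kern w w' + kern w w'' + kern w' w'')^2 / 2)" by simp
   moreover have "0 <= X ^ 3" using X0 by simp
   ultimately show "0 <= ?h w'" using sq[OF w w'] kern_bound[of w w'] X unfolding c_def by linarith
  qed
  also have "(LINT w'|M. ?h w') = 1 + 27 * X ^ 3 + q w + S2 / 2"
   using kern_integrable[OF w] sqi[OF w] qi ci[OF w] qS c0[OF w] by (simp add: kern_centered prob_space q_def)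
  finally show ?thesis .
 qed
 have "(\<integral>\<^sup>+y. ennreal ((partf M I f y) ^ 3) \<partial>G) <= (\<integral>\<^sup>+w. ennreal (1 + 27 * X ^ 3 + q w + S2 / 2) \<partial>M)"
  unfolding part_moment3 by (intro nn_integral_mono step2)
 also have "... = ennreal (LINT w|M. 1 + 27 * X ^ 3 + q w + S2 / 2)"
  using qi q_le X0 by (intro nn_integral_eq_integral) (auto simp: S2_def intro!: AE_I2 add_nonneg_nonneg)
 also have "(LINT w|M. 1 + 27 * X ^ 3 + q w + S2 / 2) = 1 + 3 * S2 / 2 + 27 * X ^ 3"
  using qi qS by (simp add: prob_space)
 finally have le: "(\<integral>\<^sup>+y. ennreal ((partf M I f y) ^ 3) \<partial>G) <= ennreal (1 + 3 * S2 / 2 + 27 * X ^ 3)" .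
 show i: ?C1
  by (rule integrableI_nonneg) (auto simp: less_imp_le[OF part_pos] intro: le_less_trans[OF le])
 have nn: "0 <= 1 + 3 * S2 / 2 + 27 * X ^ 3" using X0 by (auto simp: S2_def intro!: add_nonneg_nonneg)
 show ?C2
  using le nn by (subst (asm) nn_integral_eq_integral[OF i]) (auto simp: less_imp_le[OF part_pos])
qed

text \<open>From above, \<open>ln r <= r - 1\<close> leaves the second moment of
  \<open>partf\<close> minus one. From below, the cubic minorant of \<open>r * ln r\<close> involves
  the second and the third moment: \<open>S2\<close> gets the weight
  \<open>1 / 2 - (3 / 2) / 6 = 1 / 4\<close>, and the errors \<open>X ^ 3 + 27 * X ^ 3 / 6\<close>
  fit into \<open>6 * X ^ 3\<close>.\<close>

lemma ent_centered_bounds: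
 "ent M I f <= X^2" "S2 / 4 - 6 * X ^ 3 <= ent M I f" (is ?C1)
proof -
 note Zi = part_integrable and Z1 = part_integral
 note Z2 = part_moment2_real and Z3 = part_moment3_real
 have e: "ent M I f = (LINT y|G. partf M I f y * ln (partf M I f y))"
  unfolding ent_def by (subst integral_obs_law) auto
 have li: "integrable G (%y. partf M I f y * ln (partf M I f y))"
  using ln_part_integrable by (subst (asm) integral_obs_law) auto
 have "ent M I f <= (LINT y|G. (partf M I f y)^2 - partf M I f y)"
  unfolding e
 proof (rule integral_mono[OF li])
  show "partf M I f y * ln (partf M I f y) <= (partf M I f y)^2 - partf M I f y" for y
   using mult_left_mono[OF ln_le_minus_one[OF part_pos[of y]], of "partf M I f y"] part_pos[of y]
   by (simp add: power2_eq_square algebra_simps)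
 qed (use Z2 Zi in auto)
 thus "ent M I f <= X^2" using Z2 Zi Z1 exp_kern_bounds(2) by simp
 let ?Z = "partf M I f"
 have "(LINT y|G. (?Z y)^2 - ?Z y / 2 - 1 / 3 - (?Z y) ^ 3 / 6) <= ent M I f"
  unfolding e
 proof (rule integral_mono[OF _ li])
  show "(?Z y)^2 - ?Z y / 2 - 1 / 3 - (?Z y) ^ 3 / 6 <= ?Z y * ln (?Z y)" for y
  proof -
   have "(r - 1) + (r - 1)^2 / 2 - (r - 1) ^ 3 / 6 = r^2 - r / 2 - 1 / 3 - r ^ 3 / 6" for r :: real
    by (simp add: power2_eq_square power3_eq_cube field_simps)
   thus ?thesis using mult_ln_ge_cubic[OF part_pos[of y]] by simp
  qed
 qed (use Z2 Z3 Zi in auto)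
 also have "(LINT y|G. (?Z y)^2 - ?Z y / 2 - 1 / 3 - (?Z y) ^ 3 / 6) = (LINT y|G. (?Z y)^2) - 1 / 2 - 1 / 3 - (LINT y|G. (?Z y) ^ 3) / 6"
  using Z2 Z3 Zi Z1 by (simp add: G.prob_space)
 finally have low: "(LINT y|G. (?Z y)^2) - 1 / 2 - 1 / 3 - (LINT y|G. (?Z y) ^ 3) / 6 <= ent M I f" .
 have "0 <= X ^ 3" using X0 by simp
 thus ?C1
  using low Z2(2) exp_kern_bounds(1) Z3(2) by linarith
qed

end

text \<open>The mean \<open>m\<close> of the signal is known, so subtracting it from the observation
  loses nothing: the likelihood factors into that of the constant signal \<open>m\<close> and that
  of the centred signal at \<open>y - m\<close>. The constant part averages to
  \<open>m^2 - m^2 / 2\<close> per coordinate.\<close>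

lemma (in bounded_channel) ent_decomp:
 defines "m \<equiv> %i. LINT w|M. f i w"
 shows "bounded_channel M I (%i w. f i w - m i) (2 * b)" (is ?C1)
  and "ent M I f = (\<Sum>i\<in>I. (m i)^2) / 2 + ent M I (%i w. f i w - m i)" (is ?C2)
proof -
 have mb: "\<bar>m i\<bar> <= b" if "i \<in> I" for i
 proof -
  have "\<bar>m i\<bar> <= (LINT w|M. \<bar>f i w\<bar>)" unfolding m_def by (rule integral_abs_bound)
  also have "... <= (LINT w|M. b)" using f_integrable[OF that] bound[OF that] by (intro integral_mono) auto
  finally show ?thesis by (simp add: prob_space)
 qed
 show bc: ?C1
 proof (standard, goal_cases)
  case (3 i w) thus ?case using bound[of i w] mb[of i] by linarith
 qed (use fin meas b0 in auto)
 interpret C: bounded_channel M I "%i w. f i w - m i" "2 * b" by (rule bc)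
 define sh where "sh = (%y. \<lambda>i\<in>I. y i - m i)"
 have sh[measurable]: "sh \<in> measurable G G" unfolding sh_def by (intro measurable_restrict) auto
 have lk: "lik I f y w = exp (\<Sum>i\<in>I. m i * y i - (m i)^2 / 2) * lik I (%i w. f i w - m i) (sh y) w" for y w
  unfolding lik_def sh_def exp_add[symmetric] sum.distrib[symmetric]
  by (intro arg_cong[where f=exp] sum.cong) (auto simp: power2_eq_square field_simps)
 have pt: "partf M I f y = exp (\<Sum>i\<in>I. m i * y i - (m i)^2 / 2) * partf M I (%i w. f i w - m i) (sh y)" for y
  unfolding partf_def lk by simp
 have law: "distr (obs_law M I f) G sh = obs_law M I (%i w. f i w - m i)"
 proof -
  have "distr (obs_law M I f) G sh = distr (M \<Otimes>\<^sub>M G) G (sh \<circ> (%p. \<lambda>i\<in>I. snd p i + f i (fst p)))"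
   unfolding distr_planted[symmetric] by (rule distr_distr) auto
  also have "sh \<circ> (%p. \<lambda>i\<in>I. snd p i + f i (fst p)) = (%p. \<lambda>i\<in>I. snd p i + (f i (fst p) - m i))"
   by (auto simp: sh_def fun_eq_iff)
  finally have e: "distr (obs_law M I f) G sh = distr (M \<Otimes>\<^sub>M G) G (%p. \<lambda>i\<in>I. snd p i + (f i (fst p) - m i))" .
  show ?thesis unfolding e by (rule C.distr_planted)
 qed
 have Ei: "integrable (obs_law M I f) (%y. ln (partf M I (%i w. f i w - m i) (sh y)))"
  using C.ln_part_integrable unfolding law[symmetric] by (subst (asm) integrable_distr_eq) auto
 have "ent M I f = (LINT y|obs_law M I f. (\<Sum>i\<in>I. m i * y i - (m i)^2 / 2) + ln (partf M I (%i w. f i w - m i) (sh y)))"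
  unfolding ent_def pt by (intro Bochner_Integration.integral_cong refl) (simp add: ln_mult C.part_pos less_imp_neq[OF C.part_pos, symmetric])
 also have "... = (\<Sum>i\<in>I. m i * m i - (m i)^2 / 2) + (LINT y|obs_law M I f. ln (partf M I (%i w. f i w - m i) (sh y)))"
 proof -
  interpret P: prob_space "obs_law M I f" by (rule prob_obs_law)
  have i1: "integrable (obs_law M I f) (%y. m i * y i - (m i)^2 / 2)" if "i \<in> I" for i
   using obs_law_coord(1)[OF that] by (intro Bochner_Integration.integrable_diff integrable_mult_right P.integrable_const)
  have i2: "(LINT y|obs_law M I f. m i * y i - (m i)^2 / 2) = m i * m i - (m i)^2 / 2" if "i \<in> I" for i
   using obs_law_coord[OF that] P.prob_space by (simp add: m_def)
  show ?thesis
   by (subst Bochner_Integration.integral_add[OF Bochner_Integration.integrable_sum[OF i1] Ei], assumption,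
     subst Bochner_Integration.integral_sum[OF i1], assumption) (simp add: i2)
 qed
 also have "(LINT y|obs_law M I f. ln (partf M I (%i w. f i w - m i) (sh y))) = ent M I (%i w. f i w - m i)"
  unfolding ent_def law[symmetric] by (subst integral_distr) auto
 finally show ?C2
  by (simp add: power2_eq_square sum_divide_distrib)
qed

text \<open>First order bound below, first order bound above, second order bound below. They will be
  applied with a posterior as prior and a small increment of the ratio as signal strength.\<close>

lemma (in bounded_channel) ent_bounds:
 defines "m \<equiv> %i. LINT w|M. f i w"
 shows "(\<Sum>i\<in>I. (m i)^2) / 2 <= ent M I f" (is ?C1)
  and "(!!w w'. \<bar>\<Sum>i\<in>I. (f i w - m i) * (f i w' - m i)\<bar> <= X) ==> X <= 1 / 3 ==>
   ent M I f <= (\<Sum>i\<in>I. (m i)^2) / 2 + X^2"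
  and "(!!w w'. \<bar>\<Sum>i\<in>I. (f i w - m i) * (f i w' - m i)\<bar> <= X) ==> X <= 1 / 3 ==>
   (\<Sum>i\<in>I. (m i)^2) / 2 + (LINT p|(M \<Otimes>\<^sub>M M). (\<Sum>i\<in>I. (f i (fst p) - m i) * (f i (snd p) - m i))^2) / 4 - 6 * X ^ 3
    <= ent M I f"
proof -
 have mi: "(LINT w|M. f i w) = m i" for i by (simp add: m_def)
 note d = ent_decomp[unfolded mi]
 interpret C: bounded_channel M I "%i w. f i w - m i" "2 * b" by (rule d(1))
 show ?C1 unfolding d(2) using C.ent_ge_0 by simp
 assume X: "!!w w'. \<bar>\<Sum>i\<in>I. (f i w - m i) * (f i w' - m i)\<bar> <= X" "X <= 1 / 3"
 have "centered_channel M I (%i w. f i w - m i) (2 * b) X"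
 proof (intro centered_channel.intro d(1) centered_channel_axioms.intro)
  show "(LINT w|M. f i w - m i) = 0" if "i \<in> I" for i
   using f_integrable[OF that] by (simp add: m_def prob_space)
  show "\<bar>C.kern w w'\<bar> <= X" for w w' using X(1) by (simp add: C.kern_def)
 qed (rule X(2))
 then interpret CC: centered_channel M I "%i w. f i w - m i" "2 * b" X .
 show "ent M I f <= (\<Sum>i\<in>I. (m i)^2) / 2 + X^2" using CC.ent_centered_bounds(1) by (subst d(2)) simp
 show "(\<Sum>i\<in>I. (m i)^2) / 2 + (LINT p|(M \<Otimes>\<^sub>M M). (\<Sum>i\<in>I. (f i (fst p) - m i) * (f i (snd p) - m i))^2) / 4 - 6 * X ^ 3
    <= ent M I f"
  using CC.ent_centered_bounds(2) unfolding CC.S2_def C.kern_def by (subst d(2)) simp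
qed

definition amp :: "('i => 'a => real) => ('i => real) => 'i => 'a => real"
 where "amp e g i w = sqrt (g i) * e i w"

text \<open>Two independent observations of ratios \<open>g\<close> and \<open>d\<close> are
  combined into a sufficient one of ratio \<open>g + d\<close>. Where both ratios vanish the first
  observation is kept, so that the squares of the two weights always sum to \<open>1\<close> and the
  map preserves the noise.\<close>

definition rot :: "'i set => ('i => real) => ('i => real) => ('i => real) => ('i => real) => 'i => real"
 where "rot I g d y1 y2 = (\<lambda>i\<in>I. (if g i + d i = 0 then 1 else sqrt (g i / (g i + d i))) * y1 i
  + (if g i + d i = 0 then 0 else sqrt (d i / (g i + d i))) * y2 i)"

lemma distr_rot:
 assumes I: "finite I" and g: "\<forall>i\<in>I. 0 <= g i" and d: "\<forall>i\<in>I. 0 <= d i"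
 shows "distr (std_gauss I \<Otimes>\<^sub>M std_gauss I) (std_gauss I) (%p. rot I g d (fst p) (snd p)) = std_gauss I"
proof -
 have "(if g i + d i = 0 then 1 else sqrt (g i / (g i + d i)))^2
   + (if g i + d i = 0 then 0 else sqrt (d i / (g i + d i)))^2 = (1::real)" if "i \<in> I" for i
  using g[rule_format, OF that] d[rule_format, OF that] by (auto simp: add_divide_distrib[symmetric])
 from distr_std_gauss_rotate[OF I this] show ?thesis by (simp add: rot_def case_prod_unfold)
qed

section \<open>Dependence on the signal-to-noise ratio\<close>

locale snr = prob_space M for M :: "'a measure" +
 fixes I :: "'i set" and e :: "'i => 'a => real"
 assumes fin: "finite I" and meas: "!!i. i \<in> I ==> e i \<in> borel_measurable M"
begin

lemma channel_amp: "channel M I (amp e g)"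
proof (standard, goal_cases)
 case (2 i) thus ?case using meas[of i] unfolding amp_def[abs_def] by measurable
qed (rule fin)

lemma channel_post_amp: "channel (post M I (amp e g) y) I (amp e d)"
proof -
 interpret A: channel M I "amp e g" by (rule channel_amp)
 interpret P: prob_space "post M I (amp e g) y" by (rule A.prob_post)
 show ?thesis
 proof (standard, goal_cases)
  case (2 i)
  interpret B: channel M I "amp e d" by (rule channel_amp)
  show ?case using B.meas[OF 2] by (simp add: measurable_cong_sets[OF A.sets_post refl])
 qed (rule fin)
qed

lemma snr_post: "snr (post M I (amp e g) y) I e"
proof -
 interpret A: channel M I "amp e g" by (rule channel_amp)
 interpret P: prob_space "post M I (amp e g) y" by (rule A.prob_post)
 show ?thesis by standard (use fin meas in auto)
qed

abbreviation "G \<equiv> std_gauss I"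

sublocale G: prob_space "std_gauss I" by (rule prob_space_std_gauss)

sublocale GG: pair_prob_space "std_gauss I" "std_gauss I" ..

context
 fixes g d :: "'i => real"
 assumes g0: "\<forall>i\<in>I. 0 <= g i" and d0: "\<forall>i\<in>I. 0 <= d i"
begin

interpretation A: channel M I "amp e g" by (rule channel_amp)
interpretation D: channel M I "amp e d" by (rule channel_amp)
interpretation S: channel M I "amp e (%i. g i + d i)" by (rule channel_amp)

text \<open>Multiplied by \<open>sqrt (g i + d i)\<close>, the weights of \<open>rot\<close> become
  \<open>sqrt (g i)\<close> and \<open>sqrt (d i)\<close>: the combined observation carries exactly
  the joint likelihood.\<close>

lemma lik_rot: "lik I (amp e (%i. g i + d i)) (rot I g d y1 y2) w = lik I (amp e g) y1 w * lik I (amp e d) y2 w"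
 unfolding lik_def exp_add[symmetric] sum.distrib[symmetric]
proof (intro arg_cong[where f=exp] sum.cong refl)
 fix i assume i: "i \<in> I"
 show "amp e (%i. g i + d i) i w * rot I g d y1 y2 i - (amp e (%i. g i + d i) i w)^2 / 2
  = amp e g i w * y1 i - (amp e g i w)^2 / 2 + (amp e d i w * y2 i - (amp e d i w)^2 / 2)"
 proof (cases "g i + d i = 0")
  case True
  hence "g i = 0" "d i = 0" using g0[rule_format, OF i] d0[rule_format, OF i] by auto
  thus ?thesis by (simp add: amp_def)
 next
  case False
  hence p: "0 < g i + d i" using g0[rule_format, OF i] d0[rule_format, OF i] by auto
  have "sqrt (g i + d i) * sqrt (g i / (g i + d i)) = sqrt (g i)" "sqrt (g i + d i) * sqrt (d i / (g i + d i)) = sqrt (d i)"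
   using p by (simp_all add: real_sqrt_mult[symmetric])
  moreover have "sqrt (g i + d i) * e i w * (sqrt (g i / (g i + d i)) * y1 i + sqrt (d i / (g i + d i)) * y2 i)
   = (sqrt (g i + d i) * sqrt (g i / (g i + d i))) * e i w * y1 i + (sqrt (g i + d i) * sqrt (d i / (g i + d i))) * e i w * y2 i"
   by (simp add: algebra_simps)
  ultimately have "sqrt (g i + d i) * e i w * (sqrt (g i / (g i + d i)) * y1 i + sqrt (d i / (g i + d i)) * y2 i)
   = sqrt (g i) * e i w * y1 i + sqrt (d i) * e i w * y2 i" by simp
  thus ?thesis using p i g0[rule_format, OF i] d0[rule_format, OF i] by (simp add: amp_def rot_def power_mult_distrib algebra_simps add_divide_distrib)
 qed
qed

lemma partf_post: "partf (post M I (amp e g) y1) I (amp e d) y2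
  = (LINT w|M. lik I (amp e g) y1 w * lik I (amp e d) y2 w) / partf M I (amp e g) y1"
 unfolding partf_def[of "post M I (amp e g) y1"] by (subst A.integral_post) (auto simp: gavg_def mult.commute)

text \<open>The chain rule in multiplicative form: the second observation passes through a channel
  whose prior is the posterior of the first.\<close>

lemma part_rot: "partf M I (amp e (%i. g i + d i)) (rot I g d y1 y2)
  = partf M I (amp e g) y1 * partf (post M I (amp e g) y1) I (amp e d) y2"
proof -
 have "partf M I (amp e (%i. g i + d i)) (rot I g d y1 y2) = (LINT w|M. lik I (amp e g) y1 w * lik I (amp e d) y2 w)"
  unfolding partf_def by (intro Bochner_Integration.integral_cong refl lik_rot)
 thus ?thesis unfolding partf_post using A.part_pos[of y1] by simp
qed

lemma gavg_rot:
 assumes [measurable]: "h \<in> borel_measurable M"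
 shows "gavg M I (amp e (%i. g i + d i)) h (rot I g d y1 y2) = gavg (post M I (amp e g) y1) I (amp e d) h y2"
proof -
 have "(LINT w|post M I (amp e g) y1. h w * lik I (amp e d) y2 w)
  = (LINT w|M. h w * (lik I (amp e g) y1 w * lik I (amp e d) y2 w)) / partf M I (amp e g) y1"
  by (subst A.integral_post) (auto simp: gavg_def mult_ac)
 thus ?thesis unfolding gavg_def part_rot lik_rot using A.part_pos[of y1] by simp
qed

lemma rot_meas [measurable]: "(%p. rot I g d (fst p) (snd p)) \<in> measurable (G \<Otimes>\<^sub>M G) G"
 unfolding rot_def by (intro measurable_restrict) auto

lemma rot_meas2 [measurable]: "(%y. rot I g d y1 y) \<in> measurable G G"
 unfolding rot_def by (intro measurable_restrict) auto

text \<open>The joint law of the two observations. The density is a function of \<open>rot\<close>,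
  so that the law of the combined observation is an image of this one; \<open>nn_pair_law\<close>
  gives the disintegration over the first observation.\<close>

definition pair_law where
 "pair_law = density (G \<Otimes>\<^sub>M G) (%p. ennreal (partf M I (amp e (%i. g i + d i)) (rot I g d (fst p) (snd p))))"

lemma sets_pair_law [simp, measurable_cong]: "sets pair_law = sets (G \<Otimes>\<^sub>M G)"
 and space_pair_law [simp]: "space pair_law = space (G \<Otimes>\<^sub>M G)"
 by (auto simp: pair_law_def)

lemma distr_pair_law: "distr pair_law G (%p. rot I g d (fst p) (snd p)) = obs_law M I (amp e (%i. g i + d i))"
proof -
 have "obs_law M I (amp e (%i. g i + d i)) = density (distr (G \<Otimes>\<^sub>M G) G (%p. rot I g d (fst p) (snd p)))
   (%y. ennreal (partf M I (amp e (%i. g i + d i)) y))"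
  using distr_rot[OF fin, of g d] g0 d0 by (simp add: obs_law_def)
 also have "... = distr pair_law G (%p. rot I g d (fst p) (snd p))"
  unfolding pair_law_def by (rule density_distr) auto
 finally show ?thesis by simp
qed

lemma post_channel: "channel (post M I (amp e g) y1) I (amp e d)"
 by (rule channel_post_amp)

text \<open>\<open>part_rot\<close> splits the joint density into the density of the first
  observation and the density of the second given the first.\<close>

lemma nn_pair_law:
 assumes [measurable]: "ph \<in> borel_measurable (G \<Otimes>\<^sub>M G)"
 shows "(\<integral>\<^sup>+p. ph p \<partial>pair_law)
  = (\<integral>\<^sup>+y1. \<integral>\<^sup>+y2. ph (y1, y2) \<partial>obs_law (post M I (amp e g) y1) I (amp e d) \<partial>obs_law M I (amp e g))"
proof -
 have "(\<integral>\<^sup>+p. ph p \<partial>pair_law) = (\<integral>\<^sup>+p. ennreal (partf M I (amp e (%i. g i + d i)) (rot I g d (fst p) (snd p))) * ph p \<partial>(G \<Otimes>\<^sub>M G))"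
  unfolding pair_law_def by (rule nn_integral_density) auto
 also have "... = (\<integral>\<^sup>+y1. \<integral>\<^sup>+y2. ennreal (partf M I (amp e (%i. g i + d i)) (rot I g d y1 y2)) * ph (y1, y2) \<partial>G \<partial>G)"
  by (subst G.nn_integral_fst[symmetric]) auto
 also have "... = (\<integral>\<^sup>+y1. ennreal (partf M I (amp e g) y1) * (\<integral>\<^sup>+y2. ph (y1, y2) \<partial>obs_law (post M I (amp e g) y1) I (amp e d)) \<partial>G)"
 proof (rule nn_integral_cong)
  fix y1 assume [measurable]: "y1 \<in> space G"
  interpret C: channel "post M I (amp e g) y1" I "amp e d" by (rule post_channel)
  have [measurable]: "(%y2. ph (y1, y2)) \<in> borel_measurable G" by measurable
  show "(\<integral>\<^sup>+y2. ennreal (partf M I (amp e (%i. g i + d i)) (rot I g d y1 y2)) * ph (y1, y2) \<partial>G)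
   = ennreal (partf M I (amp e g) y1) * (\<integral>\<^sup>+y2. ph (y1, y2) \<partial>obs_law (post M I (amp e g) y1) I (amp e d))"
   by (simp add: C.nn_integral_obs_law nn_integral_cmult[symmetric] part_rot ennreal_mult less_imp_le[OF A.part_pos] less_imp_le[OF C.part_pos] mult.assoc)
 qed
 also have "... = (\<integral>\<^sup>+y1. \<integral>\<^sup>+y2. ph (y1, y2) \<partial>obs_law (post M I (amp e g) y1) I (amp e d) \<partial>obs_law M I (amp e g))"
 proof (rule A.nn_integral_obs_law[symmetric])
  have "(%y1. (\<integral>\<^sup>+y2. ennreal (partf M I (amp e (%i. g i + d i)) (rot I g d y1 y2) / partf M I (amp e g) y1) * ph (y1, y2) \<partial>G)) \<in> borel_measurable G"
   by (rule G.borel_measurable_nn_integral) (auto simp: case_prod_unfold)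
  also have "(\<integral>\<^sup>+y2. ennreal (partf M I (amp e (%i. g i + d i)) (rot I g d y1 y2) / partf M I (amp e g) y1) * ph (y1, y2) \<partial>G)
   = (\<integral>\<^sup>+y2. ph (y1, y2) \<partial>obs_law (post M I (amp e g) y1) I (amp e d))" if "y1 \<in> space G" for y1
  proof -
   interpret C: channel "post M I (amp e g) y1" I "amp e d" by (rule post_channel)
   have [measurable]: "(%y2. ph (y1, y2)) \<in> borel_measurable G" using that by measurable
   show ?thesis using A.part_pos[of y1] by (simp add: C.nn_integral_obs_law part_rot)
  qed
  hence "(%y1. (\<integral>\<^sup>+y2. ennreal (partf M I (amp e (%i. g i + d i)) (rot I g d y1 y2) / partf M I (amp e g) y1) * ph (y1, y2) \<partial>G)) \<in> borel_measurable G
   \<longleftrightarrow> (%y1. \<integral>\<^sup>+y2. ph (y1, y2) \<partial>obs_law (post M I (amp e g) y1) I (amp e d)) \<in> borel_measurable G"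
   by (intro measurable_cong)
  ultimately show "(%y1. \<integral>\<^sup>+y2. ph (y1, y2) \<partial>obs_law (post M I (amp e g) y1) I (amp e d)) \<in> borel_measurable G"
   by simp
 qed
 finally show ?thesis .
qed

lemma integral_pair_law:
 fixes F :: "_ => real"
 assumes [measurable]: "F \<in> borel_measurable (G \<Otimes>\<^sub>M G)" and F: "integrable pair_law F"
 shows "(LINT p|pair_law. F p)
  = (LINT y1|obs_law M I (amp e g). LINT y2|obs_law (post M I (amp e g) y1) I (amp e d). F (y1, y2))" (is ?eq)
  and "integrable (obs_law M I (amp e g)) (%y1. LINT y2|obs_law (post M I (amp e g) y1) I (amp e d). F (y1, y2))" (is ?int)
proof -
 let ?p = "%p. partf M I (amp e (%i. g i + d i)) (rot I g d (fst p) (snd p))"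
 have i: "integrable (G \<Otimes>\<^sub>M G) (%p. ?p p * F p)"
  using F unfolding pair_law_def by (subst (asm) integrable_density) (auto simp: less_imp_le[OF S.part_pos])
 have inner: "(LINT y2|G. ?p (y1, y2) * F (y1, y2))
  = partf M I (amp e g) y1 * (LINT y2|obs_law (post M I (amp e g) y1) I (amp e d). F (y1, y2))" if [measurable]: "y1 \<in> space G" for y1
 proof -
  interpret C: channel "post M I (amp e g) y1" I "amp e d" by (rule post_channel)
  have [measurable]: "(%y2. F (y1, y2)) \<in> borel_measurable G" by measurable
  show ?thesis by (simp add: C.integral_obs_law part_rot mult.assoc)
 qed
 have m: "(%y1. LINT y2|obs_law (post M I (amp e g) y1) I (amp e d). F (y1, y2)) \<in> borel_measurable G"
 proof -
  have "(%y1. (LINT y2|G. ?p (y1, y2) * F (y1, y2)) / partf M I (amp e g) y1) \<in> borel_measurable G"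
   by (intro borel_measurable_divide G.borel_measurable_lebesgue_integral) (auto simp: case_prod_unfold)
  thus ?thesis
   by (rule measurable_cong[THEN iffD1, rotated])
    (simp add: inner[unfolded fst_conv snd_conv] less_imp_neq[OF A.part_pos, symmetric])
 qed
 have "(LINT p|pair_law. F p) = (LINT p|(G \<Otimes>\<^sub>M G). ?p p * F p)"
  unfolding pair_law_def by (subst integral_density) (auto simp: less_imp_le[OF S.part_pos])
 also have "... = (LINT y1|G. LINT y2|G. ?p (y1, y2) * F (y1, y2))" by (rule GG.integral_fst'[OF i, symmetric])
 also have "... = (LINT y1|G. partf M I (amp e g) y1 * (LINT y2|obs_law (post M I (amp e g) y1) I (amp e d). F (y1, y2)))"
  by (intro Bochner_Integration.integral_cong refl inner)
 also have "... = (LINT y1|obs_law M I (amp e g). LINT y2|obs_law (post M I (amp e g) y1) I (amp e d). F (y1, y2))"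
  by (subst A.integral_obs_law[OF m]) simp
 finally show ?eq .
 have "integrable G (%y1. LINT y2|G. ?p (y1, y2) * F (y1, y2))" by (rule GG.integrable_fst'[OF i])
 hence "integrable G (%y1. partf M I (amp e g) y1 * (LINT y2|obs_law (post M I (amp e g) y1) I (amp e d). F (y1, y2)))"
  by (rule Bochner_Integration.integrable_cong[THEN iffD1, rotated -1]) (auto simp: inner[unfolded fst_conv snd_conv])
 thus ?int by (subst A.integral_obs_law(2)[OF m])
qed

lemma prob_pair_law: "prob_space pair_law"
proof
 have "emeasure pair_law (space pair_law) = (\<integral>\<^sup>+p. 1 \<partial>pair_law)" by simp
 also have "... = 1"
 proof (subst nn_pair_law)
  have "(\<integral>\<^sup>+y2. 1 \<partial>obs_law (post M I (amp e g) y1) I (amp e d)) = 1" for y1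
   using prob_space.emeasure_space_1[OF channel.prob_obs_law[OF post_channel]] by simp
  thus "(\<integral>\<^sup>+y1. \<integral>\<^sup>+y2. 1 \<partial>obs_law (post M I (amp e g) y1) I (amp e d) \<partial>obs_law M I (amp e g)) = 1"
   using prob_space.emeasure_space_1[OF A.prob_obs_law] by simp
 qed simp
 finally show "emeasure pair_law (space pair_law) = 1" .
qed

lemma distr_pair_law_fst: "distr pair_law G fst = obs_law M I (amp e g)"
proof (rule measure_eqI)
 fix X assume "X \<in> sets (distr pair_law G fst)"
 hence [measurable]: "X \<in> sets G" by simp
 have "emeasure (distr pair_law G fst) X = (\<integral>\<^sup>+p. indicator X (fst p) \<partial>pair_law)"
  by (subst nn_integral_indicator[symmetric], simp, subst nn_integral_distr) auto
 also have "... = (\<integral>\<^sup>+y1. indicator X y1 \<partial>obs_law M I (amp e g))"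
  using prob_space.emeasure_space_1[OF channel.prob_obs_law[OF post_channel]] by (subst nn_pair_law) auto
 finally show "emeasure (distr pair_law G fst) X = emeasure (obs_law M I (amp e g)) X" by simp
qed simp

text \<open>Posterior means form a martingale as observations are added, so their second moment
  grows by the mean square of the increment. The gain is kept as an explicit term because strict
  monotonicity of the scalar overlap will follow from the case of equality.\<close>

lemma gavg_sq_mono:
 assumes h[measurable]: "h \<in> borel_measurable M" and h2: "integrable M (%w. (h w)^2)"
 shows "(LINT y|obs_law M I (amp e g). (gavg M I (amp e g) h y)^2)
  + (LINT p|pair_law. (gavg M I (amp e (%i. g i + d i)) h (rot I g d (fst p) (snd p)) - gavg M I (amp e g) h (fst p))^2)
  = (LINT y|obs_law M I (amp e (%i. g i + d i)). (gavg M I (amp e (%i. g i + d i)) h y)^2)"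
  and "integrable pair_law (%p. (gavg M I (amp e (%i. g i + d i)) h (rot I g d (fst p) (snd p)) - gavg M I (amp e g) h (fst p))^2)"
proof -
 define a :: "('i => real) \<times> ('i => real) => real" where "a = (%p. gavg M I (amp e g) h (fst p))"
 define c where "c = (%p. gavg M I (amp e (%i. g i + d i)) h (rot I g d (fst p) (snd p)))"
 note am[measurable] = A.gavg_meas[OF h] and cm[measurable] = S.gavg_meas[OF h]
 have [measurable]: "a \<in> borel_measurable (G \<Otimes>\<^sub>M G)" "c \<in> borel_measurable (G \<Otimes>\<^sub>M G)" unfolding a_def c_def by measurable
 have ai: "integrable pair_law (%p. (a p)^2)"
  using A.gavg_sq_integrable[OF h h2] unfolding distr_pair_law_fst[symmetric] a_def by (subst (asm) integrable_distr_eq) auto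
 have ci: "integrable pair_law (%p. (c p)^2)"
  using S.gavg_sq_integrable[OF h h2] unfolding distr_pair_law[symmetric] c_def by (subst (asm) integrable_distr_eq) auto
 interpret P: prob_space pair_law by (rule prob_pair_law)
 have aci: "integrable pair_law (%p. a p * c p)"
 proof (rule Bochner_Integration.integrable_bound[OF Bochner_Integration.integrable_add[OF ai ci]])
  have "\<bar>a p * c p\<bar> <= (a p)^2 + (c p)^2" for p
  proof -
   have "2 * (\<bar>a p\<bar> * \<bar>c p\<bar>) <= (a p)^2 + (c p)^2"
    using sum_squares_bound[of "\<bar>a p\<bar>" "\<bar>c p\<bar>"] by simp
   moreover have "0 <= \<bar>a p\<bar> * \<bar>c p\<bar>" by simp
   ultimately show ?thesis unfolding abs_mult by linarith
  qed
  thus "AE p in pair_law. norm (a p * c p) <= norm ((a p)^2 + (c p)^2)"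
   by (intro AE_I2) (auto intro: order_trans[OF _ abs_ge_self])
 qed measurable
 have exp_sq: "(c p - a p)^2 = (c p)^2 - 2 * (a p * c p) + (a p)^2" for p
  by (simp add: power2_eq_square algebra_simps)
 show "integrable pair_law (%p. (c p - a p)^2)" unfolding exp_sq using ai ci aci by simp
 have h1: "integrable M h" by (rule square_integrable_imp_integrable) (auto simp: h2)
 \<comment> \<open>Orthogonality of martingale increments: given the first observation
   \<open>y1\<close>, the finer mean averages to the coarser one by the tower property under the
   posterior.\<close>
 have ac: "(LINT p|pair_law. a p * c p) = (LINT p|pair_law. (a p)^2)"
 proof -
  have inner: "(LINT y2|obs_law (post M I (amp e g) y1) I (amp e d). a (y1, y2) * c (y1, y2)) = (gavg M I (amp e g) h y1)^2" for y1
  proof -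
   interpret C: channel "post M I (amp e g) y1" I "amp e d" by (rule post_channel)
   have "(LINT y2|obs_law (post M I (amp e g) y1) I (amp e d). a (y1, y2) * c (y1, y2))
    = gavg M I (amp e g) h y1 * (LINT y2|obs_law (post M I (amp e g) y1) I (amp e d). gavg (post M I (amp e g) y1) I (amp e d) h y2)"
    unfolding a_def c_def by (simp add: gavg_rot)
   thus ?thesis
    by (simp add: C.gavg_integral(2)[OF A.integrable_post[OF h1]] A.integral_post power2_eq_square)
  qed
  have "(LINT p|pair_law. a p * c p)
   = (LINT y1|obs_law M I (amp e g). LINT y2|obs_law (post M I (amp e g) y1) I (amp e d). a (y1, y2) * c (y1, y2))"
   by (rule integral_pair_law(1)[OF _ aci]) measurable
  also have "... = (LINT y1|obs_law M I (amp e g). (gavg M I (amp e g) h y1)^2)" by (simp only: inner)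
  also have "... = (LINT p|pair_law. (a p)^2)"
   unfolding a_def distr_pair_law_fst[symmetric] by (subst integral_distr) auto
  finally show ?thesis .
 qed
 have "(LINT y|obs_law M I (amp e g). (gavg M I (amp e g) h y)^2) = (LINT p|pair_law. (a p)^2)"
  unfolding a_def distr_pair_law_fst[symmetric] by (subst integral_distr) auto
 moreover have "(LINT y|obs_law M I (amp e (%i. g i + d i)). (gavg M I (amp e (%i. g i + d i)) h y)^2) = (LINT p|pair_law. (c p)^2)"
  unfolding c_def distr_pair_law[symmetric] by (subst integral_distr) auto
 ultimately show "(LINT y|obs_law M I (amp e g). (gavg M I (amp e g) h y)^2) + (LINT p|pair_law. (c p - a p)^2)
  = (LINT y|obs_law M I (amp e (%i. g i + d i)). (gavg M I (amp e (%i. g i + d i)) h y)^2)"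
  unfolding exp_sq using ai ci aci ac by simp
qed

end

end

text \<open>The square is expanded into pairs of coordinates, and the two independent replicas are
  integrated separately.\<close>

lemma (in prob_space) replica_square:
 fixes u :: "'i => 'a => real"
 assumes J: "finite J" and [measurable]: "!!i. i \<in> J ==> u i \<in> borel_measurable M"
  and bnd: "!!i w. i \<in> J ==> \<bar>u i w\<bar> <= C"
 shows "(LINT p|(M \<Otimes>\<^sub>M M). (\<Sum>i\<in>J. u i (fst p) * u i (snd p))^2) = (\<Sum>i\<in>J. \<Sum>j\<in>J. (LINT w|M. u i w * u j w)^2)"
proof -
 interpret MM: pair_prob_space M M ..
 have i2: "integrable M (%w. u i w * u j w)" if "i \<in> J" "j \<in> J" for i j
  by (rule integrable_const_bound[where B="C * C"])
   (use that bnd[OF that(1)] bnd[OF that(2)] order_trans[OF abs_ge_zero bnd[OF that(1)]] in \<open>auto simp: abs_mult intro!: mult_mono\<close>)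
 have i4: "integrable (M \<Otimes>\<^sub>M M) (%p. (u i (fst p) * u j (fst p)) * (u i (snd p) * u j (snd p)))" if ij: "i \<in> J" "j \<in> J" for i j
 proof (rule MM.integrable_const_bound[where B="(C * C) * (C * C)"])
  have C0: "0 <= C" using order_trans[OF abs_ge_zero bnd[OF that(1)]] by simp
  have "\<bar>u i w * u j w\<bar> <= C * C" for w using bnd[OF ij(1)] bnd[OF ij(2)] C0 by (auto simp: abs_mult intro!: mult_mono)
  thus "AE p in M \<Otimes>\<^sub>M M. norm ((u i (fst p) * u j (fst p)) * (u i (snd p) * u j (snd p))) <= (C * C) * (C * C)"
   using C0 by (intro AE_I2) (simp only: real_norm_def abs_mult[of "u i _ * u j _" "u i _ * u j _"], intro mult_mono, auto)
 qed (use ij in measurable)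
 have "(LINT p|(M \<Otimes>\<^sub>M M). (\<Sum>i\<in>J. u i (fst p) * u i (snd p))^2)
  = (LINT p|(M \<Otimes>\<^sub>M M). (\<Sum>i\<in>J. \<Sum>j\<in>J. (u i (fst p) * u j (fst p)) * (u i (snd p) * u j (snd p))))"
  by (intro Bochner_Integration.integral_cong refl) (simp add: power2_eq_square sum_product mult_ac)
 also have "... = (\<Sum>i\<in>J. \<Sum>j\<in>J. (LINT p|(M \<Otimes>\<^sub>M M). (u i (fst p) * u j (fst p)) * (u i (snd p) * u j (snd p))))"
  using i4 by (simp add: Bochner_Integration.integral_sum)
 also have "... = (\<Sum>i\<in>J. \<Sum>j\<in>J. (LINT w|M. u i w * u j w)^2)"
 proof (intro sum.cong refl)
  fix i j assume ij: "i \<in> J" "j \<in> J"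
  show "(LINT p|(M \<Otimes>\<^sub>M M). (u i (fst p) * u j (fst p)) * (u i (snd p) * u j (snd p))) = (LINT w|M. u i w * u j w)^2"
   using MM.integral_fst'[OF i4[OF ij]] i2[OF ij] by (simp add: power2_eq_square)
 qed
 finally show ?thesis .
qed

locale bsnr = snr M I e for M :: "'a measure" and I :: "'i set" and e +
 fixes B :: real
 assumes bound: "!!i w. i \<in> I ==> \<bar>e i w\<bar> <= B" and B0: "0 <= B"
begin

definition "Phi g = ent M I (amp e g)"

abbreviation "gm g h y \<equiv> gavg M I (amp e g) h y"

abbreviation "ol g \<equiv> obs_law M I (amp e g)"

text \<open>The overlap of coordinate \<open>i\<close>. \<open>Phi_lower\<close> and
  \<open>Phi_upper\<close> show that half of it is the derivative of \<open>Phi\<close> in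
  \<open>g i\<close>.\<close>

definition "AA g i = (LINT y|ol g. (gm g (e i) y)^2)"

text \<open>Squared Frobenius norm of the posterior covariance matrix of the coordinates in
  \<open>J\<close>.\<close>

definition "covs g J y = (\<Sum>i\<in>J. \<Sum>j\<in>J. (gm g (%w. e i w * e j w) y - gm g (e i) y * gm g (e j) y)^2)"

definition "fluct g = (LINT y|ol g. \<bar>ln (partf M I (amp e g) y) - Phi g\<bar>)"

lemma bounded_amp:
 assumes g0: "\<forall>i\<in>I. 0 <= g i"
 shows "bounded_channel M I (amp e g) ((\<Sum>i\<in>I. sqrt (g i)) * B)"
proof -
 interpret A: channel M I "amp e g" by (rule channel_amp)
 show ?thesis
 proof (standard, goal_cases)
  case (1 i w)
  have "sqrt (g i) <= (\<Sum>i\<in>I. sqrt (g i))" using 1 g0 by (intro member_le_sum fin) auto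
  thus ?case using bound[OF 1, of w] g0[rule_format, OF 1] B0 unfolding amp_def
   by (auto simp: abs_mult g0 intro!: mult_mono sum_nonneg)
 next
  case 2 show ?case using B0 by (auto intro!: mult_nonneg_nonneg sum_nonneg simp: g0)
 qed
qed

lemma bsnr_post: "bsnr (post M I (amp e g) y) I e B"
 using snr_post[of g y] bound B0 by (simp add: bsnr_def bsnr_axioms_def)

lemma e_integrable: "i \<in> I ==> integrable M (e i)"
 by (rule integrable_const_bound[where B=B]) (auto simp: bound meas)

lemma e_prod_integrable: "i \<in> I ==> j \<in> I ==> integrable M (%w. e i w * e j w)"
 using bound B0 meas by (intro integrable_const_bound[where B="B * B"]) (auto simp: abs_mult intro!: mult_mono AE_I2)

lemma e_sq_integrable: "i \<in> I ==> integrable M (%w. (e i w)^2)"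
 using e_prod_integrable[of i i] by (simp add: power2_eq_square)

lemma gm_bound: "i \<in> I ==> \<bar>gm g (e i) y\<bar> <= B"
proof -
 assume i: "i \<in> I"
 interpret A: channel M I "amp e g" by (rule channel_amp)
 interpret P: bsnr "post M I (amp e g) y" I e B by (rule bsnr_post)
 have "\<bar>LINT w|post M I (amp e g) y. e i w\<bar> <= (LINT w|post M I (amp e g) y. \<bar>e i w\<bar>)" by (rule integral_abs_bound)
 also have "... <= (LINT w|post M I (amp e g) y. B)"
  using P.e_integrable[OF i] bound[OF i] by (intro integral_mono) auto
 finally show ?thesis by (simp add: A.integral_post[OF meas[OF i]] P.prob_space[simplified])
qed

lemma gm_sq_bound: "i \<in> I ==> (gm g (e i) y)^2 <= B^2"
 using gm_bound[of i g y] B0 by (simp add: abs_le_square_iff[symmetric])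

lemma gm_meas [measurable]: "i \<in> I ==> (%y. gm g (e i) y) \<in> borel_measurable G"
 using channel.gavg_meas[OF channel_amp meas] by simp

lemma gm_sq_integrable: "i \<in> I ==> integrable (ol g) (%y. (gm g (e i) y)^2)"
 using channel.gavg_sq_integrable[OF channel_amp meas e_sq_integrable] by simp

lemma AA_nonneg: "0 <= AA g i" unfolding AA_def by simp

lemma AA_mono:
 assumes "\<forall>i\<in>I. 0 <= g i" "\<forall>i\<in>I. 0 <= d i" "j \<in> I"
 shows "AA g j <= AA (%i. g i + d i) j"
proof -
 note G = gavg_sq_mono(1)[OF assms(1,2) meas[OF assms(3)] e_sq_integrable[OF assms(3)]]
 show ?thesis unfolding AA_def G[symmetric] by simp
qed

lemma ln_part_ol:
 assumes "\<forall>i\<in>I. 0 <= g i"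
 shows "integrable (ol g) (%y. ln (partf M I (amp e g) y))" "(LINT y|ol g. ln (partf M I (amp e g) y)) = Phi g"
 using bounded_channel.ln_part_integrable[OF bounded_amp[OF assms]] by (auto simp: Phi_def ent_def)

lemma mean_amp_post:
 assumes "i \<in> I"
 shows "(LINT w|post M I (amp e g) y. amp e d i w) = sqrt (d i) * gm g (e i) y"
 unfolding amp_def by (simp add: channel.integral_post[OF channel_amp meas[OF assms], unfolded amp_def])

context
 fixes g d :: "'i => real"
 assumes g0: "\<forall>i\<in>I. 0 <= g i" and d0: "\<forall>i\<in>I. 0 <= d i"
begin

interpretation A: channel M I "amp e g" by (rule channel_amp)
interpretation S: channel M I "amp e (%i. g i + d i)" by (rule channel_amp)
interpretation OL: prob_space "ol g" by (rule A.prob_obs_law)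
interpretation PL: prob_space "pair_law g d" by (rule prob_pair_law[OF g0 d0])

abbreviation "rho y \<equiv> ent (post M I (amp e g) y) I (amp e d)"
abbreviation "quad y \<equiv> (\<Sum>i\<in>I. d i * (gm g (e i) y)^2) / 2"

lemma gd0: "\<forall>i\<in>I. 0 <= g i + d i" using g0 d0 by simp

lemma pl_integrable:
 "integrable (pair_law g d) (%p. ln (partf M I (amp e (%i. g i + d i)) (rot I g d (fst p) (snd p))))" (is ?C1)
 "integrable (pair_law g d) (%p. ln (partf M I (amp e g) (fst p)))" (is ?C2)
proof -
 note [measurable] = rot_meas[OF g0 d0]
 show ?C1
  using ln_part_ol(1)[OF gd0] unfolding distr_pair_law[OF g0 d0, symmetric]
  by (subst (asm) integrable_distr_eq) (auto simp: measurable_cong_sets[OF sets_pair_law[OF g0 d0] refl])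
 show ?C2
  using ln_part_ol(1)[OF g0] unfolding distr_pair_law_fst[OF g0 d0, symmetric]
  by (subst (asm) integrable_distr_eq) (auto simp: measurable_cong_sets[OF sets_pair_law[OF g0 d0] refl])
qed

lemma pl_integral:
 fixes ph :: "_ => real"
 assumes [measurable]: "ph \<in> borel_measurable G"
 shows "(LINT p|pair_law g d. ph (rot I g d (fst p) (snd p))) = (LINT y|ol (%i. g i + d i). ph y)" (is ?C1)
  and "(LINT p|pair_law g d. ph (fst p)) = (LINT y|ol g. ph y)" (is ?C2)
proof -
 note [measurable] = rot_meas[OF g0 d0]
 show ?C1
  unfolding distr_pair_law[OF g0 d0, symmetric]
  by (subst integral_distr) (auto simp: measurable_cong_sets[OF sets_pair_law[OF g0 d0] refl])
 show ?C2
  unfolding distr_pair_law_fst[OF g0 d0, symmetric]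
  by (subst integral_distr) (auto simp: measurable_cong_sets[OF sets_pair_law[OF g0 d0] refl])
qed

text \<open>The logarithm of \<open>part_rot\<close>, averaged over the pair law: conditionally on
  the first observation, the contribution of the second is the relative entropy \<open>rho\<close>
  of a channel with the posterior as its prior.\<close>

lemma Phi_increment:
 "integrable (ol g) rho" (is ?C1) "Phi (%i. g i + d i) = Phi g + (LINT y|ol g. rho y)" (is ?C2)
proof -
 let ?F = "%p. ln (partf M I (amp e (%i. g i + d i)) (rot I g d (fst p) (snd p))) - ln (partf M I (amp e g) (fst p))"
 note [measurable] = rot_meas[OF g0 d0]
 have Fm: "?F \<in> borel_measurable (G \<Otimes>\<^sub>M G)" by measurable
 have Fi: "integrable (pair_law g d) ?F" using pl_integrable by simp
 have in_eq: "(LINT y2|obs_law (post M I (amp e g) y1) I (amp e d). ?F (y1, y2)) = rho y1" for y1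
  unfolding ent_def
  by (intro Bochner_Integration.integral_cong refl)
   (simp add: part_rot[OF g0 d0] ln_mult A.part_pos channel.part_pos[OF channel_post_amp]
    less_imp_neq[OF A.part_pos, symmetric] less_imp_neq[OF channel.part_pos[OF channel_post_amp], symmetric])
 note I = integral_pair_law[OF g0 d0 Fm Fi, unfolded in_eq]
 show ?C1 by (rule I(2)[unfolded in_eq])
 have "(LINT p|pair_law g d. ?F p) = Phi (%i. g i + d i) - Phi g"
  using pl_integrable pl_integral(1)[OF borel_measurable_ln[OF S.part_meas]] pl_integral(2)[OF borel_measurable_ln[OF A.part_meas]]
   ln_part_ol(2)[OF g0] ln_part_ol(2)[OF gd0] by simp
 thus ?C2
  using I(1) by simp
qed

lemma quad_integrable: "integrable (ol g) quad" and quad_integral: "(LINT y|ol g. quad y) = (\<Sum>i\<in>I. d i * AA g i) / 2"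
 using gm_sq_integrable by (auto simp: AA_def Bochner_Integration.integral_sum)

lemma post_mean_sq: "(\<Sum>i\<in>I. (LINT w|post M I (amp e g) y. amp e d i w)^2) / 2 = quad y"
 using d0 by (simp add: mean_amp_post power_mult_distrib)

lemma quad_le_rho: "quad y <= rho y"
 using bounded_channel.ent_bounds(1)[OF bsnr.bounded_amp[OF bsnr_post d0], of g y] by (simp add: post_mean_sq)

text \<open>The relative entropy of the increment is at least that of its posterior mean, which is
  \<open>quad\<close>.\<close>

lemma Phi_lower: "(\<Sum>i\<in>I. d i * AA g i) / 2 <= Phi (%i. g i + d i) - Phi g"
 using integral_mono[OF quad_integrable Phi_increment(1) quad_le_rho] Phi_increment(2) quad_integral by simp

lemma post_kern_eq:
 "(\<Sum>i\<in>I. (amp e d i w - (LINT w|post M I (amp e g) y. amp e d i w)) * (amp e d i w' - (LINT w|post M I (amp e g) y. amp e d i w)))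
 = (\<Sum>i\<in>I. d i * ((e i w - gm g (e i) y) * (e i w' - gm g (e i) y)))"
proof (intro sum.cong refl)
 fix i assume i: "i \<in> I"
 show "(amp e d i w - (LINT w|post M I (amp e g) y. amp e d i w)) * (amp e d i w' - (LINT w|post M I (amp e g) y. amp e d i w))
  = d i * ((e i w - gm g (e i) y) * (e i w' - gm g (e i) y))"
 proof -
  have "(s * a - s * m) * (s * c - s * m) = (s * s) * ((a - m) * (c - m))" for s a m c :: real by (simp add: algebra_simps)
  from this[of "sqrt (d i)" "e i w" "gm g (e i) y" "e i w'"] show ?thesis
   unfolding mean_amp_post[OF i] using d0[rule_format, OF i] by (simp add: amp_def)
 qed
qed

text \<open>A coordinate minus its posterior mean is at most \<open>2 * B\<close>, whence the factor
  \<open>4 * B^2\<close> in all smallness conditions below.\<close>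

lemma post_kern_bound:
 "\<bar>\<Sum>i\<in>I. d i * ((e i w - gm g (e i) y) * (e i w' - gm g (e i) y))\<bar> <= 4 * B^2 * (\<Sum>i\<in>I. d i)"
proof -
 have "\<bar>d i * ((e i w - gm g (e i) y) * (e i w' - gm g (e i) y))\<bar> <= 4 * B^2 * d i" if i: "i \<in> I" for i
 proof -
  have "\<bar>e i w - gm g (e i) y\<bar> <= 2 * B" for w
   using abs_triangle_ineq4[of "e i w" "gm g (e i) y"] bound[OF i, of w] gm_bound[OF i, of g y] by linarith
  hence "\<bar>(e i w - gm g (e i) y) * (e i w' - gm g (e i) y)\<bar> <= (2 * B) * (2 * B)"
   unfolding abs_mult by (intro mult_mono) (use B0 in auto)
  from mult_left_mono[OF this d0[rule_format, OF i]] show ?thesis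
   using d0[rule_format, OF i] by (simp add: abs_mult[of "d i"] power2_eq_square mult_ac)
 qed
 thus ?thesis unfolding sum_distrib_left by (intro order_trans[OF sum_abs] sum_mono)
qed

lemma post_kern_bound_amp:
 "\<bar>\<Sum>i\<in>I. (amp e d i w - (LINT w|post M I (amp e g) y. amp e d i w)) * (amp e d i w' - (LINT w|post M I (amp e g) y. amp e d i w))\<bar>
  <= 4 * B^2 * (\<Sum>i\<in>I. d i)"
 unfolding post_kern_eq by (rule post_kern_bound)

lemma Phi_upper:
 assumes X: "4 * B^2 * (\<Sum>i\<in>I. d i) <= 1 / 3"
 shows "Phi (%i. g i + d i) - Phi g <= (\<Sum>i\<in>I. d i * AA g i) / 2 + (4 * B^2 * (\<Sum>i\<in>I. d i))^2"
proof -
 have "rho y <= quad y + (4 * B^2 * (\<Sum>i\<in>I. d i))^2" for y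
  using bounded_channel.ent_bounds(2)[OF bsnr.bounded_amp[OF bsnr_post[of g y] d0] post_kern_bound_amp X]
  by (simp only: post_mean_sq)
 hence "(LINT y|ol g. rho y) <= (LINT y|ol g. quad y + (4 * B^2 * (\<Sum>i\<in>I. d i))^2)"
  using Phi_increment(1) quad_integrable by (intro integral_mono) auto
 thus ?thesis using Phi_increment(2) quad_integral quad_integrable OL.prob_space by simp
qed

text \<open>Write \<open>c\<close> for the increment of \<open>Phi\<close> and \<open>qb\<close> for
  the mean of \<open>quad\<close>. Since \<open>quad <= rho\<close> pointwise, their distance is in
  mean only the remainder \<open>c - qb\<close>. And \<open>rho\<close> is close to its mean
  \<open>c\<close>, because \<open>rho - c\<close> is the conditional expectation, given the first
  observation, of a difference of two centred logarithms of partition functions.\<close>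

lemma Phi_concentration:
 "(LINT y|ol g. \<bar>quad y - (\<Sum>i\<in>I. d i * AA g i) / 2\<bar>)
  <= 2 * (Phi (%i. g i + d i) - Phi g - (\<Sum>i\<in>I. d i * AA g i) / 2) + fluct g + fluct (%i. g i + d i)"
proof -
 define c where "c = Phi (%i. g i + d i) - Phi g"
 define qb where "qb = (\<Sum>i\<in>I. d i * AA g i) / 2"
 let ?F = "%p. \<bar>ln (partf M I (amp e (%i. g i + d i)) (rot I g d (fst p) (snd p))) - Phi (%i. g i + d i)\<bar> + \<bar>ln (partf M I (amp e g) (fst p)) - Phi g\<bar>"
 note [measurable] = rot_meas[OF g0 d0]
 have Fm: "?F \<in> borel_measurable (G \<Otimes>\<^sub>M G)" by measurable
 have F1: "integrable (pair_law g d) (%p. \<bar>ln (partf M I (amp e (%i. g i + d i)) (rot I g d (fst p) (snd p))) - Phi (%i. g i + d i)\<bar>)"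
  and F2: "integrable (pair_law g d) (%p. \<bar>ln (partf M I (amp e g) (fst p)) - Phi g\<bar>)" using pl_integrable by simp_all
 have Fi: "integrable (pair_law g d) ?F" using F1 F2 by simp
 note I = integral_pair_law[OF g0 d0 Fm Fi]
 \<comment> \<open>Given \<open>y1\<close>, the logarithm of the second factor in
   \<open>part_rot\<close> averages to \<open>rho y1\<close>; adding and subtracting the two means
   bounds its distance from \<open>c\<close> by the integrand \<open>?F\<close>.\<close>
 have rc: "\<bar>rho y1 - c\<bar> <= (LINT y2|obs_law (post M I (amp e g) y1) I (amp e d). ?F (y1, y2))" for y1
 proof -
  interpret C: bounded_channel "post M I (amp e g) y1" I "amp e d" "((\<Sum>i\<in>I. sqrt (d i)) * B)"
   by (rule bsnr.bounded_amp[OF bsnr_post d0])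
  interpret CO: prob_space "obs_law (post M I (amp e g) y1) I (amp e d)" by (rule C.prob_obs_law)
  have ln_eq: "ln (partf M I (amp e (%i. g i + d i)) (rot I g d y1 y2)) = ln (partf M I (amp e g) y1) + ln (partf (post M I (amp e g) y1) I (amp e d) y2)" for y2
   by (simp add: part_rot[OF g0 d0] ln_mult A.part_pos C.part_pos
    less_imp_neq[OF A.part_pos, symmetric] less_imp_neq[OF C.part_pos, symmetric])
  have "\<bar>rho y1 - c\<bar> = \<bar>LINT y2|obs_law (post M I (amp e g) y1) I (amp e d). ln (partf (post M I (amp e g) y1) I (amp e d) y2) - c\<bar>"
   using C.ln_part_integrable CO.prob_space by (simp add: ent_def)
  also have "... <= (LINT y2|obs_law (post M I (amp e g) y1) I (amp e d). \<bar>ln (partf (post M I (amp e g) y1) I (amp e d) y2) - c\<bar>)"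
   by (rule integral_abs_bound)
  also have "... <= (LINT y2|obs_law (post M I (amp e g) y1) I (amp e d). ?F (y1, y2))"
  proof (rule integral_mono)
   show "integrable (obs_law (post M I (amp e g) y1) I (amp e d)) (%y2. ?F (y1, y2))"
    unfolding fst_conv snd_conv ln_eq using C.ln_part_integrable by simp
   show "integrable (obs_law (post M I (amp e g) y1) I (amp e d)) (%y2. \<bar>ln (partf (post M I (amp e g) y1) I (amp e d) y2) - c\<bar>)"
    using C.ln_part_integrable by simp
   show "\<bar>ln (partf (post M I (amp e g) y1) I (amp e d) y2) - c\<bar> <= ?F (y1, y2)" for y2
    unfolding fst_conv snd_conv ln_eq c_def by linarith
  qed
  finally show ?thesis .
 qed
 have "(LINT y|ol g. \<bar>rho y - c\<bar>) <= (LINT p|pair_law g d. ?F p)"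
  unfolding I(1) by (intro integral_mono I(2) rc integrable_abs Bochner_Integration.integrable_diff Phi_increment(1) OL.integrable_const)
 also have "... = fluct (%i. g i + d i) + fluct g"
  unfolding fluct_def Bochner_Integration.integral_add[OF F1 F2]
  by (intro arg_cong2[where f="(+)"] pl_integral) measurable
 finally have r: "(LINT y|ol g. \<bar>rho y - c\<bar>) <= fluct (%i. g i + d i) + fluct g" .
 have "(LINT y|ol g. \<bar>quad y - qb\<bar>) <= (LINT y|ol g. (rho y - quad y) + \<bar>rho y - c\<bar> + (c - qb))"
 proof (rule integral_mono)
  show "\<bar>quad y - qb\<bar> <= (rho y - quad y) + \<bar>rho y - c\<bar> + (c - qb)" for y
   using quad_le_rho[of y] Phi_lower unfolding c_def qb_def by linarith
 qed (use Phi_increment(1) quad_integrable in auto)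
 also have "... = (c - qb) + (LINT y|ol g. \<bar>rho y - c\<bar>) + (c - qb)"
  using Phi_increment quad_integrable quad_integral OL.prob_space by (simp add: c_def qb_def)
 finally show ?thesis using r unfolding c_def qb_def by simp
qed

end

text \<open>The second order bound of \<open>ent_bounds\<close> under the posterior, averaged over
  the observation: the squared covariances enter with the weight \<open>h^2 / 4\<close>. The
  condition bounds \<open>card J * h\<close>, so the step has to be of order
  \<open>1 / card J\<close>.\<close>

lemma Phi_second_order:
 fixes h :: real
 assumes g0: "\<forall>i\<in>I. 0 <= g i" and J: "J \<subseteq> I" and h: "0 <= h" and X: "4 * B^2 * (card J * h) <= 1 / 3"
 shows "integrable (ol g) (covs g J)" (is ?C1)
  and "h^2 / 4 * (LINT y|ol g. covs g J y) <= Phi (%i. g i + (if i \<in> J then h else 0)) - Phi g - h * (\<Sum>i\<in>J. AA g i) / 2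
   + 6 * (4 * B^2 * (card J * h)) ^ 3" (is ?C2)
proof -
 interpret A: channel M I "amp e g" by (rule channel_amp)
 interpret OL: prob_space "ol g" by (rule A.prob_obs_law)
 define d where "d = (%i. if i \<in> J then h else 0)"
 have d0: "\<forall>i\<in>I. 0 <= d i" using h by (simp add: d_def)
 have fJ: "finite J" using J fin by (rule finite_subset)
 have sum_d: "(\<Sum>i\<in>I. d i * x i) = h * (\<Sum>i\<in>J. x i)" for x
  unfolding d_def sum_distrib_left using J fin by (simp add: if_distrib[of "%u. u * _"] sum.If_cases Int_absorb1 cong: if_cong)
 have sd: "(\<Sum>i\<in>I. d i) = card J * h" using sum_d[of "%_. 1"] by simp
 have prod_m[measurable]: "(%y. gm g (%w. e i w * e j w) y) \<in> borel_measurable G" if "i \<in> J" "j \<in> J" for i j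
 proof -
  have "(%w. e i w * e j w) \<in> borel_measurable M" using that J meas by (intro borel_measurable_times) auto
  thus ?thesis by (rule A.gavg_meas)
 qed
 have cm: "covs g J \<in> borel_measurable G" unfolding covs_def using J gm_meas prod_m by (intro borel_measurable_sum) (auto intro!: borel_measurable_power borel_measurable_diff borel_measurable_times)
 have cov_eq: "(LINT p|(post M I (amp e g) y \<Otimes>\<^sub>M post M I (amp e g) y). (\<Sum>i\<in>I. d i * ((e i (fst p) - gm g (e i) y) * (e i (snd p) - gm g (e i) y)))^2) = h^2 * covs g J y" for y
 proof -
  interpret P: bsnr "post M I (amp e g) y" I e B by (rule bsnr_post)
  let ?u = "%i w. e i w - gm g (e i) y"
  have "(LINT p|(post M I (amp e g) y \<Otimes>\<^sub>M post M I (amp e g) y). (\<Sum>i\<in>J. ?u i (fst p) * ?u i (snd p))^2)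
   = (\<Sum>i\<in>J. \<Sum>j\<in>J. (LINT w|post M I (amp e g) y. ?u i w * ?u j w)^2)"
  proof (rule P.replica_square[OF fJ])
   show "?u i \<in> borel_measurable (post M I (amp e g) y)" if "i \<in> J" for i
    using P.meas[of i] that J by auto
   show "\<bar>?u i w\<bar> <= 2 * B" if "i \<in> J" for i w
    using abs_triangle_ineq4[of "e i w" "gm g (e i) y"] bound[of i w] gm_bound[of i g y] that J by fastforce
  qed
  also have "... = covs g J y" unfolding covs_def
  proof (intro sum.cong refl arg_cong[where f="%x. x^2"])
   fix i j assume ij: "i \<in> J" "j \<in> J"
   have iI: "i \<in> I" "j \<in> I" using ij J by auto
   have m2: "(%w. e i w * e j w) \<in> borel_measurable M" using iI meas by (intro borel_measurable_times) auto
   have "(LINT w|post M I (amp e g) y. ?u i w * ?u j w)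
    = (LINT w|post M I (amp e g) y. e i w * e j w - gm g (e j) y * e i w - gm g (e i) y * e j w + gm g (e i) y * gm g (e j) y)"
    by (intro Bochner_Integration.integral_cong refl) (simp add: algebra_simps)
   also have "... = (LINT w|post M I (amp e g) y. e i w * e j w) - gm g (e j) y * gm g (e i) y - gm g (e i) y * gm g (e j) y + gm g (e i) y * gm g (e j) y"
    using P.e_integrable[OF iI(1)] P.e_integrable[OF iI(2)] P.e_prod_integrable[OF iI]
    by (simp add: P.prob_space[simplified] A.integral_post[OF meas[OF iI(1)]] A.integral_post[OF meas[OF iI(2)]])
   finally show "(LINT w|post M I (amp e g) y. ?u i w * ?u j w) = gm g (%w. e i w * e j w) y - gm g (e i) y * gm g (e j) y"
    by (simp add: A.integral_post[OF m2])
  qed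
  finally show ?thesis by (simp add: sum_d power_mult_distrib)
 qed
 have low: "(\<Sum>i\<in>I. d i * (gm g (e i) y)^2) / 2 + h^2 * covs g J y / 4 - 6 * (4 * B^2 * (card J * h)) ^ 3
   <= ent (post M I (amp e g) y) I (amp e d)" for y
  using bounded_channel.ent_bounds(3)[OF bsnr.bounded_amp[OF bsnr_post[of g y] d0] post_kern_bound_amp[OF g0 d0, unfolded sd] X]
  by (simp only: post_mean_sq[OF g0 d0] post_kern_eq[OF g0 d0] cov_eq)
 have cnn: "0 <= covs g J y" for y unfolding covs_def by (intro sum_nonneg) auto
 show ci: ?C1
 proof (rule OL.integrable_const_bound[where B="\<Sum>i\<in>J. \<Sum>j\<in>J. (2 * B^2)^2"])
  have "\<bar>covs g J y\<bar> <= (\<Sum>i\<in>J. \<Sum>j\<in>J. (2 * B^2)^2)" for y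
  proof -
   have "(gm g (%w. e i w * e j w) y - gm g (e i) y * gm g (e j) y)^2 <= (2 * B^2)^2" if ij: "i \<in> J" "j \<in> J" for i j
   proof -
    interpret P: bsnr "post M I (amp e g) y" I e B by (rule bsnr_post)
    have iI: "i \<in> I" "j \<in> I" using ij J by auto
    have m2: "(%w. e i w * e j w) \<in> borel_measurable M" using iI meas by (intro borel_measurable_times) auto
    have "\<bar>LINT w|post M I (amp e g) y. e i w * e j w\<bar> <= (LINT w|post M I (amp e g) y. \<bar>e i w * e j w\<bar>)" by (rule integral_abs_bound)
    also have "... <= (LINT w|post M I (amp e g) y. B * B)"
    proof (rule integral_mono)
     show "integrable (post M I (amp e g) y) (%w. \<bar>e i w * e j w\<bar>)" using P.e_prod_integrable[OF iI] by (rule integrable_abs)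
    qed (use bound[OF iI(1)] bound[OF iI(2)] B0 in \<open>auto simp: abs_mult intro!: mult_mono\<close>)
    finally have 1: "\<bar>gm g (%w. e i w * e j w) y\<bar> <= B^2" by (simp add: P.prob_space[simplified] A.integral_post[OF m2] power2_eq_square)
    have 2: "\<bar>gm g (e i) y * gm g (e j) y\<bar> <= B^2"
     using gm_bound[OF iI(1), of g y] gm_bound[OF iI(2), of g y] B0 unfolding abs_mult power2_eq_square by (intro mult_mono) auto
    have "\<bar>gm g (%w. e i w * e j w) y - gm g (e i) y * gm g (e j) y\<bar> <= 2 * B^2" using 1 2 by linarith
    thus ?thesis using power_mono[of "\<bar>gm g (%w. e i w * e j w) y - gm g (e i) y * gm g (e j) y\<bar>" "2 * B^2" 2] by simp
   qed
   hence "covs g J y <= (\<Sum>i\<in>J. \<Sum>j\<in>J. (2 * B^2)^2)" unfolding covs_def by (intro sum_mono)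
   thus ?thesis using cnn[of y] by (simp only: abs_of_nonneg)
  qed
  thus "AE y in ol g. norm (covs g J y) <= (\<Sum>i\<in>J. \<Sum>j\<in>J. (2 * B^2)^2)" by (intro AE_I2) simp
 qed (use cm in simp)
 have "(LINT y|ol g. (\<Sum>i\<in>I. d i * (gm g (e i) y)^2) / 2 + h^2 * covs g J y / 4 - 6 * (4 * B^2 * (card J * h)) ^ 3)
  <= (LINT y|ol g. ent (post M I (amp e g) y) I (amp e d))"
  using quad_integrable[OF g0 d0] ci Phi_increment(1)[OF g0 d0] low by (intro integral_mono) auto
 also have "(LINT y|ol g. (\<Sum>i\<in>I. d i * (gm g (e i) y)^2) / 2 + h^2 * covs g J y / 4 - 6 * (4 * B^2 * (card J * h)) ^ 3)
  = (LINT y|ol g. (\<Sum>i\<in>I. d i * (gm g (e i) y)^2) / 2) + h^2 * (LINT y|ol g. covs g J y) / 4 - 6 * (4 * B^2 * (card J * h)) ^ 3"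
  using quad_integrable[OF g0 d0] ci OL.prob_space by simp
 finally have "(\<Sum>i\<in>I. d i * AA g i) / 2 + h^2 * (LINT y|ol g. covs g J y) / 4 - 6 * (4 * B^2 * (card J * h)) ^ 3
  <= Phi (%i. g i + d i) - Phi g"
  unfolding Phi_increment(2)[OF g0 d0] quad_integral[OF g0 d0] by simp
 thus ?C2
  unfolding sum_d unfolding d_def by simp
qed

end

lemma integrable_le:
 fixes f g :: "'a => real"
 assumes "integrable M g" "f \<in> borel_measurable M" "!!x. x \<in> space M ==> \<bar>f x\<bar> <= g x"
 shows "integrable M f"
proof (rule Bochner_Integration.integrable_bound[OF assms(1,2)], rule AE_I2)
 fix x assume "x \<in> space M"
 from assms(3)[OF this] show "norm (f x) <= norm (g x)" by simp
qed

lemma (in prob_space) sq_dev_le: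
 fixes f :: "'a => real"
 assumes f: "integrable M f" "integrable M (%x. (f x)^2)"
 shows "(LINT x|M. (f x - c)^2) = (LINT x|M. (f x - (LINT x|M. f x))^2) + ((LINT x|M. f x) - c)^2"
proof -
 have e: "(f x - d)^2 = (f x)^2 - 2 * d * f x + d^2" for x d by (simp add: power2_eq_square algebra_simps)
 show ?thesis unfolding e using f by (simp add: prob_space power2_eq_square algebra_simps)
qed

section \<open>Fluctuations of the free energy\<close>

text \<open>Only finite variances are asked for, because the factors stand both for the Gaussian
  noise and for the unbounded priors.\<close>

locale real_factors =
 fixes P :: "'i => real measure" and s :: "'i => real"
 assumes prob: "!!i. prob_space (P i)" and sets: "!!i. sets (P i) = sets borel"
  and sq: "!!i. integrable (P i) (%x. x^2)"
  and var: "!!i. (LINT x|P i. (x - (LINT x|P i. x))^2) <= s i"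
begin

lemma space [simp]: "space (P i) = UNIV" using sets_eq_imp_space_eq[OF sets[of i]] by simp

lemmas sets' [simp, measurable_cong] = sets

lemma s_nonneg: "0 <= s i"
proof -
 have "0 <= (LINT x|P i. (x - (LINT x|P i. x))^2)" by simp
 thus ?thesis using var[of i] by linarith
qed

lemma id_integrable: "integrable (P i) (%x. x)"
proof -
 interpret prob_space "P i" by (rule prob)
 show ?thesis by (rule square_integrable_imp_integrable[OF _ sq]) simp
qed

sublocale product_sigma_finite P
 by (intro product_sigma_finite.intro prob_space_imp_sigma_finite prob)

lemma coord_sq_integrable:
 assumes J: "finite J" and i: "i \<in> J"
 shows "integrable (PiM J P) (%x. (x i - a)^2)"
proof -
 interpret prob_space "P i" by (rule prob)
 have d: "distr (PiM J P) (P i) (%x. x i) = P i"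
  by (rule distr_PiM_component) (auto simp: i prob)
 have e: "(x - a)^2 = x^2 - 2 * a * x + a^2" for x :: real by (simp add: power2_eq_square algebra_simps)
 have "integrable (P i) (%x. (x - a)^2)" unfolding e using sq[of i] id_integrable[of i] by simp
 hence "integrable (distr (PiM J P) (P i) (%x. x i)) (%x. (x - a)^2)" by (simp only: d)
 thus ?thesis using i by (subst (asm) integrable_distr_eq) auto
qed

definition lip :: "'i set => ('i => real) => (('i => real) => real) => bool"
 where "lip J c f \<longleftrightarrow> (\<forall>x\<in>PiE J (%_. UNIV). \<forall>i\<in>J. \<forall>r. \<bar>f (x(i := r)) - f x\<bar> <= c i * \<bar>r - x i\<bar>)"

lemma lip_diff:
 assumes J: "finite J" and f: "lip J c f" and x: "x \<in> PiE J (%_. UNIV)" and y: "y \<in> PiE J (%_. UNIV)"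
 shows "\<bar>f y - f x\<bar> <= (\<Sum>i\<in>J. c i * \<bar>y i - x i\<bar>)"
proof -
 have "\<bar>f (%i. if i \<in> K then y i else x i) - f x\<bar> <= (\<Sum>i\<in>K. c i * \<bar>y i - x i\<bar>)" if "K \<subseteq> J" for K
 proof -
  have "finite K" using that J finite_subset by blast
  thus ?thesis using that
  proof (induction K)
   case (insert k K)
   let ?x = "%i. if i \<in> K then y i else x i"
   have m: "?x \<in> PiE J (%_. UNIV)" using x y insert.prems by (auto simp: PiE_iff extensional_def)
   have "(%i. if i \<in> insert k K then y i else x i) = ?x(k := y k)" by auto
   moreover have "\<bar>f (?x(k := y k)) - f ?x\<bar> <= c k * \<bar>y k - ?x k\<bar>"
    using f m insert.prems unfolding lip_def by blast
   ultimately show ?case using insert by auto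
  qed simp
 qed
 from this[of J] have "\<bar>f (%i. if i \<in> J then y i else x i) - f x\<bar> <= (\<Sum>i\<in>J. c i * \<bar>y i - x i\<bar>)" by simp
 moreover have "(%i. if i \<in> J then y i else x i) = y" using x y by (auto simp: PiE_iff extensional_def fun_eq_iff)
 ultimately show ?thesis by simp
qed

lemma lip_sq_integrable:
 assumes J: "finite J" and f[measurable]: "f \<in> borel_measurable (PiM J P)" and l: "lip J c f"
 shows "integrable (PiM J P) (%x. (f x)^2)" (is ?C1) "integrable (PiM J P) f" (is ?C2)
proof -
 interpret Q: prob_space "PiM J P" by (rule prob_space_PiM) (rule prob)
 define x0 where "x0 = (\<lambda>i\<in>J. 0::real)"
 define S where "S = (%x. \<Sum>i\<in>J. c i * \<bar>x i\<bar>)"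
 have le: "(f x)^2 <= 2 * (f x0)^2 + 2 * (real (card J) * (\<Sum>i\<in>J. (c i)^2 * (x i)^2))" if "x \<in> space (PiM J P)" for x
 proof -
  have "\<bar>f x - f x0\<bar> <= (\<Sum>i\<in>J. c i * \<bar>x i - x0 i\<bar>)"
   by (rule lip_diff[OF J l]) (use that in \<open>auto simp: x0_def space_PiM\<close>)
  also have "... = S x" unfolding S_def x0_def by (intro sum.cong) auto
  finally have "\<bar>f x - f x0\<bar> <= \<bar>S x\<bar>" by simp
  hence "(f x - f x0)^2 <= (S x)^2" by (simp add: abs_le_square_iff)
  moreover have "(S x)^2 <= real (card J) * (\<Sum>i\<in>J. (c i)^2 * (x i)^2)"
   using sum_squared_le_sum_of_squares[of "%i. c i * \<bar>x i\<bar>" J] J unfolding S_def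
   by (simp add: power_mult_distrib mult.commute)
  moreover have "(f x)^2 <= 2 * (f x0)^2 + 2 * (f x - f x0)^2"
   using zero_le_power2[of "f x - 2 * f x0"] by (simp add: power2_eq_square algebra_simps)
  ultimately show ?thesis by linarith
 qed
 have "integrable (PiM J P) (%x. 2 * (f x0)^2 + 2 * (real (card J) * (\<Sum>i\<in>J. (c i)^2 * (x i)^2)))"
  using coord_sq_integrable[OF J, of _ 0] by auto
 thus i: ?C1
  by (rule integrable_le) (simp_all add: le)
 show ?C2 by (rule Q.square_integrable_imp_integrable[OF f i])
qed

text \<open>The variance is at most the mean square distance to \<open>h m\<close>, where
  \<open>m\<close> is the mean of the coordinate; there the Lipschitz bound transfers the variance
  of the coordinate.\<close>

lemma lip_var_one:
 assumes h[measurable]: "h \<in> borel_measurable borel" and l: "!!r t. \<bar>h r - h t\<bar> <= c * \<bar>r - t\<bar>"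
 shows "integrable (P i) (%r. (h r)^2)" (is ?C1) "integrable (P i) h" (is ?C2)
  "(LINT r|P i. (h r - (LINT r|P i. h r))^2) <= c^2 * s i" (is ?C3)
proof -
 interpret Q: prob_space "P i" by (rule prob)
 define m where "m = (LINT r|P i. r)"
 have d: "(h r - h m)^2 <= c^2 * (r - m)^2" for r
 proof -
  have "\<bar>h r - h m\<bar>^2 <= (c * \<bar>r - m\<bar>)^2" by (rule power_mono[OF l]) simp
  thus ?thesis by (simp only: power2_abs power_mult_distrib)
 qed
 have e: "(x - m)^2 = x^2 - 2 * m * x + m^2" for x :: real by (simp add: power2_eq_square algebra_simps)
 have xi: "integrable (P i) (%x. (x - m)^2)" unfolding e using sq[of i] id_integrable[of i] by simp
 have di: "integrable (P i) (%r. (h r - h m)^2)"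
  by (rule integrable_le[of _ "%r. c^2 * (r - m)^2"]) (use xi d in auto)
 have "integrable (P i) (%r. 2 * (h r - h m)^2 + 2 * (h m)^2)" using di by simp
 thus h2: ?C1
 proof (rule integrable_le)
  have "(h r)^2 <= 2 * (h r - h m)^2 + 2 * (h m)^2" for r
   using zero_le_power2[of "h r - 2 * h m"] by (simp add: power2_eq_square algebra_simps)
  thus "\<bar>(h r)^2\<bar> <= 2 * (h r - h m)^2 + 2 * (h m)^2" for r by simp
 qed simp
 show h1: ?C2 by (rule Q.square_integrable_imp_integrable[OF _ h2]) simp
 have "(LINT r|P i. (h r - (LINT r|P i. h r))^2) <= (LINT r|P i. (h r - h m)^2)"
  using Q.sq_dev_le[OF h1 h2, of "h m"] by simp
 also have "... <= (LINT r|P i. c^2 * (r - m)^2)" using d di xi by (intro integral_mono) auto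
 also have "... <= c^2 * s i" using var[of i] by (simp add: m_def mult_left_mono)
 finally show ?C3 .
qed

text \<open>Induction on the coordinates. The variance is the mean of the conditional variance in
  coordinate \<open>i\<close> plus the variance of \<open>g\<close>, obtained by integrating
  \<open>i\<close> out. The first is bounded by \<open>lip_var_one\<close>, and \<open>g\<close>
  inherits the remaining Lipschitz constants.\<close>

theorem efron_stein_lip:
 assumes J: "finite J" and "f \<in> borel_measurable (PiM J P)" and "lip J c f"
 shows "(LINT x|PiM J P. (f x - (LINT x|PiM J P. f x))^2) <= (\<Sum>i\<in>J. (c i)^2 * s i)"
 using assms
proof (induction J arbitrary: f rule: finite_induct)
 case empty
 have "(LINT x|PiM {} P. (f x - (LINT x|PiM {} P. f x))^2) = 0"
 proof -
  have c: "PiM {} P = count_space {%_. undefined}" by (rule PiM_empty)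
  show ?thesis unfolding c by (simp add: lebesgue_integral_count_space_finite)
 qed
 thus ?case by simp
next
 case (insert i J)
 note [measurable] = insert.prems(1)
 interpret Q: prob_space "PiM J P" by (rule prob_space_PiM) (rule prob)
 interpret QI: prob_space "PiM (insert i J) P" by (rule prob_space_PiM) (rule prob)
 interpret Pi: prob_space "P i" by (rule prob)
 define g where "g = (%x. LINT y|P i. f (x(i := y)))"
 have Fm[measurable]: "(%p. f ((fst p)(i := snd p))) \<in> borel_measurable (PiM J P \<Otimes>\<^sub>M P i)"
  using measurable_compose[OF measurable_add_dim[of i J P] insert.prems(1)] by (simp add: case_prod_unfold)
 have gm[measurable]: "g \<in> borel_measurable (PiM J P)"
  unfolding g_def by (rule borel_measurable_lebesgue_integral) (simp add: case_prod_unfold)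
 have in1: "x(i := y) \<in> PiE (insert i J) (%_. UNIV)" if "x \<in> PiE J (%_. UNIV)" for x :: "'i => real" and y
  using that by (auto simp: PiE_iff extensional_def)
 have li: "\<bar>f (x(i := r)) - f (x(i := t))\<bar> <= c i * \<bar>r - t\<bar>" if "x \<in> PiE J (%_. UNIV)" for x r t
  using insert.prems(2)[unfolded lip_def] in1[OF that, of t] by (metis fun_upd_same fun_upd_upd insertI1)
 have fm1: "(%y. f (x(i := y))) \<in> borel_measurable borel" if "x \<in> PiE J (%_. UNIV)" for x
 proof -
  have "(%y. f (x(i := y))) \<in> borel_measurable (P i)"
   using measurable_compose[OF measurable_Pair1'[of x "PiM J P" "P i"] Fm] that by (simp add: space_PiM)
  thus ?thesis by (simp add: measurable_cong_sets[OF sets refl])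
 qed
 note one = lip_var_one[OF fm1 li, where i=i]
 have lg: "lip J c g" unfolding lip_def
 proof (intro ballI allI)
  fix x :: "'i => real" and j r assume x: "x \<in> PiE J (%_. UNIV)" and j: "j \<in> J"
  have x': "x(j := r) \<in> PiE J (%_. UNIV)" using x j by (auto simp: PiE_iff extensional_def)
  have "\<bar>g (x(j := r)) - g x\<bar> = \<bar>LINT y|P i. f ((x(j := r))(i := y)) - f (x(i := y))\<bar>"
   unfolding g_def using one(2)[OF x x] one(2)[OF x' x'] by simp
  also have "... <= (LINT y|P i. \<bar>f ((x(j := r))(i := y)) - f (x(i := y))\<bar>)" by (rule integral_abs_bound)
  also have "... <= (LINT y|P i. c j * \<bar>r - x j\<bar>)"
  proof (rule integral_mono)
   fix y
   have ij: "i \<noteq> j" using insert.hyps j by auto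
   have "\<bar>f ((x(i := y))(j := r)) - f (x(i := y))\<bar> <= c j * \<bar>r - (x(i := y)) j\<bar>"
    using insert.prems(2)[unfolded lip_def] in1[OF x, of y] j by blast
   thus "\<bar>f ((x(j := r))(i := y)) - f (x(i := y))\<bar> <= c j * \<bar>r - x j\<bar>"
    using ij by (simp add: fun_upd_twist)
  qed (use one(2)[OF x x] one(2)[OF x' x'] in auto)
  finally show "\<bar>g (x(j := r)) - g x\<bar> <= c j * \<bar>r - x j\<bar>" by (simp add: Pi.prob_space[simplified])
 qed
 have fi: "finite (insert i J)" using insert.hyps by simp
 note f2 = lip_sq_integrable[OF fi insert.prems]
 note g2 = lip_sq_integrable[OF insert.hyps(1) gm lg]
 define m where "m = (LINT x|PiM (insert i J) P. f x)"
 have mg: "m = (LINT x|PiM J P. g x)"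
  unfolding m_def g_def by (rule product_integral_insert[OF insert.hyps f2(2)])
 have e: "(f x - m)^2 = (f x)^2 - 2 * m * f x + m^2" for x by (simp add: power2_eq_square algebra_simps)
 have e': "(g x - m)^2 = (g x)^2 - 2 * m * g x + m^2" for x by (simp add: power2_eq_square algebra_simps)
 have i2: "integrable (PiM (insert i J) P) (%x. (f x - m)^2)" unfolding e using f2 by simp
 have j2: "integrable (PiM J P) (%x. (g x - m)^2)" unfolding e' using g2 by simp
 have "(LINT x|PiM (insert i J) P. (f x - m)^2) = (LINT x|PiM J P. LINT y|P i. (f (x(i := y)) - m)^2)"
  by (rule product_integral_insert[OF insert.hyps i2])
 also have "... <= (LINT x|PiM J P. (c i)^2 * s i + (g x - m)^2)"
 proof (rule integral_mono_AE')
  show "integrable (PiM J P) (%x. (c i)^2 * s i + (g x - m)^2)" using j2 by simp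
  have "(LINT y|P i. (f (x(i := y)) - m)^2) <= (c i)^2 * s i + (g x - m)^2" if x: "x \<in> PiE J (%_. UNIV)" for x
   using Pi.sq_dev_le[OF one(2,1)[OF x x], of m] one(3)[OF x x] unfolding g_def by simp
  thus "AE x in PiM J P. (LINT y|P i. (f (x(i := y)) - m)^2) <= (c i)^2 * s i + (g x - m)^2"
   by (intro AE_I2) (simp add: space_PiM)
  show "AE x in PiM J P. 0 <= (c i)^2 * s i + (g x - m)^2"
   by (intro AE_I2 add_nonneg_nonneg mult_nonneg_nonneg s_nonneg zero_le_power2)
 qed
 also have "... = (c i)^2 * s i + (LINT x|PiM J P. (g x - m)^2)" using j2 Q.prob_space by simp
 also have "... <= (c i)^2 * s i + (\<Sum>i\<in>J. (c i)^2 * s i)"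
  using insert.IH[OF gm lg] by (simp add: mg)
 finally show ?case using insert.hyps by (simp add: m_def)
qed

end

lemma std_normal_factors: "real_factors (%_. std_normal_distribution) (%_. 1)"
proof (rule real_factors.intro)
 show "prob_space std_normal_distribution" by (rule prob_space_std_normal)
 show "integrable std_normal_distribution (%x. x^2)" by (rule integrable_std_normal_distribution_moment)
 show "(LINT x|std_normal_distribution. (x - (LINT x|std_normal_distribution. x))^2) <= 1"
  using integral_std_normal_distribution_moment_odd[of 1] std_normal_distribution_even_moments(1)[of 1]
  by (simp add: fact_2)
qed simp

text \<open>The law of total variance, with the inner variance bounded uniformly.\<close>

lemma var_pair_le:
 fixes f :: "'a \<times> 'b => real"
 assumes "prob_space A" "prob_space C"
  and fm[measurable]: "f \<in> borel_measurable (A \<Otimes>\<^sub>M C)" and f2: "integrable (A \<Otimes>\<^sub>M C) (%p. (f p)^2)"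
  and in2: "!!x. x \<in> space A ==> integrable C (%y. (f (x, y))^2)"
  and v1: "!!x. x \<in> space A ==> (LINT y|C. (f (x, y) - (LINT y|C. f (x, y)))^2) <= a"
  and v2: "(LINT x|A. ((LINT y|C. f (x, y)) - (LINT x|A. LINT y|C. f (x, y)))^2) <= b"
 shows "(LINT p|(A \<Otimes>\<^sub>M C). (f p - (LINT p|(A \<Otimes>\<^sub>M C). f p))^2) <= a + b"
proof -
 interpret A: prob_space A by fact
 interpret C: prob_space C by fact
 interpret AC: pair_prob_space A C ..
 have f1: "integrable (A \<Otimes>\<^sub>M C) f" by (rule AC.square_integrable_imp_integrable) (auto simp: f2)
 define g where "g = (%x. LINT y|C. f (x, y))"
 define m where "m = (LINT p|(A \<Otimes>\<^sub>M C). f p)"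
 have mg: "m = (LINT x|A. g x)" unfolding m_def g_def by (rule AC.integral_fst'[OF f1, symmetric])
 have e: "(f x - m)^2 = (f x)^2 - 2 * m * f x + m^2" for x by (simp add: power2_eq_square algebra_simps)
 have i2: "integrable (A \<Otimes>\<^sub>M C) (%x. (f x - m)^2)" unfolding e using f2 f1 by simp
 have in1: "integrable C (%y. f (x, y))" if x[measurable]: "x \<in> space A" for x
  by (rule C.square_integrable_imp_integrable) (auto simp: in2[OF x])
 have gm[measurable]: "g \<in> borel_measurable A" unfolding g_def by measurable
 have g2: "integrable A (%x. (g x)^2)"
 proof (rule integrable_le[OF AC.integrable_fst'[OF f2]])
  fix x assume x: "x \<in> space A"
  show "\<bar>(g x)^2\<bar> <= (LINT y|C. (f (x, y))^2)"
   using C.sq_dev_le[OF in1[OF x] in2[OF x], of 0] integral_nonneg_AE[of "%y. (f (x, y) - (LINT y|C. f (x, y)))^2" C]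
   by (simp add: g_def)
 qed simp
 have g1: "integrable A g" by (rule A.square_integrable_imp_integrable) (auto simp: g2)
 have e': "(g x - m)^2 = (g x)^2 - 2 * m * g x + m^2" for x by (simp add: power2_eq_square algebra_simps)
 have j2: "integrable A (%x. (g x - m)^2)" unfolding e' using g2 g1 by simp
 have "(LINT p|(A \<Otimes>\<^sub>M C). (f p - m)^2) = (LINT x|A. LINT y|C. (f (x, y) - m)^2)"
  by (rule AC.integral_fst'[OF i2, symmetric])
 also have "... <= (LINT x|A. a + (g x - m)^2)"
 proof (rule integral_mono)
  show "integrable A (%x. LINT y|C. (f (x, y) - m)^2)" by (rule AC.integrable_fst'[OF i2])
  show "(LINT y|C. (f (x, y) - m)^2) <= a + (g x - m)^2" if x: "x \<in> space A" for x
   using C.sq_dev_le[OF in1[OF x] in2[OF x], of m] v1[OF x] unfolding g_def by simp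
 qed (use j2 in simp)
 also have "... = a + (LINT x|A. (g x - m)^2)" using j2 by (simp add: A.prob_space)
 also have "... <= a + b" using v2 unfolding mg g_def by simp
 finally show ?thesis unfolding m_def .
qed

context bsnr
begin

text \<open>The derivative of \<open>ln (partf ...)\<close> in \<open>y i\<close> is a posterior
  mean of the signal, at most \<open>sqrt (g i) * B\<close>. The proof avoids derivatives by
  comparing the likelihoods for each \<open>w\<close>.\<close>

lemma ln_part_lip:
 assumes g0: "\<forall>i\<in>I. 0 <= g i"
 shows "\<bar>ln (partf M I (amp e g) y') - ln (partf M I (amp e g) y)\<bar> <= (\<Sum>i\<in>I. sqrt (g i) * B * \<bar>y' i - y i\<bar>)"
proof -
 interpret A: channel M I "amp e g" by (rule channel_amp)
 have "ln (partf M I (amp e g) y') <= ln (partf M I (amp e g) y) + (\<Sum>i\<in>I. sqrt (g i) * B * \<bar>y' i - y i\<bar>)" (is "_ <= _ + ?S") for y y'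
 proof -
  have "lik I (amp e g) y' w <= exp ?S * lik I (amp e g) y w" for w
  proof -
   have "amp e g i w * y' i <= amp e g i w * y i + sqrt (g i) * B * \<bar>y' i - y i\<bar>" if i: "i \<in> I" for i
   proof -
    have "amp e g i w * y' i - amp e g i w * y i = sqrt (g i) * (e i w * (y' i - y i))" by (simp add: amp_def algebra_simps)
    also have "... <= sqrt (g i) * (B * \<bar>y' i - y i\<bar>)"
    proof (rule mult_left_mono)
     have "e i w * (y' i - y i) <= \<bar>e i w\<bar> * \<bar>y' i - y i\<bar>" using abs_ge_self[of "e i w * (y' i - y i)"] by (simp add: abs_mult)
     also have "... <= B * \<bar>y' i - y i\<bar>" using bound[OF i] by (intro mult_right_mono) auto
     finally show "e i w * (y' i - y i) <= B * \<bar>y' i - y i\<bar>" .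
    qed (use g0 i in simp)
    finally show ?thesis by simp
   qed
   thus ?thesis unfolding lik_def exp_add[symmetric] exp_le_cancel_iff sum.distrib[symmetric]
    by (intro sum_mono) fastforce
  qed
  hence "partf M I (amp e g) y' <= exp ?S * partf M I (amp e g) y"
   unfolding partf_def Bochner_Integration.integral_mult_right_zero[symmetric]
   by (intro integral_mono A.lik_integrable integrable_mult_right)
  hence "ln (partf M I (amp e g) y') <= ln (exp ?S * partf M I (amp e g) y)"
   using A.part_pos by (subst ln_le_cancel_iff) auto
  also have "... = ?S + ln (partf M I (amp e g) y)" using A.part_pos[of y] by (subst ln_mult) auto
  finally show ?thesis by simp
 qed
 from this[of y' y] this[of y y'] show ?thesis by (simp add: abs_le_iff abs_minus_commute)
qed

text \<open>In the planted form the randomness is that of the noise and that of the signal, and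
  their variances add. Efron-Stein bounds the noise part. The signal part is left as the hypothesis
  \<open>W\<close>: how the signals depend on independent variables is a matter of the concrete
  model.\<close>

lemma fluct_bound:
 assumes g0: "\<forall>i\<in>I. 0 <= g i"
  and W: "!!h. h \<in> borel_measurable M ==>
   (!!w w'. w \<in> space M ==> w' \<in> space M ==> \<bar>h w' - h w\<bar> <= B * (\<Sum>i\<in>I. g i * \<bar>e i w' - e i w\<bar>)) ==>
   (LINT w|M. (h w - (LINT w|M. h w))^2) <= W"
 shows "fluct g <= sqrt (B^2 * (\<Sum>i\<in>I. g i) + W)"
proof -
 interpret A: bounded_channel M I "amp e g" "(\<Sum>i\<in>I. sqrt (g i)) * B" by (rule bounded_amp[OF g0])
 interpret N: real_factors "%_::'i. std_normal_distribution" "%_. 1" by (rule std_normal_factors)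
 define F where "F = (%p. ln (partf M I (amp e g) (\<lambda>i\<in>I. snd p i + amp e g i (fst p))))"
 have Fm[measurable]: "F \<in> borel_measurable (M \<Otimes>\<^sub>M G)" unfolding F_def by measurable
 have amp_b: "\<bar>amp e g i w\<bar> <= sqrt (g i) * B" if "i \<in> I" for i w
  using bound[OF that, of w] g0 that by (simp add: amp_def abs_mult mult_left_mono)
 have lipF: "N.lip I (%i. sqrt (g i) * B) (%z. F (w, z))" for w
  unfolding N.lip_def
 proof (intro ballI allI)
  fix z i r assume z: "z \<in> PiE I (%_. UNIV :: real set)" and i: "i \<in> I"
  have "\<bar>F (w, z(i := r)) - F (w, z)\<bar> <= (\<Sum>j\<in>I. sqrt (g j) * B * \<bar>(\<lambda>k\<in>I. (z(i := r)) k + amp e g k w) j - (\<lambda>i\<in>I. z i + amp e g i w) j\<bar>)"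
   unfolding F_def fst_conv snd_conv by (rule ln_part_lip[OF g0])
  also have "... = (\<Sum>j\<in>I. if j = i then sqrt (g i) * B * \<bar>r - z i\<bar> else 0)"
   by (intro sum.cong) auto
  also have "... = sqrt (g i) * B * \<bar>r - z i\<bar>" using fin i by simp
  finally show "\<bar>F (w, z(i := r)) - F (w, z)\<bar> <= sqrt (g i) * B * \<bar>r - z i\<bar>" .
 qed
 have Fz[measurable]: "(%z. F (w, z)) \<in> borel_measurable G" if "w \<in> space M" for w using that by measurable
 note Fz2 = N.lip_sq_integrable[OF fin Fz lipF]
 have vz: "(LINT z|G. (F (w, z) - (LINT z|G. F (w, z)))^2) <= B^2 * (\<Sum>i\<in>I. g i)" if w: "w \<in> space M" for w
 proof -
  have "(\<Sum>i\<in>I. (sqrt (g i) * B)^2 * 1) = B^2 * (\<Sum>i\<in>I. g i)"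
   unfolding sum_distrib_left using g0 by (intro sum.cong) (auto simp: power_mult_distrib)
  thus ?thesis using N.efron_stein_lip[OF fin Fz[OF w] lipF] by (simp only:)
 qed
 define h where "h = (%w. LINT z|G. F (w, z))"
 have hm: "h \<in> borel_measurable M" unfolding h_def by measurable
 have hl: "\<bar>h w' - h w\<bar> <= B * (\<Sum>i\<in>I. g i * \<bar>e i w' - e i w\<bar>)" if w: "w \<in> space M" and w': "w' \<in> space M" for w w'
 proof -
  have "\<bar>h w' - h w\<bar> = \<bar>LINT z|G. F (w', z) - F (w, z)\<bar>" unfolding h_def using Fz2(2)[OF w] Fz2(2)[OF w'] by simp
  also have "... <= (LINT z|G. \<bar>F (w', z) - F (w, z)\<bar>)" by (rule integral_abs_bound)
  also have "... <= (LINT z|G. B * (\<Sum>i\<in>I. g i * \<bar>e i w' - e i w\<bar>))"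
  proof (rule integral_mono)
   fix z
   have "\<bar>F (w', z) - F (w, z)\<bar> <= (\<Sum>j\<in>I. sqrt (g j) * B * \<bar>(\<lambda>i\<in>I. z i + amp e g i w') j - (\<lambda>i\<in>I. z i + amp e g i w) j\<bar>)"
    unfolding F_def fst_conv snd_conv by (rule ln_part_lip[OF g0])
   also have "... = B * (\<Sum>i\<in>I. g i * \<bar>e i w' - e i w\<bar>)"
    unfolding sum_distrib_left
   proof (intro sum.cong refl)
    fix i assume i: "i \<in> I"
    have "amp e g i w' - amp e g i w = sqrt (g i) * (e i w' - e i w)" by (simp add: amp_def algebra_simps)
    hence "\<bar>amp e g i w' - amp e g i w\<bar> = sqrt (g i) * \<bar>e i w' - e i w\<bar>" using g0 i by (simp add: abs_mult)
    moreover have "sqrt (g i) * sqrt (g i) = g i" using g0 i by simp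
    ultimately show "sqrt (g i) * B * \<bar>(\<lambda>i\<in>I. z i + amp e g i w') i - (\<lambda>i\<in>I. z i + amp e g i w) i\<bar> = B * (g i * \<bar>e i w' - e i w\<bar>)"
     using i by (simp add: mult_ac)
   qed
   finally show "\<bar>F (w', z) - F (w, z)\<bar> <= B * (\<Sum>i\<in>I. g i * \<bar>e i w' - e i w\<bar>)" .
  qed (use Fz2(2)[OF w] Fz2(2)[OF w'] in auto)
  finally show ?thesis by (simp add: G.prob_space)
 qed
 have F2: "integrable (M \<Otimes>\<^sub>M G) (%p. (F p)^2)"
 proof -
  define b where "b = (\<Sum>i\<in>I. sqrt (g i)) * B"
  let ?S = "%z. \<Sum>i\<in>I. b * (\<bar>z i\<bar> + sqrt (g i) * B) + b^2 / 2"
  have b0: "0 <= b" using A.b0 by (simp add: b_def)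
  have "\<bar>F p\<bar> <= ?S (snd p)" for p
  proof -
   have "\<bar>F p\<bar> <= (\<Sum>i\<in>I. b * \<bar>(\<lambda>i\<in>I. snd p i + amp e g i (fst p)) i\<bar> + b^2 / 2)"
    unfolding F_def b_def by (rule A.ln_part_bound)
   also have "... <= ?S (snd p)"
   proof (intro sum_mono add_mono mult_left_mono order_refl b0)
    fix i assume i: "i \<in> I"
    show "\<bar>(\<lambda>i\<in>I. snd p i + amp e g i (fst p)) i\<bar> <= \<bar>snd p i\<bar> + sqrt (g i) * B"
     using i amp_b[OF i, of "fst p"] abs_triangle_ineq[of "snd p i" "amp e g i (fst p)"] by simp
   qed
   finally show ?thesis .
  qed
  hence le: "(F p)^2 <= (?S (snd p))^2" for p
   by (metis abs_ge_zero power2_abs power_mono)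
  have int: "integrable (M \<Otimes>\<^sub>M G) (%p. (?S (snd p))^2)"
  proof (rule integrable_pair_snd(1)[OF prob_space_axioms prob_space_std_gauss])
   show "integrable G (%z. (?S z)^2)"
   proof (rule N.lip_sq_integrable(1)[OF fin, where c="%_. b"])
    show "N.lip I (%_. b) ?S" unfolding N.lip_def
    proof (intro ballI allI)
     fix x i r assume i: "i \<in> I"
     have "?S (x(i := r)) - ?S x = (\<Sum>j\<in>I. if j = i then b * (\<bar>r\<bar> - \<bar>x i\<bar>) else 0)"
      unfolding sum_subtractf[symmetric] by (intro sum.cong) (auto simp: algebra_simps)
     also have "... = b * (\<bar>r\<bar> - \<bar>x i\<bar>)" using fin i by simp
     finally have "\<bar>?S (x(i := r)) - ?S x\<bar> = b * \<bar>\<bar>r\<bar> - \<bar>x i\<bar>\<bar>" using b0 by (simp add: abs_mult)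
     thus "\<bar>?S (x(i := r)) - ?S x\<bar> <= b * \<bar>r - x i\<bar>"
      using b0 abs_triangle_ineq3[of r "x i"] by (simp add: mult_left_mono)
    qed
   qed measurable
  qed
  show ?thesis
  proof (rule integrable_le[OF int])
   show "(%p. (F p)^2) \<in> borel_measurable (M \<Otimes>\<^sub>M G)" by measurable
   show "\<bar>(F p)^2\<bar> <= (?S (snd p))^2" for p by (simp only: abs_of_nonneg[OF zero_le_power2] le)
  qed
 qed
 have EF: "(LINT p|(M \<Otimes>\<^sub>M G). F p) = Phi g"
  unfolding F_def ln_part_ol(2)[OF g0, symmetric] by (rule A.integral_planted(1)[symmetric]) measurable
 have v2: "(LINT w|M. ((LINT z|G. F (w, z)) - (LINT w|M. LINT z|G. F (w, z)))^2) <= W"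
  using W[OF hm hl] by (simp only: h_def)
 have v: "(LINT p|(M \<Otimes>\<^sub>M G). (F p - Phi g)^2) <= B^2 * (\<Sum>i\<in>I. g i) + W"
  unfolding EF[symmetric]
  by (rule var_pair_le[OF prob_space_axioms prob_space_std_gauss Fm F2 Fz2(1) vz v2])
 have MGp: "prob_space (M \<Otimes>\<^sub>M G)" by (rule A.MG.prob_space_axioms)
 have F1: "integrable (M \<Otimes>\<^sub>M G) F" by (rule finite_measure.square_integrable_imp_integrable[OF prob_space.finite_measure[OF MGp] Fm F2])
 have "fluct g = (LINT p|(M \<Otimes>\<^sub>M G). \<bar>F p - Phi g\<bar>)"
  unfolding fluct_def F_def by (rule A.integral_planted(1)) measurable
 also have "... <= sqrt (LINT p|(M \<Otimes>\<^sub>M G). (F p - Phi g)^2)"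
 proof (rule real_le_rsqrt)
  have i1: "integrable (M \<Otimes>\<^sub>M G) (%p. \<bar>F p - Phi g\<bar>)" using F1 by simp
  have "(F p - Phi g)^2 = (F p)^2 - 2 * Phi g * F p + (Phi g)^2" for p by (simp add: power2_eq_square algebra_simps)
  hence i2: "integrable (M \<Otimes>\<^sub>M G) (%p. \<bar>F p - Phi g\<bar>^2)" using F1 F2 by simp
  show "(LINT p|(M \<Otimes>\<^sub>M G). \<bar>F p - Phi g\<bar>)^2 <= (LINT p|(M \<Otimes>\<^sub>M G). (F p - Phi g)^2)"
   using prob_space.sq_dev_le[OF MGp i1 i2, of 0]
    integral_nonneg_AE[of "%p. (\<bar>F p - Phi g\<bar> - (LINT p|(M \<Otimes>\<^sub>M G). \<bar>F p - Phi g\<bar>))^2" "M \<Otimes>\<^sub>M G"] by simp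
 qed
 also have "... <= sqrt (B^2 * (\<Sum>i\<in>I. g i) + W)" using v by simp
 finally show ?thesis .
qed

end

section \<open>Clipping, and the index set of matrix entries and side channels\<close>

definition clip :: "real => real => real" where "clip K x = max (- K) (min K x)"

lemma clip_meas [measurable]: "clip K \<in> borel_measurable borel"
 unfolding clip_def[abs_def] by measurable

lemma clip_bound: "0 <= K ==> \<bar>clip K x\<bar> <= K" by (auto simp: clip_def)

lemma clip_le_self: "0 <= K ==> \<bar>clip K x\<bar> <= \<bar>x\<bar>" by (auto simp: clip_def)

lemma clip_lip: "\<bar>clip K x - clip K y\<bar> <= \<bar>x - y\<bar>" by (auto simp: clip_def)

text \<open>The left summand holds the matrix entries, the right one the side channels of
  \<open>U\<close> and then those of \<open>V\<close>. Treating all of them as coordinates of one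
  channel makes the chain rule available in \<open>t\<close>, \<open>a\<close> and \<open>b\<close>
  at once.\<close>

type_synonym midx = "(nat \<times> nat) + nat + nat"

definition midx :: "nat => nat => midx set"
 where "midx n m = ({..<n} \<times> {..<m}) <+> ({..<n} <+> {..<m})"

lemma sum_midx: "(\<Sum>k\<in>midx n m. G k) = (\<Sum>i<n. \<Sum>j<m. G (Inl (i, j))) + (\<Sum>i<n. G (Inr (Inl i))) + (\<Sum>j<m. G (Inr (Inr j)))"
 unfolding midx_def by (simp add: sum.Plus sum.cartesian_product add.assoc)

lemma midx_simps [simp]: "Inl (i, j) \<in> midx n m \<longleftrightarrow> i < n \<and> j < m"
 "Inr (Inl i) \<in> midx n m \<longleftrightarrow> i < n" "Inr (Inr j) \<in> midx n m \<longleftrightarrow> j < m"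
 by (auto simp: midx_def)

lemma finite_midx [simp]: "finite (midx n m)" by (simp add: midx_def)

lemma midx_cases:
 assumes "k \<in> midx n m"
 obtains i j where "i < n" "j < m" "k = Inl (i, j)" | i where "i < n" "k = Inr (Inl i)" | j where "j < m" "k = Inr (Inr j)"
 using assms by (auto simp: midx_def)

definition msig :: "real => midx => (nat => real) \<times> (nat => real) => real"
 where "msig K k w = (case k of Inl (i, j) => clip K (fst w i) * clip K (snd w j)
  | Inr (Inl i) => clip K (fst w i) | Inr (Inr j) => clip K (snd w j))"

lemma msig_simps [simp]: "msig K (Inl (i, j)) w = clip K (fst w i) * clip K (snd w j)"
 "msig K (Inr (Inl i)) w = clip K (fst w i)" "msig K (Inr (Inr j)) w = clip K (snd w j)"
 by (auto simp: msig_def)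

definition msnr :: "nat => real => real => real => midx => real"
 where "msnr n t a b k = (case k of Inl _ => t / real n | Inr (Inl _) => a | Inr (Inr _) => b)"

lemma msnr_simps [simp]: "msnr n t a b (Inl p) = t / real n" "msnr n t a b (Inr (Inl i)) = a" "msnr n t a b (Inr (Inr j)) = b"
 by (auto simp: msnr_def)

lemma msnr_add: "(%k. msnr n t a b k + msnr n t' a' b' k) = msnr n (t + t') (a + a') (b + b')"
 by (auto simp: msnr_def fun_eq_iff add_divide_distrib split: sum.splits)

section \<open>The clipped model\<close>

locale prior =
 fixes P :: "real measure"
 assumes rd: "real_distribution P" and sq: "integrable P (%x. x^2)"
begin

sublocale real_distribution P by (rule rd)

definition "var = (LINT x|P. (x - (LINT x|P. x))^2)"

sublocale F: real_factors "%_::nat. P" "%_. var"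
proof (rule real_factors.intro)
 show "prob_space P" by (rule prob_space_axioms)
 show "sets P = sets borel" by (rule events_eq_borel)
 show "integrable P (%x. x^2)" by (rule sq)
 show "(LINT x|P. (x - (LINT x|P. x))^2) <= var" by (simp only: var_def order_refl)
qed

end

text \<open>Since \<open>1 <= K\<close> implies \<open>K <= K^2\<close>, the number
  \<open>K^2\<close> bounds matrix entries and side channels alike.\<close>

locale clipped_model = U: prior PU + V: prior PV for PU PV :: "real measure" +
 fixes n m :: nat and K :: real
 assumes n: "1 <= n" and K: "1 <= K"
begin

abbreviation "UU \<equiv> \<Pi>\<^sub>M i\<in>{..<n}. PU"
abbreviation "VV \<equiv> \<Pi>\<^sub>M j\<in>{..<m}. PV"
abbreviation "Om \<equiv> UU \<Otimes>\<^sub>M VV"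
abbreviation "Ix \<equiv> midx n m"

sublocale UU: prob_space UU by (intro prob_space_PiM U.prob_space_axioms)
sublocale VV: prob_space VV by (intro prob_space_PiM V.prob_space_axioms)
sublocale UV: pair_prob_space UU VV ..

lemma K2: "K <= K^2" "1 <= K^2" "0 <= K"
 using K mult_left_mono[of 1 K K] one_le_power[OF K, of 2] by (auto simp: power2_eq_square)

lemma prod_clip_bound: "\<bar>clip K x * clip K y\<bar> <= K^2"
 using clip_bound[OF K2(3), of x] clip_bound[OF K2(3), of y] K2(3) unfolding abs_mult power2_eq_square by (intro mult_mono) auto

lemma cm:
 "i < n ==> (%w. clip K (fst w i)) \<in> borel_measurable Om" "j < m ==> (%w. clip K (snd w j)) \<in> borel_measurable Om"
proof -
 have cU: "clip K \<in> borel_measurable PU" by measurable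
 assume "i < n"
 hence i: "i \<in> {..<n}" by simp
 show "(%w. clip K (fst w i)) \<in> borel_measurable Om"
  by (rule measurable_compose[OF measurable_compose[OF measurable_fst measurable_component_singleton[OF i]] cU])
next
 have cV: "clip K \<in> borel_measurable PV" by measurable
 assume "j < m"
 hence j: "j \<in> {..<m}" by simp
 show "(%w. clip K (snd w j)) \<in> borel_measurable Om"
  by (rule measurable_compose[OF measurable_compose[OF measurable_snd measurable_component_singleton[OF j]] cV])
qed

sublocale bsnr Om Ix "msig K" "K^2"
proof (intro bsnr.intro snr.intro snr_axioms.intro bsnr_axioms.intro)
 show "prob_space Om" by (rule UV.prob_space_axioms)
 show "finite Ix" by simp
 show "msig K k \<in> borel_measurable Om" if "k \<in> Ix" for k
  using that
 proof (cases rule: midx_cases)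
  case (1 i j)
  have "(%w. clip K (fst w i) * clip K (snd w j)) \<in> borel_measurable Om"
   using 1 by (intro borel_measurable_times cm)
  thus ?thesis using 1 by (simp add: msig_def[abs_def])
 next
  case (2 i)
  have "(%w. clip K (fst w i)) \<in> borel_measurable Om" using 2 by (intro cm)
  thus ?thesis using 2 by (simp add: msig_def[abs_def])
 next
  case (3 j)
  have "(%w. clip K (snd w j)) \<in> borel_measurable Om" using 3 by (intro cm)
  thus ?thesis using 3 by (simp add: msig_def[abs_def])
 qed
 show "\<bar>msig K k w\<bar> <= K^2" if "k \<in> Ix" for k w
  using that prod_clip_bound K2 order_trans[OF clip_bound[OF K2(3)] K2(1)] by (cases rule: midx_cases) auto
 show "0 <= K^2" by simp
qed

text \<open>\<open>Dt\<close>, \<open>Da\<close> and \<open>Db\<close> below are the partial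
  derivatives of \<open>F\<close>, expressed by overlaps. The ratio of a matrix entry is
  \<open>t / n\<close>, hence the second factor \<open>n\<close> in the denominator of
  \<open>Dt\<close>.\<close>

definition "F t a b = Phi (msnr n t a b) / n"
definition "Dt t a b = (\<Sum>i<n. \<Sum>j<m. AA (msnr n t a b) (Inl (i, j))) / (2 * (real n)^2)"
definition "Da t a b = (\<Sum>i<n. AA (msnr n t a b) (Inr (Inl i))) / (2 * n)"
definition "Db t a b = (\<Sum>j<m. AA (msnr n t a b) (Inr (Inr j))) / (2 * n)"
definition "ratio = real m / real n"

lemma n0: "0 < real n" using n by simp

lemma ratio0: "0 <= ratio" by (simp add: ratio_def)

lemma msnr_nonneg: "0 <= t ==> 0 <= a ==> 0 <= b ==> \<forall>k\<in>Ix. 0 <= msnr n t a b k"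
 by (auto simp: msnr_def split: sum.splits)

lemma sum_msnr_AA: "(\<Sum>k\<in>Ix. msnr n dt da db k * AA (msnr n t a b) k) / 2 = n * (dt * Dt t a b + da * Da t a b + db * Db t a b)"
proof -
 have "(x / n * s1 + y * s2 + z * s3) / 2 = n * (x * (s1 / (2 * (real n)^2)) + y * (s2 / (2 * n)) + z * (s3 / (2 * n)))" for x y z s1 s2 s3 :: real
  using n0 by (simp add: field_simps power2_eq_square)
 thus ?thesis unfolding Dt_def Da_def Db_def sum_midx msnr_simps sum_distrib_left[symmetric] by blast
qed

lemma sum_msnr: "(\<Sum>k\<in>Ix. msnr n t a b k) = real m * t + real n * a + real m * b"
 using n0 by (simp add: sum_midx)

lemma F_lower:
 assumes "0 <= t" "0 <= a" "0 <= b" "0 <= dt" "0 <= da" "0 <= db"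
 shows "dt * Dt t a b + da * Da t a b + db * Db t a b <= F (t + dt) (a + da) (b + db) - F t a b"
 using Phi_lower[OF msnr_nonneg[OF assms(1-3)] msnr_nonneg[OF assms(4-6)]] n0
 unfolding sum_msnr_AA msnr_add F_def by (simp add: field_simps)

text \<open>\<open>rN\<close> makes the condition of \<open>Phi_upper\<close> hold with
  \<open>B = K^2\<close> for every increment of total size at most \<open>rN\<close>, and
  \<open>cN\<close> is the quadratic constant that results after division by \<open>n\<close>. It
  grows with \<open>n\<close>, so the curvature of \<open>F\<close> is not bounded
  uniformly.\<close>

definition "cN = (4 * (K^2)^2 * (n + m))^2 / n"
definition "rN = 1 / (12 * (K^2)^2 * (n + m))"

lemma rN0: "0 < rN" using n K by (auto simp: rN_def)

lemma F_upper:
 assumes "0 <= t" "0 <= a" "0 <= b" "0 <= dt" "0 <= da" "0 <= db" and r: "dt + da + db <= rN"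
 shows "F (t + dt) (a + da) (b + db) - F t a b <= dt * Dt t a b + da * Da t a b + db * Db t a b + cN * (dt + da + db)^2"
proof -
 let ?S = "\<Sum>k\<in>Ix. msnr n dt da db k"
 have S: "?S <= (n + m) * (dt + da + db)" unfolding sum_msnr using assms by (simp add: algebra_simps)
 have S0: "0 <= ?S" using msnr_nonneg[OF assms(4-6)] by (intro sum_nonneg) auto
 have K4: "0 < (K^2)^2" using K by simp
 have le: "4 * (K^2)^2 * ?S <= 4 * (K^2)^2 * (n + m) * (dt + da + db)"
  using mult_left_mono[OF S, of "4 * (K^2)^2"] by (simp add: mult_ac)
 also have "... <= 4 * (K^2)^2 * (n + m) * rN" using r by (intro mult_left_mono) auto
 also have "... = 1 / 3"
 proof -
  define c where "c = (K^2)^2 * real (n + m)"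
  have "c \<noteq> 0" using K4 n by (simp add: c_def)
  hence "4 * c * (1 / (12 * c)) = 1 / 3" by simp
  thus ?thesis by (simp add: rN_def c_def mult.assoc)
 qed
 finally have X: "4 * (K^2)^2 * ?S <= 1 / 3" .
 have "(4 * (K^2)^2 * ?S)^2 <= (4 * (K^2)^2 * (n + m) * (dt + da + db))^2"
  using le S0 by (intro power_mono) auto
 also have "... = n * (cN * (dt + da + db)^2)" using n0 by (simp add: cN_def power_mult_distrib)
 finally have "(4 * (K^2)^2 * ?S)^2 <= n * (cN * (dt + da + db)^2)" .
 with Phi_upper[OF msnr_nonneg[OF assms(1-3)] msnr_nonneg[OF assms(4-6)] X]
 have "Phi (msnr n (t + dt) (a + da) (b + db)) - Phi (msnr n t a b)
  <= n * (dt * Dt t a b + da * Da t a b + db * Db t a b) + n * (cN * (dt + da + db)^2)"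
  unfolding sum_msnr_AA msnr_add by simp
 thus ?thesis using n0 unfolding F_def by (simp add: field_simps)
qed

lemma D_nonneg: "0 <= Dt t a b" "0 <= Da t a b" "0 <= Db t a b"
 by (auto simp: Dt_def Da_def Db_def intro!: divide_nonneg_nonneg sum_nonneg AA_nonneg)

lemma AA_le_sq:
 assumes "k \<in> Ix" "!!w. \<bar>msig K k w\<bar> <= C"
 shows "AA g k <= C^2"
proof -
 have "AA g k <= (LINT w|Om. (msig K k w)^2)" unfolding AA_def
  by (rule channel.gavg_sq_integral_bounds(2)[OF channel_amp meas[OF assms(1)] e_sq_integrable[OF assms(1)]])
 also have "... <= (LINT w|Om. C^2)"
  using assms(2) e_sq_integrable[OF assms(1)] by (intro integral_mono) (auto simp: abs_le_square_iff[symmetric] intro: order_trans[OF _ abs_ge_self])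
 finally show ?thesis by (simp add: UV.prob_space)
qed

lemma D_le: "Dt t a b <= ratio * (K^2)^2 / 2" (is ?C1) "Da t a b <= K^2 / 2" (is ?C2) "Db t a b <= ratio * K^2 / 2" (is ?C3)
proof -
 have "(\<Sum>i<n. \<Sum>j<m. AA (msnr n t a b) (Inl (i, j))) <= (\<Sum>i<n. \<Sum>j<m. (K^2)^2)"
  by (intro sum_mono AA_le_sq) (auto simp: prod_clip_bound)
 thus ?C1 using n0 by (simp add: Dt_def ratio_def field_simps power2_eq_square)
 have "(\<Sum>i<n. AA (msnr n t a b) (Inr (Inl i))) <= (\<Sum>i<n. K^2)"
  by (intro sum_mono AA_le_sq) (auto simp: clip_bound K2)
 thus ?C2 using n0 by (simp add: Da_def field_simps)
 have "(\<Sum>j<m. AA (msnr n t a b) (Inr (Inr j))) <= (\<Sum>j<m. K^2)"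
  by (intro sum_mono AA_le_sq) (auto simp: clip_bound K2)
 thus ?C3 using n0 by (simp add: Db_def ratio_def field_simps)
qed

lemma D_mono:
 assumes "0 <= t" "0 <= a" "0 <= b" "t <= t'" "a <= a'" "b <= b'"
 shows "Dt t a b <= Dt t' a' b'" (is ?C1) "Da t a b <= Da t' a' b'" (is ?C2) "Db t a b <= Db t' a' b'" (is ?C3)
proof -
 have A: "AA (msnr n t a b) k <= AA (msnr n t' a' b') k" if "k \<in> Ix" for k
  using AA_mono[OF msnr_nonneg[OF assms(1-3)] msnr_nonneg[of "t' - t" "a' - a" "b' - b"] that] assms
  by (simp add: msnr_add)
 show ?C1 ?C2 ?C3
  unfolding Dt_def Da_def Db_def by (auto intro!: divide_right_mono sum_mono A)
qed

text \<open>Variance of the logarithm of the partition function per unit of \<open>n\<close>: first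
  the noise, then the signals \<open>V\<close> and \<open>U\<close>. It is uniform over
  \<open>t <= T\<close> and \<open>a, b <= A\<close>.\<close>

definition "vN T A = (K^2)^2 * (ratio * T + A + ratio * A) + ((K^2 * (T * K + A))^2 * V.var * ratio + (K^2 * (T * K * ratio + A))^2 * U.var)"

text \<open>Changing \<open>u i\<close> affects \<open>m\<close> matrix entries, each by at most
  \<open>t / n * K\<close> times the change, and one side channel, which gives the constant
  \<open>t * K * ratio + a\<close>; for \<open>v j\<close> there are \<open>n\<close> entries and
  the constant is \<open>t * K + b\<close>. Efron-Stein is applied to \<open>V\<close> for fixed
  \<open>U\<close>, and to \<open>U\<close> after \<open>V\<close> is integrated out.\<close>

lemma lipschitz_variance:
 assumes t: "0 <= t" "0 <= a" "0 <= b" and hm: "h \<in> borel_measurable Om"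
  and hl: "!!w w'. w \<in> space Om ==> w' \<in> space Om ==> \<bar>h w' - h w\<bar> <= K^2 * (\<Sum>k\<in>Ix. msnr n t a b k * \<bar>msig K k w' - msig K k w\<bar>)"
 shows "(LINT w|Om. (h w - (LINT w|Om. h w))^2) <= m * ((K^2 * (t * K + b))^2 * V.var) + n * ((K^2 * (t * K * ratio + a))^2 * U.var)"
proof -
 note [measurable] = hm
 \<comment> \<open>Clipped signals differ by at most \<open>2 * K^2\<close>, so \<open>h\<close> is
   bounded by its value at one point plus \<open>C\<close>; this settles all integrability.\<close>
 define C where "C = K^2 * (\<Sum>k\<in>Ix. msnr n t a b k * (2 * K^2))"
 obtain w0 where w0: "w0 \<in> space Om" using UV.not_empty by blast
 have hb: "\<bar>h w\<bar> <= \<bar>h w0\<bar> + C" if w: "w \<in> space Om" for w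
 proof -
  have "\<bar>h w - h w0\<bar> <= C" unfolding C_def
  proof (rule order_trans[OF hl[OF w0 w]], intro mult_left_mono sum_mono)
   fix k assume k: "k \<in> Ix"
   show "\<bar>msig K k w - msig K k w0\<bar> <= 2 * K^2" using bound[OF k, of w] bound[OF k, of w0] by linarith
  qed (use msnr_nonneg[OF t] in auto)
  thus ?thesis by linarith
 qed
 have hb2: "\<bar>(h w)^2\<bar> <= (\<bar>h w0\<bar> + C)^2" if w: "w \<in> space Om" for w
  using power_mono[OF hb[OF w], of 2] by simp
 have cu: "(\<Sum>k\<in>Ix. msnr n t a b k * \<bar>msig K k (u(i := r), v) - msig K k (u, v)\<bar>) <= (t * K * ratio + a) * \<bar>r - u i\<bar>"
  if i: "i < n" for u v i r
 proof -
  have "(\<Sum>i'<n. \<Sum>j<m. t / n * \<bar>clip K ((u(i := r)) i') * clip K (v j) - clip K (u i') * clip K (v j)\<bar>)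
   = (\<Sum>i'<n. if i' = i then (\<Sum>j<m. t / n * \<bar>clip K r * clip K (v j) - clip K (u i) * clip K (v j)\<bar>) else 0)"
   by (intro sum.cong) auto
  also have "... = (\<Sum>j<m. t / n * \<bar>clip K r * clip K (v j) - clip K (u i) * clip K (v j)\<bar>)" using i by simp
  also have "... <= (\<Sum>j<m. t / n * (\<bar>r - u i\<bar> * K))"
  proof (intro sum_mono mult_left_mono)
   fix j
   have "\<bar>clip K r * clip K (v j) - clip K (u i) * clip K (v j)\<bar> = \<bar>clip K r - clip K (u i)\<bar> * \<bar>clip K (v j)\<bar>"
    by (simp add: abs_mult[symmetric] left_diff_distrib)
   also have "... <= \<bar>r - u i\<bar> * K" by (intro mult_mono clip_lip clip_bound K2) auto
   finally show "\<bar>clip K r * clip K (v j) - clip K (u i) * clip K (v j)\<bar> <= \<bar>r - u i\<bar> * K" .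
  qed (use t n0 in auto)
  also have "... = t * K * ratio * \<bar>r - u i\<bar>" by (simp add: ratio_def)
  finally have 1: "(\<Sum>i'<n. \<Sum>j<m. t / n * \<bar>clip K ((u(i := r)) i') * clip K (v j) - clip K (u i') * clip K (v j)\<bar>) <= t * K * ratio * \<bar>r - u i\<bar>" .
  have "(\<Sum>i'<n. a * \<bar>clip K ((u(i := r)) i') - clip K (u i')\<bar>) = (\<Sum>i'<n. if i' = i then a * \<bar>clip K r - clip K (u i)\<bar> else 0)"
   by (intro sum.cong) auto
  also have "... = a * \<bar>clip K r - clip K (u i)\<bar>" using i by simp
  also have "... <= a * \<bar>r - u i\<bar>" using t clip_lip by (intro mult_left_mono) auto
  finally show ?thesis using 1 by (simp add: sum_midx algebra_simps)
 qed
 have cv: "(\<Sum>k\<in>Ix. msnr n t a b k * \<bar>msig K k (u, v(j := r)) - msig K k (u, v)\<bar>) <= (t * K + b) * \<bar>r - v j\<bar>"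
  if j: "j < m" for u v j r
 proof -
  have "(\<Sum>i<n. \<Sum>j'<m. t / n * \<bar>clip K (u i) * clip K ((v(j := r)) j') - clip K (u i) * clip K (v j')\<bar>)
   = (\<Sum>i<n. \<Sum>j'<m. if j' = j then t / n * \<bar>clip K (u i) * clip K r - clip K (u i) * clip K (v j)\<bar> else 0)"
   by (intro sum.cong) auto
  also have "... = (\<Sum>i<n. t / n * \<bar>clip K (u i) * clip K r - clip K (u i) * clip K (v j)\<bar>)" using j by simp
  also have "... <= (\<Sum>i<n. t / n * (K * \<bar>r - v j\<bar>))"
  proof (intro sum_mono mult_left_mono)
   fix i
   have "\<bar>clip K (u i) * clip K r - clip K (u i) * clip K (v j)\<bar> = \<bar>clip K (u i)\<bar> * \<bar>clip K r - clip K (v j)\<bar>"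
    by (simp add: abs_mult[symmetric] right_diff_distrib)
   also have "... <= K * \<bar>r - v j\<bar>" by (intro mult_mono clip_lip clip_bound K2) auto
   finally show "\<bar>clip K (u i) * clip K r - clip K (u i) * clip K (v j)\<bar> <= K * \<bar>r - v j\<bar>" .
  qed (use t n0 in auto)
  also have "... = t * K * \<bar>r - v j\<bar>" using n0 by simp
  finally have 1: "(\<Sum>i<n. \<Sum>j'<m. t / n * \<bar>clip K (u i) * clip K ((v(j := r)) j') - clip K (u i) * clip K (v j')\<bar>) <= t * K * \<bar>r - v j\<bar>" .
  have "(\<Sum>j'<m. b * \<bar>clip K ((v(j := r)) j') - clip K (v j')\<bar>) = (\<Sum>j'<m. if j' = j then b * \<bar>clip K r - clip K (v j)\<bar> else 0)"
   by (intro sum.cong) auto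
  also have "... = b * \<bar>clip K r - clip K (v j)\<bar>" using j by simp
  also have "... <= b * \<bar>r - v j\<bar>" using t clip_lip by (intro mult_left_mono) auto
  finally show ?thesis using 1 by (simp add: sum_midx algebra_simps)
 qed
 have sp: "(u, v) \<in> space Om \<longleftrightarrow> u \<in> PiE {..<n} (%_. UNIV) \<and> v \<in> PiE {..<m} (%_. UNIV)" for u v
  by (auto simp: space_pair_measure space_PiM)
 have lv: "V.F.lip {..<m} (%_. K^2 * (t * K + b)) (%v. h (u, v))" if u: "u \<in> space UU" for u
  unfolding V.F.lip_def
 proof (intro ballI allI)
  fix v j r assume v: "v \<in> PiE {..<m} (%_. UNIV::real set)" and j: "j \<in> {..<m}"
  have v': "v(j := r) \<in> PiE {..<m} (%_. UNIV)" using v j by (auto simp: PiE_iff extensional_def)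
  have "\<bar>h (u, v(j := r)) - h (u, v)\<bar> <= K^2 * (\<Sum>k\<in>Ix. msnr n t a b k * \<bar>msig K k (u, v(j := r)) - msig K k (u, v)\<bar>)"
   using u v v' by (intro hl) (auto simp: sp space_PiM)
  also have "... <= K^2 * ((t * K + b) * \<bar>r - v j\<bar>)" using cv j by (intro mult_left_mono) auto
  finally show "\<bar>h (u, v(j := r)) - h (u, v)\<bar> <= K^2 * (t * K + b) * \<bar>r - v j\<bar>" by (simp add: mult.assoc)
 qed
 have hu[measurable]: "(%v. h (u, v)) \<in> borel_measurable VV" if "u \<in> space UU" for u using that by measurable
 have hi: "integrable VV (%v. h (u, v))" if u: "u \<in> space UU" for u
  by (rule VV.integrable_const_bound[where B="\<bar>h w0\<bar> + C"]) (use hb u hu in \<open>auto simp: space_pair_measure\<close>)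
 define q where "q = (%u. LINT v|VV. h (u, v))"
 have qm[measurable]: "q \<in> borel_measurable UU" unfolding q_def by measurable
 have lu: "U.F.lip {..<n} (%_. K^2 * (t * K * ratio + a)) q"
  unfolding U.F.lip_def
 proof (intro ballI allI)
  fix u i r assume u: "u \<in> PiE {..<n} (%_. UNIV::real set)" and i: "i \<in> {..<n}"
  have u': "u(i := r) \<in> PiE {..<n} (%_. UNIV)" using u i by (auto simp: PiE_iff extensional_def)
  have su: "u \<in> space UU" "u(i := r) \<in> space UU" using u u' by (auto simp: space_PiM)
  have "\<bar>q (u(i := r)) - q u\<bar> = \<bar>LINT v|VV. h (u(i := r), v) - h (u, v)\<bar>"
   unfolding q_def using hi su by simp
  also have "... <= (LINT v|VV. \<bar>h (u(i := r), v) - h (u, v)\<bar>)" by (rule integral_abs_bound)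
  also have "... <= (LINT v|VV. K^2 * ((t * K * ratio + a) * \<bar>r - u i\<bar>))"
  proof (rule integral_mono)
   fix v assume v: "v \<in> space VV"
   have "\<bar>h (u(i := r), v) - h (u, v)\<bar> <= K^2 * (\<Sum>k\<in>Ix. msnr n t a b k * \<bar>msig K k (u(i := r), v) - msig K k (u, v)\<bar>)"
    using su v by (intro hl) (auto simp: space_pair_measure)
   also have "... <= K^2 * ((t * K * ratio + a) * \<bar>r - u i\<bar>)" using cu i by (intro mult_left_mono) auto
   finally show "\<bar>h (u(i := r), v) - h (u, v)\<bar> <= K^2 * ((t * K * ratio + a) * \<bar>r - u i\<bar>)" .
  qed (use hi su in auto)
  finally show "\<bar>q (u(i := r)) - q u\<bar> <= K^2 * (t * K * ratio + a) * \<bar>r - u i\<bar>" by (simp add: VV.prob_space mult.assoc)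
 qed
 have "(LINT w|Om. (h w - (LINT w|Om. h w))^2) <= (\<Sum>j<m. (K^2 * (t * K + b))^2 * V.var) + (\<Sum>i<n. (K^2 * (t * K * ratio + a))^2 * U.var)"
 proof (rule var_pair_le[OF UU.prob_space_axioms VV.prob_space_axioms hm])
  show "integrable Om (%p. (h p)^2)"
   by (rule UV.integrable_const_bound[where B="(\<bar>h w0\<bar> + C)^2"]) (use hb2 in auto)
  show "integrable VV (%v. (h (u, v))^2)" if u: "u \<in> space UU" for u
   by (rule V.F.lip_sq_integrable(1)[OF _ hu[OF u] lv[OF u]]) simp
  show "(LINT v|VV. (h (u, v) - (LINT v|VV. h (u, v)))^2) <= (\<Sum>j<m. (K^2 * (t * K + b))^2 * V.var)" if u: "u \<in> space UU" for u
   by (rule V.F.efron_stein_lip[OF _ hu[OF u] lv[OF u]]) simp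
  show "(LINT u|UU. ((LINT v|VV. h (u, v)) - (LINT u|UU. LINT v|VV. h (u, v)))^2) <= (\<Sum>i<n. (K^2 * (t * K * ratio + a))^2 * U.var)"
   using U.F.efron_stein_lip[OF _ qm lu] unfolding q_def by simp
 qed
 thus ?thesis by simp
qed

lemma fluct_le:
 assumes t: "0 <= t" "0 <= a" "0 <= b" and T: "t <= T" "a <= A" "b <= A"
 shows "fluct (msnr n t a b) <= sqrt (n * vN T A)"
proof -
 have "fluct (msnr n t a b) <= sqrt ((K^2)^2 * (\<Sum>k\<in>Ix. msnr n t a b k) + (m * ((K^2 * (t * K + b))^2 * V.var) + n * ((K^2 * (t * K * ratio + a))^2 * U.var)))"
  by (rule fluct_bound[OF msnr_nonneg[OF t]]) (rule lipschitz_variance[OF t])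
 also have "... <= sqrt (n * vN T A)"
 proof (rule real_sqrt_le_mono)
  have mr: "real m = n * ratio" using n0 by (simp add: ratio_def)
  have v0: "0 <= U.var" "0 <= V.var" by (auto simp: U.var_def V.var_def)
  have 1: "(K^2)^2 * (\<Sum>k\<in>Ix. msnr n t a b k) <= (K^2)^2 * (n * (ratio * T + A + ratio * A))"
  proof (rule mult_left_mono)
   have "ratio * t <= ratio * T" "ratio * b <= ratio * A" using T ratio0 by (auto intro: mult_left_mono)
   hence "real n * (ratio * t + a + ratio * b) <= n * (ratio * T + A + ratio * A)"
    using T n0 by (intro mult_left_mono) auto
   thus "(\<Sum>k\<in>Ix. msnr n t a b k) <= n * (ratio * T + A + ratio * A)"
    unfolding sum_msnr mr by (simp add: distrib_left mult.assoc)
  qed simp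
  have 2: "m * ((K^2 * (t * K + b))^2 * V.var) <= m * ((K^2 * (T * K + A))^2 * V.var)"
   using T t K2 v0 by (intro mult_left_mono mult_right_mono power_mono add_mono) (auto intro!: mult_nonneg_nonneg add_nonneg_nonneg)
  have 3: "n * ((K^2 * (t * K * ratio + a))^2 * U.var) <= n * ((K^2 * (T * K * ratio + A))^2 * U.var)"
   using T t K2 v0 ratio0 by (intro mult_left_mono mult_right_mono power_mono add_mono) (auto intro!: mult_nonneg_nonneg add_nonneg_nonneg)
  have "n * vN T A = (K^2)^2 * (n * (ratio * T + A + ratio * A)) + (m * ((K^2 * (T * K + A))^2 * V.var) + n * ((K^2 * (T * K * ratio + A))^2 * U.var))"
   unfolding vN_def mr by (simp add: algebra_simps)
  thus "(K^2)^2 * (\<Sum>k\<in>Ix. msnr n t a b k) + (m * ((K^2 * (t * K + b))^2 * V.var) + n * ((K^2 * (t * K * ratio + a))^2 * U.var)) <= n * vN T A"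
   using 1 2 3 by linarith
 qed
 finally show ?thesis .
qed

end

section \<open>Decoupling of the two overlaps, and the defect of the equation\<close>

lemma (in prob_space) replica_prod:
 fixes f g :: "'i => 'a => real"
 assumes [measurable]: "!!i. i \<in> J ==> f i \<in> borel_measurable M" "!!j. j \<in> L ==> g j \<in> borel_measurable M"
  and bf: "!!i w. i \<in> J ==> \<bar>f i w\<bar> <= C" and bg: "!!i w. i \<in> L ==> \<bar>g i w\<bar> <= C"
 shows "(LINT p|(M \<Otimes>\<^sub>M M). (\<Sum>i\<in>J. f i (fst p) * f i (snd p)) * (\<Sum>j\<in>L. g j (fst p) * g j (snd p)))
  = (\<Sum>i\<in>J. \<Sum>j\<in>L. (LINT w|M. f i w * g j w)^2)"
proof -
 interpret MM: pair_prob_space M M ..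
 have le: "\<bar>f i w * g j w\<bar> <= C * C" if "i \<in> J" "j \<in> L" for i j w
  using bf[OF that(1), of w] bg[OF that(2), of w] unfolding abs_mult by (intro mult_mono) auto
 have i2: "integrable M (%w. f i w * g j w)" if "i \<in> J" "j \<in> L" for i j
  by (rule integrable_const_bound[where B="C * C"]) (use that le in auto)
 have i4: "integrable (M \<Otimes>\<^sub>M M) (%p. (f i (fst p) * g j (fst p)) * (f i (snd p) * g j (snd p)))" if ij: "i \<in> J" "j \<in> L" for i j
 proof (rule MM.integrable_const_bound[where B="(C * C) * (C * C)"])
  show "AE p in M \<Otimes>\<^sub>M M. norm ((f i (fst p) * g j (fst p)) * (f i (snd p) * g j (snd p))) <= (C * C) * (C * C)"
   by (intro AE_I2) (simp only: real_norm_def abs_mult[of "f i _ * g j _" "f i _ * g j _"], intro mult_mono le ij abs_ge_zero, auto)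
 qed (use ij in measurable)
 have "(LINT p|(M \<Otimes>\<^sub>M M). (\<Sum>i\<in>J. f i (fst p) * f i (snd p)) * (\<Sum>j\<in>L. g j (fst p) * g j (snd p)))
  = (LINT p|(M \<Otimes>\<^sub>M M). (\<Sum>i\<in>J. \<Sum>j\<in>L. (f i (fst p) * g j (fst p)) * (f i (snd p) * g j (snd p))))"
  by (intro Bochner_Integration.integral_cong refl) (simp add: sum_product mult_ac)
 also have "... = (\<Sum>i\<in>J. \<Sum>j\<in>L. (LINT p|(M \<Otimes>\<^sub>M M). (f i (fst p) * g j (fst p)) * (f i (snd p) * g j (snd p))))"
  using i4 by (simp add: Bochner_Integration.integral_sum)
 also have "... = (\<Sum>i\<in>J. \<Sum>j\<in>L. (LINT w|M. f i w * g j w)^2)"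
 proof (intro sum.cong refl)
  fix i j assume ij: "i \<in> J" "j \<in> L"
  show "(LINT p|(M \<Otimes>\<^sub>M M). (f i (fst p) * g j (fst p)) * (f i (snd p) * g j (snd p))) = (LINT w|M. f i w * g j w)^2"
   using MM.integral_fst'[OF i4[OF ij]] by (simp add: power2_eq_square)
 qed
 finally show ?thesis .
qed

text \<open>This linearises a fourth root: once the outer square root is taken, the bound is affine
  in \<open>x\<close> and can be averaged over the observation. The free parameter
  \<open>eta\<close> is made small later.\<close>

lemma fourth_root_young:
 fixes x eta :: real
 assumes "0 <= x" "0 < eta"
 shows "sqrt x <= 2 * (eta + x / eta ^ 3)^2"
proof (cases "sqrt x <= eta^2")
 case True
 have "eta^2 <= (eta + x / eta ^ 3)^2" using assms by (intro power_mono) auto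
 thus ?thesis using True zero_le_power2[of "eta + x / eta ^ 3"] by linarith
next
 case False
 define s where "s = sqrt x"
 have s: "0 <= s" "x = s * s" "eta^2 <= s" using assms False by (auto simp: s_def)
 have "s * eta^2 <= x" unfolding s(2) using s by (intro mult_left_mono) auto
 hence "s * eta^2 / eta ^ 3 <= x / eta ^ 3" using assms by (intro divide_right_mono) auto
 hence "s / eta <= x / eta ^ 3" using assms by (simp add: power2_eq_square power3_eq_cube)
 hence "(eta + s / eta)^2 <= (eta + x / eta ^ 3)^2" using assms s by (intro power_mono) auto
 moreover have "2 * s <= (eta + s / eta)^2"
 proof -
  have "(eta + s / eta)^2 = eta^2 + (s / eta)^2 + 2 * s" using assms by (simp add: power2_sum)
  thus ?thesis by simp
 qed
 ultimately show ?thesis using s unfolding s_def[symmetric] by linarith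
qed

context clipped_model
begin

abbreviation "Jn \<equiv> (%i. Inr (Inl i) :: midx) ` {..<n}"

lemma sum_Jn: "(\<Sum>k\<in>Jn. q k) = (\<Sum>i<n. q (Inr (Inl i)))"
 by (subst sum.reindex) (auto simp: inj_on_def)

lemma card_Jn: "card Jn = n"
 by (subst card_image) (auto simp: inj_on_def)

lemma msnr_Jn: "(%k. msnr n t a b k + (if k \<in> Jn then h else 0)) k = msnr n t (a + h) b k" if "k \<in> Ix"
 using that by (cases rule: midx_cases) auto

lemma amp_cong: "(!!k. k \<in> Ix ==> g k = g' k) ==> Phi g = Phi g'"
proof -
 assume g: "!!k. k \<in> Ix ==> g k = g' k"
 have "lik Ix (amp (msig K) g) = lik Ix (amp (msig K) g')"
  by (intro ext) (simp add: lik_def amp_def g)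
 hence "partf Om Ix (amp (msig K) g) = partf Om Ix (amp (msig K) g')" by (simp add: partf_def[abs_def])
 thus ?thesis by (simp add: Phi_def ent_def obs_law_def)
qed

text \<open>For two posterior replicas, \<open>SS\<close> and \<open>TT\<close> are the means of the
  overlaps of \<open>U\<close> and of \<open>V\<close>, and \<open>RR\<close> is the mean of their
  product; averaged over \<open>y\<close> they give \<open>Da\<close>, \<open>Db\<close> and
  \<open>Dt\<close> up to factors.\<close>

definition "SS g y = (\<Sum>i<n. (gm g (msig K (Inr (Inl i))) y)^2)"
definition "TT g y = (\<Sum>j<m. (gm g (msig K (Inr (Inr j))) y)^2)"
definition "RR g y = (\<Sum>i<n. \<Sum>j<m. (gm g (msig K (Inl (i, j))) y)^2)"

definition "CC g y = covs g Jn y"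

lemma gm_clip_bound:
 assumes k: "k \<in> Ix" and C: "!!w. \<bar>msig K k w\<bar> <= C"
 shows "(gm g (msig K k) y)^2 <= C^2"
proof -
 interpret A: channel Om Ix "amp (msig K) g" by (rule channel_amp)
 interpret P: bsnr "post Om Ix (amp (msig K) g) y" Ix "msig K" "K^2" by (rule bsnr_post)
 have "\<bar>LINT w|post Om Ix (amp (msig K) g) y. msig K k w\<bar> <= (LINT w|post Om Ix (amp (msig K) g) y. \<bar>msig K k w\<bar>)" by (rule integral_abs_bound)
 also have "... <= (LINT w|post Om Ix (amp (msig K) g) y. C)"
  using P.e_integrable[OF k] C by (intro integral_mono) auto
 finally have "\<bar>gm g (msig K k) y\<bar> <= C" by (simp add: A.integral_post[OF meas[OF k]] P.prob_space[simplified])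
 from power_mono[OF this, of 2] show ?thesis by simp
qed

lemma TT_le: "0 <= TT g y" "TT g y <= m * K^2" (is ?C1)
proof -
 show "0 <= TT g y" unfolding TT_def by (intro sum_nonneg) auto
 have "TT g y <= (\<Sum>j<m. K^2)" unfolding TT_def
  by (intro sum_mono gm_clip_bound) (auto simp: clip_bound K2)
 thus ?C1 by simp
qed

lemma CC_nonneg: "0 <= CC g y" unfolding CC_def covs_def by (intro sum_nonneg) auto

lemma CC_eq: "CC g y = (\<Sum>i<n. \<Sum>i'<n. (gm g (%w. msig K (Inr (Inl i)) w * msig K (Inr (Inl i')) w) y - gm g (msig K (Inr (Inl i))) y * gm g (msig K (Inr (Inl i'))) y)^2)"
 unfolding CC_def covs_def sum_Jn ..

text \<open>The left side is the posterior covariance of the two replica overlaps \<open>X\<close>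
  and \<open>V\<close>, at most the bound on \<open>V\<close> times the standard deviation of
  \<open>X\<close>. The variance of \<open>X\<close> is a sum over pairs of differences of squares,
  each at most \<open>2 * K^2\<close> times a posterior covariance, and Cauchy-Schwarz over the
  pairs brings in \<open>CC\<close>.\<close>

lemma overlap_decoupling:
 "\<bar>RR g y - SS g y * TT g y\<bar> <= m * K^2 * sqrt (2 * K^2 * n * sqrt (CC g y))"
proof -
 interpret A: channel Om Ix "amp (msig K) g" by (rule channel_amp)
 define nu where "nu = post Om Ix (amp (msig K) g) y"
 have sets_nu[measurable_cong, simp]: "sets nu = sets Om" by (simp add: nu_def)
 interpret P: bsnr nu Ix "msig K" "K^2" unfolding nu_def by (rule bsnr_post)
 interpret PP: pair_prob_space nu nu ..
 define u where "u = (%i. msig K (Inr (Inl i)))"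
 define v where "v = (%j. msig K (Inr (Inr j)))"
 have uD: "msig K (Inr (Inl i)) = u i" and vD: "msig K (Inr (Inr j)) = v j" for i j by (simp_all add: u_def v_def)
 have um: "u i \<in> borel_measurable nu" if "i \<in> {..<n}" for i using P.meas[of "Inr (Inl i)"] that by (simp add: u_def)
 have vm: "v j \<in> borel_measurable nu" if "j \<in> {..<m}" for j using P.meas[of "Inr (Inr j)"] that by (simp add: v_def)
 have ub: "\<bar>u i w\<bar> <= K" and vb: "\<bar>v i w\<bar> <= K" for i w by (auto simp: u_def v_def clip_bound K2)
 have uM: "u i \<in> borel_measurable Om" if "i \<in> {..<n}" for i using um[OF that] by simp
 have vM: "v i \<in> borel_measurable Om" if "i \<in> {..<m}" for i using vm[OF that] by simp
 have gm_eq: "(LINT w|nu. f w) = gm g f y" if "f \<in> borel_measurable Om" for f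
  unfolding nu_def by (rule A.integral_post[OF that])
 define X where "X = (%p. \<Sum>i<n. u i (fst p) * u i (snd p))"
 define V where "V = (%p. \<Sum>j<m. v j (fst p) * v j (snd p))"
 note um[measurable] vm[measurable]
 have Xm[measurable]: "X \<in> borel_measurable (nu \<Otimes>\<^sub>M nu)" unfolding X_def by (intro borel_measurable_sum) measurable
 have Vm[measurable]: "V \<in> borel_measurable (nu \<Otimes>\<^sub>M nu)" unfolding V_def by (intro borel_measurable_sum) measurable
 have Xb: "\<bar>X p\<bar> <= n * K^2" for p
 proof -
  have "\<bar>X p\<bar> <= (\<Sum>i<n. \<bar>u i (fst p) * u i (snd p)\<bar>)" unfolding X_def by (rule sum_abs)
  also have "... <= (\<Sum>i<n. K * K)" unfolding abs_mult by (intro sum_mono mult_mono ub K2) auto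
  finally show ?thesis by (simp add: power2_eq_square)
 qed
 have Vb: "\<bar>V p\<bar> <= m * K^2" for p
 proof -
  have "\<bar>V p\<bar> <= (\<Sum>j<m. \<bar>v j (fst p) * v j (snd p)\<bar>)" unfolding V_def by (rule sum_abs)
  also have "... <= (\<Sum>j<m. K * K)" unfolding abs_mult by (intro sum_mono mult_mono vb K2) auto
  finally show ?thesis by (simp add: power2_eq_square)
 qed
 have Xi: "integrable (nu \<Otimes>\<^sub>M nu) X" by (rule PP.integrable_const_bound[where B="n * K^2"]) (auto simp: Xb)
 have Vi: "integrable (nu \<Otimes>\<^sub>M nu) V" by (rule PP.integrable_const_bound[where B="m * K^2"]) (auto simp: Vb)
 have X2i: "integrable (nu \<Otimes>\<^sub>M nu) (%p. (X p)^2)"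
  by (rule PP.integrable_const_bound[where B="(n * K^2)^2"]) (use power_mono[OF Xb, where n=2] in auto)
 have XVi: "integrable (nu \<Otimes>\<^sub>M nu) (%p. X p * V p)"
  by (rule PP.integrable_const_bound[where B="(n * K^2) * (m * K^2)"]) (auto simp: abs_mult Xb Vb intro!: mult_mono)
 have EX: "(LINT p|(nu \<Otimes>\<^sub>M nu). X p) = SS g y"
  using P.replica_prod[of "{..<n}" u "{0::nat}" "%_ _. 1" K] um ub K by (simp add: X_def SS_def gm_eq uM uD)
 have EV: "(LINT p|(nu \<Otimes>\<^sub>M nu). V p) = TT g y"
  using P.replica_prod[of "{..<m}" v "{0::nat}" "%_ _. 1" K] vm vb K by (simp add: V_def TT_def gm_eq vM vD)
 have EX2: "(LINT p|(nu \<Otimes>\<^sub>M nu). (X p)^2) = (\<Sum>i<n. \<Sum>i'<n. (gm g (%w. u i w * u i' w) y)^2)"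
 proof -
  have "(LINT p|(nu \<Otimes>\<^sub>M nu). (X p)^2) = (\<Sum>i<n. \<Sum>i'<n. (LINT w|nu. u i w * u i' w)^2)"
   using P.replica_prod[of "{..<n}" u "{..<n}" u K] um ub by (simp add: X_def power2_eq_square)
  also have "... = (\<Sum>i<n. \<Sum>i'<n. (gm g (%w. u i w * u i' w) y)^2)"
   using uM by (intro sum.cong refl arg_cong[where f="%x. x^2"] gm_eq borel_measurable_times) auto
  finally show ?thesis .
 qed
 have EXV: "(LINT p|(nu \<Otimes>\<^sub>M nu). X p * V p) = RR g y"
 proof -
  have "(LINT p|(nu \<Otimes>\<^sub>M nu). X p * V p) = (\<Sum>i<n. \<Sum>j<m. (LINT w|nu. u i w * v j w)^2)"
   using P.replica_prod[of "{..<n}" u "{..<m}" v K] um ub vm vb by (simp add: X_def V_def)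
  also have "... = (\<Sum>i<n. \<Sum>j<m. (gm g (%w. u i w * v j w) y)^2)"
   using uM vM by (intro sum.cong refl arg_cong[where f="%x. x^2"] gm_eq borel_measurable_times) auto
  also have "... = RR g y" unfolding RR_def u_def v_def by (simp add: msig_def[abs_def])
  finally show ?thesis .
 qed
 have varX: "(LINT p|(nu \<Otimes>\<^sub>M nu). (X p)^2) - (SS g y)^2 <= 2 * K^2 * n * sqrt (CC g y)"
 proof -
  let ?mu = "%i. gm g (u i) y"
  let ?c = "%i i'. gm g (%w. u i w * u i' w) y - ?mu i * ?mu i'"
  have mub: "\<bar>?mu i\<bar> <= K" if "i < n" for i
   using gm_clip_bound[of "Inr (Inl i)" K g y] that clip_bound[OF K2(3)] K2(3)
   by (simp add: u_def abs_le_square_iff[symmetric])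
  have cb: "\<bar>gm g (%w. u i w * u i' w) y\<bar> <= K^2" if "i < n" "i' < n" for i i'
  proof -
   have "\<bar>LINT w|nu. u i w * u i' w\<bar> <= (LINT w|nu. \<bar>u i w * u i' w\<bar>)" by (rule integral_abs_bound)
   also have "... <= (LINT w|nu. K * K)"
   proof (rule integral_mono)
    show "integrable nu (%w. \<bar>u i w * u i' w\<bar>)"
     by (rule P.integrable_const_bound[where B="K * K"]) (use that in \<open>auto simp: abs_mult intro!: mult_mono ub K2\<close>)
    show "\<bar>u i w * u i' w\<bar> <= K * K" for w unfolding abs_mult by (intro mult_mono ub K2) auto
   qed simp
   finally show ?thesis using that uM by (simp add: P.prob_space gm_eq power2_eq_square)
  qed
  have "(SS g y)^2 = (\<Sum>i<n. \<Sum>i'<n. (?mu i * ?mu i')^2)"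
   unfolding SS_def uD power2_eq_square[of "\<Sum>i<n. _ i"] sum_product by (simp add: power_mult_distrib)
  hence "(LINT p|(nu \<Otimes>\<^sub>M nu). (X p)^2) - (SS g y)^2 = (\<Sum>i<n. \<Sum>i'<n. ?c i i' * (gm g (%w. u i w * u i' w) y + ?mu i * ?mu i'))"
   unfolding EX2 by (simp add: sum_subtractf[symmetric] power2_eq_square algebra_simps)
  also have "... <= (\<Sum>i<n. \<Sum>i'<n. \<bar>?c i i'\<bar> * (2 * K^2))"
  proof (intro sum_mono)
   fix i i' assume i: "i \<in> {..<n}" "i' \<in> {..<n}"
   have "\<bar>?mu i * ?mu i'\<bar> <= K^2" using mub i K2 unfolding abs_mult power2_eq_square by (intro mult_mono) auto
   hence "\<bar>gm g (%w. u i w * u i' w) y + ?mu i * ?mu i'\<bar> <= 2 * K^2" using cb[of i i'] i by auto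
   hence "\<bar>?c i i' * (gm g (%w. u i w * u i' w) y + ?mu i * ?mu i')\<bar> <= \<bar>?c i i'\<bar> * (2 * K^2)"
    unfolding abs_mult by (intro mult_left_mono) auto
   thus "?c i i' * (gm g (%w. u i w * u i' w) y + ?mu i * ?mu i') <= \<bar>?c i i'\<bar> * (2 * K^2)" by linarith
  qed
  also have "... = 2 * K^2 * (\<Sum>i<n. \<Sum>i'<n. \<bar>?c i i'\<bar>)" by (simp add: sum_distrib_left mult_ac)
  also have "(\<Sum>i<n. \<Sum>i'<n. \<bar>?c i i'\<bar>) <= n * sqrt (CC g y)"
  proof -
   have "(\<Sum>p\<in>{..<n} \<times> {..<n}. \<bar>?c (fst p) (snd p)\<bar>)^2 <= (\<Sum>p\<in>{..<n} \<times> {..<n}. \<bar>?c (fst p) (snd p)\<bar>^2) * card ({..<n} \<times> {..<n})"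
    by (rule sum_squared_le_sum_of_squares)
   hence "(\<Sum>i<n. \<Sum>i'<n. \<bar>?c i i'\<bar>)^2 <= (n * sqrt (CC g y))^2"
    using CC_nonneg[of g y] by (simp add: sum.cartesian_product' CC_eq u_def power_mult_distrib power2_eq_square[of "real n"] mult_ac)
   thus ?thesis by (rule power2_le_imp_le) (simp add: CC_nonneg)
  qed
  finally show ?thesis using K2 by (simp add: mult_left_mono mult.assoc)
 qed
 have "\<bar>RR g y - SS g y * TT g y\<bar> = \<bar>LINT p|(nu \<Otimes>\<^sub>M nu). (X p - SS g y) * V p\<bar>"
  using XVi Vi by (simp add: left_diff_distrib EXV EV)
 also have "... <= (LINT p|(nu \<Otimes>\<^sub>M nu). \<bar>(X p - SS g y) * V p\<bar>)" by (rule integral_abs_bound)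
 also have "... <= (LINT p|(nu \<Otimes>\<^sub>M nu). \<bar>X p - SS g y\<bar> * (m * K^2))"
 proof (rule integral_mono)
  have "integrable (nu \<Otimes>\<^sub>M nu) (%p. (X p - SS g y) * V p)" using XVi Vi by (simp add: left_diff_distrib)
  thus "integrable (nu \<Otimes>\<^sub>M nu) (%p. \<bar>(X p - SS g y) * V p\<bar>)" by (rule integrable_abs)
  show "\<bar>(X p - SS g y) * V p\<bar> <= \<bar>X p - SS g y\<bar> * (m * K^2)" for p
   unfolding abs_mult by (intro mult_left_mono Vb) simp
 qed (use Xi in simp)
 also have "... = m * K^2 * (LINT p|(nu \<Otimes>\<^sub>M nu). \<bar>X p - SS g y\<bar>)" by simp
 also have "... <= m * K^2 * sqrt (2 * K^2 * n * sqrt (CC g y))"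
 proof (intro mult_left_mono real_le_rsqrt)
  have i1: "integrable (nu \<Otimes>\<^sub>M nu) (%p. \<bar>X p - SS g y\<bar>)" using Xi by simp
  have e: "(X p - SS g y)^2 = (X p)^2 - 2 * SS g y * X p + (SS g y)^2" for p by (simp add: power2_eq_square algebra_simps)
  have i2: "integrable (nu \<Otimes>\<^sub>M nu) (%p. \<bar>X p - SS g y\<bar>^2)" unfolding power2_abs e using Xi X2i by simp
  have "(LINT p|(nu \<Otimes>\<^sub>M nu). \<bar>X p - SS g y\<bar>)^2 <= (LINT p|(nu \<Otimes>\<^sub>M nu). (X p - SS g y)^2)"
   using prob_space.sq_dev_le[OF PP.prob_space_axioms i1 i2, of 0]
    integral_nonneg_AE[of "%p. (\<bar>X p - SS g y\<bar> - (LINT p|(nu \<Otimes>\<^sub>M nu). \<bar>X p - SS g y\<bar>))^2" "nu \<Otimes>\<^sub>M nu"] by simp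
  also have "... = (LINT p|(nu \<Otimes>\<^sub>M nu). (X p)^2) - (SS g y)^2"
   unfolding e using Xi X2i by (simp add: EX PP.prob_space power2_eq_square)
  finally show "(LINT p|(nu \<Otimes>\<^sub>M nu). \<bar>X p - SS g y\<bar>)^2 <= 2 * K^2 * n * sqrt (CC g y)" using varX by linarith
 qed (use K2 in simp)
 finally show ?thesis .
qed

lemma decoupling_young:
 fixes eta :: real
 assumes eta: "0 < eta"
 shows "sqrt (2 * K^2 * n * sqrt (CC g y)) <= 2 * K * n * (eta + CC g y / ((real n)^2 * eta ^ 3))"
proof (rule real_le_lsqrt)
 define x where "x = CC g y / (real n)^2"
 have x0: "0 <= x" using CC_nonneg by (simp add: x_def)
 have "sqrt (CC g y) = n * sqrt x" using n0 by (simp add: x_def real_sqrt_divide)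
 hence "2 * K^2 * n * sqrt (CC g y) = 2 * K^2 * (real n)^2 * sqrt x" by (simp add: power2_eq_square)
 also have "... <= 2 * K^2 * (real n)^2 * (2 * (eta + x / eta ^ 3)^2)"
  using fourth_root_young[OF x0 eta] by (intro mult_left_mono) auto
 also have "... = (2 * K * n * (eta + CC g y / ((real n)^2 * eta ^ 3)))^2" by (simp add: x_def power_mult_distrib)
 finally show "2 * K^2 * n * sqrt (CC g y) <= (2 * K * n * (eta + CC g y / ((real n)^2 * eta ^ 3)))^2" .
qed (use eta K2 CC_nonneg in \<open>auto intro!: mult_nonneg_nonneg add_nonneg_nonneg divide_nonneg_nonneg\<close>)

text \<open>The Bregman remainder of \<open>F\<close> in \<open>a\<close>; nonnegative for
  nonnegative arguments by \<open>F_lower\<close>.\<close>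

definition "Del h t a b = F t (a + h) b - F t a b - h * Da t a b"

text \<open>The means of \<open>RR\<close>, \<open>SS\<close> and \<open>TT\<close> are
  \<open>Dt\<close>, \<open>Da\<close> and \<open>Db\<close> up to factors. Decoupling costs
  posterior covariances, which \<open>Phi_second_order\<close> bounds by \<open>Del\<close> at the
  step \<open>h'\<close>; there \<open>n * h'\<close> must be bounded. Replacing \<open>SS\<close>
  by its mean costs its fluctuation over the observation, which \<open>Phi_concentration\<close>
  bounds by \<open>Del\<close> at the step \<open>h\<close>. It is enough that one of the two
  overlaps concentrates, so remainders in \<open>a\<close> suffice.\<close>

theorem derivative_defect:
 fixes t a b T A h h' eta :: real
 assumes t: "0 <= t" "0 <= a" "0 <= b" "t <= T" "a + 1 <= A" "b <= A" and h: "0 < h" "h <= 1"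
  and h': "0 < h'" "4 * (K^2)^2 * (n * h') <= 1 / 3" and eta: "0 < eta"
 shows "\<bar>Dt t a b - 2 * Da t a b * Db t a b\<bar>
  <= ratio * K^2 * (K * (eta + (4 * Del h' t a b / (n * h'^2) + 24 * (4 * (K^2)^2) ^ 3 * n * h') / eta ^ 3)
    + 2 / h * (Del h t a b + sqrt (vN T A / n)))"
proof -
 define g where "g = msnr n t a b"
 have g0: "\<forall>k\<in>Ix. 0 <= g k" unfolding g_def by (rule msnr_nonneg[OF t(1-3)])
 interpret A: channel Om Ix "amp (msig K) g" by (rule channel_amp)
 interpret OL: prob_space "ol g" by (rule A.prob_obs_law)
 have JI: "Jn \<subseteq> Ix" by auto
 have PhiF: "Phi (msnr n t a b) = n * F t a b" for t a b using n0 by (simp add: F_def)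
 have DaS: "(\<Sum>i<n. AA g (Inr (Inl i))) = 2 * n * Da t a b" using n0 by (simp add: Da_def g_def)
 have shift: "Phi (%k. g k + (if k \<in> Jn then s else 0)) = n * F t (a + s) b" for s
  using amp_cong[of "%k. g k + (if k \<in> Jn then s else 0)" "msnr n t (a + s) b"] msnr_Jn[of _ t a b s] by (simp add: g_def PhiF)
 define ES where "ES = (LINT y|ol g. SS g y)"
 have Si: "integrable (ol g) (SS g)" and ES: "ES = 2 * n * Da t a b"
 proof -
  show "integrable (ol g) (SS g)" unfolding SS_def using gm_sq_integrable by (intro Bochner_Integration.integrable_sum) auto
  show "ES = 2 * n * Da t a b" unfolding ES_def SS_def DaS[symmetric] AA_def
   using gm_sq_integrable by (subst Bochner_Integration.integral_sum) auto
 qed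
 have Ti: "integrable (ol g) (TT g)" and ET: "(LINT y|ol g. TT g y) = 2 * n * Db t a b"
 proof -
  show "integrable (ol g) (TT g)" unfolding TT_def using gm_sq_integrable by (intro Bochner_Integration.integrable_sum) auto
  have "(\<Sum>j<m. AA g (Inr (Inr j))) = 2 * n * Db t a b" using n0 by (simp add: Db_def g_def)
  thus "(LINT y|ol g. TT g y) = 2 * n * Db t a b" unfolding TT_def AA_def
   using gm_sq_integrable by (subst Bochner_Integration.integral_sum) auto
 qed
 have Ri: "integrable (ol g) (RR g)" and ER: "(LINT y|ol g. RR g y) = 2 * (real n)^2 * Dt t a b"
 proof -
  show "integrable (ol g) (RR g)" unfolding RR_def using gm_sq_integrable by (intro Bochner_Integration.integrable_sum) auto
  have "(\<Sum>i<n. \<Sum>j<m. AA g (Inl (i, j))) = 2 * (real n)^2 * Dt t a b" using n0 by (simp add: Dt_def g_def)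
  thus "(LINT y|ol g. RR g y) = 2 * (real n)^2 * Dt t a b" unfolding RR_def AA_def
   using gm_sq_integrable by (subst Bochner_Integration.integral_sum) (auto intro!: Bochner_Integration.integrable_sum simp: Bochner_Integration.integral_sum)
 qed
 have CI: "integrable (ol g) (CC g)"
  and CE: "h'^2 / 4 * (LINT y|ol g. CC g y) <= n * Del h' t a b + 6 * (4 * (K^2)^2 * (n * h')) ^ 3"
 proof -
  have X: "4 * (K^2)^2 * (card Jn * h') <= 1 / 3" using h'(2) by (simp add: card_Jn)
  note P = Phi_second_order[OF g0 JI less_imp_le[OF h'(1)] X]
  show "integrable (ol g) (CC g)" using P(1) unfolding CC_def[abs_def] .
  show "h'^2 / 4 * (LINT y|ol g. CC g y) <= n * Del h' t a b + 6 * (4 * (K^2)^2 * (n * h')) ^ 3"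
   using P(2) unfolding CC_def shift sum_Jn DaS card_Jn Del_def by (simp add: g_def PhiF algebra_simps)
 qed
 define ka where "ka = (LINT y|ol g. CC g y) / (real n)^2"
 have ka: "ka <= 4 * Del h' t a b / (n * h'^2) + 24 * (4 * (K^2)^2) ^ 3 * n * h'"
 proof -
  have "ka = (h'^2 / 4 * (LINT y|ol g. CC g y)) * (4 / (h'^2 * (real n)^2))" using h' n0 by (simp add: ka_def)
  also have "... <= (n * Del h' t a b + 6 * (4 * (K^2)^2 * (n * h')) ^ 3) * (4 / (h'^2 * (real n)^2))"
   by (intro mult_right_mono CE) simp
  also have "... = 4 * Del h' t a b / (n * h'^2) + 24 * (4 * (K^2)^2) ^ 3 * n * h'"
   using h' n0 by (simp add: field_simps power2_eq_square power3_eq_cube)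
  finally show ?thesis .
 qed
 have conc: "(LINT y|ol g. \<bar>SS g y - ES\<bar>) <= 2 / h * (2 * (n * Del h t a b) + 2 * sqrt (n * vN T A))"
 proof -
  define d where "d = (%k::midx. if k \<in> Jn then h else 0)"
  have d0: "\<forall>k\<in>Ix. 0 <= d k" using h by (simp add: d_def)
  have sd: "(\<Sum>k\<in>Ix. d k * x k) = h * (\<Sum>i<n. x (Inr (Inl i)))" for x
  proof -
   have "(\<Sum>k\<in>Ix. d k * x k) = (\<Sum>k\<in>Jn. h * x k)"
    using JI by (intro sum.mono_neutral_cong_right) (auto simp: d_def)
   thus ?thesis by (simp add: sum_Jn sum_distrib_left)
  qed
  have fl: "fluct g <= sqrt (n * vN T A)" unfolding g_def using t by (intro fluct_le) auto
  have "fluct (%k. g k + d k) = fluct (msnr n t (a + h) b)"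
  proof -
   have "amp (msig K) (%k. g k + d k) k = amp (msig K) (msnr n t (a + h) b) k" if "k \<in> Ix" for k
    using msnr_Jn[OF that, of t a b h] by (simp add: amp_def[abs_def] g_def d_def)
   hence "lik Ix (amp (msig K) (%k. g k + d k)) = lik Ix (amp (msig K) (msnr n t (a + h) b))"
    by (intro ext) (simp add: lik_def)
   hence "partf Om Ix (amp (msig K) (%k. g k + d k)) = partf Om Ix (amp (msig K) (msnr n t (a + h) b))"
    by (simp add: partf_def[abs_def])
   thus ?thesis by (simp add: fluct_def Phi_def ent_def obs_law_def)
  qed
  also have "... <= sqrt (n * vN T A)" using t h by (intro fluct_le) auto
  finally have fl2: "fluct (%k. g k + d k) <= sqrt (n * vN T A)" .
  have "(LINT y|ol g. \<bar>h * SS g y / 2 - h * (2 * n * Da t a b) / 2\<bar>) <= 2 * (n * Del h t a b) + 2 * sqrt (n * vN T A)"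
   using Phi_concentration[OF g0 d0] fl fl2 unfolding sd DaS SS_def[symmetric]
   unfolding d_def shift by (simp add: Del_def g_def PhiF algebra_simps)
  also have "(%y. \<bar>h * SS g y / 2 - h * (2 * n * Da t a b) / 2\<bar>) = (%y. h / 2 * \<bar>SS g y - ES\<bar>)"
  proof
   fix y
   have "h * SS g y / 2 - h * (2 * n * Da t a b) / 2 = h / 2 * (SS g y - ES)" by (simp add: ES algebra_simps)
   thus "\<bar>h * SS g y / 2 - h * (2 * n * Da t a b) / 2\<bar> = h / 2 * \<bar>SS g y - ES\<bar>" using h by (simp only: abs_mult)
  qed
  finally have "h / 2 * (LINT y|ol g. \<bar>SS g y - ES\<bar>) <= 2 * (n * Del h t a b) + 2 * sqrt (n * vN T A)" by simp
  thus ?thesis using h by (simp add: field_simps)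
 qed
 have "\<bar>(LINT y|ol g. RR g y) - ES * (LINT y|ol g. TT g y)\<bar> = \<bar>LINT y|ol g. RR g y - ES * TT g y\<bar>"
  using Ri Ti by simp
 also have "... <= (LINT y|ol g. \<bar>RR g y - ES * TT g y\<bar>)" by (rule integral_abs_bound)
 also have "... <= (LINT y|ol g. m * K^2 * (2 * K * n * (eta + CC g y / ((real n)^2 * eta ^ 3)) + \<bar>SS g y - ES\<bar>))"
 proof (rule integral_mono)
  fix y
  have "\<bar>RR g y - ES * TT g y\<bar> <= \<bar>RR g y - SS g y * TT g y\<bar> + \<bar>(SS g y - ES) * TT g y\<bar>"
   by (simp add: left_diff_distrib)
  also have "\<bar>RR g y - SS g y * TT g y\<bar> <= m * K^2 * (2 * K * n * (eta + CC g y / ((real n)^2 * eta ^ 3)))"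
   by (rule order_trans[OF overlap_decoupling mult_left_mono[OF decoupling_young[OF eta]]]) simp
  also have "\<bar>(SS g y - ES) * TT g y\<bar> <= m * K^2 * \<bar>SS g y - ES\<bar>"
   using TT_le[of g y] mult_right_mono[of "\<bar>TT g y\<bar>" "m * K^2" "\<bar>SS g y - ES\<bar>"] by (simp add: abs_mult mult_ac)
  finally show "\<bar>RR g y - ES * TT g y\<bar> <= m * K^2 * (2 * K * n * (eta + CC g y / ((real n)^2 * eta ^ 3)) + \<bar>SS g y - ES\<bar>)"
   by (simp add: distrib_left)
 qed (use Ri Ti Si CI in \<open>auto intro!: integrable_abs\<close>)
 also have "... = m * K^2 * (2 * K * n * (eta + ka / eta ^ 3) + (LINT y|ol g. \<bar>SS g y - ES\<bar>))"
 proof -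
  have i1: "integrable (ol g) (%y. 2 * K * n * (eta + CC g y / ((real n)^2 * eta ^ 3)))" using CI by simp
  have i2: "integrable (ol g) (%y. \<bar>SS g y - ES\<bar>)" using Si by simp
  have "(LINT y|ol g. 2 * K * n * (eta + CC g y / ((real n)^2 * eta ^ 3))) = 2 * K * n * (eta + ka / eta ^ 3)"
   using CI OL.prob_space by (simp add: ka_def)
  thus ?thesis using i1 i2 by simp
 qed
 also have "... <= m * K^2 * (2 * K * n * (eta + (4 * Del h' t a b / (n * h'^2) + 24 * (4 * (K^2)^2) ^ 3 * n * h') / eta ^ 3)
   + 2 / h * (2 * (n * Del h t a b) + 2 * sqrt (n * vN T A)))"
  using eta K2 by (intro mult_left_mono add_mono conc divide_right_mono ka order_refl) auto
 finally have main: "\<bar>2 * (real n)^2 * Dt t a b - 2 * n * Da t a b * (2 * n * Db t a b)\<bar> <= ..."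
  unfolding ER ET ES by simp
 have e1: "\<bar>2 * (real n)^2 * Dt t a b - 2 * n * Da t a b * (2 * n * Db t a b)\<bar> = 2 * (real n)^2 * \<bar>Dt t a b - 2 * Da t a b * Db t a b\<bar>"
 proof -
  have "2 * (real n)^2 * Dt t a b - 2 * n * Da t a b * (2 * n * Db t a b) = 2 * (real n)^2 * (Dt t a b - 2 * Da t a b * Db t a b)"
   by (simp add: power2_eq_square algebra_simps)
  thus ?thesis by (simp add: abs_mult)
 qed
 have sq: "sqrt (n * vN T A) = n * sqrt (vN T A / n)"
 proof -
  have "n * vN T A = (real n)^2 * (vN T A / n)" using n0 by (simp add: power2_eq_square)
  hence "sqrt (n * vN T A) = sqrt ((real n)^2) * sqrt (vN T A / n)" by (simp only: real_sqrt_mult)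
  thus ?thesis by simp
 qed
 let ?Y = "K * (eta + (4 * Del h' t a b / (n * h'^2) + 24 * (4 * (K^2)^2) ^ 3 * n * h') / eta ^ 3)"
 have e2: "m * K^2 * (2 * K * n * (eta + (4 * Del h' t a b / (n * h'^2) + 24 * (4 * (K^2)^2) ^ 3 * n * h') / eta ^ 3)
   + 2 / h * (2 * (n * Del h t a b) + 2 * sqrt (n * vN T A)))
  = 2 * (real n)^2 * (ratio * K^2 * (?Y + 2 / h * (Del h t a b + sqrt (vN T A / n))))"
 proof -
  have mr: "real m = n * ratio" using n0 by (simp add: ratio_def)
  have alg: "N * r * k2 * (2 * k * N * y + hh * (2 * (N * d) + 2 * (N * s))) = 2 * (N * N) * (r * k2 * (k * y + hh * (d + s)))"
   for N r k2 k y hh d s :: real by (simp add: algebra_simps)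
  show ?thesis unfolding sq mr power2_eq_square[of "real n"] by (rule alg)
 qed
 show ?thesis using main n0 unfolding e1 e2 by simp
qed

end

section \<open>Calculus for functions with one-sided quadratic bounds\<close>

lemma telescoping_le:
 fixes ph :: "real => real"
 assumes rho: "0 < rho" and step: "!!s u. 0 <= s ==> 0 < u ==> u <= rho ==> s + u <= 1 ==> ph (s + u) - ph s <= L * u + C * u^2"
 shows "ph 1 - ph 0 <= L"
proof (rule field_le_epsilon)
 fix eps :: real assume eps: "0 < eps"
 obtain N :: nat where N: "max (1 / rho) (\<bar>C\<bar> / eps) < real N" using reals_Archimedean2 by blast
 have "0 < 1 / rho" using rho by simp
 hence N0: "0 < real N" using N by linarith
 have u1: "1 / real N <= rho" using N rho N0 by (simp add: field_simps)
 have "\<bar>C\<bar> / eps <= real N" using N by linarith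
 hence "\<bar>C\<bar> <= real N * eps" using eps by (simp add: pos_divide_le_eq)
 hence "C <= eps * real N" using abs_ge_self[of C] by (simp add: mult.commute)
 hence u2: "C * (1 / real N) <= eps" using N0 by (simp add: pos_divide_le_eq)
 \<comment> \<open>Over \<open>N\<close> equal steps the quadratic errors add up to
   \<open>C / N\<close>.\<close>
 have "ph 1 - ph 0 = (\<Sum>k<N. ph (real (Suc k) / real N) - ph (real k / real N))"
  using N0 by (subst sum_lessThan_telescope) simp
 also have "... <= (\<Sum>k<N. L * (1 / real N) + C * (1 / real N)^2)"
 proof (rule sum_mono)
  fix k assume k: "k \<in> {..<N}"
  have "real k + 1 <= real N" using k by auto
  hence "real k / real N + 1 / real N <= 1" using N0 by (simp add: field_simps)
  thus "ph (real (Suc k) / real N) - ph (real k / real N) <= L * (1 / real N) + C * (1 / real N)^2"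
   using step[of "real k / real N" "1 / real N"] u1 N0 by (simp add: add_divide_distrib add.commute)
 qed
 also have "... = L + C * (1 / real N)" using N0 by (simp add: power2_eq_square field_simps)
 finally show "ph 1 - ph 0 <= L + eps" using u2 by linarith
qed

lemma quad_deriv:
 fixes f :: "real => real"
 assumes rho: "0 < rho" and q: "!!y. y \<in> S ==> \<bar>y - x\<bar> <= rho ==> \<bar>f y - f x - D * (y - x)\<bar> <= Q * (y - x)^2"
 shows "(f has_field_derivative D) (at x within S)"
 unfolding has_field_derivative_iff
proof (rule tendstoI)
 fix eps :: real assume eps: "0 < eps"
 define d where "d = min rho (eps / (\<bar>Q\<bar> + 1))"
 have d: "0 < d" using rho eps by (simp add: d_def)
 have "dist ((f y - f x) / (y - x)) D < eps" if y: "y \<in> S" "y \<noteq> x" "dist y x < d" for y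
 proof -
  have ne: "y - x \<noteq> 0" using y by simp
  have yd: "\<bar>y - x\<bar> < d" using y by (simp add: dist_real_def)
  have "(f y - f x) / (y - x) - D = (f y - f x - D * (y - x)) / (y - x)" using ne by (simp add: field_simps)
  hence "\<bar>(f y - f x) / (y - x) - D\<bar> = \<bar>f y - f x - D * (y - x)\<bar> / \<bar>y - x\<bar>" by (simp only: abs_divide)
  also have "... <= (Q * (y - x)^2) / \<bar>y - x\<bar>" using q[OF y(1)] yd by (intro divide_right_mono) (auto simp: d_def)
  also have "... = Q * \<bar>y - x\<bar>"
  proof -
   have "Q * z^2 / z = Q * z" if "z \<noteq> 0" for z using that by (simp add: power2_eq_square)
   from this[of "\<bar>y - x\<bar>"] show ?thesis using ne by simp
  qed
  also have "... <= \<bar>Q\<bar> * \<bar>y - x\<bar>" by (intro mult_right_mono) auto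
  also have "... <= (\<bar>Q\<bar> + 1) * \<bar>y - x\<bar>" by (intro mult_right_mono) auto
  also have "... < (\<bar>Q\<bar> + 1) * (eps / (\<bar>Q\<bar> + 1))" using yd by (intro mult_strict_left_mono) (auto simp: d_def)
  also have "... = eps"
  proof -
   have "\<bar>Q\<bar> + 1 \<noteq> 0" by linarith
   thus ?thesis by simp
  qed
  finally show ?thesis by (simp add: dist_real_def)
 qed
 thus "\<forall>\<^sub>F y in at x within S. dist ((f y - f x) / (y - x)) D < eps"
  unfolding eventually_at using d by (intro exI[of _ d]) auto
qed

text \<open>Squaring removes the kink of the positive part at \<open>0\<close>; the energy of the
  lower bound is built from this function for that reason.\<close>

lemma DERIV_pos_part_sq: "((%r::real. (max 0 r)^2) has_field_derivative 2 * max 0 x) (at x)"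
proof (rule quad_deriv[of 1 UNIV x _ _ 1])
 fix y :: real
 consider "x <= 0" "y <= 0" | "x <= 0" "0 < y" | "0 < x" "0 <= y" | "0 < x" "y < 0" by linarith
 thus "\<bar>(max 0 y)^2 - (max 0 x)^2 - 2 * max 0 x * (y - x)\<bar> <= 1 * (y - x)^2"
 proof cases
  case 1 thus ?thesis by (simp add: max_def)
 next
  case 2
  hence "y^2 <= (y - x)^2" by (intro power_mono) auto
  thus ?thesis using 2 by (simp add: max_def)
 next
  case 3
  have "y^2 - x^2 - 2 * x * (y - x) = (y - x)^2" by (simp add: power2_eq_square algebra_simps)
  thus ?thesis using 3 by (simp add: max_def)
 next
  case 4
  have "x * y <= 0" using 4 by (simp add: mult_nonneg_nonpos)
  hence nn: "0 <= x * x - 2 * (x * y)" using zero_le_square[of x] by linarith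
  have "0 - x^2 - 2 * x * (y - x) = x * x - 2 * (x * y)" by (simp add: power2_eq_square algebra_simps)
  hence "\<bar>0 - x^2 - 2 * x * (y - x)\<bar> = x * x - 2 * (x * y)" using nn by simp
  also have "... <= (y - x)^2" using zero_le_square[of y] by (simp add: power2_eq_square algebra_simps)
  finally have "\<bar>0 - x^2 - 2 * x * (y - x)\<bar> <= (y - x)^2" .
  thus ?thesis using 4 by (simp add: max_def)
 qed
qed simp

definition orth :: "(real \<times> real \<times> real) set" where "orth = {0..} \<times> {0..} \<times> {0..}"

lemma lip_continuous_on_orth:
 fixes f :: "real \<times> real \<times> real => real"
 assumes rho: "0 < rho" and l: "!!t a b t' a' b'. 0 <= t ==> 0 <= a ==> 0 <= b ==> 0 <= t' ==> 0 <= a' ==> 0 <= b' ==>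
  \<bar>t' - t\<bar> + \<bar>a' - a\<bar> + \<bar>b' - b\<bar> <= rho ==> \<bar>f (t', a', b') - f (t, a, b)\<bar> <= L * (\<bar>t' - t\<bar> + \<bar>a' - a\<bar> + \<bar>b' - b\<bar>)"
 shows "continuous_on orth f"
 unfolding continuous_on_iff
proof (intro ballI allI impI)
 fix p :: "real \<times> real \<times> real" and eps :: real assume p: "p \<in> orth" and eps: "0 < eps"
 define d where "d = min (rho / 3) (eps / (3 * (\<bar>L\<bar> + 1)))"
 have d: "0 < d" using rho eps by (simp add: d_def)
 have "dist (f q) (f p) < eps" if q: "q \<in> orth" "dist q p < d" for q
 proof -
  obtain t a b where pe: "p = (t, a, b)" by (cases p)
  obtain t' a' b' where qe: "q = (t', a', b')" by (cases q)
  define s where "s = \<bar>t' - t\<bar> + \<bar>a' - a\<bar> + \<bar>b' - b\<bar>"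
  have 1: "dist t' t <= dist q p" "dist (a', b') (a, b) <= dist q p"
   using dist_fst_le[of q p] dist_snd_le[of q p] by (auto simp: pe qe)
  have 2: "dist a' a <= dist (a', b') (a, b)" "dist b' b <= dist (a', b') (a, b)"
   using dist_fst_le[of "(a', b')" "(a, b)"] dist_snd_le[of "(a', b')" "(a, b)"] by auto
  have s: "s < 3 * d" using 1 2 q(2) unfolding s_def dist_real_def by linarith
  have "\<bar>f q - f p\<bar> <= L * s" unfolding pe qe s_def
   using p q(1) s by (intro l) (auto simp: orth_def pe qe s_def d_def)
  also have "... <= (\<bar>L\<bar> + 1) * s" by (intro mult_right_mono) (auto simp: s_def)
  also have "... < (\<bar>L\<bar> + 1) * (3 * d)" using s by (intro mult_strict_left_mono) auto
  also have "... <= (\<bar>L\<bar> + 1) * (3 * (eps / (3 * (\<bar>L\<bar> + 1))))" by (intro mult_left_mono) (auto simp: d_def)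
  also have "... = eps"
  proof -
   have "c * (3 * (eps / (3 * c))) = eps" if "c \<noteq> 0" for c :: real using that by simp
   moreover have "\<bar>L\<bar> + 1 \<noteq> 0" by linarith
   ultimately show ?thesis by blast
  qed
  finally show ?thesis by (simp add: dist_real_def)
 qed
 thus "\<exists>d>0. \<forall>q\<in>orth. dist q p < d --> dist (f q) (f p) < eps" using d by blast
qed

section \<open>An approximate Hamilton-Jacobi equation\<close>

text \<open>\<open>Mt\<close>, \<open>Mu\<close> and \<open>Mv\<close> will be uniform in
  \<open>n\<close> and enter the estimates. \<open>C\<close> and \<open>r\<close> depend on
  \<open>n\<close>; they only provide differentiability for a fixed \<open>n\<close>, and the two
  final bounds do not contain them.\<close>

locale approx_hj =
 fixes F Dt Da Db :: "real => real => real => real" and Mt Mu Mv C r :: real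
 assumes lower: "!!t a b dt da db. 0 <= t ==> 0 <= a ==> 0 <= b ==> 0 <= dt ==> 0 <= da ==> 0 <= db ==>
   dt * Dt t a b + da * Da t a b + db * Db t a b <= F (t + dt) (a + da) (b + db) - F t a b"
  and upper: "!!t a b dt da db. 0 <= t ==> 0 <= a ==> 0 <= b ==> 0 <= dt ==> 0 <= da ==> 0 <= db ==> dt + da + db <= r ==>
   F (t + dt) (a + da) (b + db) - F t a b <= dt * Dt t a b + da * Da t a b + db * Db t a b + C * (dt + da + db)^2"
  and D0: "!!t a b. 0 <= Dt t a b" "!!t a b. 0 <= Da t a b" "!!t a b. 0 <= Db t a b"
  and DM: "!!t a b. Dt t a b <= Mt" "!!t a b. Da t a b <= Mu / 2" "!!t a b. Db t a b <= Mv / 2"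
  and mono: "!!t a b t' a' b'. 0 <= t ==> 0 <= a ==> 0 <= b ==> t <= t' ==> a <= a' ==> b <= b' ==>
   Dt t a b <= Dt t' a' b' \<and> Da t a b <= Da t' a' b' \<and> Db t a b <= Db t' a' b'"
  and r: "0 < r" and C: "0 <= C"
begin

lemma M0: "0 <= Mt" "0 <= Mu" "0 <= Mv"
 using order_trans[OF D0(1) DM(1)] order_trans[OF D0(2) DM(2)] order_trans[OF D0(3) DM(3)] by auto

text \<open>The counterpart of \<open>lower\<close> with the gradient at the far end: the local
  upper bound is summed along the segment, where the gradient is largest at the end by
  \<open>mono\<close>.\<close>

lemma increment_le:
 assumes z: "0 <= t" "0 <= a" "0 <= b" and d: "0 <= dt" "0 <= da" "0 <= db"
 shows "F (t + dt) (a + da) (b + db) - F t a b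
  <= dt * Dt (t + dt) (a + da) (b + db) + da * Da (t + dt) (a + da) (b + db) + db * Db (t + dt) (a + da) (b + db)" (is "_ <= ?L")
proof -
 let ?ph = "%s. F (t + s * dt) (a + s * da) (b + s * db)"
 let ?S = "dt + da + db"
 have "?ph 1 - ?ph 0 <= ?L"
 proof (rule telescoping_le)
  show "0 < r / (?S + 1)" using r d by (auto intro!: divide_pos_pos add_nonneg_pos)
  fix s u :: real assume s: "0 <= s" "0 < u" "u <= r / (?S + 1)" "s + u <= 1"
  have "u * (?S + 1) <= r" using s d by (simp add: pos_le_divide_eq add_nonneg_pos)
  hence ur: "u * dt + u * da + u * db <= r" using s by (simp add: algebra_simps)
  have s1: "s * x <= x" if "0 <= x" for x using s that by (intro mult_left_le_one_le) auto
  have "?ph (s + u) - ?ph s <= (u * dt) * Dt (t + s * dt) (a + s * da) (b + s * db) + (u * da) * Da (t + s * dt) (a + s * da) (b + s * db)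
   + (u * db) * Db (t + s * dt) (a + s * da) (b + s * db) + C * (u * dt + u * da + u * db)^2"
   using upper[of "t + s * dt" "a + s * da" "b + s * db" "u * dt" "u * da" "u * db"] z d s ur
   by (simp add: distrib_right add.assoc)
  also have "... <= (u * dt) * Dt (t + dt) (a + da) (b + db) + (u * da) * Da (t + dt) (a + da) (b + db)
   + (u * db) * Db (t + dt) (a + da) (b + db) + C * (u * dt + u * da + u * db)^2"
   using mono[of "t + s * dt" "a + s * da" "b + s * db" "t + dt" "a + da" "b + db"] z d s s1
   by (intro add_mono mult_left_mono order_refl) auto
  also have "... = ?L * u + (C * ?S^2) * u^2" by (simp add: power2_eq_square algebra_simps)
  finally show "?ph (s + u) - ?ph s <= ?L * u + (C * ?S^2) * u^2" .
 qed
 thus ?thesis by simp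
qed

lemma increment_lip:
 assumes "0 <= t" "0 <= a" "0 <= b" and d: "0 <= dt" "0 <= da" "0 <= db"
 shows "0 <= F (t + dt) (a + da) (b + db) - F t a b" (is ?C1) "F (t + dt) (a + da) (b + db) - F t a b <= dt * Mt + da * (Mu / 2) + db * (Mv / 2)" (is ?C2)
proof -
 have "0 <= dt * Dt t a b + da * Da t a b + db * Db t a b" using d D0 by (intro add_nonneg_nonneg mult_nonneg_nonneg)
 thus ?C1 using lower[OF assms] by linarith
 have "dt * Dt (t + dt) (a + da) (b + db) + da * Da (t + dt) (a + da) (b + db) + db * Db (t + dt) (a + da) (b + db)
  <= dt * Mt + da * (Mu / 2) + db * (Mv / 2)" using d DM by (intro add_mono mult_left_mono)
 thus ?C2
  using increment_le[OF assms] by linarith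
qed

lemma F_mono:
 assumes "0 <= t" "0 <= a" "0 <= b" "t <= t'" "a <= a'" "b <= b'"
 shows "F t a b <= F t' a' b'" "F t' a' b' <= F t a b + (t' - t) * Mt + (a' - a) * (Mu / 2) + (b' - b) * (Mv / 2)"
 using increment_lip[of t a b "t' - t" "a' - a" "b' - b"] assms by auto

lemma F_lip:
 assumes "0 <= t" "0 <= a" "0 <= b" "0 <= t'" "0 <= a'" "0 <= b'"
 shows "\<bar>F t' a' b' - F t a b\<bar> <= \<bar>t' - t\<bar> * Mt + \<bar>a' - a\<bar> * (Mu / 2) + \<bar>b' - b\<bar> * (Mv / 2)"
proof -
 have one: "F t' a' b' - F t a b <= \<bar>t' - t\<bar> * Mt + \<bar>a' - a\<bar> * (Mu / 2) + \<bar>b' - b\<bar> * (Mv / 2)"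
  if "0 <= t" "0 <= a" "0 <= b" "0 <= t'" "0 <= a'" "0 <= b'" for t a b t' a' b'
 proof -
  have "F t' a' b' <= F (max t t') (max a a') (max b b')" using that by (intro F_mono) auto
  also have "... <= F t a b + (max t t' - t) * Mt + (max a a' - a) * (Mu / 2) + (max b b' - b) * (Mv / 2)"
   using that by (intro F_mono) auto
  also have "... <= F t a b + \<bar>t' - t\<bar> * Mt + \<bar>a' - a\<bar> * (Mu / 2) + \<bar>b' - b\<bar> * (Mv / 2)"
   using M0 by (intro add_mono mult_right_mono order_refl) auto
  finally show ?thesis by simp
 qed
 show ?thesis using one[of t a b t' a' b'] one[of t' a' b' t a b] assms by (simp add: abs_minus_commute abs_le_iff)
qed

text \<open>A further step \<open>s\<close> in one coordinate is compared in two ways: from the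
  displaced point \<open>lower\<close> bounds its gain below by \<open>s\<close> times the new
  derivative, and from the original point \<open>upper\<close> bounds the total gain above. The
  total displacement is at most \<open>2 * s\<close>, which gives \<open>C * (2 * s)^2\<close>, that
  is \<open>4 * C * s\<close> after division by \<open>s\<close>.\<close>

lemma D_lip_mono:
 assumes z: "0 <= t" "0 <= a" "0 <= b" and d: "0 <= dt" "0 <= da" "0 <= db" and s: "dt + da + db <= s" "0 < s" "2 * s <= r"
 shows "Dt (t + dt) (a + da) (b + db) <= Dt t a b + 4 * C * s" (is ?C1)
  "Da (t + dt) (a + da) (b + db) <= Da t a b + 4 * C * s" (is ?C2)
  "Db (t + dt) (a + da) (b + db) <= Db t a b + 4 * C * s" (is ?C3)
proof -
 have low: "dt * Dt t a b + da * Da t a b + db * Db t a b <= F (t + dt) (a + da) (b + db) - F t a b"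
  by (rule lower[OF z d])
 have key: "D' <= D + 4 * C * s"
  if a1: "s * D' <= F2 - F (t + dt) (a + da) (b + db)"
   and a2: "F2 - F t a b <= dt * Dt t a b + da * Da t a b + db * Db t a b + s * D + C * (dt + da + db + s)^2" for D D' F2
 proof -
  have "C * (dt + da + db + s)^2 <= C * (2 * s)^2" using d s C by (intro mult_left_mono power_mono) auto
  hence "s * D' <= s * (D + 4 * C * s)" using a1 a2 low by (simp add: power2_eq_square algebra_simps)
  thus ?thesis using s(2) by simp
 qed
 show ?C1
  by (rule key[of _ "F (t + (dt + s)) (a + da) (b + db)"])
   (use lower[of "t + dt" "a + da" "b + db" s 0 0] upper[of t a b "dt + s" da db] z d s in \<open>auto simp: algebra_simps\<close>)
 show ?C2
  by (rule key[of _ "F (t + dt) (a + (da + s)) (b + db)"])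
   (use lower[of "t + dt" "a + da" "b + db" 0 s 0] upper[of t a b dt "da + s" db] z d s in \<open>auto simp: algebra_simps\<close>)
 show ?C3
  by (rule key[of _ "F (t + dt) (a + da) (b + (db + s))"])
   (use lower[of "t + dt" "a + da" "b + db" 0 0 s] upper[of t a b dt da "db + s"] z d s in \<open>auto simp: algebra_simps\<close>)
qed

lemma D_lip:
 assumes z: "0 <= t" "0 <= a" "0 <= b" "0 <= t'" "0 <= a'" "0 <= b'"
  and s: "\<bar>t' - t\<bar> + \<bar>a' - a\<bar> + \<bar>b' - b\<bar> <= r / 2"
 shows "\<bar>Dt t' a' b' - Dt t a b\<bar> <= 4 * C * (\<bar>t' - t\<bar> + \<bar>a' - a\<bar> + \<bar>b' - b\<bar>)" (is ?C1)
  "\<bar>Da t' a' b' - Da t a b\<bar> <= 4 * C * (\<bar>t' - t\<bar> + \<bar>a' - a\<bar> + \<bar>b' - b\<bar>)" (is ?C2)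
  "\<bar>Db t' a' b' - Db t a b\<bar> <= 4 * C * (\<bar>t' - t\<bar> + \<bar>a' - a\<bar> + \<bar>b' - b\<bar>)" (is ?C3)
proof -
 have one: "Dt t' a' b' - Dt t a b <= 4 * C * (\<bar>t' - t\<bar> + \<bar>a' - a\<bar> + \<bar>b' - b\<bar>) \<and>
  Da t' a' b' - Da t a b <= 4 * C * (\<bar>t' - t\<bar> + \<bar>a' - a\<bar> + \<bar>b' - b\<bar>) \<and>
  Db t' a' b' - Db t a b <= 4 * C * (\<bar>t' - t\<bar> + \<bar>a' - a\<bar> + \<bar>b' - b\<bar>)"
  if "0 <= t" "0 <= a" "0 <= b" "0 <= t'" "0 <= a'" "0 <= b'" and s: "\<bar>t' - t\<bar> + \<bar>a' - a\<bar> + \<bar>b' - b\<bar> <= r / 2" for t a b t' a' b'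
 proof (cases "\<bar>t' - t\<bar> + \<bar>a' - a\<bar> + \<bar>b' - b\<bar> = 0")
  case True
  hence "t' = t" "a' = a" "b' = b" by linarith+
  thus ?thesis by simp
 next
  case False
  let ?s = "\<bar>t' - t\<bar> + \<bar>a' - a\<bar> + \<bar>b' - b\<bar>"
  have m: "Dt t' a' b' <= Dt (max t t') (max a a') (max b b') \<and> Da t' a' b' <= Da (max t t') (max a a') (max b b') \<and> Db t' a' b' <= Db (max t t') (max a a') (max b b')"
   using that by (intro mono) auto
  have sum: "(max t t' - t) + (max a a' - a) + (max b b' - b) <= ?s" by auto
  have half: "2 * u <= r" if "u <= r / 2" for u using that by simp
  have "0 <= ?s" by (intro add_nonneg_nonneg abs_ge_zero)
  hence s2: "0 < ?s" "2 * ?s <= r" using False half[OF s] by (simp_all only: less_le) auto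
  have n: "0 <= max t t' - t" "0 <= max a a' - a" "0 <= max b b' - b" by auto
  have e: "t + (max t t' - t) = max t t'" "a + (max a a' - a) = max a a'" "b + (max b b' - b) = max b b'" by auto
  note l = D_lip_mono[OF that(1-3) n sum s2, unfolded e]
  show ?thesis
  proof (intro conjI)
   show "Dt t' a' b' - Dt t a b <= 4 * C * ?s" using l(1) m[THEN conjunct1] by linarith
   show "Da t' a' b' - Da t a b <= 4 * C * ?s" using l(2) m[THEN conjunct2, THEN conjunct1] by linarith
   show "Db t' a' b' - Db t a b <= 4 * C * ?s" using l(3) m[THEN conjunct2, THEN conjunct2] by linarith
  qed
 qed
 have sw: "\<bar>t - t'\<bar> + \<bar>a - a'\<bar> + \<bar>b - b'\<bar> = \<bar>t' - t\<bar> + \<bar>a' - a\<bar> + \<bar>b' - b\<bar>" by (simp only: abs_minus_commute)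
 note o1 = one[OF z s] and o2 = one[OF z(4-6) z(1-3), unfolded sw, OF s]
 show ?C1
  using o1[THEN conjunct1] o2[THEN conjunct1] by (intro abs_leI) linarith+
 show ?C2
  using o1[THEN conjunct2, THEN conjunct1] o2[THEN conjunct2, THEN conjunct1] by (intro abs_leI) linarith+
 show ?C3
  using o1[THEN conjunct2, THEN conjunct2] o2[THEN conjunct2, THEN conjunct2] by (intro abs_leI) linarith+
qed

lemma F_quad:
 assumes z: "0 <= t" "0 <= a" "0 <= b" "0 <= t'" "0 <= a'" "0 <= b'"
  and s: "\<bar>t' - t\<bar> + \<bar>a' - a\<bar> + \<bar>b' - b\<bar> <= r / 2"
 shows "\<bar>F t' a' b' - F t a b - ((t' - t) * Dt t a b + (a' - a) * Da t a b + (b' - b) * Db t a b)\<bar>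
  <= 5 * C * (\<bar>t' - t\<bar> + \<bar>a' - a\<bar> + \<bar>b' - b\<bar>)^2"
proof -
 let ?s = "\<bar>t' - t\<bar> + \<bar>a' - a\<bar> + \<bar>b' - b\<bar>"
 \<comment> \<open>The one-sided bounds need nonnegative increments, so both points are reached from
   their componentwise minimum.\<close>
 define t0 where "t0 = min t t'" define a0 where "a0 = min a a'" define b0 where "b0 = min b b'"
 have w: "0 <= t0" "0 <= a0" "0 <= b0" using z by (auto simp: t0_def a0_def b0_def)
 have e: "0 <= t - t0" "0 <= a - a0" "0 <= b - b0" "0 <= t' - t0" "0 <= a' - a0" "0 <= b' - b0"
  by (auto simp: t0_def a0_def b0_def)
 have le: "(t - t0) + (a - a0) + (b - b0) <= ?s" "(t' - t0) + (a' - a0) + (b' - b0) <= ?s"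
  by (auto simp: t0_def a0_def b0_def)
 have sr: "?s <= r" using s r by linarith
 define P where "P = (%t a b. (t - t0) * Dt t0 a0 b0 + (a - a0) * Da t0 a0 b0 + (b - b0) * Db t0 a0 b0)"
 have q: "P t a b <= F t a b - F t0 a0 b0 \<and> F t a b - F t0 a0 b0 <= P t a b + C * ?s^2"
  if "0 <= t - t0" "0 <= a - a0" "0 <= b - b0" "(t - t0) + (a - a0) + (b - b0) <= ?s" for t a b
 proof -
  have "C * ((t - t0) + (a - a0) + (b - b0))^2 <= C * ?s^2" using that C by (intro mult_left_mono power_mono) auto
  thus ?thesis
   using lower[OF w that(1-3)] upper[OF w that(1-3) order_trans[OF that(4) sr]] unfolding P_def by simp
 qed
 note q1 = q[OF e(1-3) le(1)] and q2 = q[OF e(4-6) le(2)]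
 define Q where "Q = (t' - t) * (Dt t a b - Dt t0 a0 b0) + (a' - a) * (Da t a b - Da t0 a0 b0) + (b' - b) * (Db t a b - Db t0 a0 b0)"
 have wz: "\<bar>t - t0\<bar> + \<bar>a - a0\<bar> + \<bar>b - b0\<bar> <= ?s" using e le by simp
 have wz4: "4 * C * (\<bar>t - t0\<bar> + \<bar>a - a0\<bar> + \<bar>b - b0\<bar>) <= 4 * C * ?s" using wz C by (intro mult_left_mono) auto
 have Dl: "\<bar>Dt t a b - Dt t0 a0 b0\<bar> <= 4 * C * ?s" "\<bar>Da t a b - Da t0 a0 b0\<bar> <= 4 * C * ?s" "\<bar>Db t a b - Db t0 a0 b0\<bar> <= 4 * C * ?s"
  by (rule order_trans[OF D_lip(1)[OF w z(1-3) order_trans[OF wz s]] wz4], rule order_trans[OF D_lip(2)[OF w z(1-3) order_trans[OF wz s]] wz4],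
   rule order_trans[OF D_lip(3)[OF w z(1-3) order_trans[OF wz s]] wz4])
 have "\<bar>Q\<bar> <= \<bar>t' - t\<bar> * (4 * C * ?s) + \<bar>a' - a\<bar> * (4 * C * ?s) + \<bar>b' - b\<bar> * (4 * C * ?s)"
 proof -
  have tri: "\<bar>u + v + w\<bar> <= \<bar>u\<bar> + \<bar>v\<bar> + \<bar>w\<bar>" for u v w :: real by linarith
  show ?thesis unfolding Q_def
   by (rule order_trans[OF tri], unfold abs_mult, intro add_mono mult_left_mono Dl abs_ge_zero)
 qed
 also have "... = 4 * C * ?s^2"
 proof -
  have "x * (4 * C * (x + y + z)) + y * (4 * C * (x + y + z)) + z * (4 * C * (x + y + z)) = 4 * C * (x + y + z)^2" for x y z
   by (simp add: power2_eq_square algebra_simps)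
  thus ?thesis by blast
 qed
 finally have Q: "\<bar>Q\<bar> <= 4 * C * ?s^2" .
 have "P t' a' b' - P t a b = (t' - t) * Dt t a b + (a' - a) * Da t a b + (b' - b) * Db t a b - Q"
  by (simp add: P_def Q_def algebra_simps)
 hence eq: "(t' - t) * Dt t a b + (a' - a) * Da t a b + (b' - b) * Db t a b = P t' a' b' - P t a b + Q" by simp
 have sq: "5 * C * ?s^2 = 4 * C * ?s^2 + C * ?s^2" by simp
 have fin: "\<bar>f' - f - (p' - p + q)\<bar> <= c4 + c1"
  if "p <= f - f0 \<and> f - f0 <= p + c1" "p' <= f' - f0 \<and> f' - f0 <= p' + c1" "\<bar>q\<bar> <= c4" for f f' f0 p p' q c1 c4 :: real
  using that by linarith
 show ?thesis unfolding eq sq by (rule fin[OF q1 q2 Q])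
qed

lemma F_cont: "continuous_on orth (%(t, a, b). F t a b)"
proof (rule lip_continuous_on_orth[of 1 _ "Mt + Mu / 2 + Mv / 2"], simp)
 fix t a b t' a' b' :: real assume z: "0 <= t" "0 <= a" "0 <= b" "0 <= t'" "0 <= a'" "0 <= b'"
 have "\<bar>F t' a' b' - F t a b\<bar> <= \<bar>t' - t\<bar> * Mt + \<bar>a' - a\<bar> * (Mu / 2) + \<bar>b' - b\<bar> * (Mv / 2)" by (rule F_lip[OF z])
 also have "... <= \<bar>t' - t\<bar> * (Mt + Mu / 2 + Mv / 2) + \<bar>a' - a\<bar> * (Mt + Mu / 2 + Mv / 2) + \<bar>b' - b\<bar> * (Mt + Mu / 2 + Mv / 2)"
  using M0 by (intro add_mono mult_left_mono) auto
 finally show "\<bar>(case (t', a', b') of (t, a, b) => F t a b) - (case (t, a, b) of (t, a, b) => F t a b)\<bar>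
  <= (Mt + Mu / 2 + Mv / 2) * (\<bar>t' - t\<bar> + \<bar>a' - a\<bar> + \<bar>b' - b\<bar>)" by (simp add: algebra_simps)
qed

lemma D_cont: "continuous_on orth (%(t, a, b). Dt t a b)" "continuous_on orth (%(t, a, b). Da t a b)" "continuous_on orth (%(t, a, b). Db t a b)"
 by (rule lip_continuous_on_orth[of "r / 2" _ "4 * C"], use r D_lip in auto)+

end

section \<open>Upper bound by doubling of variables\<close>

context approx_hj
begin

lemma init_subgradient:
 assumes "0 <= a" "0 <= a'" "0 <= b"
 shows "F 0 a' b >= F 0 a b + (a' - a) * Da 0 a b" (is ?C1) "F 0 b a' >= F 0 b a + (a' - a) * Db 0 b a" (is ?C2)
proof -
 show ?C1
 proof (cases "a <= a'")
  case True thus ?thesis using lower[of 0 a b 0 "a' - a" 0] assms by simp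
 next
  case False thus ?thesis using increment_le[of 0 a' b 0 "a - a'" 0] assms by (simp add: algebra_simps)
 qed
 show ?C2
 proof (cases "a <= a'")
  case True thus ?thesis using lower[of 0 b a 0 0 "a' - a"] assms by simp
 next
  case False thus ?thesis using increment_le[of 0 b a' 0 0 "a - a'"] assms by (simp add: algebra_simps)
 qed
qed

text \<open>The initial value is a sum of functions of one variable each, so a subgradient in each
  variable gives joint convexity.\<close>

lemma init_convex:
 assumes "0 <= a1" "0 <= a2" "0 <= b1" "0 <= b2" and te: "0 <= te" "te <= 1"
  and sep: "!!a b. 0 <= a ==> 0 <= b ==> F 0 a b = gu a + gv b"
 shows "F 0 (te * a1 + (1 - te) * a2) (te * b1 + (1 - te) * b2) <= te * F 0 a1 b1 + (1 - te) * F 0 a2 b2"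
proof -
 let ?a = "te * a1 + (1 - te) * a2" and ?b = "te * b1 + (1 - te) * b2"
 have z: "0 <= ?a" "0 <= ?b" using assms by auto
 let ?p = "Da 0 ?a 0" and ?q = "Db 0 0 ?b"
 have u: "gu a' >= gu ?a + (a' - ?a) * ?p" if "0 <= a'" for a'
  using init_subgradient(1)[of ?a a' 0] z that by (simp add: sep)
 have v: "gv b' >= gv ?b + (b' - ?b) * ?q" if "0 <= b'" for b'
  using init_subgradient(2)[of ?b b' 0] z that by (simp add: sep)
 have "te * (gu ?a + (a1 - ?a) * ?p) + (1 - te) * (gu ?a + (a2 - ?a) * ?p) <= te * gu a1 + (1 - te) * gu a2"
  using u assms by (intro add_mono mult_left_mono) auto
 moreover have "te * (gu ?a + (a1 - ?a) * ?p) + (1 - te) * (gu ?a + (a2 - ?a) * ?p) = gu ?a" by (simp add: algebra_simps)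
 moreover have "te * (gv ?b + (b1 - ?b) * ?q) + (1 - te) * (gv ?b + (b2 - ?b) * ?q) <= te * gv b1 + (1 - te) * gv b2"
  using v assms by (intro add_mono mult_left_mono) auto
 moreover have "te * (gv ?b + (b1 - ?b) * ?q) + (1 - te) * (gv ?b + (b2 - ?b) * ?q) = gv ?b" by (simp add: algebra_simps)
 ultimately show ?thesis using assms z by (simp add: sep algebra_simps)
qed

context
 fixes x :: "real => real" and X :: real
 assumes x: "!!y. y \<in> {0..Mu} ==> 0 <= x y \<and> x y <= X"
begin

text \<open>The value along the line of velocity \<open>(x y, y)\<close> with running cost
  \<open>x y * y / 2\<close>. At a gradient \<open>(p, q)\<close> with \<open>y = 2 * p\<close>,
  transport minus cost equals \<open>2 * p * q\<close> whatever \<open>x y\<close> is. So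
  \<open>V\<close> acts as a supersolution for any bounded choice of \<open>x\<close>, and
  \<open>y\<close> ranges over the possible values of \<open>2 * Da\<close>.\<close>

definition "branch y t c b = F 0 (c + t * x y) (b + t * y) - t * x y * y / 2"
definition "V t c b = (SUP y\<in>{0..Mu}. branch y t c b)"

lemma X0: "0 <= X" using x[of 0] M0 by auto

lemma Mu_ne: "{0..Mu} \<noteq> {}" using M0 by auto

lemma branch_le: "0 <= t ==> 0 <= c ==> 0 <= b ==> y \<in> {0..Mu} ==> branch y t c b <= F 0 (c + t * X) (b + t * Mu)"
proof -
 assume a: "0 <= t" "0 <= c" "0 <= b" and y: "y \<in> {0..Mu}"
 have "F 0 (c + t * x y) (b + t * y) <= F 0 (c + t * X) (b + t * Mu)"
  using a y x[OF y] by (intro F_mono) (auto intro!: mult_left_mono)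
 moreover have "0 <= t * x y * y / 2" using a y x[OF y] by auto
 ultimately show ?thesis unfolding branch_def by linarith
qed

lemma branch_bdd: "0 <= t ==> 0 <= c ==> 0 <= b ==> bdd_above ((%y. branch y t c b) ` {0..Mu})"
 using branch_le by (intro bdd_aboveI2) blast

lemma V_ge: "0 <= t ==> 0 <= c ==> 0 <= b ==> y \<in> {0..Mu} ==> branch y t c b <= V t c b"
 unfolding V_def by (rule cSUP_upper[OF _ branch_bdd])

lemma V_le: "(!!y. y \<in> {0..Mu} ==> branch y t c b <= S) ==> V t c b <= S"
 unfolding V_def by (rule cSUP_least[OF Mu_ne])

lemma V_lip:
 assumes z: "0 <= t" "0 <= c" "0 <= b" "0 <= t'" "0 <= c'" "0 <= b'"
 shows "\<bar>V t' c' b' - V t c b\<bar> <= (Mu + Mv + X * Mu + Mv * Mu + 1) * (\<bar>t' - t\<bar> + \<bar>c' - c\<bar> + \<bar>b' - b\<bar>)"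
proof -
 let ?L = "Mu + Mv + X * Mu + Mv * Mu + 1"
 have one: "V t' c' b' <= V t c b + ?L * (\<bar>t' - t\<bar> + \<bar>c' - c\<bar> + \<bar>b' - b\<bar>)"
  if z: "0 <= t" "0 <= c" "0 <= b" "0 <= t'" "0 <= c'" "0 <= b'" for t c b t' c' b'
 proof (rule V_le)
  fix y assume y: "y \<in> {0..Mu}"
  note xy = x[OF y]
  have "\<bar>F 0 (c' + t' * x y) (b' + t' * y) - F 0 (c + t * x y) (b + t * y)\<bar>
   <= \<bar>(c' + t' * x y) - (c + t * x y)\<bar> * (Mu / 2) + \<bar>(b' + t' * y) - (b + t * y)\<bar> * (Mv / 2)"
   using F_lip[of 0 "c + t * x y" "b + t * y" 0 "c' + t' * x y" "b' + t' * y"] z y xy by auto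
  also have "... <= (\<bar>c' - c\<bar> + \<bar>t' - t\<bar> * X) * (Mu / 2) + (\<bar>b' - b\<bar> + \<bar>t' - t\<bar> * Mu) * (Mv / 2)"
  proof (intro add_mono mult_right_mono)
   have "(c' + t' * x y) - (c + t * x y) = (c' - c) + (t' - t) * x y" by (simp add: algebra_simps)
   moreover have "\<bar>(t' - t) * x y\<bar> <= \<bar>t' - t\<bar> * X" using xy by (simp add: abs_mult mult_left_mono)
   ultimately show "\<bar>(c' + t' * x y) - (c + t * x y)\<bar> <= \<bar>c' - c\<bar> + \<bar>t' - t\<bar> * X"
    using abs_triangle_ineq[of "c' - c" "(t' - t) * x y"] by linarith
   have "(b' + t' * y) - (b + t * y) = (b' - b) + (t' - t) * y" by (simp add: algebra_simps)
   moreover have "\<bar>(t' - t) * y\<bar> <= \<bar>t' - t\<bar> * Mu" using y by (simp add: abs_mult mult_left_mono)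
   ultimately show "\<bar>(b' + t' * y) - (b + t * y)\<bar> <= \<bar>b' - b\<bar> + \<bar>t' - t\<bar> * Mu"
    using abs_triangle_ineq[of "b' - b" "(t' - t) * y"] by linarith
  qed (use M0 in auto)
  finally have 1: "F 0 (c' + t' * x y) (b' + t' * y) <= F 0 (c + t * x y) (b + t * y) + ((\<bar>c' - c\<bar> + \<bar>t' - t\<bar> * X) * (Mu / 2) + (\<bar>b' - b\<bar> + \<bar>t' - t\<bar> * Mu) * (Mv / 2))"
   by linarith
  have xyM: "0 <= x y * y" "x y * y <= X * Mu" using xy y X0 by (auto intro!: mult_mono)
  have "(t - t') * (x y * y) <= \<bar>t' - t\<bar> * (X * Mu)"
  proof -
   have "(t - t') * (x y * y) <= \<bar>t' - t\<bar> * (x y * y)" using xyM by (intro mult_right_mono) auto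
   also have "... <= \<bar>t' - t\<bar> * (X * Mu)" using xyM by (intro mult_left_mono) auto
   finally show ?thesis .
  qed
  hence 2: "- (t' * x y * y / 2) <= - (t * x y * y / 2) + \<bar>t' - t\<bar> * (X * Mu) / 2" by (simp add: algebra_simps)
  have "branch y t' c' b' <= branch y t c b + ((\<bar>c' - c\<bar> + \<bar>t' - t\<bar> * X) * (Mu / 2) + (\<bar>b' - b\<bar> + \<bar>t' - t\<bar> * Mu) * (Mv / 2)) + \<bar>t' - t\<bar> * (X * Mu) / 2"
   unfolding branch_def using 1 2 by linarith
  also have "... = branch y t c b + (\<bar>c' - c\<bar> * (Mu / 2) + \<bar>b' - b\<bar> * (Mv / 2) + \<bar>t' - t\<bar> * (X * Mu + Mu * Mv / 2))"
   by (simp add: algebra_simps)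
  also have "... <= branch y t c b + (\<bar>c' - c\<bar> * ?L + \<bar>b' - b\<bar> * ?L + \<bar>t' - t\<bar> * ?L)"
  proof -
   have nn: "0 <= X * Mu" "0 <= Mv * Mu" "Mu * Mv / 2 = Mv * Mu / 2" using M0 X0 by simp_all
   have "Mu / 2 <= ?L" "Mv / 2 <= ?L" "X * Mu + Mu * Mv / 2 <= ?L" using nn M0 by linarith+
   thus ?thesis
    by (rule add_left_mono[OF add_mono[OF add_mono[OF mult_left_mono[OF _ abs_ge_zero] mult_left_mono[OF _ abs_ge_zero]] mult_left_mono[OF _ abs_ge_zero]]])
  qed
  also have "... <= V t c b + ?L * (\<bar>t' - t\<bar> + \<bar>c' - c\<bar> + \<bar>b' - b\<bar>)"
   using V_ge[OF z(1-3) y] by (simp add: algebra_simps)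
  finally show "branch y t' c' b' <= V t c b + ?L * (\<bar>t' - t\<bar> + \<bar>c' - c\<bar> + \<bar>b' - b\<bar>)" .
 qed
 show ?thesis using one[OF z] one[OF z(4-6) z(1-3)] by (simp add: abs_le_iff abs_minus_commute)
qed

lemma V_cont: "continuous_on orth (%(t, c, b). V t c b)"
 by (rule lip_continuous_on_orth[of 1]) (use V_lip in auto)

text \<open>One half of dynamic programming. Following the line of \<open>y\<close> for time
  \<open>s\<close> and then that of \<open>y'\<close> for time \<open>t - s\<close> ends at the
  convex combination, with weight \<open>te = s / t\<close>, of the ends of the two straight lines;
  the costs combine in the same way, and the initial value is convex.\<close>

lemma V_dynamic:
 assumes z: "0 < t" "0 <= c" "0 <= b" and s: "0 <= s" "s <= t" and y: "y \<in> {0..Mu}"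
  and sep: "!!a b. 0 <= a ==> 0 <= b ==> F 0 a b = gu a + gv b"
 shows "V (t - s) (c + s * x y) (b + s * y) - s * x y * y / 2 <= V t c b"
proof -
 have "V (t - s) (c + s * x y) (b + s * y) <= V t c b + s * x y * y / 2"
 proof (rule V_le)
  fix y' assume y': "y' \<in> {0..Mu}"
  define te where "te = s / t"
  have te: "0 <= te" "te <= 1" using z s by (auto simp: te_def)
  have st: "s = te * t" using z by (simp add: te_def)
  have e1: "c + s * x y + (t - s) * x y' = te * (c + t * x y) + (1 - te) * (c + t * x y')"
   and e2: "b + s * y + (t - s) * y' = te * (b + t * y) + (1 - te) * (b + t * y')"
   unfolding st by (simp_all add: algebra_simps)
  have "F 0 (c + s * x y + (t - s) * x y') (b + s * y + (t - s) * y')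
   <= te * F 0 (c + t * x y) (b + t * y) + (1 - te) * F 0 (c + t * x y') (b + t * y')"
   unfolding e1 e2 using z y y' x[OF y] x[OF y'] te by (intro init_convex[where gu=gu and gv=gv] sep) auto
  moreover have "te * branch y t c b + (1 - te) * branch y' t c b <= te * V t c b + (1 - te) * V t c b"
   using V_ge[of t c b] z y y' te by (intro add_mono mult_left_mono) auto
  moreover have "te * V t c b + (1 - te) * V t c b = V t c b" by (simp add: algebra_simps)
  moreover have "te * branch y t c b = te * F 0 (c + t * x y) (b + t * y) - s * x y * y / 2"
   unfolding branch_def st by (simp add: right_diff_distrib)
  moreover have "(1 - te) * branch y' t c b = (1 - te) * F 0 (c + t * x y') (b + t * y') - (t - s) * x y' * y' / 2"
   unfolding branch_def st by (simp add: left_diff_distrib right_diff_distrib diff_divide_distrib)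
  ultimately show "branch y' (t - s) (c + s * x y) (b + s * y) <= V t c b + s * x y * y / 2"
   unfolding branch_def by linarith
 qed
 thus ?thesis by simp
qed

text \<open>\<open>Ps\<close> compares \<open>F\<close> at \<open>a\<close> with \<open>V\<close> at
  an independent \<open>c\<close>. At its maximum the penalty \<open>(a - c)^2 / (2 * eta)\<close>
  puts \<open>F\<close> below a touching parabola in \<open>a\<close>, which is the premise under
  which \<open>err\<close> declares the defect small. The \<open>ka\<close> term confines the
  maximum to a box of size \<open>R\<close>, and the \<open>de\<close> term makes the comparison
  strict.\<close>

theorem upper_bound:
 fixes T S eta ka de R :: real
 assumes T: "0 < T" and eta: "0 < eta" and ka: "0 < ka" "ka * (X + Mu) <= de / 2" and de: "0 < de"
  and sep: "!!a b. 0 <= a ==> 0 <= b ==> F 0 a b = gu a + gv b"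
  and S: "!!y. y \<in> {0..Mu} ==> F 0 (T * x y) (T * y) - T * x y * y / 2 <= S"
  and Q: "Q = Mt * T + Mu^2 * eta / 4 + (Mu / 2) * (T * X) + (Mv / 2) * (T * Mu) + de * T"
  and R: "Q / ka + sqrt (4 * eta * Q) <= R"
  and err: "!!t a b. 0 <= t ==> 0 <= a ==> 0 <= b ==> t <= T ==> a <= R ==> b <= R ==>
   (!!h. 0 <= h ==> F t (a + h) b - F t a b - h * Da t a b <= h^2 / (2 * eta)) ==>
   Dt t a b - 2 * Da t a b * Db t a b < de / 2"
 shows "F T 0 0 <= S + de * T + Mu^2 * eta / 8"
proof -
 define Ps where "Ps = (%t a b c. F t a b - V t c b - (a - c)^2 / (2 * eta) - ka * (c + b) - de * t)"
 have VT: "V T 0 0 <= S" by (rule V_le) (use S in \<open>simp add: branch_def\<close>)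
 have V0: "V 0 c b = F 0 c b" for c b unfolding V_def branch_def using M0 by simp
 have VF: "F 0 c b <= V t c b" if "0 <= t" "0 <= c" "0 <= b" for t c b
 proof -
  have "F 0 c b <= F 0 (c + t * x 0) (b + t * 0)" using that x[of 0] M0 by (intro F_mono) auto
  also have "... = branch 0 t c b" by (simp add: branch_def)
  also have "... <= V t c b" using that M0 by (intro V_ge) auto
  finally show ?thesis .
 qed
 have quadb: "Mu / 2 * d - d^2 / (4 * eta) <= Mu^2 * eta / 4" "Mu / 2 * d - d^2 / (2 * eta) <= Mu^2 * eta / 8" for d
 proof -
  have "Mu^2 * eta / 4 - (Mu / 2 * d - d^2 / (4 * eta)) = (Mu * eta - d)^2 / (4 * eta)" using eta by (simp add: field_simps power2_eq_square)
  moreover have "0 <= (Mu * eta - d)^2 / (4 * eta)" using eta by simp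
  ultimately show "Mu / 2 * d - d^2 / (4 * eta) <= Mu^2 * eta / 4" by linarith
  have "Mu^2 * eta / 8 - (Mu / 2 * d - d^2 / (2 * eta)) = (Mu * eta - 2 * d)^2 / (8 * eta)" using eta by (simp add: field_simps power2_eq_square)
  moreover have "0 <= (Mu * eta - 2 * d)^2 / (8 * eta)" using eta by simp
  ultimately show "Mu / 2 * d - d^2 / (2 * eta) <= Mu^2 * eta / 8" by linarith
 qed
 have Fd: "F t a b - V t c b <= t * Mt + Mu / 2 * \<bar>a - c\<bar>" if "0 <= t" "0 <= a" "0 <= b" "0 <= c" for t a b c
  using F_lip[of 0 c b t a b] VF[of t c b] that by (simp add: abs_le_iff mult.commute)
 \<comment> \<open>\<open>ps0\<close> contains the value \<open>F T 0 0\<close> to be bounded.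
   Wherever \<open>Ps\<close> is at least \<open>ps0\<close>, the penalties are at most
   \<open>Q\<close>: one half of the quadratic penalty absorbs the Lipschitz growth of
   \<open>F\<close> in \<open>a - c\<close>, the other half is kept for the estimate.\<close>
 define ps0 where "ps0 = Ps T 0 0 0"
 have coer: "ka * (c + b) + (a - c)^2 / (4 * eta) <= Q" if z: "0 <= t" "t <= T" "0 <= a" "0 <= b" "0 <= c" and ge: "ps0 <= Ps t a b c" for t a b c
 proof -
  have "Ps t a b c <= t * Mt + Mu / 2 * \<bar>a - c\<bar> - (a - c)\<^sup>2 / (2 * eta) - ka * (c + b) - de * t"
   unfolding Ps_def using Fd[OF z(1,3,4,5)] by linarith
  also have "... = t * Mt + (Mu / 2 * \<bar>a - c\<bar> - \<bar>a - c\<bar>^2 / (4 * eta)) - (a - c)^2 / (4 * eta) - ka * (c + b) - de * t"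
   by (simp add: field_simps)
  also have "... <= T * Mt + Mu^2 * eta / 4 - (a - c)^2 / (4 * eta) - ka * (c + b)"
   using quadb(1)[of "\<bar>a - c\<bar>"] mult_right_mono[OF z(2) M0(1)] mult_nonneg_nonneg[of de t] de z by linarith
  finally have up: "Ps t a b c <= T * Mt + Mu^2 * eta / 4 - (a - c)^2 / (4 * eta) - ka * (c + b)" .
  have "V T 0 0 <= F 0 0 0 + (Mu / 2) * (T * X) + (Mv / 2) * (T * Mu)"
  proof (rule V_le)
   fix y assume "y \<in> {0..Mu}"
   hence "branch y T 0 0 <= F 0 (0 + T * X) (0 + T * Mu)" using T by (intro branch_le) auto
   also have "... <= F 0 0 0 + (Mu / 2) * (T * X) + (Mv / 2) * (T * Mu)"
    using F_mono(2)[of 0 0 0 0 "T * X" "T * Mu"] T X0 M0 by (simp add: mult.commute)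
   finally show "branch y T 0 0 <= F 0 0 0 + (Mu / 2) * (T * X) + (Mv / 2) * (T * Mu)" .
  qed
  moreover have "F 0 0 0 <= F T 0 0" using T by (intro F_mono) auto
  ultimately have "- ((Mu / 2) * (T * X) + (Mv / 2) * (T * Mu)) - de * T <= ps0" unfolding ps0_def Ps_def by simp
  thus ?thesis using up ge unfolding Q by (simp add: mult.commute)
 qed
 have Q0: "0 <= Q" using coer[of T 0 0 0] T by (simp add: ps0_def)
 have inR: "a <= R \<and> b <= R \<and> c <= R" if z: "0 <= t" "t <= T" "0 <= a" "0 <= b" "0 <= c" and ge: "ps0 <= Ps t a b c" for t a b c
 proof -
  have k: "ka * (c + b) + (a - c)^2 / (4 * eta) <= Q" by (rule coer[OF z ge])
  have nn: "0 <= (a - c)^2 / (4 * eta)" "0 <= ka * (c + b)" using eta ka z by auto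
  have "ka * (c + b) <= Q" using k nn by linarith
  hence cb: "c + b <= Q / ka" using ka by (simp add: pos_le_divide_eq mult.commute)
  have "(a - c)^2 / (4 * eta) <= Q" using k nn by linarith
  hence "(a - c)^2 <= 4 * eta * Q" using eta by (simp add: pos_divide_le_eq mult.commute)
  hence ac: "\<bar>a - c\<bar> <= sqrt (4 * eta * Q)" by (metis real_sqrt_abs real_sqrt_le_mono)
  have "0 <= sqrt (4 * eta * Q)" using eta Q0 by simp
  thus ?thesis using cb ac R z by linarith
 qed
 have R0: "0 <= R" using inR[of T 0 0 0] T by (simp add: ps0_def)
 define K where "K = {0..T} \<times> {0..R} \<times> {0..R} \<times> {0..R}"
 have "\<exists>p\<in>K. \<forall>q\<in>K. (%(t, a, b, c). Ps t a b c) q <= (%(t, a, b, c). Ps t a b c) p"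
 proof (rule continuous_attains_sup)
  show "compact K" unfolding K_def by (intro compact_Times compact_Icc)
  show "K \<noteq> {}" unfolding K_def using T R0 by auto
  have c1: "continuous_on K (%p. (case (fst p, fst (snd p), fst (snd (snd p))) of (t, a, b) => F t a b))"
   by (rule continuous_on_compose2[OF F_cont]) (auto intro!: continuous_intros simp: orth_def K_def)
  have c2: "continuous_on K (%p. (case (fst p, snd (snd (snd p)), fst (snd (snd p))) of (t, c, b) => V t c b))"
   by (rule continuous_on_compose2[OF V_cont]) (auto intro!: continuous_intros simp: orth_def K_def)
  have "continuous_on K (%p. F (fst p) (fst (snd p)) (fst (snd (snd p))) - V (fst p) (snd (snd (snd p))) (fst (snd (snd p)))
    - (fst (snd p) - snd (snd (snd p)))^2 / (2 * eta) - ka * (snd (snd (snd p)) + fst (snd (snd p))) - de * fst p)"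
   using c1 c2 eta by (auto intro!: continuous_intros)
  thus "continuous_on K (%(t, a, b, c). Ps t a b c)" by (simp add: Ps_def case_prod_unfold)
 qed
 then obtain t a b c where K: "0 <= t" "t <= T" "0 <= a" "0 <= b" "0 <= c"
  and mx: "!!t' a' b' c'. 0 <= t' ==> t' <= T ==> 0 <= a' ==> a' <= R ==> 0 <= b' ==> b' <= R ==> 0 <= c' ==> c' <= R ==> Ps t' a' b' c' <= Ps t a b c"
  unfolding K_def by (auto simp: Ball_def)
 have ge0: "ps0 <= Ps t a b c" unfolding ps0_def using mx[of T 0 0 0] T R0 by simp
 \<comment> \<open>A point where \<open>Ps\<close> reaches \<open>ps0\<close> lies in the box
   anyway, so the maximum over the box is a global one.\<close>
 have gmx: "Ps t' a' b' c' <= Ps t a b c" if "0 <= t'" "t' <= T" "0 <= a'" "0 <= b'" "0 <= c'" for t' a' b' c'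
 proof (cases "ps0 <= Ps t' a' b' c'")
  case True
  thus ?thesis using inR[OF that True] mx that by blast
 next
  case False thus ?thesis using ge0 by linarith
 qed
 have t0: "t = 0"
 proof (rule ccontr)
  assume "t \<noteq> 0"
  hence tp: "0 < t" using K by simp
  define y where "y = 2 * Da t a b"
  have y: "y \<in> {0..Mu}" using D0 DM(2)[of t a b] by (simp add: y_def)
  note xy = x[OF y]
  define e where "e = Dt t a b - 2 * Da t a b * Db t a b"
  \<comment> \<open>Maximality in \<open>a\<close> gives a parabola of slope
    \<open>(a - c) / eta\<close>. This slope is at most \<open>Da\<close>: for \<open>a > 0\<close>
    by moving to the left, and for \<open>a = 0\<close> because it is then not positive.\<close>
  have touch: "F t (a + h) b - F t a b - h * Da t a b <= h^2 / (2 * eta)" if h: "0 <= h" for h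
  proof -
   have up: "F t (a + h) b - F t a b <= h * ((a - c) / eta) + h^2 / (2 * eta)" if "- a <= h" for h
   proof -
    have "(a + h - c)^2 / (2 * eta) - (a - c)^2 / (2 * eta) = h * ((a - c) / eta) + h^2 / (2 * eta)"
     using eta by (simp add: divide_simps) (simp add: power2_eq_square algebra_simps)
    moreover have "Ps t (a + h) b c <= Ps t a b c" using K that by (intro gmx) auto
    ultimately show ?thesis unfolding Ps_def by linarith
   qed
   have "(a - c) / eta <= Da t a b"
   proof (cases "a = 0")
    case True
    hence "(a - c) / eta <= 0" using K eta by (simp add: divide_nonpos_pos)
    thus ?thesis using D0(2)[of t a b] by linarith
   next
    case False
    show ?thesis
    proof (rule field_le_epsilon)
     fix eps :: real assume eps: "0 < eps"
     define h where "h = min a (2 * eta * eps)"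
     have h: "0 < h" "h <= a" "h <= 2 * eta * eps" using False K eta eps by (auto simp: h_def)
     have "F t a b - F t (a - h) b <= h * Da t a b" using increment_le[of t "a - h" b 0 h 0] h K by simp
     hence "- h * Da t a b <= F t (a + - h) b - F t a b" by simp
     also have "... <= - h * ((a - c) / eta) + h^2 / (2 * eta)" using up[of "- h"] h by simp
     finally have le: "- h * Da t a b <= - h * ((a - c) / eta) + h^2 / (2 * eta)" .
     have "h * (h / (2 * eta)) = h^2 / (2 * eta)" by (simp add: power2_eq_square)
     hence "h * ((a - c) / eta) <= h * (Da t a b + h / (2 * eta))" using le unfolding distrib_left by linarith
     hence "(a - c) / eta <= Da t a b + h / (2 * eta)" using h(1) by (rule mult_left_le_imp_le)
     moreover have "h / (2 * eta) <= eps" using h eta by (simp add: pos_divide_le_eq mult_ac)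
     ultimately show "(a - c) / eta <= Da t a b + eps" by linarith
    qed
   qed
   hence "h * ((a - c) / eta) <= h * Da t a b" using h by (intro mult_left_mono)
   thus ?thesis using up[of h] h K by simp
  qed
  have "e < de / 2" unfolding e_def using inR[OF K ge0] K touch by (intro err) auto
  \<comment> \<open>From the maximum, time goes back by \<open>s\<close> while \<open>a\<close>,
    \<open>b\<close>, \<open>c\<close> move with velocity \<open>x y\<close>, \<open>y\<close>,
    \<open>x y\<close>. The difference \<open>a - c\<close> and its penalty stay fixed,
    \<open>V_dynamic\<close> controls \<open>V\<close>, and as \<open>y = 2 * Da\<close> the first
    order terms of \<open>F\<close> leave exactly the defect \<open>e\<close>.\<close>
  moreover have "de <= e + ka * (x y + y)"
  proof (rule field_le_epsilon)
   fix eps :: real assume eps: "0 < eps"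
   define q where "q = 1 + x y + y"
   have q: "1 <= q" using xy y by (simp add: q_def)
   \<comment> \<open>The three bounds keep the time nonnegative, stay within the range of
     \<open>F_quad\<close>, and make the quadratic error at most \<open>eps * s\<close>.\<close>
   define s where "s = Min {t, r / (2 * q), eps / (5 * C * q^2 + 1)}"
   have dpos: "0 < 5 * C * q^2 + 1" using C by (simp add: add_nonneg_pos)
   have s: "0 < s" "s <= t" "s <= r / (2 * q)" "s <= eps / (5 * C * q^2 + 1)"
    unfolding s_def using tp r q eps dpos by auto
   have sq: "s * q <= r / 2" using s(3) q by (simp add: pos_le_divide_eq mult_ac)
   have mv: "\<bar>(t - s) - t\<bar> + \<bar>(a + s * x y) - a\<bar> + \<bar>(b + s * y) - b\<bar> = s * q"
    using s xy y by (simp add: q_def algebra_simps)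
   have "\<bar>F (t - s) (a + s * x y) (b + s * y) - F t a b - (((t - s) - t) * Dt t a b + ((a + s * x y) - a) * Da t a b + ((b + s * y) - b) * Db t a b)\<bar> <= 5 * C * (s * q)^2"
    unfolding mv[symmetric] by (rule F_quad) (use K s xy y sq mv in auto)
   hence Fl: "F t a b + s * (- Dt t a b + x y * Da t a b + y * Db t a b) - 5 * C * (s * q)^2 <= F (t - s) (a + s * x y) (b + s * y)"
    by (simp add: abs_le_iff algebra_simps)
   have "Ps (t - s) (a + s * x y) (b + s * y) (c + s * x y) <= Ps t a b c"
    using K s xy y by (intro gmx) auto
   hence "F (t - s) (a + s * x y) (b + s * y) - V (t - s) (c + s * x y) (b + s * y) - ka * s * (x y + y) + de * s <= F t a b - V t c b"
    unfolding Ps_def by (simp add: algebra_simps)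
   moreover have "V (t - s) (c + s * x y) (b + s * y) - s * x y * y / 2 <= V t c b"
    using V_dynamic[OF tp K(5,4) _ s(2) y sep] s by simp
   ultimately have "F (t - s) (a + s * x y) (b + s * y) - ka * s * (x y + y) + de * s <= F t a b + s * x y * y / 2" by linarith
   hence main: "s * (- Dt t a b + x y * Da t a b + y * Db t a b) - 5 * C * (s * q)^2 - ka * s * (x y + y) + de * s <= s * x y * y / 2"
    using Fl by linarith
   have Ge: "- Dt t a b + x y * Da t a b + y * Db t a b = - e + x y * y / 2" by (simp add: e_def y_def algebra_simps)
   have "s * de <= s * (e + ka * (x y + y) + 5 * C * q^2 * s)"
    using main unfolding Ge by (simp add: power2_eq_square algebra_simps)
   hence "de <= e + ka * (x y + y) + 5 * C * q^2 * s" using s(1) by simp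
   moreover have "5 * C * q^2 * s <= eps"
   proof -
    have "5 * C * q^2 * s <= (5 * C * q^2 + 1) * s" using s by (intro mult_right_mono) auto
    also have "... <= eps" using s(4) dpos by (simp add: pos_le_divide_eq mult.commute)
    finally show ?thesis .
   qed
   ultimately show "de <= e + ka * (x y + y) + eps" by linarith
  qed
  moreover have "ka * (x y + y) <= ka * (X + Mu)" using xy y ka by (intro mult_left_mono add_mono) auto
  ultimately show False using ka(2) by linarith
 qed
 have "Ps t a b c <= Mu^2 * eta / 8"
 proof -
  have "F 0 a b - F 0 c b <= Mu / 2 * \<bar>a - c\<bar>" using F_lip[of 0 c b 0 a b] K abs_ge_self[of "F 0 a b - F 0 c b"] by (simp add: mult.commute)
  moreover have "0 <= ka * (c + b)" using ka K by simp
  moreover have "Mu / 2 * \<bar>a - c\<bar> - (a - c)\<^sup>2 / (2 * eta) <= Mu^2 * eta / 8" using quadb(2)[of "\<bar>a - c\<bar>"] by simp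
  ultimately show ?thesis unfolding Ps_def t0 V0 by simp
 qed
 hence "ps0 <= Mu^2 * eta / 8" using ge0 by linarith
 thus ?thesis using VT unfolding ps0_def Ps_def by simp
qed

end

end

section \<open>Lower bound by an energy estimate\<close>

context approx_hj
begin

text \<open>\<open>energy\<close> measures by how much \<open>F\<close> along a characteristic line falls below the level \<open>c\<close>. It
 starts from \<open>0\<close>, and its growth is controlled by the defect of the equation, because \<open>Da\<close> is monotone
 in \<open>b\<close> and the second mean value theorem turns the transport term into a boundary term.\<close>

context
 fixes x T B c :: real
 assumes x: "0 <= x" and T: "0 < T" and B: "0 < B"
  and c0: "!!b. b \<in> {0..B} ==> c <= F 0 (T * x) b - x * b / 2" and cB: "c <= F 0 0 B - x * B / 2"
begin

definition "line a t b = F t (a + (T - t) * x) b - x * b / 2"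
definition "energy a t = integral {0..B} (%b. (max 0 (c - line a t b))^2)"
definition "defect t a b = Dt t a b - 2 * Da t a b * Db t a b"
definition "depth = \<bar>c\<bar> + x * B / 2 + \<bar>F 0 0 0\<bar>"

lemma arg_nonneg: "0 <= a ==> t \<in> {0..T} ==> 0 <= a + (T - t) * x"
 using x by simp

lemma line_deriv_t:
 assumes a: "0 <= a" and b: "0 <= b" and t: "t \<in> {0..T}"
 shows "((%t. line a t b) has_field_derivative (Dt t (a + (T - t) * x) b - x * Da t (a + (T - t) * x) b)) (at t within {0..T})"
proof (rule quad_deriv[of "r / (2 * (1 + x))"])
 show "0 < r / (2 * (1 + x))" using r x by (intro divide_pos_pos) auto
 fix s assume s: "s \<in> {0..T}" and d: "\<bar>s - t\<bar> <= r / (2 * (1 + x))"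
 define al where "al = a + (T - t) * x"
 define be where "be = a + (T - s) * x"
 have ba: "be - al = - ((s - t) * x)" by (simp add: al_def be_def algebra_simps)
 have "\<bar>be - al\<bar> = \<bar>s - t\<bar> * x" unfolding ba using x by (simp add: abs_mult)
 hence sz: "\<bar>s - t\<bar> + \<bar>be - al\<bar> + \<bar>b - b\<bar> = \<bar>s - t\<bar> * (1 + x)" by (simp add: algebra_simps)
 have "\<bar>s - t\<bar> * (1 + x) <= r / (2 * (1 + x)) * (1 + x)" using d x by (intro mult_right_mono) auto
 also have "... = r / 2" using x by (simp add: field_simps)
 finally have le: "\<bar>s - t\<bar> * (1 + x) <= r / 2" .
 have "\<bar>F s be b - F t al b - ((s - t) * Dt t al b + (be - al) * Da t al b + (b - b) * Db t al b)\<bar> <= 5 * C * (\<bar>s - t\<bar> * (1 + x))^2"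
  unfolding sz[symmetric]
  by (rule F_quad) (use s t a b arg_nonneg[OF a] le sz in \<open>auto simp: al_def be_def\<close>)
 also have "(s - t) * Dt t al b + (be - al) * Da t al b + (b - b) * Db t al b = (Dt t al b - x * Da t al b) * (s - t)"
  unfolding ba by (simp add: algebra_simps)
 also have "5 * C * (\<bar>s - t\<bar> * (1 + x))^2 = (5 * C * (1 + x)^2) * (s - t)^2" by (simp add: power_mult_distrib)
 finally show "\<bar>line a s b - line a t b - (Dt t (a + (T - t) * x) b - x * Da t (a + (T - t) * x) b) * (s - t)\<bar> <= (5 * C * (1 + x)^2) * (s - t)^2"
  by (simp add: line_def al_def be_def)
qed

lemma line_deriv_b:
 assumes a: "0 <= a" and b: "b \<in> {0..B}" and t: "t \<in> {0..T}"
 shows "((%b. line a t b) has_field_derivative (Db t (a + (T - t) * x) b - x / 2)) (at b within {0..B})"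
proof (rule quad_deriv[of "r / 2"])
 show "0 < r / 2" using r by simp
 fix s assume s: "s \<in> {0..B}" and d: "\<bar>s - b\<bar> <= r / 2"
 define al where "al = a + (T - t) * x"
 have "\<bar>F t al s - F t al b - ((t - t) * Dt t al b + (al - al) * Da t al b + (s - b) * Db t al b)\<bar> <= 5 * C * (\<bar>t - t\<bar> + \<bar>al - al\<bar> + \<bar>s - b\<bar>)^2"
  by (rule F_quad) (use s t a b arg_nonneg[OF a] d in \<open>auto simp: al_def\<close>)
 hence "\<bar>F t al s - F t al b - (s - b) * Db t al b\<bar> <= 5 * C * (s - b)^2" by simp
 moreover have "line a t s - line a t b - (Db t (a + (T - t) * x) b - x / 2) * (s - b) = F t al s - F t al b - (s - b) * Db t al b"
  by (simp add: line_def al_def algebra_simps diff_divide_distrib)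
 ultimately show "\<bar>line a t s - line a t b - (Db t (a + (T - t) * x) b - x / 2) * (s - b)\<bar> <= (5 * C) * (s - b)^2" by simp
qed

lemma cont_along:
 assumes a: "0 <= a" and f: "continuous_on orth (%(t, a, b). f t a b)"
 shows "continuous_on ({0..T} \<times> {0..B}) (%(t, b). f t (a + (T - t) * x) b)" (is ?C1)
  "t \<in> {0..T} ==> continuous_on {0..B} (%b. f t (a + (T - t) * x) b)"
proof -
 have "continuous_on ({0..T} \<times> {0..B}) (%p. (case (fst p, a + (T - fst p) * x, snd p) of (t, a, b) => f t a b))"
  by (rule continuous_on_compose2[OF f]) (use arg_nonneg[OF a] in \<open>auto intro!: continuous_intros simp: orth_def\<close>)
 thus 1: ?C1 by (simp add: case_prod_unfold)
 assume t: "t \<in> {0..T}"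
 have "continuous_on {0..B} (%b. (case (t, b) of (t, b) => f t (a + (T - t) * x) b))"
  by (rule continuous_on_compose2[OF 1]) (use t in \<open>auto intro!: continuous_intros\<close>)
 thus "continuous_on {0..B} (%b. f t (a + (T - t) * x) b)" by simp
qed

lemma line_cont:
 assumes a: "0 <= a"
 shows "continuous_on ({0..T} \<times> {0..B}) (%(t, b). line a t b)" "t \<in> {0..T} ==> continuous_on {0..B} (line a t)"
 using cont_along[OF a F_cont] unfolding line_def case_prod_unfold by (auto intro!: continuous_intros)

lemma line_depth:
 assumes a: "0 <= a" and b: "b \<in> {0..B}" and t: "t \<in> {0..T}"
 shows "max 0 (c - line a t b) <= depth"
proof -
 have "F 0 0 0 <= F t (a + (T - t) * x) b" using arg_nonneg[OF a t] b t by (intro F_mono) auto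
 moreover have "x * b / 2 <= x * B / 2" using x b by (intro divide_right_mono mult_left_mono) auto
 moreover have "0 <= x * B / 2" using x B by simp
 ultimately show ?thesis unfolding line_def depth_def by linarith
qed

lemma depth_nonneg: "0 <= depth" unfolding depth_def using x B by simp

lemma energy_deriv:
 assumes a: "0 <= a" and t: "t \<in> {0..T}"
 shows "\<exists>D. (energy a has_field_derivative D) (at t within {0..T}) \<and> D <= 2 * depth * integral {0..B} (%b. \<bar>defect t (a + (T - t) * x) b\<bar>)"
proof -
 define al where "al = (%t. a + (T - t) * x)"
 define p where "p = (%t b. max 0 (c - line a t b))"
 define g where "g = (%t b. 2 * p t b * - (Dt t (al t) b - x * Da t (al t) b))"
 define u where "u = (%b. 2 * p t b * - (Db t (al t) b - x / 2))"
 have pc: "continuous_on ({0..T} \<times> {0..B}) (%(t, b). p t b)" "!!t. t \<in> {0..T} ==> continuous_on {0..B} (p t)"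
  using line_cont[OF a] unfolding p_def case_prod_unfold by (auto intro!: continuous_intros)
 note Dc = D_cont[THEN cont_along(1)[OF a]] D_cont[THEN cont_along(2)[OF a _ t]]
 have gt: "((%t. (p t b)^2) has_field_derivative g t b) (at t within {0..T})" if "t \<in> {0..T}" "b \<in> {0..B}" for t b
 proof -
  have "((%t. c - line a t b) has_field_derivative - (Dt t (al t) b - x * Da t (al t) b)) (at t within {0..T})"
   using DERIV_diff[OF DERIV_const line_deriv_t[OF a _ that(1)], of b c] that unfolding al_def by simp
  from DERIV_chain2[OF DERIV_pos_part_sq this] show ?thesis unfolding p_def g_def .
 qed
 have gb: "((%b. (p t b)^2) has_field_derivative u b) (at b within {0..B})" if "b \<in> {0..B}" for b
 proof -
  have "((%b. c - line a t b) has_field_derivative - (Db t (al t) b - x / 2)) (at b within {0..B})"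
   using DERIV_diff[OF DERIV_const line_deriv_b[OF a that t], of c] unfolding al_def by simp
  from DERIV_chain2[OF DERIV_pos_part_sq this] show ?thesis unfolding p_def u_def .
 qed
 have "((%t. integral (cbox 0 B) (%b. (p t b)^2)) has_field_derivative integral (cbox 0 B) (g t)) (at t within {0..T})"
 proof (rule leibniz_rule_field_derivative)
  show "((%t. (p t b)^2) has_field_derivative g t b) (at t within {0..T})" if "t \<in> {0..T}" "b \<in> cbox 0 B" for t b
   using gt that by simp
  show "(%b. (p t b)^2) integrable_on cbox 0 B" if "t \<in> {0..T}" for t
   using pc(2)[OF that] by (intro integrable_continuous) (auto intro!: continuous_intros)
  show "continuous_on ({0..T} \<times> cbox 0 B) (%(t, b). g t b)"
   unfolding g_def al_def case_prod_unfold cbox_interval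
   by (intro continuous_intros pc(1)[unfolded case_prod_unfold] Dc(1,2)[unfolded case_prod_unfold])
 qed (use t in auto)
 hence D: "(energy a has_field_derivative integral {0..B} (g t)) (at t within {0..T})"
  unfolding energy_def[abs_def] p_def by simp
 have uc: "continuous_on {0..B} u" unfolding u_def al_def by (intro continuous_intros pc(2)[OF t] Dc(6))
 have ui: "u integrable_on {0..B}" by (rule integrable_continuous_real[OF uc])
 have ftc: "integral {s..s'} u = (p t s')^2 - (p t s)^2" if "0 <= s" "s <= s'" "s' <= B" for s s'
 proof (rule integral_unique, rule fundamental_theorem_of_calculus[OF that(2)])
  fix b assume b: "b \<in> {s..s'}"
  show "((%b. (p t b)^2) has_vector_derivative u b) (at b within {s..s'})"
   using has_vector_derivative_within_subset[OF gb[unfolded has_real_derivative_iff_has_vector_derivative]] b that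
   by (metis atLeastAtMost_iff atLeastatMost_subset_iff order_trans)
 qed
 \<comment> \<open>\<open>cB\<close> is stated with \<open>F 0 0 B\<close>, the smallest value of
   \<open>F\<close> at \<open>b = B\<close>, so the deficit vanishes there at all times and the
   boundary term at \<open>B\<close> drops out.\<close>
 have pB: "p t B = 0"
 proof -
  have "F 0 0 B <= F t (a + (T - t) * x) B" using arg_nonneg[OF a t] B t by (intro F_mono) auto
  thus ?thesis using cB unfolding p_def line_def by simp
 qed
 have mono_Da: "Da t (al t) b <= Da t (al t) b'" if "0 <= b" "b <= b'" for b b'
  using mono[of t "al t" b t "al t" b'] arg_nonneg[OF a t] t that by (auto simp: al_def)
 obtain s where s: "s \<in> {0..B}"
  and smv: "integral {0..B} (%b. Da t (al t) b * u b) = Da t (al t) 0 * integral {0..s} u + Da t (al t) B * integral {s..B} u"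
  by (rule second_mean_value_theorem[OF ui less_imp_le[OF B], of "%b. Da t (al t) b"], rule mono_Da)
 have "integral {0..B} (%b. Da t (al t) b * u b) = - (Da t (al t) 0 * (p t 0)^2) - (Da t (al t) B - Da t (al t) 0) * (p t s)^2"
 proof -
  have I: "integral {0..s} u = (p t s)^2 - (p t 0)^2" "integral {s..B} u = - (p t s)\<^sup>2"
   using ftc[of 0 s] ftc[of s B] s pB by auto
  show ?thesis unfolding smv I by (simp add: algebra_simps)
 qed
 also have "... <= 0"
 proof -
  have "0 <= Da t (al t) 0 * (p t 0)^2" using D0(2) by (intro mult_nonneg_nonneg) auto
  moreover have "0 <= (Da t (al t) B - Da t (al t) 0) * (p t s)^2" using mono_Da[of 0 B] B by (intro mult_nonneg_nonneg) auto
  ultimately show ?thesis by linarith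
 qed
 finally have bd: "integral {0..B} (%b. Da t (al t) b * u b) <= 0" .
 have dc: "continuous_on {0..B} (%b. defect t (al t) b)"
  unfolding defect_def al_def by (intro continuous_intros Dc(4-6))
 have i1: "(%b. 2 * depth * \<bar>defect t (al t) b\<bar>) integrable_on {0..B}"
  by (intro integrable_continuous_real continuous_intros dc)
 have i2: "(%b. 2 * (Da t (al t) b * u b)) integrable_on {0..B}"
  unfolding al_def by (intro integrable_continuous_real continuous_intros uc Dc(5))
 have ig: "g t integrable_on {0..B}"
  unfolding g_def[abs_def] al_def by (intro integrable_continuous_real continuous_intros pc(2)[OF t] Dc(4,5))
 have "integral {0..B} (g t) <= integral {0..B} (%b. 2 * depth * \<bar>defect t (al t) b\<bar> + 2 * (Da t (al t) b * u b))"
 proof (rule integral_le[OF ig integrable_add[OF i1 i2]])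
  fix b assume b: "b \<in> {0..B}"
  \<comment> \<open>\<open>Dt\<close> is replaced by the defect plus \<open>2 * Da * Db\<close>;
    what remains is \<open>2 * Da\<close> times the derivative \<open>u\<close> of the squared
    deficit in \<open>b\<close>.\<close>
  have "g t b = 2 * p t b * - defect t (al t) b + 2 * (Da t (al t) b * u b)"
   by (simp add: g_def u_def defect_def algebra_simps)
  moreover have "2 * p t b * - defect t (al t) b <= 2 * depth * \<bar>defect t (al t) b\<bar>"
  proof -
   have "2 * p t b * - defect t (al t) b <= 2 * p t b * \<bar>defect t (al t) b\<bar>" by (intro mult_left_mono) (auto simp: p_def)
   also have "... <= 2 * depth * \<bar>defect t (al t) b\<bar>" using line_depth[OF a b t] by (intro mult_right_mono) (auto simp: p_def)
   finally show ?thesis .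
  qed
  ultimately show "g t b <= 2 * depth * \<bar>defect t (al t) b\<bar> + 2 * (Da t (al t) b * u b)" by linarith
 qed
 also have "... = 2 * depth * integral {0..B} (%b. \<bar>defect t (al t) b\<bar>) + 2 * integral {0..B} (%b. Da t (al t) b * u b)"
  using integral_add[OF i1 i2] by simp
 finally show ?thesis using D bd unfolding al_def by (intro exI[of _ "integral {0..B} (g t)"]) auto
qed

text \<open>If \<open>F T 0 0\<close> were below \<open>c - 2 * om\<close>, the Lipschitz bounds
  would keep \<open>F\<close> at time \<open>T\<close> below \<open>c - om\<close> on a box of sides
  \<open>be'\<close> and \<open>be\<close>, and each energy started in \<open>[0, be']\<close> would
  reach \<open>be * om^2\<close>. But the energies start from \<open>0\<close> and grow only through
  the defect. They are averaged over the starting points \<open>p j\<close> because the defect is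
  assumed small only on average over these.\<close>

theorem lower_bound:
 fixes N :: nat and p :: "nat => real" and E be be' om :: real
 assumes N: "0 < N" and p: "!!j. j < N ==> 0 <= p j \<and> p j <= be'"
  and E: "!!t b. t \<in> {0..T} ==> b \<in> {0..B} ==> (\<Sum>j<N. \<bar>defect t (p j + (T - t) * x) b\<bar>) <= N * E"
  and be: "0 < be" "be <= B" and om: "0 < om" "Mu / 2 * be' + Mv / 2 * be <= om"
  and small: "2 * depth * (B * E) * T < be * om^2"
 shows "c - 2 * om <= F T 0 0"
proof (rule ccontr)
 assume "\<not> c - 2 * om <= F T 0 0"
 hence low: "F T 0 0 < c - 2 * om" by simp
 define J where "J = (%t. \<Sum>j<N. energy (p j) t)"
 have "\<forall>j t. \<exists>D. j < N \<and> t \<in> {0..T} --> (energy (p j) has_field_derivative D) (at t within {0..T}) \<and> D <= 2 * depth * integral {0..B} (%b. \<bar>defect t (p j + (T - t) * x) b\<bar>)"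
  using energy_deriv p by blast
 then obtain D where D: "!!j t. j < N ==> t \<in> {0..T} ==> (energy (p j) has_field_derivative D j t) (at t within {0..T})"
   "!!j t. j < N ==> t \<in> {0..T} ==> D j t <= 2 * depth * integral {0..B} (%b. \<bar>defect t (p j + (T - t) * x) b\<bar>)"
  by metis
 have JD: "(J has_field_derivative (\<Sum>j<N. D j t)) (at t within {0..T})" if "t \<in> {0..T}" for t
  unfolding J_def using D(1) that by (intro DERIV_sum) auto
 have Dle: "(\<Sum>j<N. D j t) <= 2 * depth * (B * (N * E))" if t: "t \<in> {0..T}" for t
 proof -
  have dc: "(%b. \<bar>defect t (p j + (T - t) * x) b\<bar>) integrable_on {0..B}" if "j < N" for j
  proof -
   have "0 <= p j" using p[OF that] by simp
   note Dc = D_cont[THEN cont_along(2)[OF this _ t]]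
   have "continuous_on {0..B} (%b. \<bar>defect t (p j + (T - t) * x) b\<bar>)"
    unfolding defect_def by (intro continuous_intros Dc)
   thus ?thesis by (rule integrable_continuous_real)
  qed
  have "(\<Sum>j<N. D j t) <= (\<Sum>j<N. 2 * depth * integral {0..B} (%b. \<bar>defect t (p j + (T - t) * x) b\<bar>))"
   using D(2) t by (intro sum_mono) auto
  also have "... = 2 * depth * integral {0..B} (%b. \<Sum>j<N. \<bar>defect t (p j + (T - t) * x) b\<bar>)"
   using dc by (subst integral_sum) (auto simp: sum_distrib_left)
  also have "... <= 2 * depth * integral {0..B} (%b. N * E)"
   using dc E[OF t] depth_nonneg by (intro mult_left_mono integral_le integrable_sum) auto
  also have "... = 2 * depth * (B * (N * E))" using B by simp
  finally show ?thesis .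
 qed
 obtain xi where xi: "xi \<in> {0<..<T}" and mvt: "J T - J 0 = (\<Sum>j<N. D j xi) * (T - 0)"
  using mvt_simple[OF T, of J "%t. (*) (\<Sum>j<N. D j t)"] JD unfolding has_field_derivative_def by auto
 have J0: "J 0 = 0"
 proof -
  have "energy (p j) 0 = 0" if "j < N" for j
  proof -
   have "energy (p j) 0 = integral {0..B} (%b. 0)" unfolding energy_def
   proof (rule integral_cong)
    fix b assume b: "b \<in> {0..B}"
    have "F 0 (T * x) b <= F 0 (p j + (T - 0) * x) b" using p[OF that] x T b by (intro F_mono) auto
    thus "(max 0 (c - line (p j) 0 b))^2 = 0" using c0[OF b] by (simp add: line_def)
   qed
   thus ?thesis by simp
  qed
  thus ?thesis by (simp add: J_def)
 qed
 have "N * (be * om^2) <= J T"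
 proof -
  have "be * om^2 <= energy (p j) T" if j: "j < N" for j
  proof -
   have i: "(%b. (max 0 (c - line (p j) T b))^2) integrable_on {0..B}"
    using line_cont(2)[of "p j" T] p[OF j] T by (intro integrable_continuous_real) (auto intro!: continuous_intros)
   have "be * om^2 = integral {0..be} (%b. om^2)" using be by simp
   also have "... <= integral {0..be} (%b. (max 0 (c - line (p j) T b))^2)"
   proof (rule integral_le)
    show "(%b. (max 0 (c - line (p j) T b))^2) integrable_on {0..be}"
     by (rule integrable_on_subinterval[OF i]) (use be in auto)
    fix b assume b: "b \<in> {0..be}"
    have "F T (p j) b <= F T 0 0 + (T - T) * Mt + (p j - 0) * (Mu / 2) + (b - 0) * (Mv / 2)"
     using p[OF j] b T by (intro F_mono) auto
    also have "... <= F T 0 0 + (be' * (Mu / 2) + be * (Mv / 2))"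
    proof -
     have "p j * (Mu / 2) <= be' * (Mu / 2)" "b * (Mv / 2) <= be * (Mv / 2)"
      using p[OF j] b M0 by (auto intro!: mult_right_mono)
     thus ?thesis by simp
    qed
    finally have "F T (p j) b <= F T 0 0 + om" using om(2) by (simp add: mult.commute)
    moreover have "0 <= x * b / 2" using x b by simp
    ultimately have "om <= c - line (p j) T b" using low by (simp add: line_def)
    thus "om^2 <= (max 0 (c - line (p j) T b))^2" using om by (intro power_mono) auto
   qed (rule integrable_const_ivl)
   also have "... <= energy (p j) T" unfolding energy_def
    by (rule integral_subset_le) (use be i in \<open>auto intro!: integrable_on_subinterval[OF i]\<close>)
   finally show ?thesis .
  qed
  hence "(\<Sum>j<N. be * om^2) <= J T" unfolding J_def by (intro sum_mono) auto
  thus ?thesis by simp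
 qed
 moreover have "J T <= 2 * depth * (B * (N * E)) * T" using mvt J0 Dle[of xi] xi T by (simp add: mult_right_mono)
 ultimately have "N * (be * om^2) <= N * (2 * depth * (B * E) * T)" by (simp add: algebra_simps)
 hence "be * om^2 <= 2 * depth * (B * E) * T" using N by simp
 thus False using small by simp
qed

end

text \<open>By convexity a remainder is at most \<open>h\<close> times the increase of
  \<open>Da\<close> over \<open>k\<close> grid points, since \<open>h <= k * s\<close>. The sum
  telescopes, leaving \<open>k\<close> terms at the upper end, each at most \<open>Mu / 2\<close>.
  The bound does not depend on \<open>N\<close>, so the average over a long grid is small.\<close>

lemma sum_Delta_le:
 fixes N k :: nat and s h :: real
 assumes t: "0 <= t" "0 <= a" "0 <= b" and s: "0 <= s" and h: "0 <= h" "h <= k * s"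
 shows "(\<Sum>j<N. F t (a + j * s + h) b - F t (a + j * s) b - h * Da t (a + j * s) b) <= h * (k * (Mu / 2))"
proof -
 define ph where "ph = (%j::nat. Da t (a + j * s) b)"
 have le: "F t (a + j * s + h) b - F t (a + j * s) b - h * Da t (a + j * s) b <= h * (ph (j + k) - ph j)" for j :: nat
 proof -
  have js: "0 <= j * s" using s by simp
  have "F t (a + j * s + h) b - F t (a + j * s) b <= h * Da t (a + j * s + h) b"
   using increment_le[of t "a + j * s" b 0 h 0] t js h by simp
  moreover have "Da t (a + j * s + h) b <= ph (j + k)"
   unfolding ph_def using mono[of t "a + j * s + h" b t "a + (j + k) * s" b] t js h by (simp add: algebra_simps)
  hence "h * Da t (a + j * s + h) b <= h * ph (j + k)" using h by (intro mult_left_mono)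
  ultimately show ?thesis by (simp add: ph_def algebra_simps)
 qed
 have tel: "(\<Sum>j<N. ph (j + k)) + (\<Sum>j<k. ph j) = (\<Sum>j<N. ph j) + (\<Sum>j<k. ph (N + j))"
 proof -
  have split: "(\<Sum>j<p + q. ph j) = (\<Sum>j<p. ph j) + (\<Sum>j<q. ph (p + j))" for p q
   by (induct q) (simp_all add: add.assoc[symmetric])
  have "(\<Sum>j<N. ph (j + k)) = (\<Sum>j<N. ph (k + j))" by (simp only: add.commute)
  thus ?thesis using split[of N k] split[of k N] by (simp only: add.commute)
 qed
 have "(\<Sum>j<N. ph (j + k) - ph j) = (\<Sum>j<k. ph (N + j)) - (\<Sum>j<k. ph j)" using tel by (simp add: sum_subtractf)
 also have "... <= (\<Sum>j<k. Mu / 2) - 0" using D0(2) DM(2) by (intro diff_mono sum_mono sum_nonneg) (auto simp: ph_def)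
 finally have "h * (\<Sum>j<N. ph (j + k) - ph j) <= h * (k * (Mu / 2))" using h by (intro mult_left_mono) auto
 moreover have "(\<Sum>j<N. F t (a + j * s + h) b - F t (a + j * s) b - h * Da t (a + j * s) b) <= h * (\<Sum>j<N. ph (j + k) - ph j)"
  unfolding sum_distrib_left by (intro sum_mono le)
 ultimately show ?thesis by linarith
qed

end

section \<open>Marginal channels and the initial value\<close>

lemma obs_law_marginal:
 assumes c: "channel M J f" and c': "channel M' I f'"
  and xi: "xi \<in> measurable M M'" "distr M M' xi = M'"
  and io: "inj_on io I" "io ` I \<subseteq> J"
  and eq: "!!i w. i \<in> I ==> w \<in> space M ==> f (io i) w = f' i (xi w)"
 shows "(%y. \<lambda>i\<in>I. y (io i)) \<in> measurable (std_gauss J) (std_gauss I)"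
  "distr (obs_law M J f) (std_gauss I) (%y. \<lambda>i\<in>I. y (io i)) = obs_law M' I f'"
proof -
 interpret A: channel M J f by fact
 interpret B: channel M' I f' by fact
 let ?r = "%y. \<lambda>i\<in>I. y (io i)"
 show r: "?r \<in> measurable (std_gauss J) (std_gauss I)"
  using io by (intro measurable_restrict measurable_component_singleton) auto
 have dr: "distr (std_gauss J) (std_gauss I) ?r = std_gauss I"
  using io by (intro distr_PiM_reindex prob_space_std_normal) auto
 have mp: "(%(w, z). (xi w, ?r z)) \<in> measurable (M \<Otimes>\<^sub>M std_gauss J) (M' \<Otimes>\<^sub>M std_gauss I)"
  using xi(1) r by (simp add: measurable_split_conv)
 have pm: "distr (M \<Otimes>\<^sub>M std_gauss J) (M' \<Otimes>\<^sub>M std_gauss I) (%(w, z). (xi w, ?r z)) = M' \<Otimes>\<^sub>M std_gauss I"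
  using pair_measure_distr[OF xi(1) r] unfolding dr xi(2) by (simp add: B.G.sigma_finite_measure_axioms)
 have "distr (obs_law M J f) (std_gauss I) ?r = distr (M \<Otimes>\<^sub>M std_gauss J) (std_gauss I) (?r \<circ> (%p. \<lambda>i\<in>J. snd p i + f i (fst p)))"
  unfolding A.distr_planted[symmetric] by (rule distr_distr[OF r A.shift_meas])
 also have "... = distr (M \<Otimes>\<^sub>M std_gauss J) (std_gauss I) ((%p. \<lambda>i\<in>I. snd p i + f' i (fst p)) \<circ> (%(w, z). (xi w, ?r z)))"
  by (rule distr_cong) (use eq io in \<open>auto simp: space_pair_measure fun_eq_iff\<close>)
 also have "... = obs_law M' I f'"
  unfolding distr_distr[OF B.shift_meas mp, symmetric] pm B.distr_planted by (rule refl)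
 finally show "distr (obs_law M J f) (std_gauss I) ?r = obs_law M' I f'" .
qed

lemma integral_obs_law_marginal:
 fixes h :: "('i => real) => real"
 assumes m: "channel M J f" "channel M' I f'" "xi \<in> measurable M M'" "distr M M' xi = M'" "inj_on io I" "io ` I \<subseteq> J"
  "!!i w. i \<in> I ==> w \<in> space M ==> f (io i) w = f' i (xi w)" and h: "h \<in> borel_measurable (std_gauss I)"
 shows "(LINT y|obs_law M J f. h (\<lambda>i\<in>I. y (io i))) = (LINT y|obs_law M' I f'. h y)" (is ?C1)
  "integrable (obs_law M J f) (%y. h (\<lambda>i\<in>I. y (io i))) \<longleftrightarrow> integrable (obs_law M' I f') h" (is ?C2)
proof -
 have d1: "(%y. \<lambda>i\<in>I. y (io i)) \<in> measurable (std_gauss J) (std_gauss I)"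
  by (rule obs_law_marginal(1)[OF m])
 have d2: "distr (obs_law M J f) (std_gauss I) (%y. \<lambda>i\<in>I. y (io i)) = obs_law M' I f'"
  by (rule obs_law_marginal(2)[OF m])
 have r: "(%y. \<lambda>i\<in>I. y (io i)) \<in> measurable (obs_law M J f) (std_gauss I)"
  using d1 by (simp add: measurable_cong_sets[OF channel.sets_obs_law[OF m(1)] refl])
 show ?C1
  by (rule trans[OF integral_distr[OF r h, symmetric]]) (rule arg_cong[OF d2])
 show ?C2
  by (rule trans[OF integrable_distr_eq[OF r h, symmetric]]) (rule arg_cong[OF d2])
qed

text \<open>A coordinate with zero signal contributes a factor \<open>1\<close> to the likelihood,
  so dropping it does not change the entropy.\<close>

lemma ent_reindex:
 assumes c: "channel M J f" "channel M I f'" and io: "inj_on io I" "io ` I \<subseteq> J"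
  and eq: "!!i w. i \<in> I ==> w \<in> space M ==> f (io i) w = f' i w"
  and zero: "!!k w. k \<in> J ==> k \<notin> io ` I ==> w \<in> space M ==> f k w = 0"
 shows "ent M J f = ent M I f'"
proof -
 interpret A: channel M J f by fact
 interpret B: channel M I f' by fact
 have "lik J f y w = lik I f' (\<lambda>i\<in>I. y (io i)) w" if w: "w \<in> space M" for y w
 proof -
  have "(\<Sum>k\<in>J. f k w * y k - (f k w)^2 / 2) = (\<Sum>k\<in>io ` I. f k w * y k - (f k w)^2 / 2)"
   using io zero w A.fin by (intro sum.mono_neutral_right) auto
  also have "... = (\<Sum>i\<in>I. f' i w * y (io i) - (f' i w)^2 / 2)"
   using eq w by (simp add: sum.reindex[OF io(1)])
  finally show ?thesis by (simp add: lik_def)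
 qed
 hence "partf M J f y = partf M I f' (\<lambda>i\<in>I. y (io i))" for y
  unfolding partf_def by (intro Bochner_Integration.integral_cong) auto
 thus ?thesis unfolding ent_def
  using integral_obs_law_marginal(1)[OF c measurable_ident_sets[OF refl] _ io, of "%y. ln (partf M I f' y)"] eq
  by (simp add: distr_id2)
qed

definition scal :: "real measure => (real => real) => real => real"
 where "scal P e g = ent P {()} (amp (%_. e) (%_. g))"

lemma (in prior) bsnr_clip: "0 <= K ==> bsnr P {()} (%_. clip K) K"
 by (intro bsnr.intro snr.intro snr_axioms.intro bsnr_axioms.intro prob_space_axioms) (auto simp: clip_bound)

lemma (in prior) scal_0: "scal P e 0 = 0"
 by (simp add: scal_def ent_def partf_def lik_def amp_def prob_space[simplified])

context clipped_model
begin

lemma lik_init: "lik Ix (amp (msig K) (msnr n 0 a b)) y w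
 = (\<Prod>i<n. lik {()} (amp (%_. clip K) (%_. a)) (%_. y (Inr (Inl i))) (fst w i))
 * (\<Prod>j<m. lik {()} (amp (%_. clip K) (%_. b)) (%_. y (Inr (Inr j))) (snd w j))"
 unfolding lik_def sum_midx exp_add by (simp add: amp_def exp_sum)

lemma integral_prod_model:
 assumes f: "!!i. i < n ==> integrable PU (f i)" and g: "!!j. j < m ==> integrable PV (g j)"
 shows "(LINT w|Om. (\<Prod>i<n. f i (fst w i)) * (\<Prod>j<m. g j (snd w j))) = (\<Prod>i<n. LINT x|PU. f i x) * ((\<Prod>j<m. LINT x|PV. g j x) :: real)"
proof -
 have ps: "product_sigma_finite (%_::nat. PU)" "product_sigma_finite (%_::nat. PV)"
  unfolding product_sigma_finite_def using U.sigma_finite_measure_axioms V.sigma_finite_measure_axioms by auto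
 note PU = product_sigma_finite.product_integrable_prod[OF ps(1)] product_sigma_finite.product_integral_prod[OF ps(1)]
 note PV = product_sigma_finite.product_integrable_prod[OF ps(2)] product_sigma_finite.product_integral_prod[OF ps(2)]
 have 1: "integrable UU (%u. \<Prod>i<n. f i (u i))" "(LINT u|UU. (\<Prod>i<n. f i (u i))) = (\<Prod>i<n. LINT x|PU. f i x)"
  using f by (auto intro!: PU)
 have 2: "integrable VV (%v. \<Prod>j<m. g j (v j))" "(LINT v|VV. (\<Prod>j<m. g j (v j))) = (\<Prod>j<m. LINT x|PV. g j x)"
  using g by (auto intro!: PV)
 have "integrable Om (%w. (\<Prod>i<n. f i (fst w i)) * (\<Prod>j<m. g j (snd w j)))"
 proof (rule UV.Fubini_integrable)
  have [measurable]: "(%u. \<Prod>i<n. f i (u i)) \<in> borel_measurable UU" "(%v. \<Prod>j<m. g j (v j)) \<in> borel_measurable VV"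
   using 1(1) 2(1) by auto
  show "(%w. (\<Prod>i<n. f i (fst w i)) * (\<Prod>j<m. g j (snd w j))) \<in> borel_measurable Om" by measurable
  show "integrable UU (%u. LINT v|VV. norm ((\<Prod>i<n. f i (fst (u, v) i)) * (\<Prod>j<m. g j (snd (u, v) j))))"
   using 1(1) by (simp add: abs_mult)
  show "AE u in UU. integrable VV (%v. (\<Prod>i<n. f i (fst (u, v) i)) * (\<Prod>j<m. g j (snd (u, v) j)))"
   using 2(1) by simp
 qed
 from UV.integral_fst'[OF this] show ?thesis using 1 2 by simp
qed

lemma fst_component:
 assumes i: "i < n"
 shows "(%w. fst w i) \<in> measurable Om PU" (is ?C1) "distr Om PU (%w. fst w i) = PU" (is ?C2)
proof -
 have c: "(%u. u i) \<in> measurable UU PU" using i by (intro measurable_component_singleton) auto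
 show m: ?C1 by (rule measurable_compose[OF measurable_fst c])
 have "distr Om PU (%w. fst w i) = distr (distr Om UU fst) PU (%u. u i)"
  by (subst distr_distr[OF c measurable_fst]) (simp add: comp_def)
 also have "... = PU" unfolding VV.distr_pair_fst
  using distr_PiM_component[of "{..<n}" "%_. PU" i] i U.prob_space_axioms by simp
 finally show ?C2 .
qed

lemma distr_snd: "distr Om VV snd = VV"
proof (rule measure_eqI)
 fix X assume "X \<in> sets (distr Om VV snd)"
 hence X: "X \<in> sets VV" by simp
 have "emeasure (distr Om VV snd) X = emeasure Om (space UU \<times> X)"
  using sets.sets_into_space[OF X] by (subst emeasure_distr[OF measurable_snd X]) (auto intro!: arg_cong[where f="emeasure Om"] simp: space_pair_measure)
 also have "... = emeasure VV X" using X by (subst VV.emeasure_pair_measure_Times) (auto simp: UU.emeasure_space_1)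
 finally show "emeasure (distr Om VV snd) X = emeasure VV X" .
qed simp

lemma snd_component:
 assumes j: "j < m"
 shows "(%w. snd w j) \<in> measurable Om PV" (is ?C1) "distr Om PV (%w. snd w j) = PV" (is ?C2)
proof -
 have c: "(%u. u j) \<in> measurable VV PV" using j by (intro measurable_component_singleton) auto
 show m: ?C1 by (rule measurable_compose[OF measurable_snd c])
 have "distr Om PV (%w. snd w j) = distr (distr Om VV snd) PV (%u. u j)"
  by (subst distr_distr[OF c measurable_snd]) (simp add: comp_def)
 also have "... = PV" unfolding distr_snd
  using distr_PiM_component[of "{..<m}" "%_. PV" j] j V.prob_space_axioms by simp
 finally show ?C2 .
qed

text \<open>At \<open>t = 0\<close> the matrix entries are pure noise and the likelihood is a
  product over the side channels, whose signals are independent. The logarithm becomes a sum, and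
  each term is averaged under its own marginal.\<close>

lemma F_init:
 assumes a: "0 <= a" and b: "0 <= b"
 shows "F 0 a b = scal PU (clip K) a + ratio * scal PV (clip K) b"
proof -
 interpret bu: bsnr PU "{()}" "%_. clip K" K by (rule U.bsnr_clip[OF K2(3)])
 interpret bv: bsnr PV "{()}" "%_. clip K" K by (rule V.bsnr_clip[OF K2(3)])
 let ?fu = "amp (%_::unit. clip K) (%_. a)" and ?fv = "amp (%_::unit. clip K) (%_. b)"
 let ?g = "msnr n 0 a b"
 interpret cu: channel PU "{()}" ?fu by (rule bu.channel_amp)
 interpret cv: channel PV "{()}" ?fv by (rule bv.channel_amp)
 have c: "channel Om Ix (amp (msig K) ?g)" by (rule channel_amp)
 define hu where "hu = (%y. ln (partf PU {()} ?fu y))"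
 define hv where "hv = (%y. ln (partf PV {()} ?fv y))"
 have hm: "hu \<in> borel_measurable (std_gauss {()})" "hv \<in> borel_measurable (std_gauss {()})"
  unfolding hu_def hv_def by measurable
 have hi: "integrable (obs_law PU {()} ?fu) hu" "integrable (obs_law PV {()} ?fv) hv"
  unfolding hu_def hv_def using bu.ln_part_ol(1)[of "%_. a"] bv.ln_part_ol(1)[of "%_. b"] a b by auto
 have ln: "ln (partf Om Ix (amp (msig K) ?g) y) = (\<Sum>i<n. hu (\<lambda>k\<in>{()}. y (Inr (Inl i)))) + (\<Sum>j<m. hv (\<lambda>k\<in>{()}. y (Inr (Inr j))))" for y
 proof -
  have "partf Om Ix (amp (msig K) ?g) y = (\<Prod>i<n. partf PU {()} ?fu (%_. y (Inr (Inl i)))) * (\<Prod>j<m. partf PV {()} ?fv (%_. y (Inr (Inr j))))"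
   unfolding partf_def[of Om] lik_init by (subst integral_prod_model) (auto simp: partf_def cu.lik_integrable cv.lik_integrable)
  moreover have "hu (%_. s) = hu (\<lambda>k\<in>{()}. s)" "hv (%_. s) = hv (\<lambda>k\<in>{()}. s)" for s by (simp_all add: hu_def hv_def partf_def lik_def)
  moreover have "0 < (\<Prod>i<n. partf PU {()} ?fu (%_. y (Inr (Inl i))))" "0 < (\<Prod>j<m. partf PV {()} ?fv (%_. y (Inr (Inr j))))"
   by (auto intro!: prod_pos cu.part_pos cv.part_pos)
  moreover have "ln (\<Prod>i<n. partf PU {()} ?fu (%_. y (Inr (Inl i)))) = (\<Sum>i<n. hu (%_. y (Inr (Inl i))))"
   "ln (\<Prod>j<m. partf PV {()} ?fv (%_. y (Inr (Inr j)))) = (\<Sum>j<m. hv (%_. y (Inr (Inr j))))"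
   unfolding hu_def hv_def by (intro ln_prod; auto simp: less_imp_neq[OF cu.part_pos, symmetric] less_imp_neq[OF cv.part_pos, symmetric])+
  ultimately show ?thesis by (simp add: ln_mult_pos)
 qed
 have mu: "(LINT y|ol ?g. hu (\<lambda>k\<in>{()}. y (Inr (Inl i)))) = scal PU (clip K) a" "integrable (ol ?g) (%y. hu (\<lambda>k\<in>{()}. y (Inr (Inl i))))" if i: "i < n" for i
 proof -
  note mi = fst_component(1)[OF i] and di = fst_component(2)[OF i]
  have eq: "amp (msig K) ?g (Inr (Inl i)) w = ?fu k (fst w i)" for k w by (simp add: amp_def)
  note im = integral_obs_law_marginal[OF c cu.channel_axioms mi di, where io="%_. Inr (Inl i)", OF _ _ eq]
  show "(LINT y|ol ?g. hu (\<lambda>k\<in>{()}. y (Inr (Inl i)))) = scal PU (clip K) a"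
   unfolding scal_def ent_def hu_def[symmetric] using i hm by (intro im(1)) auto
  show "integrable (ol ?g) (%y. hu (\<lambda>k\<in>{()}. y (Inr (Inl i))))" using im(2)[of hu] i hm hi by auto
 qed
 have mv: "(LINT y|ol ?g. hv (\<lambda>k\<in>{()}. y (Inr (Inr j)))) = scal PV (clip K) b" "integrable (ol ?g) (%y. hv (\<lambda>k\<in>{()}. y (Inr (Inr j))))" if j: "j < m" for j
 proof -
  note mj = snd_component(1)[OF j] and dj = snd_component(2)[OF j]
  have eq: "amp (msig K) ?g (Inr (Inr j)) w = ?fv k (snd w j)" for k w by (simp add: amp_def)
  note im = integral_obs_law_marginal[OF c cv.channel_axioms mj dj, where io="%_. Inr (Inr j)", OF _ _ eq]
  show "(LINT y|ol ?g. hv (\<lambda>k\<in>{()}. y (Inr (Inr j)))) = scal PV (clip K) b"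
   unfolding scal_def ent_def hv_def[symmetric] using j hm by (intro im(1)) auto
  show "integrable (ol ?g) (%y. hv (\<lambda>k\<in>{()}. y (Inr (Inr j))))" using im(2)[of hv] j hm hi by auto
 qed
 have "Phi ?g = (LINT y|ol ?g. (\<Sum>i<n. hu (\<lambda>k\<in>{()}. y (Inr (Inl i)))) + (\<Sum>j<m. hv (\<lambda>k\<in>{()}. y (Inr (Inr j)))))"
  unfolding Phi_def ent_def ln by (rule refl)
 also have "... = n * scal PU (clip K) a + m * scal PV (clip K) b"
 proof -
  let ?A = "%y i. hu (\<lambda>k\<in>{()}. y (Inr (Inl i)))" and ?B = "%y j. hv (\<lambda>k\<in>{()}. y (Inr (Inr j)))"
  have "(LINT y|ol ?g. (\<Sum>i<n. ?A y i) + (\<Sum>j<m. ?B y j)) = (LINT y|ol ?g. (\<Sum>i<n. ?A y i)) + (LINT y|ol ?g. (\<Sum>j<m. ?B y j))"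
   by (intro Bochner_Integration.integral_add Bochner_Integration.integrable_sum mu(2) mv(2)) auto
  also have "(LINT y|ol ?g. (\<Sum>i<n. ?A y i)) = (\<Sum>i<n. LINT y|ol ?g. ?A y i)"
   by (intro Bochner_Integration.integral_sum mu(2)) auto
  also have "(LINT y|ol ?g. (\<Sum>j<m. ?B y j)) = (\<Sum>j<m. LINT y|ol ?g. ?B y j)"
   by (intro Bochner_Integration.integral_sum mv(2)) auto
  also have "(\<Sum>i<n. LINT y|ol ?g. ?A y i) = (\<Sum>i<n. scal PU (clip K) a)" by (intro sum.cong refl mu(1)) auto
  also have "(\<Sum>j<m. LINT y|ol ?g. ?B y j) = (\<Sum>j<m. scal PV (clip K) b)" by (intro sum.cong refl mv(1)) auto
  finally show ?thesis by (simp only: sum_constant card_lessThan)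
 qed
 finally show ?thesis unfolding F_def ratio_def using n0 by (simp add: add_divide_distrib)
qed

text \<open>Unlike the bounds in \<open>D_le\<close>, this one is free of \<open>K\<close>: it fixes
  the range of \<open>y\<close> in the upper bound, which must be the same for every
  truncation.\<close>

lemma Da_le: "Da t a b <= (LINT x|PU. x^2) / 2"
proof -
 have "AA g (Inr (Inl i)) <= (LINT x|PU. x^2)" if i: "i < n" for g i
 proof -
  have k: "Inr (Inl i) \<in> Ix" using i by simp
  note mi = fst_component(1)[OF i] and di = fst_component(2)[OF i]
  have "AA g (Inr (Inl i)) <= (LINT w|Om. (msig K (Inr (Inl i)) w)^2)" unfolding AA_def
   by (rule channel.gavg_sq_integral_bounds(2)[OF channel_amp meas[OF k] e_sq_integrable[OF k]])
  also have "... = (LINT x|distr Om PU (%w. fst w i). (clip K x)^2)"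
   by (subst integral_distr[OF mi]) auto
  also have "... = (LINT x|PU. (clip K x)^2)" unfolding di by (rule refl)
  also have "... <= (LINT x|PU. x^2)"
  proof -
   have le: "(clip K x)^2 <= x^2" for x using power_mono[OF clip_le_self[OF K2(3), of x], of 2] by simp
   have "integrable PU (%x. (clip K x)^2)"
    by (rule Bochner_Integration.integrable_bound[OF U.sq]) (use le in auto)
   thus ?thesis using le by (intro integral_mono U.sq)
  qed
  finally show ?thesis .
 qed
 hence "(\<Sum>i<n. AA (msnr n t a b) (Inr (Inl i))) <= (\<Sum>i<n. LINT x|PU. x^2)" by (intro sum_mono) auto
 thus ?thesis using n0 by (simp add: Da_def field_simps)
qed

text \<open>With \<open>La\<close> in place of the ratio, the bounds on the derivatives are the same
  for all large \<open>n\<close>; \<open>cN\<close> and \<open>rN\<close> still depend on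
  \<open>n\<close>.\<close>

lemma approx_hj_model:
 assumes La: "ratio <= La"
 shows "approx_hj F Dt Da Db (La * (K^2)^2 / 2) (LINT x|PU. x^2) (La * K^2) cN rN"
proof
 show "Dt t a b <= La * (K^2)^2 / 2" for t a b
  using D_le(1)[of t a b] mult_right_mono[OF La, of "(K^2)^2"] by simp
 show "Db t a b <= La * K^2 / 2" for t a b
  using D_le(3)[of t a b] mult_right_mono[OF La, of "K^2"] by simp
 show "0 <= cN" by (simp add: cN_def)
qed (use F_lower F_upper D_nonneg D_mono Da_le rN0 in auto)

lemma F_000: "F 0 0 0 = 0"
 using F_init[of 0 0] by (simp add: U.scal_0 V.scal_0)

end

lemma exists_small:
 fixes A D c :: real
 assumes "0 <= A" "0 < D" "0 < c"
 shows "\<exists>s>0. s <= c \<and> A * s <= D"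
proof (intro exI[of _ "min c (D / (A + 1))"] conjI)
 have "A * min c (D / (A + 1)) <= A * (D / (A + 1))" using assms by (intro mult_left_mono) auto
 also have "... <= D" using assms by (simp add: field_simps)
 finally show "A * min c (D / (A + 1)) <= D" .
qed (use assms in auto)

lemma eventually_small_over: "0 < (D::real) ==> \<forall>\<^sub>F n in sequentially. A / real n <= D"
proof -
 assume D: "0 < D"
 have "(%n. A / real n) \<longlonglongrightarrow> 0" by (rule lim_const_over_n)
 from order_tendstoD(2)[OF this D] show ?thesis by (rule eventually_mono) simp
qed

lemma nat_floor_half:
 fixes u :: real
 assumes "2 <= u"
 shows "u / 2 <= real (nat \<lfloor>u\<rfloor>)" (is ?C1) "real (nat \<lfloor>u\<rfloor>) <= u" (is ?C2) "0 < nat \<lfloor>u\<rfloor>" (is ?C3)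
proof -
 have "0 <= \<lfloor>u\<rfloor>" "0 < \<lfloor>u\<rfloor>" using assms by auto
 hence e: "real (nat \<lfloor>u\<rfloor>) = real_of_int \<lfloor>u\<rfloor>" and ?C3 by auto
 thus ?C3 by simp
 show ?C1 ?C2 unfolding e using floor_correct[of u] assms by linarith+
qed

lemma nat_ceiling_twice:
 fixes u :: real
 assumes "1 <= u"
 shows "u <= real (nat \<lceil>u\<rceil>)" (is ?C1) "real (nat \<lceil>u\<rceil>) <= 2 * u" (is ?C2)
proof -
 have "0 <= \<lceil>u\<rceil>" using assms by linarith
 hence e: "real (nat \<lceil>u\<rceil>) = real_of_int \<lceil>u\<rceil>" by simp
 show ?C1 ?C2 unfolding e using ceiling_correct[of u] assms by linarith+
qed

section \<open>The limit of the clipped model\<close>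

locale clipped_seq = U: prior PU + V: prior PV for PU PV :: "real measure" +
 fixes m :: "nat => nat" and al K :: real
 assumes K: "1 <= K" and al: "0 < al" and ratio: "(%n. real (m n) / real n) \<longlonglongrightarrow> al"
begin

abbreviation "FF n \<equiv> clipped_model.F PU PV n (m n) K"
abbreviation "EU \<equiv> LINT x|PU. x^2"
abbreviation "err n t a b \<equiv> clipped_model.Dt PU PV n (m n) K t a b - 2 * clipped_model.Da PU PV n (m n) K t a b * clipped_model.Db PU PV n (m n) K t a b"
abbreviation "DEL n h t a b \<equiv> clipped_model.F PU PV n (m n) K t (a + h) b - clipped_model.F PU PV n (m n) K t a b - h * clipped_model.Da PU PV n (m n) K t a b"

definition "La = al + 1"

lemma model: "1 <= n ==> clipped_model PU PV n K"
 by (intro clipped_model.intro clipped_model_axioms.intro U.prior_axioms V.prior_axioms K)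

lemma ratio_le: "\<forall>\<^sub>F n in sequentially. 1 <= n \<and> real (m n) / real n <= La"
proof (rule eventually_conj)
 show "\<forall>\<^sub>F n in sequentially. 1 <= n" by (rule eventually_ge_at_top)
 show "\<forall>\<^sub>F n in sequentially. real (m n) / real n <= La"
  using order_tendstoD(2)[OF ratio, of La] by (auto simp: La_def elim: eventually_mono)
qed

lemma La: "1 <= La" "0 < La" using al by (auto simp: La_def)

lemma K2: "1 <= K^2" "0 <= K" using K one_le_power[OF K, of 2] by auto

text \<open>\<open>derivative_defect\<close> made uniform over a box. First \<open>eta\<close> and
  then \<open>te\<close> are chosen, with the microscopic step \<open>te / n\<close>, so that the
  terms without remainders are small; the fluctuation term vanishes as \<open>n\<close> grows with
  \<open>h\<close> fixed. Both \<open>te\<close> and \<open>M1\<close> are independent of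
  \<open>h\<close>, which remains to be chosen.\<close>

lemma defect_small:
 assumes D: "0 < D" and T: "0 <= T" and R: "0 <= R"
 obtains te M1 where "0 < te" "0 <= M1"
  "!!h. 0 < h ==> h <= 1 ==> \<forall>\<^sub>F n in sequentially. \<forall>t a b. 0 <= t --> t <= T --> 0 <= a --> a <= R --> 0 <= b --> b <= R -->
   \<bar>err n t a b\<bar> <= D + M1 * (n * DEL n (te / n) t a b) + (2 * La * K^2) / h * DEL n h t a b"
proof -
 define c where "c = (4 * (K^2)^2) ^ 3"
 have c0: "0 <= c" by (simp add: c_def)
 define L where "L = La * K^2"
 have L0: "0 < L" using La K2 by (auto simp: L_def intro!: mult_pos_pos)
 have LK0: "0 <= L * K" using L0 K by simp
 obtain eta where eta: "0 < eta" "L * K * eta <= D / 3"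
  using exists_small[of "L * K" "D / 3" 1] LK0 D by auto
 have q0: "0 <= L * K * (24 * c / eta ^ 3)" using c0 eta by (intro mult_nonneg_nonneg[OF LK0]) auto
 \<comment> \<open>The cap \<open>1 / (12 * (K^2)^2)\<close> is the smallness condition of
   \<open>derivative_defect\<close> for \<open>n * h' = te\<close>.\<close>
 obtain te where te: "0 < te" "te <= 1 / (12 * (K^2)^2)" "L * K * (24 * c / eta ^ 3) * te <= D / 3"
  using exists_small[OF q0, of "D / 3" "1 / (12 * (K^2)^2)"] D K2 K by auto
 have te': "4 * (K^2)^2 * te <= 1 / 3"
 proof -
  have "4 * (K^2)^2 * te <= 4 * (K^2)^2 * (1 / (12 * (K^2)^2))" using te by (intro mult_left_mono) auto
  also have "... = 1 / 3" using K by simp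
  finally show ?thesis .
 qed
 define M1 where "M1 = L * K * (4 / (te^2 * eta ^ 3))"
 define A where "A = R + 1"
 define vb where "vb = (K^2)^2 * (La * T + A + La * A) + ((K^2 * (T * K + A))^2 * V.var * La + (K^2 * (T * K * La + A))^2 * U.var)"
 show thesis
 proof (rule that[OF te(1), of M1])
  show "0 <= M1" unfolding M1_def using eta te by (intro mult_nonneg_nonneg[OF LK0]) auto
  fix h :: real assume h: "0 < h" "h <= 1"
  have "(%n. (2 * L / h) * sqrt (vb / real n)) \<longlonglongrightarrow> (2 * L / h) * sqrt 0"
   by (intro tendsto_mult tendsto_const tendsto_real_sqrt lim_const_over_n)
  hence "(%n. (2 * L / h) * sqrt (vb / real n)) \<longlonglongrightarrow> 0" by simp
  from order_tendstoD(2)[OF this, of "D / 3"] D have ev: "\<forall>\<^sub>F n in sequentially. (2 * L / h) * sqrt (vb / real n) < D / 3" by simp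
  show "\<forall>\<^sub>F n in sequentially. \<forall>t a b. 0 <= t --> t <= T --> 0 <= a --> a <= R --> 0 <= b --> b <= R -->
   \<bar>err n t a b\<bar> <= D + M1 * (n * DEL n (te / n) t a b) + (2 * La * K^2) / h * DEL n h t a b"
   using ev ratio_le
  proof (eventually_elim, intro allI impI)
   fix n t a b assume en: "(2 * L / h) * sqrt (vb / real n) < D / 3" and nr: "1 <= n \<and> real (m n) / real n <= La"
    and t: "0 <= t" "t <= T" and a: "0 <= a" "a <= R" and b: "0 <= b" "b <= R"
   interpret M: clipped_model PU PV n "m n" K by (rule model) (use nr in simp)
   have n0: "0 < real n" by (rule M.n0)
   have r: "M.ratio <= La" using nr by (simp add: M.ratio_def)
   note r0 = M.ratio0
   have var0: "0 <= U.var" "0 <= V.var" by (simp_all add: U.var_def V.var_def)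
   have vle: "M.vN T A <= vb"
   proof -
    have q1: "M.ratio * T <= La * T" "M.ratio * A <= La * A" using r T R by (auto intro!: mult_right_mono simp: A_def)
    have "T * K * M.ratio <= T * K * La" using r T K2 by (intro mult_left_mono) auto
    hence q3: "K^2 * (T * K * M.ratio + A) <= K^2 * (T * K * La + A)" by (intro mult_left_mono) auto
    have q4: "0 <= K^2 * (T * K * M.ratio + A)" using T R K2 r0 by (auto intro!: mult_nonneg_nonneg add_nonneg_nonneg simp: A_def)
    have "(K^2)^2 * (M.ratio * T + A + M.ratio * A) <= (K^2)^2 * (La * T + A + La * A)"
     using q1 by (intro mult_left_mono) auto
    moreover have "(K^2 * (T * K + A))^2 * V.var * M.ratio <= (K^2 * (T * K + A))^2 * V.var * La"
     using r var0 by (intro mult_left_mono) auto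
    moreover have "(K^2 * (T * K * M.ratio + A))^2 * U.var <= (K^2 * (T * K * La + A))^2 * U.var"
     by (rule mult_right_mono[OF power_mono[OF q3 q4] var0(1)])
    ultimately show ?thesis unfolding M.vN_def vb_def by linarith
   qed
   have th: "real n * (te / real n) = te" using n0 by simp
   have h': "0 < te / real n" using te n0 by simp
   have tA: "t <= T" "a + 1 <= A" "b <= A" using t a b R by (auto simp: A_def)
   have hh: "4 * (K^2)^2 * (real n * (te / real n)) <= 1 / 3" unfolding th by (rule te')
   define d1 where "d1 = DEL n (te / n) t a b"
   define d2 where "d2 = DEL n h t a b"
   define s where "s = sqrt (M.vN T A / real n)"
   define X where "X = K * (eta + (4 * d1 / (n * (te / n)^2) + 24 * c * n * (te / n)) / eta ^ 3) + 2 / h * (d2 + s)"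
   have bound: "\<bar>err n t a b\<bar> <= M.ratio * K^2 * X"
    using M.derivative_defect[OF t(1) a(1) b(1) tA h h' hh eta(1)] unfolding X_def c_def d1_def d2_def s_def M.Del_def .
   have d0: "0 <= d1" "0 <= d2"
    using M.F_lower[OF t(1) a(1) b(1), of 0 "te / n" 0] M.F_lower[OF t(1) a(1) b(1), of 0 h 0] h h' unfolding d1_def d2_def by auto
   have "0 <= X" unfolding X_def s_def using K2 eta c0 d0 n0 h te M.vN_def
    by (intro add_nonneg_nonneg mult_nonneg_nonneg divide_nonneg_nonneg real_sqrt_ge_zero) (auto simp: M.vN_def A_def T R r0 var0 intro!: add_nonneg_nonneg mult_nonneg_nonneg)
   hence "M.ratio * K^2 * X <= L * X" unfolding L_def using r by (intro mult_right_mono) auto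
   also have "... = L * K * eta + M1 * (n * d1) + L * K * (24 * c / eta ^ 3) * te + (2 * L) / h * d2 + (2 * L / h) * s"
   proof -
    have e1: "4 * d1 / (n * (te / n)^2) = 4 / te^2 * (n * d1)" using n0 by (simp add: power_divide power2_eq_square)
    have e2: "24 * c * n * (te / n) = 24 * c * te" using n0 by simp
    show ?thesis unfolding X_def e1 e2 M1_def by (simp add: add_divide_distrib distrib_left distrib_right mult_ac)
   qed
   also have "... <= D / 3 + M1 * (n * d1) + D / 3 + (2 * L) / h * d2 + D / 3"
   proof -
    have "s <= sqrt (vb / real n)" unfolding s_def using vle n0 by (intro real_sqrt_le_mono divide_right_mono) auto
    hence "(2 * L / h) * s <= (2 * L / h) * sqrt (vb / real n)" using L0 h by (intro mult_left_mono) auto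
    thus ?thesis using en eta(2) te(3) by linarith
   qed
   finally show "\<bar>err n t a b\<bar> <= D + M1 * (n * DEL n (te / n) t a b) + (2 * La * K^2) / h * DEL n h t a b"
    using bound unfolding d1_def d2_def L_def by (simp add: mult.assoc)
  qed
 qed
qed

text \<open>Read off from the matrix model with \<open>n = m = 1\<close>, whose initial value in
  \<open>b\<close> is the scalar free energy.\<close>

lemma scal_le:
 assumes "0 <= b"
 shows "0 <= scal PV (clip K) b" (is ?C1) "scal PV (clip K) b <= b * (La * K^2 / 2)" (is ?C2)
proof -
 have one: "(1::nat) <= 1" by simp
 interpret M: clipped_model PU PV 1 1 K by (rule model[OF one])
 have r: "M.ratio = 1" unfolding M.ratio_def by simp
 have r1: "M.ratio <= La" unfolding r by (rule La(1))
 interpret approx_hj M.F M.Dt M.Da M.Db "La * (K^2)^2 / 2" EU "La * K^2" M.cN M.rN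
  by (rule M.approx_hj_model[OF r1])
 have e: "M.F 0 0 b = scal PV (clip K) b" using M.F_init[OF order_refl assms, unfolded M.ratio_def] by (simp add: U.scal_0)
 have "M.F 0 0 0 <= M.F 0 0 b" "M.F 0 0 b <= M.F 0 0 0 + (0 - 0) * (La * (K^2)^2 / 2) + (0 - 0) * (EU / 2) + (b - 0) * (La * K^2 / 2)"
  using assms by (intro F_mono; simp)+
 thus ?C1 ?C2 unfolding M.F_000 e by simp_all
qed

text \<open>The touching parabola makes both remainders explicit:
  \<open>n * (te / n)^2 / (2 * eta)\<close> vanishes as \<open>n\<close> grows, and
  \<open>h^2 / (2 * eta)\<close> divided by \<open>h\<close> is small with \<open>h\<close>.\<close>

theorem limsup_bound:
 fixes x :: "real => real" and X T S eps :: real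
 assumes x: "!!y. y \<in> {0..EU} ==> 0 <= x y \<and> x y <= X" and T: "0 < T" and eps: "0 < eps"
  and S: "!!y. y \<in> {0..EU} ==> scal PU (clip K) (T * x y) + al * scal PV (clip K) (T * y) - T * x y * y / 2 <= S"
 shows "\<forall>\<^sub>F n in sequentially. FF n T 0 0 <= S + eps"
proof -
 have EU0: "0 <= EU" by simp
 have X0: "0 <= X" using x[of 0] EU0 by auto
 define de where "de = eps / (4 * T)"
 have de: "0 < de" "de * T = eps / 4" using eps T by (auto simp: de_def)
 obtain eta where eta: "0 < eta" "EU^2 / 8 * eta <= eps / 4" using exists_small[of "EU^2 / 8" "eps / 4" 1] eps by auto
 obtain ka where ka: "0 < ka" "(X + EU) * ka <= de / 2" using exists_small[of "X + EU" "de / 2" 1] de X0 EU0 by auto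
 define Q where "Q = La * (K^2)^2 / 2 * T + EU^2 * eta / 4 + EU / 2 * (T * X) + La * K^2 / 2 * (T * EU) + de * T"
 define R where "R = Q / ka + sqrt (4 * eta * Q)"
 have Q0: "0 <= Q" unfolding Q_def using T EU0 eta X0 de La by (intro add_nonneg_nonneg mult_nonneg_nonneg divide_nonneg_nonneg) auto
 have R0: "0 <= R" unfolding R_def using Q0 ka eta by simp
 obtain te M1 where te: "0 < te" and M1: "0 <= M1" and ev:
  "!!h. 0 < h ==> h <= 1 ==> \<forall>\<^sub>F n in sequentially. \<forall>t a b. 0 <= t --> t <= T --> 0 <= a --> a <= R --> 0 <= b --> b <= R -->
   \<bar>err n t a b\<bar> <= de / 8 + M1 * (n * DEL n (te / n) t a b) + (2 * La * K^2) / h * DEL n h t a b"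
  using defect_small[of "de / 8" T R] de T R0 by auto
 have A0: "0 <= 2 * La * K^2 / (2 * eta)" using La eta by simp
 obtain h where h: "0 < h" "h <= 1" "2 * La * K^2 / (2 * eta) * h <= de / 8"
  using exists_small[OF A0, of "de / 8" 1] de by auto
 have ev2: "\<forall>\<^sub>F n in sequentially. (M1 * te^2 / (2 * eta)) / real n <= de / 8" by (rule eventually_small_over) (use de in simp)
 define W where "W = T * EU * (La * K^2 / 2) + 1"
 have W: "0 < W" unfolding W_def using T EU0 La by (intro add_nonneg_pos mult_nonneg_nonneg) auto
 have ev3: "\<forall>\<^sub>F n in sequentially. \<bar>real (m n) / real n - al\<bar> < eps / (4 * W)"
  using tendstoD[OF ratio, of "eps / (4 * W)"] eps W by (simp add: dist_real_def)
 show ?thesis using ev[OF h(1,2)] ev2 ev3 ratio_le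
 proof eventually_elim
  case (elim n)
  interpret M: clipped_model PU PV n "m n" K by (rule model) (use elim(4) in simp)
  have r: "M.ratio <= La" using elim(4) by (simp add: M.ratio_def)
  interpret approx_hj M.F M.Dt M.Da M.Db "La * (K^2)^2 / 2" EU "La * K^2" M.cN M.rN
   by (rule M.approx_hj_model[OF r])
  have n0: "0 < real n" by (rule M.n0)
  have "M.F T 0 0 <= (S + eps / 4) + de * T + EU^2 * eta / 8"
  proof (rule upper_bound[where x=x and X=X and ka=ka and R=R and Q=Q, OF x T eta(1) ka(1) _ de(1)])
   show "ka * (X + EU) <= de / 2" using ka(2) by (simp add: mult.commute)
   show "M.F 0 a b = scal PU (clip K) a + M.ratio * scal PV (clip K) b" if "0 <= a" "0 <= b" for a b by (rule M.F_init[OF that])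
   show "M.F 0 (T * x y) (T * y) - T * x y * y / 2 <= S + eps / 4" if y: "y \<in> {0..EU}" for y
   proof -
    define s where "s = scal PV (clip K) (T * y)"
    have s: "0 <= s" "s <= W"
    proof -
     have "T * y * (La * K^2 / 2) <= T * EU * (La * K^2 / 2)"
      using y T La by (intro mult_right_mono) auto
     moreover have "0 <= T * y" using y T by simp
     ultimately show "0 <= s" "s <= W" using scal_le[of "T * y"] unfolding s_def W_def by linarith+
    qed
    have "(M.ratio - al) * s <= eps / (4 * W) * W"
     using elim(3) s eps W by (intro mult_mono) (auto simp: M.ratio_def)
    also have "... = eps / 4" using W by simp
    finally have "M.ratio * s <= al * s + eps / 4" by (simp add: algebra_simps)
    moreover have "M.F 0 (T * x y) (T * y) = scal PU (clip K) (T * x y) + M.ratio * s"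
     unfolding s_def using x[OF y] y T by (intro M.F_init) auto
    ultimately show ?thesis using S[OF y] unfolding s_def by linarith
   qed
   show "Q = La * (K^2)^2 / 2 * T + EU^2 * eta / 4 + EU / 2 * (T * X) + La * K^2 / 2 * (T * EU) + de * T" by (rule Q_def)
   show "Q / ka + sqrt (4 * eta * Q) <= R" by (simp add: R_def)
   fix t a b assume z: "0 <= t" "0 <= a" "0 <= b" "t <= T" "a <= R" "b <= R"
    and touch: "!!h. 0 <= h ==> M.F t (a + h) b - M.F t a b - h * M.Da t a b <= h^2 / (2 * eta)"
   have "\<bar>err n t a b\<bar> <= de / 8 + M1 * (n * DEL n (te / n) t a b) + (2 * La * K^2) / h * DEL n h t a b"
    using elim(1) z by blast
   also have "... <= de / 8 + M1 * (n * ((te / n)^2 / (2 * eta))) + (2 * La * K^2) / h * (h^2 / (2 * eta))"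
    using touch[of "te / n"] touch[of h] h te M1 n0 La by (intro add_mono mult_left_mono order_refl) auto
   also have "... <= de / 8 + de / 8 + de / 8"
   proof -
    have "M1 * (n * ((te / n)^2 / (2 * eta))) = (M1 * te^2 / (2 * eta)) / real n" using n0 by (simp add: power_divide power2_eq_square)
    moreover have "(2 * La * K^2) / h * (h^2 / (2 * eta)) = 2 * La * K^2 / (2 * eta) * h" using h by (simp add: power2_eq_square)
    ultimately show ?thesis using elim(2) h(3) by linarith
   qed
   finally show "M.Dt t a b - 2 * M.Da t a b * M.Db t a b < de / 2" using de by linarith
  qed
  moreover have "EU^2 * eta / 8 <= eps / 4" using eta(2) by simp
  ultimately show ?case using de(2) eps by linarith
 qed
qed

text \<open>The grid of starting points has the microscopic step \<open>s = te / n\<close> and about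
  \<open>be' / s\<close> points. Divided by this number, the telescoped remainders are of order
  \<open>1 / n\<close> for the step \<open>s\<close>, and of order \<open>h\<close> for the fixed
  step, which spans about \<open>h / s\<close> grid points.\<close>

theorem liminf_bound:
 fixes x T B c eps :: real
 assumes x: "0 <= x" and T: "0 < T" and B: "0 < B" and eps: "0 < eps"
  and c0: "!!b. b \<in> {0..B} ==> c <= scal PU (clip K) (T * x) + al * scal PV (clip K) b - x * b / 2"
  and cB: "c <= al * scal PV (clip K) B - x * B / 2"
 shows "\<forall>\<^sub>F n in sequentially. c - eps <= FF n T 0 0"
proof -
 have EU0: "0 <= EU" by simp
 define om where "om = eps / 4"
 define c' where "c' = c - eps / 2"
 have om: "0 < om" using eps by (simp add: om_def)
 obtain be' where be': "0 < be'" "EU / 2 * be' <= om / 2" using exists_small[of "EU / 2" "om / 2" 1] EU0 om by auto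
 have L0: "0 <= La * K^2 / 2" using La by simp
 obtain be where be: "0 < be" "be <= B" "La * K^2 / 2 * be <= om / 2" using exists_small[OF L0, of "om / 2" B] om B by auto
 define Q where "Q = \<bar>c'\<bar> + x * B / 2"
 have Q0: "0 <= 2 * Q * B * T" using x B T by (simp add: Q_def)
 have bo: "0 < be * om^2" using be om by simp
 obtain E where E: "0 < E" "2 * Q * B * T * E <= be * om^2 / 2" using exists_small[OF Q0, of "be * om^2 / 2" 1] bo by auto
 define R where "R = be' + T * x + B"
 have R0: "0 <= R" using be' T x B by (simp add: R_def)
 obtain te M1 where te: "0 < te" and M1: "0 <= M1" and ev:
  "!!h. 0 < h ==> h <= 1 ==> \<forall>\<^sub>F n in sequentially. \<forall>t a b. 0 <= t --> t <= T --> 0 <= a --> a <= R --> 0 <= b --> b <= R -->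
   \<bar>err n t a b\<bar> <= E / 4 + M1 * (n * DEL n (te / n) t a b) + (2 * La * K^2) / h * DEL n h t a b"
  using defect_small[of "E / 4" T R] E T R0 by auto
 have A0: "0 <= La * K^2 * EU * 4 / be'" using La EU0 be' by simp
 obtain h where h: "0 < h" "h <= 1" "La * K^2 * EU * 4 / be' * h <= E / 4"
  using exists_small[OF A0, of "E / 4" 1] E by auto
 have ev1: "\<forall>\<^sub>F n in sequentially. (M1 * te * (EU / 2) * (2 * te / be')) / real n <= E / 4" by (rule eventually_small_over) (use E in simp)
 have ev2: "\<forall>\<^sub>F n in sequentially. (2 * te / be') / real n <= 1" by (rule eventually_small_over) simp
 have ev4: "\<forall>\<^sub>F n in sequentially. te / real n <= h" by (rule eventually_small_over[OF h(1)])
 define W where "W = B * (La * K^2 / 2) + 1"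
 have W: "0 < W" unfolding W_def using B La by (intro add_nonneg_pos mult_nonneg_nonneg) auto
 have ev3: "\<forall>\<^sub>F n in sequentially. \<bar>real (m n) / real n - al\<bar> < eps / (2 * W)"
  using tendstoD[OF ratio, of "eps / (2 * W)"] eps W by (simp add: dist_real_def)
 show ?thesis using ev[OF h(1,2)] ev1 ev2 ev3 ev4 ratio_le
 proof eventually_elim
  case (elim n)
  interpret M: clipped_model PU PV n "m n" K by (rule model) (use elim(6) in simp)
  have r: "M.ratio <= La" using elim(6) by (simp add: M.ratio_def)
  interpret approx_hj M.F M.Dt M.Da M.Db "La * (K^2)^2 / 2" EU "La * K^2" M.cN M.rN
   by (rule M.approx_hj_model[OF r])
  have n0: "0 < real n" by (rule M.n0)
  have rs: "al * scal PV (clip K) b <= M.ratio * scal PV (clip K) b + eps / 2" if b: "b \<in> {0..B}" for b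
  proof -
   have "b * (La * K^2 / 2) <= B * (La * K^2 / 2)" using b La by (intro mult_right_mono) auto
   moreover have "0 <= b" using b by simp
   ultimately have s: "0 <= scal PV (clip K) b" "scal PV (clip K) b <= W" using scal_le[of b] unfolding W_def by linarith+
   have "(al - M.ratio) * scal PV (clip K) b <= eps / (2 * W) * W"
    using elim(4) s eps W by (intro mult_mono) (auto simp: M.ratio_def)
   also have "... = eps / 2" using W by simp
   finally show ?thesis by (simp add: algebra_simps)
  qed
  have b0: "c' <= M.F 0 (T * x) b - x * b / 2" if b: "b \<in> {0..B}" for b
   using c0[OF b] rs[OF b] M.F_init[of "T * x" b] b T x by (simp add: c'_def)
  have bB: "c' <= M.F 0 0 B - x * B / 2"
   using cB rs[of B] M.F_init[of 0 B] B by (simp add: c'_def U.scal_0)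
  define s where "s = te / real n"
  have s0: "0 < s" using te n0 by (simp add: s_def)
  have ns: "n * s = te" using n0 by (simp add: s_def)
  define N where "N = nat \<lfloor>be' / s\<rfloor>"
  define k where "k = nat \<lceil>h / s\<rceil>"
  have bs: "0 <= be' / s" "0 <= h / s" using be' s0 h by auto
  \<comment> \<open>Rounding the numbers of grid points costs at most a factor
    \<open>2\<close>.\<close>
  have "2 <= be' / s" using elim(3) be' n0 te unfolding s_def by (simp add: field_simps)
  hence N: "be' / s / 2 <= real N" "real N <= be' / s" "0 < N" unfolding N_def by (rule nat_floor_half)+
  have "1 <= h / s" using elim(5) s0 unfolding s_def[symmetric] by simp
  hence k: "h / s <= real k" "real k <= 2 * (h / s)" unfolding k_def by (rule nat_ceiling_twice)+
  have ks: "h <= real k * s" using k(1) s0 by (simp add: pos_divide_le_eq)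
  have key: "c' - 2 * om <= M.F T 0 0"
  proof (rule lower_bound[where c=c' and N=N and p="%j. real j * s" and E=E and be=be and be'=be', OF x T B b0 bB N(3)])
   fix j assume "j < N"
   hence "real j * s <= real N * s" using s0 by (intro mult_right_mono) auto
   also have "... <= be'" using N(2) s0 by (simp add: pos_le_divide_eq)
   finally show "0 <= real j * s \<and> real j * s <= be'" using s0 by simp
  next
   fix t b assume t: "t \<in> {0..T}" and b: "b \<in> {0..B}"
   define a where "a = (T - t) * x"
   have "(T - t) * x <= T * x" using t x by (intro mult_right_mono) auto
   hence a: "0 <= a" "a <= T * x" using t x by (auto simp: a_def)
   have jN: "0 <= a + real j * s \<and> a + real j * s <= R" if "j < N" for j
   proof -
    have "real j * s <= real N * s" using s0 that by (intro mult_right_mono) auto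
    also have "... <= be'" using N(2) s0 by (simp add: pos_le_divide_eq)
    finally have "real j * s <= be'" .
    thus ?thesis using a B s0 by (simp add: R_def)
   qed
   have "0 <= T * x" using T x by simp
   hence bR: "0 <= b" "b <= R" using b be'(1) by (auto simp: R_def)
   have "(\<Sum>j<N. \<bar>err n t (a + j * s) b\<bar>) <= (\<Sum>j<N. E / 4 + M1 * (n * DEL n s t (a + j * s) b) + (2 * La * K^2) / h * DEL n h t (a + j * s) b)"
    using elim(1) t jN bR unfolding s_def[symmetric] by (intro sum_mono) auto
   also have "... = N * (E / 4) + M1 * (n * (\<Sum>j<N. DEL n s t (a + j * s) b)) + (2 * La * K^2) / h * (\<Sum>j<N. DEL n h t (a + j * s) b)"
    by (simp only: sum.distrib sum_distrib_left[symmetric] sum_constant card_lessThan)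
   also have "... <= N * (E / 4) + M1 * (n * (s * (1 * (EU / 2)))) + (2 * La * K^2) / h * (h * (k * (EU / 2)))"
   proof (intro add_mono mult_left_mono order_refl)
    show "(\<Sum>j<N. DEL n s t (a + j * s) b) <= s * (1 * (EU / 2))"
     using sum_Delta_le[of t a b s s 1 N] t a bR s0 by simp
    show "(\<Sum>j<N. DEL n h t (a + j * s) b) <= h * (k * (EU / 2))"
     using sum_Delta_le[of t a b s h k N] t a bR s0 h ks by simp
   qed (use M1 La h in auto)
   also have "... <= N * (E / 4) + N * (E / 4) + N * (E / 4)"
   proof -
    have "M1 * (n * (s * (1 * (EU / 2)))) = M1 * te * (EU / 2)" unfolding ns[symmetric] by simp
    also have "... <= (be' / s / 2) * (E / 4)"
    proof -
     have "M1 * te * (EU / 2) = (be' / s / 2) * (M1 * te * (EU / 2) * (2 * te / be') / real n)"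
     proof -
      have "y = (be' / s / 2) * (y * (2 * te / be') / real n)" for y
       unfolding s_def using be'(1) n0 te by simp
      thus ?thesis .
     qed
     also have "... <= (be' / s / 2) * (E / 4)" using elim(2) bs by (intro mult_left_mono) auto
     finally show ?thesis .
    qed
    also have "... <= N * (E / 4)" using N(1) E by (intro mult_right_mono) auto
    finally have 1: "M1 * (n * (s * (1 * (EU / 2)))) <= N * (E / 4)" .
    have "(2 * La * K^2) / h * (h * (k * (EU / 2))) = La * K^2 * EU * k" using h by simp
    also have "... <= La * K^2 * EU * (2 * (h / s))" using k(2) La by (intro mult_left_mono) auto
    also have "... = (La * K^2 * EU * 4 / be' * h) * (be' / s / 2)" using be'(1) by simp
    also have "... <= (E / 4) * real N" using h(3) N(1) bs E by (intro mult_mono) auto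
    finally have 2: "(2 * La * K^2) / h * (h * (k * (EU / 2))) <= N * (E / 4)" by (simp add: mult.commute)
    show ?thesis using 1 2 by linarith
   qed
   also have "... <= N * E" using E by (simp add: field_simps)
   finally have "(\<Sum>j<N. \<bar>err n t (a + j * s) b\<bar>) <= N * E" .
   moreover have "defect t a b = err n t a b" for t a b by (rule defect_def[OF x T B b0 bB])
   ultimately show "(\<Sum>j<N. \<bar>defect t (real j * s + (T - t) * x) b\<bar>) <= N * E"
    unfolding a_def by (simp only: add.commute)
  next
   show "EU / 2 * be' + La * K^2 / 2 * be <= om" using be be' by linarith
   have "depth x B c' = \<bar>c'\<bar> + x * B / 2 + \<bar>M.F 0 0 0\<bar>" by (rule depth_def[OF x T B b0 bB])
   hence "depth x B c' = Q" by (simp add: Q_def M.F_000)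
   hence "2 * depth x B c' * (B * E) * T = 2 * Q * B * T * E" by simp
   thus "2 * depth x B c' * (B * E) * T < be * om^2" using E(2) bo by linarith
  qed (use be om in auto)
  thus ?case unfolding c'_def om_def by simp
 qed
qed

end

section \<open>Removal of the truncation\<close>

text \<open>Pratt's lemma: split off the part of \<open>X k\<close> above the limit of the dominating sequence.\<close>

lemma integral_pratt:
 fixes X D :: "nat => 'a => real" and X' D' :: "'a => real"
 assumes Xm[measurable]: "!!k. X k \<in> borel_measurable M" "X' \<in> borel_measurable M"
  and Di: "!!k. integrable M (D k)" "integrable M D'"
  and bnd: "!!k w. w \<in> space M ==> 0 <= X k w \<and> X k w <= D k w"
  and lim: "!!w. w \<in> space M ==> (%k. X k w) \<longlonglongrightarrow> X' w" "!!w. w \<in> space M ==> (%k. D k w) \<longlonglongrightarrow> D' w"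
  and int: "(%k. LINT w|M. D k w) \<longlonglongrightarrow> (LINT w|M. D' w)"
 shows "(%k. LINT w|M. X k w) \<longlonglongrightarrow> (LINT w|M. X' w)"
proof -
 have [measurable]: "!!k. D k \<in> borel_measurable M" "D' \<in> borel_measurable M" using Di by auto
 have D'0: "0 <= D' w" if "w \<in> space M" for w
  by (rule LIMSEQ_le_const[OF lim(2)[OF that]]) (use bnd[OF that] order_trans in blast)
 have XD: "X' w <= D' w" if "w \<in> space M" for w
  by (rule LIMSEQ_le[OF lim(1)[OF that] lim(2)[OF that]]) (use bnd[OF that] in blast)
 have Xi: "integrable M (X k)" for k
 proof (rule Bochner_Integration.integrable_bound[OF Di(1)[of k]])
  have "\<bar>X k w\<bar> <= \<bar>D k w\<bar>" if "w \<in> space M" for w using bnd[OF that, of k] by linarith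
  thus "AE w in M. norm (X k w) <= norm (D k w)" by (intro AE_I2) simp
 qed simp
 have mi: "integrable M (%w. min (X k w) (D' w))" for k
  using Xi Di by (intro integrable_min)
 have 1: "(%k. LINT w|M. min (X k w) (D' w)) \<longlonglongrightarrow> (LINT w|M. X' w)"
 proof (rule integral_dominated_convergence[where w=D'])
  show "AE w in M. (%k. min (X k w) (D' w)) \<longlonglongrightarrow> X' w"
  proof (rule AE_I2)
   fix w assume w: "w \<in> space M"
   have "(%k. min (X k w) (D' w)) \<longlonglongrightarrow> min (X' w) (D' w)" by (intro tendsto_min lim(1)[OF w] tendsto_const)
   thus "(%k. min (X k w) (D' w)) \<longlonglongrightarrow> X' w" using XD[OF w] by (simp add: min_def)
  qed
  show "AE w in M. norm (min (X k w) (D' w)) <= D' w" for k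
   using bnd D'0 by (intro AE_I2) (auto simp: abs_le_iff min_def intro: order_trans[of _ 0])
 qed (use Di in auto)
 have 2: "(%k. LINT w|M. max 0 (D' w - D k w)) \<longlonglongrightarrow> (LINT w|M. 0)"
 proof (rule integral_dominated_convergence[where w=D'])
  show "AE w in M. (%k. max 0 (D' w - D k w)) \<longlonglongrightarrow> 0"
  proof (rule AE_I2)
   fix w assume w: "w \<in> space M"
   have "(%k. max 0 (D' w - D k w)) \<longlonglongrightarrow> max 0 (D' w - D' w)" by (intro tendsto_intros lim(2)[OF w])
   thus "(%k. max 0 (D' w - D k w)) \<longlonglongrightarrow> 0" by simp
  qed
  show "AE w in M. norm (max 0 (D' w - D k w)) <= D' w" for k
  proof (rule AE_I2)
   fix w assume w: "w \<in> space M"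
   have "0 <= D k w" using bnd[OF w, of k] by linarith
   thus "norm (max 0 (D' w - D k w)) <= D' w" using D'0[OF w] by (simp add: max_def)
  qed
 qed (use Di in auto)
 have 3: "(%k. (LINT w|M. X k w) - (LINT w|M. min (X k w) (D' w))) \<longlonglongrightarrow> 0"
 proof (rule tendsto_sandwich[OF always_eventually always_eventually tendsto_const])
  show "\<forall>k. 0 <= (LINT w|M. X k w) - (LINT w|M. min (X k w) (D' w))"
   using Xi mi by (auto intro!: integral_mono)
  show "\<forall>k. (LINT w|M. X k w) - (LINT w|M. min (X k w) (D' w))
   <= ((LINT w|M. D k w) - (LINT w|M. D' w)) + (LINT w|M. max 0 (D' w - D k w))"
  proof
   fix k
   have "(LINT w|M. X k w - min (X k w) (D' w)) <= (LINT w|M. D k w - D' w + max 0 (D' w - D k w))"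
   proof (rule integral_mono)
    fix w assume w: "w \<in> space M"
    show "X k w - min (X k w) (D' w) <= D k w - D' w + max 0 (D' w - D k w)"
     using bnd[OF w, of k] by (auto simp: min_def max_def)
   qed (use Xi mi Di in auto)
   moreover have "(LINT w|M. X k w - min (X k w) (D' w)) = (LINT w|M. X k w) - (LINT w|M. min (X k w) (D' w))"
    using Xi mi by (intro Bochner_Integration.integral_diff) auto
   moreover have "(LINT w|M. D k w - D' w + max 0 (D' w - D k w)) = ((LINT w|M. D k w) - (LINT w|M. D' w)) + (LINT w|M. max 0 (D' w - D k w))"
    using Di by (subst Bochner_Integration.integral_add) auto
   ultimately show "(LINT w|M. X k w) - (LINT w|M. min (X k w) (D' w))
    <= ((LINT w|M. D k w) - (LINT w|M. D' w)) + (LINT w|M. max 0 (D' w - D k w))" by simp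
  qed
  show "(%k. ((LINT w|M. D k w) - (LINT w|M. D' w)) + (LINT w|M. max 0 (D' w - D k w))) \<longlonglongrightarrow> 0"
   using tendsto_add[OF tendsto_diff[OF int tendsto_const[of "LINT w|M. D' w"]] 2] by simp
 qed
 from tendsto_add[OF 3 1] show ?thesis by simp
qed

lemma std_gauss_coord:
 assumes "i \<in> I"
 shows "(%z. z i) \<in> measurable (std_gauss I) std_normal_distribution" (is ?C1)
  "distr (std_gauss I) std_normal_distribution (%z. z i) = std_normal_distribution" (is ?C2)
  "integrable (std_gauss I) (%z. (z i)^2)" (is ?C3)
proof -
 show m: ?C1
  by (rule measurable_component_singleton[OF assms])
 show d: ?C2
  using assms prob_space_std_normal by (intro distr_PiM_component) auto
 have "integrable std_normal_distribution (%x::real. x^2)" using std_normal_distribution_even_moments(2)[of 1] by simp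
 hence "integrable (distr (std_gauss I) std_normal_distribution (%z. z i)) (%x::real. x^2)" unfolding d .
 thus ?C3 by (subst (asm) integrable_distr_eq[OF m]) auto
qed

context channel
begin

text \<open>The signal need not be bounded here. The exponent is at least
  \<open>- (y^2 / 2 + f^2)\<close>, and the tangent of \<open>exp\<close> at the mean
  \<open>- c\<close> of this minorant gives the lower bound, as in Jensen's inequality; the upper
  bound is \<open>part_le\<close>.\<close>

lemma ln_part_abs_le:
 assumes sq: "!!i. i \<in> I ==> integrable M (%w. (f i w)^2)"
 shows "\<bar>ln (partf M I f y)\<bar> <= (\<Sum>i\<in>I. (y i)^2 / 2 + (LINT w|M. (f i w)^2))"
proof -
 let ?L = "%w. \<Sum>i\<in>I. - ((y i)^2 / 2 + (f i w)^2)"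
 define c where "c = (\<Sum>i\<in>I. (y i)^2 / 2 + (LINT w|M. (f i w)^2))"
 have Li: "integrable M ?L" using sq by (intro Bochner_Integration.integrable_sum) auto
 have LI: "(LINT w|M. ?L w) = - c"
  using sq by (subst Bochner_Integration.integral_sum) (auto simp: c_def sum_negf[symmetric] prob_space intro!: sum.cong)
 have "- c <= ln (partf M I f y)"
 proof -
  have le: "exp (- c) * (1 + (?L w - - c)) <= lik I f y w" for w
  proof -
   have "exp (- c) * (1 + (?L w - - c)) <= exp (- c) * exp (?L w - - c)"
    by (intro mult_left_mono exp_ge_add_one_self) auto
   also have "... = exp (?L w)" by (simp add: exp_add[symmetric])
   also have "... <= lik I f y w" unfolding lik_def exp_le_cancel_iff
   proof (rule sum_mono)
    fix i assume "i \<in> I"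
    show "- ((y i)^2 / 2 + (f i w)^2) <= f i w * y i - (f i w)^2 / 2"
    proof -
     have "0 <= (y i)^2 + (f i w)^2 + 2 * (f i w * y i)"
      using zero_le_power2[of "y i + f i w"] by (simp add: power2_sum mult.commute mult.left_commute)
     thus ?thesis by simp
    qed
   qed
   finally show ?thesis .
  qed
  have "exp (- c) = (LINT w|M. exp (- c) * (1 + (?L w - - c)))"
   using Li LI by (simp add: prob_space)
  also have "... <= partf M I f y" unfolding partf_def
   by (rule integral_mono) (use Li le lik_integrable in auto)
  finally show ?thesis by (simp add: ln_ge_iff part_pos)
 qed
 moreover have "ln (partf M I f y) <= c"
 proof -
  have "ln (partf M I f y) <= ln (exp (\<Sum>i\<in>I. (y i)^2 / 2))" using part_le[of y] part_pos[of y] by (subst ln_le_cancel_iff) auto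
  also have "... <= c" unfolding c_def by (simp, intro sum_mono) auto
  finally show ?thesis .
 qed
 ultimately show ?thesis unfolding c_def by linarith
qed

end

context snr
begin

text \<open>The planted representation puts all the channels below on the common space \<open>M \<Otimes>\<^sub>M G\<close>, where
 their observations converge pointwise.\<close>

context
 fixes es :: "nat => 'i => 'a => real" and gs :: "nat => 'i => real" and g :: "'i => real" and b :: real
 assumes sq: "!!i. i \<in> I ==> integrable M (%w. (e i w)^2)"
  and es_meas: "!!k i. i \<in> I ==> es k i \<in> borel_measurable M"
  and es_le: "!!k i w. i \<in> I ==> \<bar>es k i w\<bar> <= \<bar>e i w\<bar>"
  and es_lim: "!!i w. i \<in> I ==> (%k. es k i w) \<longlonglongrightarrow> e i w"
  and gs_bound: "!!k i. i \<in> I ==> 0 <= gs k i \<and> gs k i <= b"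
  and gs_lim: "!!i. i \<in> I ==> (%k. gs k i) \<longlonglongrightarrow> g i"
begin

definition "fs k = amp (es k) (gs k)"
definition "planted f p = (\<lambda>i\<in>I. snd p i + f i (fst p))"

lemma fs_channel: "channel M I (fs k)"
 unfolding fs_def by (rule snr.channel_amp, intro snr.intro snr_axioms.intro prob_space_axioms fin es_meas)

lemma fs_lim: "i \<in> I ==> (%k. fs k i w) \<longlonglongrightarrow> amp e g i w"
 unfolding fs_def amp_def by (intro tendsto_intros es_lim gs_lim)

lemma fs_sq_le: "i \<in> I ==> (fs k i w)^2 <= b * (e i w)^2"
proof -
 assume i: "i \<in> I"
 have "(es k i w)^2 <= (e i w)^2" using es_le[OF i, of k w] by (simp add: abs_le_square_iff)
 thus ?thesis using gs_bound[OF i, of k] by (auto simp: fs_def amp_def power_mult_distrib intro!: mult_mono)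
qed

lemma fs_sq_integrable: "i \<in> I ==> integrable M (%w. (fs k i w)^2)"
proof -
 assume i: "i \<in> I"
 have bi: "integrable M (%w. b * (e i w)^2)" using sq[OF i] by simp
 show ?thesis
  by (rule Bochner_Integration.integrable_bound[OF bi])
   (use channel.meas[OF fs_channel, of i k] i fs_sq_le[OF i, of k] in \<open>auto intro!: AE_I2 intro: order_trans[OF _ abs_ge_self]\<close>)
qed

lemma planted_lim: "i \<in> I ==> (%k. planted (fs k) p i) \<longlonglongrightarrow> planted (amp e g) p i"
 unfolding planted_def by (simp add: tendsto_add fs_lim)

lemma planted_sq_le: "i \<in> I ==> (planted (fs k) p i)^2 <= 2 * (snd p i)^2 + 2 * b * (e i (fst p))^2"
proof -
 assume i: "i \<in> I"
 have "(snd p i + fs k i (fst p))^2 <= 2 * (snd p i)^2 + 2 * (fs k i (fst p))^2"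
  using zero_le_power2[of "snd p i - fs k i (fst p)"] by (simp add: power2_sum power2_diff)
 thus ?thesis using fs_sq_le[OF i, of k "fst p"] i by (simp add: planted_def)
qed

text \<open>Dominated convergence under the prior for a fixed \<open>p\<close>:
  \<open>lik_le\<close> bounds the likelihood by a function of the observation alone, and the
  planted observations stay bounded along the sequence.\<close>

lemma weighted_lik_lim:
 assumes hm: "!!k. h k \<in> borel_measurable M" "h' \<in> borel_measurable M" and H: "integrable M H"
  and hl: "!!w. (%k. h k w) \<longlonglongrightarrow> h' w" and hH: "!!k w. \<bar>h k w\<bar> <= H w"
 shows "(%k. LINT w|M. h k w * lik I (fs k) (planted (fs k) p) w) \<longlonglongrightarrow> (LINT w|M. h' w * lik I (amp e g) (planted (amp e g) p) w)"
proof (rule integral_dominated_convergence)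
 let ?c = "exp (\<Sum>i\<in>I. (2 * (snd p i)^2 + 2 * b * (e i (fst p))^2) / 2)"
 show "integrable M (%w. H w * ?c)" using H by simp
 show "AE w in M. (%k. h k w * lik I (fs k) (planted (fs k) p) w) \<longlonglongrightarrow> h' w * lik I (amp e g) (planted (amp e g) p) w"
  unfolding lik_def by (intro AE_I2 tendsto_intros hl fs_lim planted_lim) auto
 show "AE w in M. norm (h k w * lik I (fs k) (planted (fs k) p) w) <= H w * ?c" for k
 proof (rule AE_I2)
  fix w
  have "lik I (fs k) (planted (fs k) p) w <= exp (\<Sum>i\<in>I. (planted (fs k) p i)^2 / 2)" by (rule lik_le)
  also have "... <= ?c" unfolding exp_le_cancel_iff by (intro sum_mono divide_right_mono planted_sq_le) auto
  finally have "lik I (fs k) (planted (fs k) p) w <= ?c" .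
  hence "\<bar>h k w\<bar> * lik I (fs k) (planted (fs k) p) w <= H w * ?c"
   using hH[of k w] lik_pos[of I "fs k" "planted (fs k) p" w] by (intro mult_mono) auto
  thus "norm (h k w * lik I (fs k) (planted (fs k) p) w) <= H w * ?c"
   using lik_pos[of I "fs k" "planted (fs k) p" w] by (simp add: abs_mult)
 qed
 show "(%w. h k w * lik I (fs k) (planted (fs k) p) w) \<in> borel_measurable M" for k
  by (intro borel_measurable_times hm channel.lik_meas1[OF fs_channel])
 show "(%w. h' w * lik I (amp e g) (planted (amp e g) p) w) \<in> borel_measurable M"
  by (intro borel_measurable_times hm channel.lik_meas1[OF channel_amp])
qed

lemma part_lim: "(%k. partf M I (fs k) (planted (fs k) p)) \<longlonglongrightarrow> partf M I (amp e g) (planted (amp e g) p)"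
 unfolding partf_def using weighted_lik_lim[of "%_ _. 1" "%_. 1" "%_. 1" p] by simp

lemma gavg_lim:
 assumes "!!k. h k \<in> borel_measurable M" "h' \<in> borel_measurable M" "integrable M H"
  and "!!w. (%k. h k w) \<longlonglongrightarrow> h' w" "!!k w. \<bar>h k w\<bar> <= H w"
 shows "(%k. gavg M I (fs k) (h k) (planted (fs k) p)) \<longlonglongrightarrow> gavg M I (amp e g) h' (planted (amp e g) p)"
 unfolding gavg_def using channel.part_pos[OF channel_amp, of g "planted (amp e g) p"]
 by (intro tendsto_divide weighted_lik_lim[OF assms] part_lim) auto

lemma planted_meas: "channel M I f ==> planted f \<in> measurable (M \<Otimes>\<^sub>M G) G"
 unfolding planted_def[abs_def] by (rule channel.shift_meas)

lemma ent_lim: "(%k. ent M I (fs k)) \<longlonglongrightarrow> ent M I (amp e g)"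
proof -
 have pl: "ent M I f = (LINT p|(M \<Otimes>\<^sub>M G). ln (partf M I f (planted f p)))"
  and pm: "(%p. ln (partf M I f (planted f p))) \<in> borel_measurable (M \<Otimes>\<^sub>M G)" if f: "channel M I f" for f
 proof -
  interpret C: channel M I f by (rule f)
  show "ent M I f = (LINT p|(M \<Otimes>\<^sub>M G). ln (partf M I f (planted f p)))"
   unfolding ent_def planted_def by (rule C.integral_planted(1)) measurable
  show "(%p. ln (partf M I f (planted f p))) \<in> borel_measurable (M \<Otimes>\<^sub>M G)"
   by (rule measurable_compose[OF planted_meas[OF f]]) measurable
 qed
 let ?w = "%p. \<Sum>i\<in>I. (2 * (snd p i)^2 + 2 * b * (e i (fst p))^2) / 2 + b * (LINT w|M. (e i w)^2)"
 show ?thesis unfolding pl[OF fs_channel] pl[OF channel_amp]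
 proof (rule integral_dominated_convergence[where w="?w"])
  interpret MG: pair_prob_space M G ..
  show "integrable (M \<Otimes>\<^sub>M G) ?w"
   using integrable_pair_fst(1)[OF G.prob_space_axioms sq] integrable_pair_snd(1)[OF prob_space_axioms G.prob_space_axioms std_gauss_coord(3)]
   by (intro Bochner_Integration.integrable_sum) auto
  show "AE p in M \<Otimes>\<^sub>M G. (%k. ln (partf M I (fs k) (planted (fs k) p))) \<longlonglongrightarrow> ln (partf M I (amp e g) (planted (amp e g) p))"
   using channel.part_pos[OF channel_amp] by (intro AE_I2 tendsto_ln part_lim) (simp add: less_imp_neq[symmetric])
  show "AE p in M \<Otimes>\<^sub>M G. norm (ln (partf M I (fs k) (planted (fs k) p))) <= ?w p" for k
  proof (rule AE_I2)
   fix p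
   have "\<bar>ln (partf M I (fs k) (planted (fs k) p))\<bar> <= (\<Sum>i\<in>I. (planted (fs k) p i)^2 / 2 + (LINT w|M. (fs k i w)^2))"
    by (rule channel.ln_part_abs_le[OF fs_channel fs_sq_integrable])
   also have "... <= ?w p"
   proof (intro sum_mono add_mono divide_right_mono planted_sq_le)
    fix i assume i: "i \<in> I"
    have "(LINT w|M. (fs k i w)^2) <= (LINT w|M. b * (e i w)^2)"
     using fs_sq_integrable[OF i] sq[OF i] fs_sq_le[OF i] by (intro integral_mono) auto
    thus "(LINT w|M. (fs k i w)^2) <= b * (LINT w|M. (e i w)^2)" by simp
   qed auto
   finally show "norm (ln (partf M I (fs k) (planted (fs k) p))) <= ?w p" by simp
  qed
 qed (rule pm[OF channel_amp] pm[OF fs_channel])+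
qed

text \<open>The squares of the posterior means are dominated by the posterior means of the squares,
  which vary with \<open>k\<close>. By the tower property the integrals of these are prior moments,
  which converge, so Pratt's lemma applies.\<close>

lemma gavg_sq_lim:
 assumes i: "i \<in> I"
 shows "(%k. LINT y|obs_law M I (fs k). (gavg M I (fs k) (es k i) y)^2) \<longlonglongrightarrow> (LINT y|obs_law M I (amp e g). (gavg M I (amp e g) (e i) y)^2)"
proof -
 note em = meas[OF i] es_meas[OF i]
 have ei: "integrable M (e i)" by (rule square_integrable_imp_integrable[OF em(1) sq[OF i]])
 have esq: "(es k i w)^2 <= (e i w)^2" for k w using es_le[OF i, of k w] by (simp add: abs_le_square_iff)
 have es2: "integrable M (%w. (es k i w)^2)" for k
  by (rule Bochner_Integration.integrable_bound[OF sq[OF i]]) (use em esq in auto)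
 have em2: "(%w. (es k i w)^2) \<in> borel_measurable M" "(%w. (e i w)^2) \<in> borel_measurable M" for k using em by auto
 have sqpl: "(LINT y|obs_law M I f. (gavg M I f h y)^2) = (LINT p|(M \<Otimes>\<^sub>M G). (gavg M I f h (planted f p))^2)"
  and sqm: "(%p. (gavg M I f h (planted f p))^2) \<in> borel_measurable (M \<Otimes>\<^sub>M G)"
  if f: "channel M I f" and h: "h \<in> borel_measurable M" for f h
 proof -
  interpret C: channel M I f by (rule f)
  have m: "gavg M I f h \<in> borel_measurable G" by (rule C.gavg_meas[OF h])
  show "(LINT y|obs_law M I f. (gavg M I f h y)^2) = (LINT p|(M \<Otimes>\<^sub>M G). (gavg M I f h (planted f p))^2)"
   unfolding planted_def by (rule C.integral_planted(1)) (use m in measurable)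
  show "(%p. (gavg M I f h (planted f p))^2) \<in> borel_measurable (M \<Otimes>\<^sub>M G)"
   by (intro borel_measurable_power measurable_compose[OF planted_meas[OF f] m])
 qed
 have pl1: "integrable (M \<Otimes>\<^sub>M G) (%p. gavg M I f h (planted f p))"
  and pl2: "(LINT p|(M \<Otimes>\<^sub>M G). gavg M I f h (planted f p)) = (LINT w|M. h w)"
  if f: "channel M I f" and h: "integrable M h" for f h
 proof -
  interpret C: channel M I f by (rule f)
  have m: "gavg M I f h \<in> borel_measurable G" using h by (intro C.gavg_meas) auto
  show "integrable (M \<Otimes>\<^sub>M G) (%p. gavg M I f h (planted f p))"
   using C.gavg_integral(1)[OF h] unfolding C.integral_planted(2)[OF m] planted_def .
  show "(LINT p|(M \<Otimes>\<^sub>M G). gavg M I f h (planted f p)) = (LINT w|M. h w)"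
   using C.gavg_integral(2)[OF h] unfolding C.integral_planted(1)[OF m] planted_def .
 qed
 have "(%k. LINT p|(M \<Otimes>\<^sub>M G). (gavg M I (fs k) (es k i) (planted (fs k) p))^2)
  \<longlonglongrightarrow> (LINT p|(M \<Otimes>\<^sub>M G). (gavg M I (amp e g) (e i) (planted (amp e g) p))^2)"
 proof (rule integral_pratt[where D="%k p. gavg M I (fs k) (%w. (es k i w)^2) (planted (fs k) p)" and D'="%p. gavg M I (amp e g) (%w. (e i w)^2) (planted (amp e g) p)"])
  show "0 <= (gavg M I (fs k) (es k i) (planted (fs k) p))^2 \<and> (gavg M I (fs k) (es k i) (planted (fs k) p))^2 <= gavg M I (fs k) (%w. (es k i w)^2) (planted (fs k) p)" for k p
   using channel.gavg_sq_le[OF fs_channel em(2) es2] by simp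
  show "(%k. (gavg M I (fs k) (es k i) (planted (fs k) p))^2) \<longlonglongrightarrow> (gavg M I (amp e g) (e i) (planted (amp e g) p))^2" for p
   by (rule tendsto_power[OF gavg_lim[where H="%w. \<bar>e i w\<bar>"]]) (use em ei es_lim[OF i] es_le[OF i] in auto)
  show "(%k. gavg M I (fs k) (%w. (es k i w)^2) (planted (fs k) p)) \<longlonglongrightarrow> gavg M I (amp e g) (%w. (e i w)^2) (planted (amp e g) p)" for p
   by (rule gavg_lim[where H="%w. (e i w)^2", OF em2 sq[OF i] tendsto_power[OF es_lim[OF i]]]) (use esq in auto)
  show "(%k. LINT p|(M \<Otimes>\<^sub>M G). gavg M I (fs k) (%w. (es k i w)^2) (planted (fs k) p)) \<longlonglongrightarrow> (LINT p|(M \<Otimes>\<^sub>M G). gavg M I (amp e g) (%w. (e i w)^2) (planted (amp e g) p))"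
   unfolding pl2[OF fs_channel es2] pl2[OF channel_amp sq[OF i]]
   by (rule integral_dominated_convergence[where w="%w. (e i w)^2"]) (use em2 sq[OF i] esq in \<open>auto intro!: tendsto_power es_lim[OF i]\<close>)
 qed (rule sqm[OF fs_channel em(2)] sqm[OF channel_amp em(1)] pl1[OF fs_channel es2] pl1[OF channel_amp sq[OF i]])+
 thus ?thesis unfolding sqpl[OF fs_channel em(2)] sqpl[OF channel_amp em(1)] .
qed

end

end

text \<open>Two bounded signals are compared by moving the signal-to-noise ratio from one copy of the index
 set to the other.\<close>

lemma ent_path_bound:
 assumes b: "bsnr M I e B" and b': "bsnr M I e' B" and g0: "\<forall>i\<in>I. 0 <= g i" and tau: "0 < tau"
 shows "ent M I (amp e' g) - ent M I (amp e g)
  <= (\<Sum>i\<in>I. g i * ((LINT w|M. (e' i w - e i w)^2) / (2 * tau) + tau / 2 * (LINT w|M. (e' i w + e i w)^2))) / 2"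
proof -
 interpret E: bsnr M I e B by fact
 interpret E': bsnr M I e' B by fact
 let ?I = "I <+> I" and ?e = "case_sum e e'"
 interpret D: bsnr M ?I ?e B
  by (intro bsnr.intro snr.intro snr_axioms.intro bsnr_axioms.intro E.prob_space_axioms)
   (use E.fin E.meas E'.meas E.bound E'.bound E.B0 in auto)
 define q where "q = (%s t::real. case_sum (%i. s * g i) (%i. t * g i))"
 define ph where "ph = (%s. D.Phi (q (1 - s) s))"
 define L where "L = (%i. (LINT w|M. (e' i w - e i w)^2) / (2 * tau) + tau / 2 * (LINT w|M. (e' i w + e i w)^2))"
 define c where "c = 4 * B^2 * (\<Sum>i\<in>I. g i)"
 have c0: "0 <= c" unfolding c_def using g0 by (intro mult_nonneg_nonneg sum_nonneg) auto
 have q0: "\<forall>k\<in>?I. 0 <= q s t k" if "0 <= s" "0 <= t" for s t using g0 that by (auto simp: q_def)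
 have sumq: "(\<Sum>k\<in>?I. q s t k * h k) = s * (\<Sum>i\<in>I. g i * h (Inl i)) + t * (\<Sum>i\<in>I. g i * h (Inr i))" for s t h
  using E.fin by (simp add: sum.Plus q_def sum_distrib_left mult.assoc)
 have qadd: "(%k. q s t k + q s' t' k) = q (s + s') (t + t')" for s t s' t'
  by (auto simp: q_def fun_eq_iff distrib_right split: sum.splits)
 \<comment> \<open>The difference of the two squared posterior means is the product of the means of
   \<open>e' - e\<close> and \<open>e' + e\<close>. Young's inequality with weight
   \<open>tau\<close> separates them, and posterior second moments are bounded by prior
   ones.\<close>
 have AAd: "D.AA h (Inr i) - D.AA h (Inl i) <= L i" if i: "i \<in> I" for h i
 proof -
  interpret C: channel M ?I "amp ?e h" by (rule D.channel_amp)
  let ?d = "%w. e' i w - e i w" and ?s = "%w. e' i w + e i w"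
  have m: "e i \<in> borel_measurable M" "e' i \<in> borel_measurable M" using E.meas E'.meas i by auto
  have i1: "integrable M (e i)" "integrable M (e' i)" using E.e_integrable E'.e_integrable i by auto
  have i2: "integrable M (%w. (?d w)^2)" "integrable M (%w. (?s w)^2)"
  proof -
   have sqb: "(a - b)^2 <= (2 * B)^2" "(a + b)^2 <= (2 * B)^2" if "\<bar>a\<bar> <= B" "\<bar>b\<bar> <= B" for a b :: real
    using that by (intro abs_le_square_iff[THEN iffD1]; linarith)+
   show "integrable M (%w. (?d w)^2)" "integrable M (%w. (?s w)^2)"
    using m sqb[OF E'.bound[OF i] E.bound[OF i]] by (auto intro!: E.integrable_const_bound[where B="(2 * B)^2"] AE_I2 simp del: power_mult_distrib)
  qed
  have dm: "?d \<in> borel_measurable M" "?s \<in> borel_measurable M" using m by auto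
  have gs: "D.gm h ?s y = D.gm h (e' i) y + D.gm h (e i) y" for y
   using i1 C.mult_lik_integrable[OF i1(1)] C.mult_lik_integrable[OF i1(2)]
   by (simp add: gavg_def distrib_right add_divide_distrib)
  have gd: "D.gm h ?d y = D.gm h (e' i) y - D.gm h (e i) y" for y by (rule C.gavg_diff[OF i1(2,1)])
  have pt: "(D.gm h (e' i) y)^2 - (D.gm h (e i) y)^2 <= (D.gm h ?d y)^2 / (2 * tau) + tau / 2 * (D.gm h ?s y)^2" for y
  proof -
   define x where "x = D.gm h ?d y"
   define z where "z = D.gm h ?s y"
   have "(D.gm h (e' i) y)^2 - (D.gm h (e i) y)^2 = x * z" unfolding x_def z_def gs gd by (simp add: power2_eq_square algebra_simps)
   moreover have "0 <= (x - tau * z)^2 / (2 * tau)" using tau by simp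
   moreover have "(x - tau * z)^2 / (2 * tau) = x^2 / (2 * tau) - x * z + tau / 2 * z^2"
    using tau by (simp add: field_simps power2_eq_square)
   ultimately show ?thesis unfolding x_def z_def by linarith
  qed
  have sq1: "integrable (D.ol h) (%y. (D.gm h (e' i) y)^2)" "integrable (D.ol h) (%y. (D.gm h (e i) y)^2)"
   using C.gavg_sq_integrable[OF m(2) E'.e_sq_integrable[OF i]] C.gavg_sq_integrable[OF m(1) E.e_sq_integrable[OF i]] by auto
  have sq2: "integrable (D.ol h) (%y. (D.gm h ?d y)^2)" "integrable (D.ol h) (%y. (D.gm h ?s y)^2)"
   using C.gavg_sq_integrable[OF dm(1) i2(1)] C.gavg_sq_integrable[OF dm(2) i2(2)] by auto
  have "D.AA h (Inr i) - D.AA h (Inl i) = (LINT y|D.ol h. (D.gm h (e' i) y)^2 - (D.gm h (e i) y)^2)"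
   unfolding D.AA_def using sq1 by simp
  also have "... <= (LINT y|D.ol h. (D.gm h ?d y)^2 / (2 * tau) + tau / 2 * (D.gm h ?s y)^2)"
   using sq1 sq2 by (intro integral_mono pt) auto
  also have "... = (LINT y|D.ol h. (D.gm h ?d y)^2) / (2 * tau) + tau / 2 * (LINT y|D.ol h. (D.gm h ?s y)^2)"
   using sq2 by simp
  also have "... <= L i" unfolding L_def
   using tau C.gavg_sq_integral_bounds(2)[OF dm(1) i2(1)] C.gavg_sq_integral_bounds(2)[OF dm(2) i2(2)]
   by (intro add_mono divide_right_mono mult_left_mono) auto
  finally show ?thesis .
 qed
 have "ph 1 - ph 0 <= (\<Sum>i\<in>I. g i * L i) / 2"
 proof (rule telescoping_le)
  show "0 < 1 / (3 * (c + 1))" using c0 by simp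
  fix s u :: real assume s: "0 <= s" "0 < u" "u <= 1 / (3 * (c + 1))" "s + u <= 1"
  \<comment> \<open>The chain rule only handles nonnegative increments, so the points
    \<open>s\<close> and \<open>s + u\<close> of the path are both compared with the common lower
    point of ratios \<open>1 - s - u\<close> and \<open>s\<close>.\<close>
  let ?q = "q (1 - s - u) s"
  have "c * u <= (c + 1) * u" using s by (intro mult_right_mono) auto
  also have "... <= (c + 1) * (1 / (3 * (c + 1)))" using s c0 by (intro mult_left_mono) auto
  also have "... = 1 / 3" using c0 by simp
  finally have cu: "c * u <= 1 / 3" .
  have sq: "(\<Sum>k\<in>?I. q 0 u k) = u * (\<Sum>i\<in>I. g i)" using sumq[of 0 u "%_. 1"] by simp
  hence X: "4 * B^2 * (\<Sum>k\<in>?I. q 0 u k) = c * u" by (simp add: c_def)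
  have up: "D.Phi (%k. ?q k + q 0 u k) - D.Phi ?q <= (\<Sum>k\<in>?I. q 0 u k * D.AA ?q k) / 2 + (4 * B^2 * (\<Sum>k\<in>?I. q 0 u k))^2"
   by (rule D.Phi_upper) (use q0 s X cu in auto)
  have lo: "(\<Sum>k\<in>?I. q u 0 k * D.AA ?q k) / 2 <= D.Phi (%k. ?q k + q u 0 k) - D.Phi ?q"
   by (rule D.Phi_lower) (use q0 s in auto)
  have "ph (s + u) - ph s = D.Phi (%k. ?q k + q 0 u k) - D.Phi (%k. ?q k + q u 0 k)"
   unfolding ph_def qadd by (simp add: algebra_simps)
  also have "... <= u * ((\<Sum>i\<in>I. g i * (D.AA ?q (Inr i) - D.AA ?q (Inl i))) / 2) + c^2 * u^2"
   using up lo unfolding X sumq by (simp add: sum_subtractf right_diff_distrib diff_divide_distrib power_mult_distrib)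
  also have "... <= u * ((\<Sum>i\<in>I. g i * L i) / 2) + c^2 * u^2"
   using s g0 AAd by (intro add_mono mult_left_mono divide_right_mono sum_mono) auto
  finally show "ph (s + u) - ph s <= (\<Sum>i\<in>I. g i * L i) / 2 * u + c^2 * u^2" by (simp add: mult.commute)
 qed
 moreover have "ph 0 = ent M I (amp e g)" unfolding ph_def D.Phi_def
  by (rule ent_reindex[where io=Inl, OF D.channel_amp E.channel_amp]) (auto simp: amp_def q_def)
 moreover have "ph 1 = ent M I (amp e' g)" unfolding ph_def D.Phi_def
  by (rule ent_reindex[where io=Inr, OF D.channel_amp E'.channel_amp]) (auto simp: amp_def q_def)
 ultimately show ?thesis unfolding L_def by simp
qed

lemma clip_dist: "0 <= K ==> K <= K' ==> \<bar>clip K' x - clip K x\<bar> <= \<bar>x - clip K x\<bar>"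
 by (auto simp: clip_def max_def min_def abs_if)

lemma clip_tendsto: "(%k. clip (real (Suc k)) x) \<longlonglongrightarrow> x"
proof (rule tendsto_eventually)
 obtain N :: nat where N: "\<bar>x\<bar> < real N" using reals_Archimedean2 by blast
 show "\<forall>\<^sub>F k in sequentially. clip (real (Suc k)) x = x"
  using eventually_ge_at_top[of N]
 proof eventually_elim
  case (elim k)
  hence "\<bar>x\<bar> <= real (Suc k)" using N by simp
  thus ?case by (auto simp: clip_def)
 qed
qed

section \<open>Scalar channels with unbounded signals\<close>

definition ovl :: "real measure => (real => real) => real => real"
 where "ovl P e g = (LINT y|obs_law P {()} (amp (%_. e) (%_. g)). (gavg P {()} (amp (%_. e) (%_. g)) e y)^2)"

context prior
begin

abbreviation "E2 \<equiv> LINT x|P. x^2"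

lemma integrable_id: "integrable P (%x. x)"
 by (rule square_integrable_imp_integrable) (auto simp: sq)

lemma snr_id: "snr P {()} (%_ x. x)"
 by (intro snr.intro snr_axioms.intro prob_space_axioms) auto

lemma bsnr_clip': "0 <= K ==> K <= B ==> bsnr P {()} (%_. clip K) B"
 by (intro bsnr.intro snr.intro snr_axioms.intro bsnr_axioms.intro prob_space_axioms)
  (auto intro: order_trans[OF clip_bound])

definition "tail K = (LINT x|P. (x - clip K x)^2)"

lemma tail_sq_le: "0 <= K ==> (x - clip K x)^2 <= x^2"
 by (rule abs_le_square_iff[THEN iffD1]) (auto simp: clip_def)

lemma tail_integrable: "0 <= K ==> integrable P (%x. (x - clip K x)^2)"
 by (rule Bochner_Integration.integrable_bound[OF sq]) (use tail_sq_le in auto)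

lemma tail_tendsto: "(%k. tail (real (Suc k))) \<longlonglongrightarrow> 0"
proof -
 have "(%k. tail (real (Suc k))) \<longlonglongrightarrow> (LINT x|P. 0)" unfolding tail_def
 proof (rule integral_dominated_convergence[where w="%x. x^2"])
  show "AE x in P. (%k. (x - clip (real (Suc k)) x)^2) \<longlonglongrightarrow> 0"
  proof (rule AE_I2)
   fix x :: real
   have "(%k. (x - clip (real (Suc k)) x)^2) \<longlonglongrightarrow> (x - x)^2" by (intro tendsto_intros clip_tendsto)
   thus "(%k. (x - clip (real (Suc k)) x)^2) \<longlonglongrightarrow> 0" by simp
  qed
  show "AE x in P. norm ((x - clip (real (Suc k)) x)^2) <= x^2" for k
   using tail_sq_le[of "real (Suc k)"] by (intro AE_I2) auto
 qed (use sq in auto)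
 thus ?thesis by simp
qed

lemma scal_clip_tendsto: "0 <= g ==> (%k. scal P (clip (real (Suc k))) g) \<longlonglongrightarrow> scal P (%x. x) g"
 and ovl_clip_tendsto: "0 <= g ==> (%k. ovl P (clip (real (Suc k))) g) \<longlonglongrightarrow> ovl P (%x. x) g"
proof -
 assume g: "0 <= g"
 interpret S: snr P "{()}" "%_ x. x" by (rule snr_id)
 have fs: "S.fs (%k _. clip (real (Suc k))) (%_ _. g) k = amp (%_. clip (real (Suc k))) (%_. g)" for k
  by (rule S.fs_def[where b=g and g="%_. g"]) (use sq g clip_tendsto clip_le_self[of "real (Suc _)"] in auto)
 show "(%k. scal P (clip (real (Suc k))) g) \<longlonglongrightarrow> scal P (%x. x) g"
  unfolding scal_def fs[symmetric] by (rule S.ent_lim[where b=g]) (use sq g clip_tendsto clip_le_self[of "real (Suc _)"] in auto)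
 show "(%k. ovl P (clip (real (Suc k))) g) \<longlonglongrightarrow> ovl P (%x. x) g"
  unfolding ovl_def fs[symmetric] by (rule S.gavg_sq_lim[where b=g]) (use sq g clip_tendsto clip_le_self[of "real (Suc _)"] in auto)
qed

text \<open>The limit theorem that removes the clipping, now used with a fixed signal and a moving
  ratio.\<close>

lemma ovl_continuous: "continuous_on {0..} (ovl P (%x. x))"
 unfolding continuous_on_sequentially comp_def
proof (intro allI ballI impI)
 fix u :: "nat => real" and g assume g: "g \<in> {0..}" and u: "(\<forall>n. u n \<in> {0..}) \<and> u \<longlonglongrightarrow> g"
 interpret S: snr P "{()}" "%_ x. x" by (rule snr_id)
 obtain b where b: "!!n. \<bar>u n\<bar> <= b"
  using convergent_imp_Bseq[of u] u unfolding convergent_def Bseq_def by auto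
 have ub: "0 <= u n \<and> u n <= b" for n using b[of n] u by auto
 have fs: "S.fs (%k _ x. x) (%k _. u k) k = amp (%_ x. x) (%_. u k)" for k
  by (rule S.fs_def[where b=b and g="%_. g"]) (use sq ub u in auto)
 show "(%n. ovl P (%x. x) (u n)) \<longlonglongrightarrow> ovl P (%x. x) g"
  unfolding ovl_def fs[symmetric] by (rule S.gavg_sq_lim[where b=b]) (use sq ub u in auto)
qed

lemma scal_clip_increment:
 assumes K: "0 <= K" and g: "0 <= g" and d: "0 <= d"
 shows "d * ovl P (clip K) g / 2 <= scal P (clip K) (g + d) - scal P (clip K) g" (is ?C1)
  "scal P (clip K) (g + d) - scal P (clip K) g <= d * ovl P (clip K) (g + d) / 2" (is ?C2)
proof -
 interpret B: bsnr P "{()}" "%_. clip K" K by (rule bsnr_clip[OF K])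
 have Phi: "B.Phi (%_. g) = scal P (clip K) g" for g by (simp add: B.Phi_def scal_def)
 have AA: "B.AA (%_. g) () = ovl P (clip K) g" for g by (simp add: B.AA_def ovl_def)
 have lo: "d * ovl P (clip K) g / 2 <= scal P (clip K) (g + d) - scal P (clip K) g" if "0 <= g" "0 <= d" for g d
  using B.Phi_lower[of "%_. g" "%_. d"] that by (simp add: Phi AA)
 show ?C1 by (rule lo[OF g d])
 have mono: "ovl P (clip K) g <= ovl P (clip K) (g + d)" if "0 <= g" "0 <= d" for g d
  using B.AA_mono[of "%_. g" "%_. d" "()"] that by (simp add: AA)
 have "scal P (clip K) (g + 1 * d) - scal P (clip K) (g + 0 * d) <= d * ovl P (clip K) (g + d) / 2"
 proof (rule telescoping_le[where ph="%s. scal P (clip K) (g + s * d)" and C="(4 * K^2 * d)^2"])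
  show "0 < 1 / (3 * (4 * K^2 * d + 1))" using d by (auto intro!: divide_pos_pos add_nonneg_pos)
  fix s u :: real assume s: "0 <= s" "0 < u" "u <= 1 / (3 * (4 * K^2 * d + 1))" "s + u <= 1"
  have c0: "0 <= 4 * K^2 * d" using d by simp
  have "4 * K^2 * d * u <= (4 * K^2 * d + 1) * u" using s by (intro mult_right_mono) auto
  also have "... <= (4 * K^2 * d + 1) * (1 / (3 * (4 * K^2 * d + 1)))" using s c0 by (intro mult_left_mono) auto
  also have "... = 1 / 3"
  proof -
   have "4 * K^2 * d + 1 \<noteq> 0" using c0 by linarith
   thus ?thesis by (simp only: divide_divide_eq_left[symmetric] times_divide_eq_right mult_1_right) simp
  qed
  finally have X: "4 * K^2 * (u * d) <= 1 / 3" by (simp add: mult_ac)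
  have sd: "0 <= s * d" "0 <= u * d" using s d by auto
  have "scal P (clip K) ((g + s * d) + u * d) - scal P (clip K) (g + s * d) <= (u * d) * ovl P (clip K) (g + s * d) / 2 + (4 * K^2 * (u * d))^2"
   using B.Phi_upper[of "%_. g + s * d" "%_. u * d"] sd g X by (simp add: Phi AA)
  also have "... <= (u * d) * ovl P (clip K) (g + d) / 2 + (4 * K^2 * (u * d))^2"
  proof -
   have "0 <= (1 - s) * d" using s d by simp
   hence "ovl P (clip K) (g + s * d) <= ovl P (clip K) (g + d)"
    using mono[of "g + s * d" "(1 - s) * d"] g sd by (simp add: algebra_simps)
   thus ?thesis using sd by (intro add_mono divide_right_mono mult_left_mono) auto
  qed
  finally show "scal P (clip K) (g + (s + u) * d) - scal P (clip K) (g + s * d) <= d * ovl P (clip K) (g + d) / 2 * u + (4 * K^2 * d)^2 * u^2"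
   by (simp add: algebra_simps power_mult_distrib)
 qed
 thus ?C2 by simp
qed

lemma scal_increment:
 assumes g: "0 <= g" and d: "0 <= d"
 shows "d * ovl P (%x. x) g / 2 <= scal P (%x. x) (g + d) - scal P (%x. x) g" (is ?C1)
  "scal P (%x. x) (g + d) - scal P (%x. x) g <= d * ovl P (%x. x) (g + d) / 2" (is ?C2)
proof -
 have gd: "0 <= g + d" using g d by simp
 have D: "(%k. scal P (clip (real (Suc k))) (g + d) - scal P (clip (real (Suc k))) g) \<longlonglongrightarrow> scal P (%x. x) (g + d) - scal P (%x. x) g"
  by (intro tendsto_diff scal_clip_tendsto g gd)
 have O: "(%k. d * ovl P (clip (real (Suc k))) g / 2) \<longlonglongrightarrow> d * ovl P (%x. x) g / 2"
  "(%k. d * ovl P (clip (real (Suc k))) (g + d) / 2) \<longlonglongrightarrow> d * ovl P (%x. x) (g + d) / 2"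
  by (intro tendsto_intros ovl_clip_tendsto g gd; simp)+
 show ?C1
  by (rule LIMSEQ_le[OF O(1) D]) (use scal_clip_increment(1)[OF _ g d] in auto)
 show ?C2
  by (rule LIMSEQ_le[OF D O(2)]) (use scal_clip_increment(2)[OF _ g d] in auto)
qed

lemma clip_pair_bounds:
 assumes K: "0 <= K" "K <= K'"
 shows "(LINT x|P. (clip K' x - clip K x)^2) <= tail K" (is ?C1) "(LINT x|P. (clip K' x + clip K x)^2) <= 4 * E2" (is ?C2)
proof -
 have d: "(clip K' x - clip K x)^2 <= (x - clip K x)^2" for x
  by (rule abs_le_square_iff[THEN iffD1, OF clip_dist[OF K]])
 have s: "(clip K' x + clip K x)^2 <= 4 * x^2" for x
 proof -
  have "\<bar>clip K' x + clip K x\<bar> <= \<bar>2 * x\<bar>"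
   using clip_le_self[of K x] clip_le_self[of K' x] K by linarith
  hence "(clip K' x + clip K x)^2 <= (2 * x)^2" by (rule abs_le_square_iff[THEN iffD1])
  thus ?thesis by (simp add: power_mult_distrib)
 qed
 have "integrable P (%x. (clip K' x - clip K x)^2)"
  by (rule Bochner_Integration.integrable_bound[OF tail_integrable[OF K(1)]]) (use d in auto)
 thus ?C1
  unfolding tail_def by (intro integral_mono tail_integrable K d)
 have s4: "integrable P (%x. 4 * x^2)" using sq by simp
 have "integrable P (%x. (clip K' x + clip K x)^2)"
  by (rule Bochner_Integration.integrable_bound[OF s4]) (use s in auto)
 hence "(LINT x|P. (clip K' x + clip K x)^2) <= (LINT x|P. 4 * x^2)" by (intro integral_mono s s4)
 thus ?C2 by simp
qed

text \<open>\<open>ent_path_bound\<close> between two clipping levels, then the higher level goes to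
  infinity. With \<open>tau\<close> small first and \<open>K\<close> large afterwards, both terms
  become small.\<close>

lemma scal_truncation:
 assumes K: "0 <= K" and g: "0 <= g" and tau: "0 < tau"
 shows "\<bar>scal P (%x. x) g - scal P (clip K) g\<bar> <= g * (tail K / (2 * tau) + tau / 2 * (4 * E2)) / 2" (is "_ <= ?R")
proof (rule LIMSEQ_le_const2)
 show "(%k. \<bar>scal P (clip (real (Suc k))) g - scal P (clip K) g\<bar>) \<longlonglongrightarrow> \<bar>scal P (%x. x) g - scal P (clip K) g\<bar>"
  by (intro tendsto_intros scal_clip_tendsto g)
 obtain N :: nat where N: "K <= real N" using reals_Archimedean2[of K] less_imp_le by blast
 have "\<bar>scal P (clip K') g - scal P (clip K) g\<bar> <= ?R" if K': "K <= K'" for K'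
 proof -
  have b: "bsnr P {()} (%_. clip K) K'" "bsnr P {()} (%_. clip K') K'" using K K' by (auto intro!: bsnr_clip')
  note bd = clip_pair_bounds[OF K K']
  have le: "g * ((LINT x|P. (clip K' x - clip K x)^2) / (2 * tau) + tau / 2 * (LINT x|P. (clip K' x + clip K x)^2)) / 2 <= ?R"
   using bd g tau by (intro divide_right_mono mult_left_mono add_mono) auto
  have "scal P (clip K') g - scal P (clip K) g <= ?R"
   using ent_path_bound[OF b(1) b(2) _ tau, of "%_. g"] g le unfolding scal_def by simp
  moreover have "scal P (clip K) g - scal P (clip K') g <= ?R"
   using ent_path_bound[OF b(2) b(1) _ tau, of "%_. g"] g le unfolding scal_def by (simp add: power2_commute add.commute)
  ultimately show ?thesis by linarith
 qed
 thus "\<exists>N. \<forall>k\<ge>N. \<bar>scal P (clip (real (Suc k))) g - scal P (clip K) g\<bar> <= ?R"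
  using N by (intro exI[of _ N]) auto
qed

lemma ovl_bounds: "0 <= ovl P (%x. x) g" (is ?C1) "ovl P (%x. x) g <= E2" (is ?C2)
proof -
 interpret S: snr P "{()}" "%_ x. x" by (rule snr_id)
 show ?C1 unfolding ovl_def by simp
 show ?C2 unfolding ovl_def
  by (rule channel.gavg_sq_integral_bounds(2)[OF S.channel_amp _ sq]) simp
qed

end

section \<open>Conditional expectation, and strict monotonicity of the scalar overlap\<close>

context channel
begin

text \<open>The defining identity of conditional expectation: the posterior mean at the observation
  integrates like \<open>g\<close> over every event determined by the observation. For
  \<open>g >= 0\<close> this is \<open>nishimori_nn\<close>; positive and negative parts do the
  rest.\<close>

lemma gavg_planted_set:
 assumes g: "integrable M g" and B[measurable]: "B \<in> sets G"
 shows "(LINT p|(M \<Otimes>\<^sub>M G). indicator B (\<lambda>i\<in>I. snd p i + f i (fst p)) * g (fst p))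
  = (LINT p|(M \<Otimes>\<^sub>M G). indicator B (\<lambda>i\<in>I. snd p i + f i (fst p)) * gavg M I f g (\<lambda>i\<in>I. snd p i + f i (fst p)))"
  (is "?L g = ?R g")
proof -
 let ?p = "%p. \<lambda>i\<in>I. snd p i + f i (fst p)"
 have nonneg: "?L g = ?R g" if g: "integrable M g" "!!w. 0 <= g w" for g
 proof -
  have gm[measurable]: "g \<in> borel_measurable M" using g by auto
  have gv[measurable]: "gavg M I f g \<in> borel_measurable G" by (rule gavg_meas[OF gm])
  have nn: "0 <= gavg M I f g y" for y
   unfolding gavg_def by (intro divide_nonneg_pos part_pos integral_nonneg_AE AE_I2) (simp add: g less_imp_le[OF lik_pos])
  have "(\<integral>\<^sup>+p. ennreal (indicator B (?p p) * g (fst p)) \<partial>(M \<Otimes>\<^sub>M G))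
   = (\<integral>\<^sup>+w. \<integral>\<^sup>+z. indicator B (\<lambda>i\<in>I. z i + f i w) * ennreal (g w) \<partial>G \<partial>M)"
   by (subst G.nn_integral_fst[symmetric]) (auto simp: ennreal_mult g ennreal_indicator)
  also have "... = (\<integral>\<^sup>+y. \<integral>\<^sup>+w. indicator B y * ennreal (g w) * ennreal (lik I f y w) \<partial>M \<partial>G)"
   by (rule nishimori_nn[symmetric]) measurable
  also have "... = (\<integral>\<^sup>+y. ennreal (partf M I f y) * (indicator B y * ennreal (gavg M I f g y)) \<partial>G)"
  proof (intro nn_integral_cong)
   fix y
   have "(\<integral>\<^sup>+w. ennreal (g w) * ennreal (lik I f y w) \<partial>M) = (\<integral>\<^sup>+w. ennreal (g w * lik I f y w) \<partial>M)"
    by (simp add: ennreal_mult g less_imp_le[OF lik_pos])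
   also have "... = ennreal (LINT w|M. g w * lik I f y w)"
    by (rule nn_integral_eq_integral) (auto simp: mult_lik_integrable g less_imp_le[OF lik_pos])
   also have "... = ennreal (partf M I f y) * ennreal (gavg M I f g y)"
    using part_pos[of y] unfolding gavg_def by (subst ennreal_mult'[symmetric]) (auto simp: less_imp_le)
   finally show "(\<integral>\<^sup>+w. indicator B y * ennreal (g w) * ennreal (lik I f y w) \<partial>M) = ennreal (partf M I f y) * (indicator B y * ennreal (gavg M I f g y))"
    by (cases "y \<in> B") simp_all
  qed
  also have "... = (\<integral>\<^sup>+y. indicator B y * ennreal (gavg M I f g y) \<partial>obs_law M I f)"
   by (rule nn_integral_obs_law[symmetric]) measurable
  also have "... = (\<integral>\<^sup>+p. indicator B (?p p) * ennreal (gavg M I f g (?p p)) \<partial>(M \<Otimes>\<^sub>M G))"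
   unfolding distr_planted[symmetric] by (subst nn_integral_distr) auto
  also have "... = (\<integral>\<^sup>+p. ennreal (indicator B (?p p) * gavg M I f g (?p p)) \<partial>(M \<Otimes>\<^sub>M G))"
   by (simp add: ennreal_mult nn ennreal_indicator)
  finally have eq: "(\<integral>\<^sup>+p. ennreal (indicator B (?p p) * g (fst p)) \<partial>(M \<Otimes>\<^sub>M G)) = (\<integral>\<^sup>+p. ennreal (indicator B (?p p) * gavg M I f g (?p p)) \<partial>(M \<Otimes>\<^sub>M G))" .
  show ?thesis
   by (subst (1 2) integral_eq_nn_integral) (auto simp: eq g nn)
 qed
 define gp where "gp = (%w. max 0 (g w))"
 define gn where "gn = (%w. max 0 (- g w))"
 have i: "integrable M gp" "integrable M gn" using g unfolding gp_def gn_def by auto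
 have n: "!!w. 0 <= gp w" "!!w. 0 <= gn w" unfolding gp_def gn_def by auto
 have [measurable]: "gp \<in> borel_measurable M" "gn \<in> borel_measurable M" using i by auto
 have ig: "integrable (M \<Otimes>\<^sub>M G) (%p. indicator B (?p p) * h (fst p))" if h: "integrable M h" for h :: "_ => real"
 proof (rule Bochner_Integration.integrable_bound[OF integrable_pair_fst(1)[OF G.prob_space_axioms h]])
  have [measurable]: "h \<in> borel_measurable M" using h by auto
  show "(%p. indicator B (?p p) * h (fst p)) \<in> borel_measurable (M \<Otimes>\<^sub>M G)" by measurable
 qed (auto simp: indicator_def)
 have iv: "integrable (M \<Otimes>\<^sub>M G) (%p. indicator B (?p p) * gavg M I f h (?p p))" if h: "integrable M h" for h :: "_ => real"
 proof -
  have hm: "h \<in> borel_measurable M" using h by auto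
  have m[measurable]: "gavg M I f h \<in> borel_measurable G" by (rule gavg_meas[OF hm])
  have "integrable (M \<Otimes>\<^sub>M G) (%p. gavg M I f h (?p p))" using gavg_integral(1)[OF h] unfolding integral_planted(2)[OF m] .
  thus ?thesis by (rule Bochner_Integration.integrable_bound) (auto simp: indicator_def)
 qed
 have ge: "g w = gp w - gn w" for w by (simp add: gp_def gn_def)
 have ve: "gavg M I f g y = gavg M I f gp y - gavg M I f gn y" for y
  using gavg_diff[OF i, of y] unfolding ge[symmetric] .
 have "?L g = ?L gp - ?L gn"
  unfolding ge right_diff_distrib by (rule Bochner_Integration.integral_diff[OF ig[OF i(1)] ig[OF i(2)]])
 moreover have "?R g = ?R gp - ?R gn"
  unfolding ve right_diff_distrib by (rule Bochner_Integration.integral_diff[OF iv[OF i(1)] iv[OF i(2)]])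
 ultimately show ?thesis by (simp only: nonneg[OF i(1) n(1)] nonneg[OF i(2) n(2)])
qed

end

text \<open>Raising the observation tilts the posterior by \<open>exp (c * x)\<close> with
  \<open>c > 0\<close>. The function \<open>(x - mu) * (exp (c * x) - exp (c * mu))\<close> is
  nonnegative and vanishes only at \<open>mu\<close>, so its mean under the old weight is positive
  unless the law is a point mass; this is the claim after normalisation.\<close>

lemma gavg_strict_mono:
 fixes Q :: "real measure"
 assumes Q: "prob_space Q" "sets Q = sets borel" "integrable Q (%x. x)" and nc: "!!c. \<not> (AE x in Q. x = c)"
  and d: "0 < d" and y: "y () < (y' () :: real)"
 shows "gavg Q {()} (amp (%_ x. x) (%_. d)) (%x. x) y < gavg Q {()} (amp (%_ x. x) (%_. d)) (%x. x) y'"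
proof -
 interpret Q: prob_space Q by fact
 have idm: "(%x. x) \<in> borel_measurable Q" using Q(3) by auto
 interpret S: snr Q "{()}" "%_ x. x"
  by (intro snr.intro snr_axioms.intro Q.prob_space_axioms) (use idm in auto)
 let ?f = "amp (%_::unit. %x::real. x) (%_. d)"
 interpret C: channel Q "{()}" ?f by (rule S.channel_amp)
 define c where "c = sqrt d * (y' () - y ())"
 have c: "0 < c" using d y by (simp add: c_def)
 have tilt: "lik {()} ?f y' x = lik {()} ?f y x * exp (c * x)" for x
  by (simp add: lik_def amp_def c_def exp_add[symmetric] algebra_simps)
 define mu where "mu = gavg Q {()} ?f (%x. x) y"
 note pp = C.part_pos
 have num: "(LINT x|Q. x * lik {()} ?f y x) = mu * partf Q {()} ?f y"
  using pp[of y] by (simp add: mu_def gavg_def)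
 have li: "integrable Q (%x. x * lik {()} ?f z x)" "integrable Q (lik {()} ?f z)" for z
  using C.mult_lik_integrable[OF Q(3)] C.lik_integrable by auto
 define h where "h = (%x. (x - mu) * lik {()} ?f y x * (exp (c * x) - exp (c * mu)))"
 have hrw: "h = (%x. (x * lik {()} ?f y' x - mu * lik {()} ?f y' x) - exp (c * mu) * (x * lik {()} ?f y x - mu * lik {()} ?f y x))"
  unfolding h_def tilt by (simp add: algebra_simps)
 have hi: "integrable Q h" unfolding hrw using li by auto
 have hI: "(LINT x|Q. h x) = (LINT x|Q. x * lik {()} ?f y' x) - mu * partf Q {()} ?f y'"
  unfolding hrw using li num by (simp add: partf_def)
 have h0: "0 <= h x" for x
 proof -
  have "0 <= (x - mu) * (exp (c * x) - exp (c * mu))" using c by (auto simp: zero_le_mult_iff)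
  thus ?thesis unfolding h_def using lik_pos[of "{()}" ?f y x]
   by (simp add: mult.assoc mult.left_commute[of _ "lik {()} ?f y x"] zero_le_mult_iff[of "lik {()} ?f y x"])
 qed
 have hz: "h x = 0 \<longleftrightarrow> x = mu" for x
  using c lik_pos[of "{()}" ?f y x] by (auto simp: h_def)
 have "0 < (LINT x|Q. h x)"
 proof (rule ccontr)
  assume "\<not> 0 < (LINT x|Q. h x)"
  hence "(LINT x|Q. h x) = 0" using h0 integral_nonneg_AE[of h Q] by (simp add: order_antisym)
  hence "AE x in Q. h x = 0" using integral_nonneg_eq_0_iff_AE[OF hi] h0 by auto
  thus False using nc[of mu] unfolding hz by simp
 qed
 hence "mu * partf Q {()} ?f y' < (LINT x|Q. x * lik {()} ?f y' x)" unfolding hI by simp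
 thus ?thesis unfolding mu_def[symmetric] unfolding gavg_def using pp[of y'] by (simp add: pos_less_divide_eq)
qed

lemma std_gauss_unit_no_atom:
 assumes "AE z in std_gauss {()}. z () = (t :: real)"
 shows False
proof -
 have m: "(%z. z ()) \<in> measurable (std_gauss {()}) std_normal_distribution"
  and d: "distr (std_gauss {()}) std_normal_distribution (%z. z ()) = std_normal_distribution"
  by (rule std_gauss_coord, simp)+
 have "AE x in distr (std_gauss {()}) std_normal_distribution (%z. z ()). x = t"
  using assms by (subst AE_distr_iff[OF m]) auto
 hence "AE x in std_normal_distribution. x = t" unfolding d .
 hence "AE x in lborel. x = t" by (simp add: AE_density std_normal_density_def)
 moreover have "AE x in lborel. x \<noteq> t" by (rule AE_lborel_singleton)
 ultimately have "AE x in (lborel :: real measure). False" by eventually_elim auto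
 hence "emeasure (lborel :: real measure) UNIV = 0" using AE_iff_null[of lborel "%_. False"] by (auto simp: null_sets_def)
 thus False by simp
qed

context prior
begin

lemma not_const: "0 < var ==> \<not> (AE x in P. x = c)"
proof
 assume v: "0 < var" and ae: "AE x in P. x = c"
 have "(LINT x|P. x) = (LINT x|P. c)" using ae by (intro integral_cong_AE) auto
 hence mean: "(LINT x|P. x) = c" by (simp add: prob_space[simplified])
 have "var = (LINT x|P. 0)" unfolding var_def mean using ae by (intro integral_cong_AE) auto
 thus False using v by simp
qed

text \<open>Equality in \<open>gavg_sq_mono\<close> would mean that an additional observation almost
  surely leaves the posterior mean unchanged. For a fixed first observation this mean is strictly
  increasing in the second, so it takes a given value at one point at most, which the Gaussian law
  does not charge.\<close>

lemma ovl_strict_mono: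
 assumes v: "0 < var" and g: "0 <= g" and d: "0 < d"
 shows "ovl P (%x. x) g < ovl P (%x. x) (g + d)"
proof (rule ccontr)
 assume ne: "\<not> ovl P (%x. x) g < ovl P (%x. x) (g + d)"
 interpret S: snr P "{()}" "%_ x. x" by (rule snr_id)
 let ?e = "%_::unit. %x::real. x"
 have g0: "\<forall>i\<in>{()}. 0 <= g" and d0: "\<forall>i\<in>{()}. 0 <= d" using g d by auto
 let ?a = "%y1. gavg P {()} (amp ?e (%_. g)) (%x. x) y1"
 let ?c = "%y1 y2. gavg (post P {()} (amp ?e (%_. g)) y1) {()} (amp ?e (%_. d)) (%x. x) y2"
 let ?D = "%p. (gavg P {()} (amp ?e (%_. g + d)) (%x. x) (rot {()} (%_. g) (%_. d) (fst p) (snd p)) - ?a (fst p))^2"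
 have idm: "(%x. x) \<in> borel_measurable P" by simp
 note gm = S.gavg_sq_mono[OF g0 d0 idm sq]
 interpret A: channel P "{()}" "amp ?e (%_. g)" by (rule S.channel_amp)
 interpret Sm: channel P "{()}" "amp ?e (%_. g + d)" by (rule S.channel_amp)
 have "0 <= (LINT p|S.pair_law (%_. g) (%_. d). ?D p)" by (rule integral_nonneg_AE) simp
 hence "(LINT p|S.pair_law (%_. g) (%_. d). ?D p) = 0"
  using gm(1) ne unfolding ovl_def by linarith
 hence "AE p in S.pair_law (%_. g) (%_. d). ?D p = 0"
  using integral_nonneg_eq_0_iff_AE[OF gm(2)] by auto
 hence "AE p in S.pair_law (%_. g) (%_. d). ?c (fst p) (snd p) = ?a (fst p)"
  using S.gavg_rot[OF g0 d0 idm] by (auto elim: eventually_mono)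
 hence "AE p in S.G \<Otimes>\<^sub>M S.G. ?c (fst p) (snd p) = ?a (fst p)"
  unfolding S.pair_law_def[OF g0 d0] using S.rot_meas[OF g0 d0]
  by (subst (asm) AE_density) (auto simp: Sm.part_pos)
 from S.GG.AE_pair[OF this] have ae: "AE y1 in S.G. AE y2 in S.G. ?c y1 y2 = ?a y1" by simp
 have "\<exists>y1. AE y2 in S.G. ?c y1 y2 = ?a y1"
 proof (rule ccontr)
  assume "\<nexists>y1. AE y2 in S.G. ?c y1 y2 = ?a y1"
  with ae have "AE y1 in S.G. False" by (auto elim: eventually_mono)
  thus False using S.G.AE_False by simp
 qed
 then obtain y1 where ae2: "AE y2 in S.G. ?c y1 y2 = ?a y1" by blast
 let ?Q = "post P {()} (amp ?e (%_. g)) y1"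
 have Q: "prob_space ?Q" "sets ?Q = sets borel" "integrable ?Q (%x. x)"
  using A.prob_post A.sets_post A.integrable_post[OF integrable_id] by auto
 have nc: "\<not> (AE x in ?Q. x = t)" for t
 proof
  assume "AE x in ?Q. x = t"
  hence "AE x in P. x = t"
   unfolding post_def by (subst (asm) AE_density) (auto simp: A.part_pos lik_pos divide_pos_pos)
  thus False using not_const[OF v] by blast
 qed
 have strict: "?c y1 y < ?c y1 y'" if "y () < y' ()" for y y'
  by (rule gavg_strict_mono) (use Q nc d that in auto)
 have "\<exists>y0. ?c y1 y0 = ?a y1"
 proof (rule ccontr)
  assume "\<nexists>y0. ?c y1 y0 = ?a y1"
  with ae2 have "AE y in S.G. False" by (auto elim: eventually_mono)
  thus False using S.G.AE_False by simp
 qed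
 then obtain y0 where y0: "?c y1 y0 = ?a y1" by blast
 have "AE y2 in S.G. y2 () = y0 ()"
  using ae2
 proof eventually_elim
  case (elim y2)
  thus ?case using strict[of y2 y0] strict[of y0 y2] y0 by (cases "y2 ()" "y0 ()" rule: linorder_cases) auto
 qed
 thus False by (rule std_gauss_unit_no_atom)
qed

section \<open>Identification of the scalar free energy and overlap\<close>

lemma prob_scalar_space: "prob_space (scalar_space P)"
proof -
 interpret N: prob_space std_normal_distribution by (rule prob_space_std_normal)
 interpret pair_prob_space P std_normal_distribution ..
 show ?thesis unfolding scalar_space_def by (rule prob_space_axioms)
qed

lemma scalar_space_distr:
 "(%p. (fst p, snd p ())) \<in> measurable (P \<Otimes>\<^sub>M std_gauss {()}) (scalar_space P)" (is ?C1)
 "distr (P \<Otimes>\<^sub>M std_gauss {()}) (scalar_space P) (%p. (fst p, snd p ())) = scalar_space P" (is ?C2)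
proof -
 have m: "(%z. z ()) \<in> measurable (std_gauss {()}) std_normal_distribution"
  and d: "distr (std_gauss {()}) std_normal_distribution (%z. z ()) = std_normal_distribution"
  by (rule std_gauss_coord, simp)+
 show ?C1
  unfolding scalar_space_def by (intro measurable_Pair measurable_fst measurable_compose[OF measurable_snd m])
 have "sigma_finite_measure (distr (std_gauss {()}) std_normal_distribution (%z. z ()))"
  unfolding d by (rule prob_space_imp_sigma_finite[OF prob_space_std_normal])
 from pair_measure_distr[OF measurable_ident_sets[OF refl, of P] m this]
 show ?C2
  unfolding d by (simp add: scalar_space_def distr_id2 case_prod_unfold)
qed

lemma integral_scalar_space:
 fixes h :: "real \<times> real => real"
 assumes "h \<in> borel_measurable (scalar_space P)"
 shows "(LINT w|scalar_space P. h w) = (LINT p|(P \<Otimes>\<^sub>M std_gauss {()}). h (fst p, snd p ()))"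
  "integrable (scalar_space P) h \<longleftrightarrow> integrable (P \<Otimes>\<^sub>M std_gauss {()}) (%p. h (fst p, snd p ()))"
 by (rule trans[OF arg_cong[OF scalar_space_distr(2), of "%M. integral\<^sup>L M h", symmetric] integral_distr[OF scalar_space_distr(1) assms]])
  (rule trans[OF arg_cong[OF scalar_space_distr(2), of "%M. integrable M h", symmetric] integrable_distr_eq[OF scalar_space_distr(1) assms]])

lemma unit_embed_meas: "(%y. \<lambda>i\<in>{()}. y) \<in> measurable borel (std_gauss {()})"
 by (intro measurable_restrict) auto

lemma scalar_obs_meas: "scalar_obs g \<in> measurable (scalar_space P) borel"
 unfolding scalar_obs_def scalar_space_def by measurable

text \<open>The exponent in \<open>psi\<close> is the logarithm of the likelihood at the planted
  observation \<open>sqrt g * X + Z\<close>.\<close>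

lemma psi_eq_scal:
 assumes g: "0 <= g"
 shows "psi P g = scal P (%x. x) g"
proof -
 interpret S: snr P "{()}" "%_ x. x" by (rule snr_id)
 let ?f = "amp (%_::unit. %x::real. x) (%_. g)"
 interpret C: channel P "{()}" ?f by (rule S.channel_amp)
 define h where "h = (%w. ln (partf P {()} ?f (\<lambda>i\<in>{()}. scalar_obs g w)))"
 have hm: "h \<in> borel_measurable (scalar_space P)"
  unfolding h_def using measurable_compose[OF measurable_compose[OF scalar_obs_meas unit_embed_meas] C.part_meas] by simp
 have "psi P g = (LINT w|scalar_space P. h w)"
  unfolding psi_def
 proof (rule Bochner_Integration.integral_cong[OF refl])
  fix w :: "real \<times> real"
  obtain X Z where w: "w = (X, Z)" by (cases w)
  have "sqrt g * x * Z + g * x * X - g / 2 * x^2 = sqrt g * x * (sqrt g * X + Z) - (sqrt g * x)^2 / 2" for x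
  proof -
   have "sqrt g * x * (sqrt g * X) = (sqrt g * sqrt g) * x * X" by (simp add: mult_ac)
   thus ?thesis using g by (simp add: power_mult_distrib distrib_left)
  qed
  thus "(case w of (X, Z) => ln (LINT x|P. exp (sqrt g * x * Z + g * x * X - g / 2 * x^2))) = h w"
   by (simp add: w h_def partf_def lik_def amp_def scalar_obs_def)
 qed
 also have "... = (LINT p|(P \<Otimes>\<^sub>M std_gauss {()}). ln (partf P {()} ?f (\<lambda>i\<in>{()}. snd p i + ?f i (fst p))))"
  unfolding integral_scalar_space(1)[OF hm]
  by (rule Bochner_Integration.integral_cong[OF refl]) (simp add: h_def partf_def lik_def amp_def scalar_obs_def add.commute)
 also have "... = scal P (%x. x) g"
  unfolding scal_def ent_def by (rule C.integral_planted(1)[symmetric]) measurable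
 finally show ?thesis .
qed

text \<open>By \<open>gavg_planted_set\<close> the conditional expectation is the posterior mean
  \<open>h\<close> at the observation. As \<open>h\<close> is measurable with respect to the
  observation, the mean of \<open>h\<close> times the signal is the mean of
  \<open>h^2\<close>.\<close>

lemma overlap_eq_ovl: "overlap P g = ovl P (%x. x) g"
proof -
 interpret S: snr P "{()}" "%_ x. x" by (rule snr_id)
 let ?f = "amp (%_::unit. %x::real. x) (%_. g)"
 interpret C: channel P "{()}" ?f by (rule S.channel_amp)
 let ?S = "scalar_space P" and ?Y = "scalar_obs g"
 let ?F = "vimage_algebra (space ?S) ?Y borel"
 let ?gv = "gavg P {()} ?f (%x. x)"
 let ?pl = "%p. \<lambda>i\<in>{()}. snd p i + ?f i (fst p)"
 interpret SP: prob_space ?S by (rule prob_scalar_space)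
 have gvm: "?gv \<in> borel_measurable (std_gauss {()})" by (rule C.gavg_meas) simp
 define h where "h = (%w. ?gv (\<lambda>i\<in>{()}. ?Y w))"
 have fs: "fst \<in> borel_measurable ?S" unfolding scalar_space_def by measurable
 have hm: "h \<in> borel_measurable ?S"
  unfolding h_def using measurable_compose[OF measurable_compose[OF scalar_obs_meas unit_embed_meas] gvm] by simp
 have YF: "?Y \<in> measurable ?F borel" by (rule measurable_vimage_algebra1) auto
 have hF: "h \<in> borel_measurable ?F"
  unfolding h_def using measurable_compose[OF measurable_compose[OF YF unit_embed_meas] gvm] by simp
 have setsF: "sets ?F = {?Y -` A \<inter> space ?S |A. A \<in> sets borel}" by (rule sets_vimage_algebra2) auto
 have "subalgebra ?S ?F"
  unfolding subalgebra_def setsF using measurable_sets[OF scalar_obs_meas] by auto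
 then interpret F: finite_measure_subalgebra ?S ?F
  by (intro finite_measure_subalgebra.intro finite_measure_subalgebra_axioms.intro SP.finite_measure_axioms)
 have pl: "h (fst p, snd p ()) = ?gv (?pl p)" for p
  by (simp add: h_def gavg_def partf_def lik_def amp_def scalar_obs_def add.commute)
 have fi: "integrable ?S fst" unfolding scalar_space_def by (rule integrable_pair_fst(1)[OF prob_space_std_normal integrable_id])
 have f2: "integrable ?S (%w. (fst w)^2)" unfolding scalar_space_def by (rule integrable_pair_fst(1)[OF prob_space_std_normal sq])
 have gv2: "(%y. (?gv y)^2) \<in> borel_measurable (std_gauss {()})" using gvm by simp
 have idm: "(%x. x) \<in> borel_measurable P" by simp
 have h2m: "(%w. (h w)^2) \<in> borel_measurable ?S" using hm by simp
 have h2: "integrable ?S (%w. (h w)^2)"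
  unfolding integral_scalar_space(2)[OF h2m] pl using C.gavg_sq_integrable[OF idm sq] unfolding C.integral_planted(2)[OF gv2] .
 have h2I: "(LINT w|?S. (h w)^2) = ovl P (%x. x) g"
  unfolding integral_scalar_space(1)[OF h2m] pl ovl_def C.integral_planted(1)[OF gv2] by (rule refl)
 have hi: "integrable ?S h" by (rule SP.square_integrable_imp_integrable[OF hm h2])
 have hfi: "integrable ?S (%w. h w * fst w)"
 proof (rule Bochner_Integration.integrable_bound[OF Bochner_Integration.integrable_add[OF h2 f2]])
  show "(%w. h w * fst w) \<in> borel_measurable ?S" using hm fs by simp
  have "\<bar>a * b\<bar> <= \<bar>a^2 + b^2\<bar>" for a b :: real
  proof -
   have "2 * (\<bar>a\<bar> * \<bar>b\<bar>) <= a^2 + b^2" using sum_squares_bound[of "\<bar>a\<bar>" "\<bar>b\<bar>"] by simp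
   moreover have "0 <= \<bar>a\<bar> * \<bar>b\<bar>" by simp
   ultimately show ?thesis unfolding abs_mult by linarith
  qed
  thus "AE w in ?S. norm (h w * fst w) <= norm ((h w)^2 + (fst w)^2)" by simp
 qed
 have ce: "AE w in ?S. real_cond_exp ?S ?F fst w = h w"
 proof (rule F.real_cond_exp_charact[OF _ fi hi hF])
  fix A assume "A \<in> sets ?F"
  then obtain B where B: "B \<in> sets borel" "A = ?Y -` B \<inter> space ?S" unfolding setsF by auto
  define B' where "B' = {y \<in> space (std_gauss {()}). y () \<in> B}"
  have B': "B' \<in> sets (std_gauss {()})"
   unfolding B'_def using measurable_sets[OF std_gauss_coord(1)[of "()" "{()}"], of B] B(1) by (simp add: vimage_def Int_def conj_commute)
  have Am: "A \<in> sets ?S" unfolding B(2) using measurable_sets[OF scalar_obs_meas B(1)] .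
  have ind: "indicator A (fst p, snd p ()) = (indicator B' (?pl p) :: real)" if "p \<in> space (P \<Otimes>\<^sub>M std_gauss {()})" for p
   using that measurable_space[OF C.shift_meas that] by (auto simp: B(2) B'_def indicator_def scalar_obs_def amp_def scalar_space_def space_pair_measure add.commute)
  have si: "(LINT w:A|?S. k w) = (LINT p|(P \<Otimes>\<^sub>M std_gauss {()}). indicator B' (?pl p) * k (fst p, snd p ()))"
   if k: "k \<in> borel_measurable ?S" for k :: "real \<times> real => real"
  proof -
   have m: "(%w. indicator A w * k w) \<in> borel_measurable ?S" using k Am by simp
   show ?thesis unfolding set_lebesgue_integral_def real_scaleR_def integral_scalar_space(1)[OF m]
    by (rule Bochner_Integration.integral_cong[OF refl]) (simp add: ind)
  qed
  show "(LINT w:A|?S. fst w) = (LINT w:A|?S. h w)"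
   unfolding si[OF fs] si[OF hm] pl fst_conv by (rule C.gavg_planted_set[OF integrable_id B'])
 qed
 have cm: "real_cond_exp ?S ?F fst \<in> borel_measurable ?S" by simp
 have "overlap P g = (LINT w|?S. h w * fst w)"
  unfolding overlap_def using ce cm hm fs by (intro integral_cong_AE) (auto elim!: eventually_mono)
 also have "... = (LINT w|?S. h w * real_cond_exp ?S ?F fst w)"
  by (rule F.real_cond_exp_intg(2)[OF hfi hF fs, symmetric])
 also have "... = (LINT w|?S. (h w)^2)"
  using ce cm hm by (intro integral_cong_AE) (auto elim!: eventually_mono simp: power2_eq_square)
 finally show ?thesis unfolding h2I .
qed

end

section \<open>The matrix channel without clipping\<close>

lemma pair_assoc_distr:
 assumes A: "prob_space A" and B: "prob_space B" and C: "prob_space C"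
 shows "(%p. (fst (fst p), snd (fst p), snd p)) \<in> measurable ((A \<Otimes>\<^sub>M B) \<Otimes>\<^sub>M C) (A \<Otimes>\<^sub>M (B \<Otimes>\<^sub>M C))"
  "distr ((A \<Otimes>\<^sub>M B) \<Otimes>\<^sub>M C) (A \<Otimes>\<^sub>M (B \<Otimes>\<^sub>M C)) (%p. (fst (fst p), snd (fst p), snd p)) = A \<Otimes>\<^sub>M (B \<Otimes>\<^sub>M C)"
proof -
 interpret A: prob_space A by fact
 interpret B: prob_space B by fact
 interpret C: prob_space C by fact
 interpret BC: pair_prob_space B C ..
 interpret AB: pair_prob_space A B ..
 let ?h = "%p. (fst (fst p), snd (fst p), snd p)"
 show m[measurable]: "?h \<in> measurable ((A \<Otimes>\<^sub>M B) \<Otimes>\<^sub>M C) (A \<Otimes>\<^sub>M (B \<Otimes>\<^sub>M C))" by measurable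
 have "A \<Otimes>\<^sub>M (B \<Otimes>\<^sub>M C) = distr ((A \<Otimes>\<^sub>M B) \<Otimes>\<^sub>M C) (A \<Otimes>\<^sub>M (B \<Otimes>\<^sub>M C)) ?h"
 proof (rule pair_measure_eqI)
  fix X Y assume X[measurable]: "X \<in> sets A" and Y[measurable]: "Y \<in> sets (B \<Otimes>\<^sub>M C)"
  have "emeasure (distr ((A \<Otimes>\<^sub>M B) \<Otimes>\<^sub>M C) (A \<Otimes>\<^sub>M (B \<Otimes>\<^sub>M C)) ?h) (X \<times> Y)
   = (\<integral>\<^sup>+p. indicator (X \<times> Y) p \<partial>distr ((A \<Otimes>\<^sub>M B) \<Otimes>\<^sub>M C) (A \<Otimes>\<^sub>M (B \<Otimes>\<^sub>M C)) ?h)" by (subst nn_integral_indicator) auto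
  also have "... = (\<integral>\<^sup>+p. indicator X (fst (fst p)) * indicator Y (snd (fst p), snd p) \<partial>((A \<Otimes>\<^sub>M B) \<Otimes>\<^sub>M C))"
   by (subst nn_integral_distr) (auto simp: indicator_times)
  also have "... = (\<integral>\<^sup>+q. \<integral>\<^sup>+c. indicator X (fst q) * indicator Y (snd q, c) \<partial>C \<partial>(A \<Otimes>\<^sub>M B))"
   by (subst C.nn_integral_fst[symmetric]) auto
  also have "... = (\<integral>\<^sup>+a. \<integral>\<^sup>+b. \<integral>\<^sup>+c. indicator X a * indicator Y (b, c) \<partial>C \<partial>B \<partial>A)"
   by (subst B.nn_integral_fst[symmetric]) auto
  also have "... = (\<integral>\<^sup>+a. indicator X a * (\<integral>\<^sup>+b. \<integral>\<^sup>+c. indicator Y (b, c) \<partial>C \<partial>B) \<partial>A)"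
  proof (rule nn_integral_cong)
   fix a show "(\<integral>\<^sup>+b. \<integral>\<^sup>+c. indicator X a * indicator Y (b, c) \<partial>C \<partial>B) = indicator X a * (\<integral>\<^sup>+b. \<integral>\<^sup>+c. indicator Y (b, c) \<partial>C \<partial>B)"
    by (cases "a \<in> X") simp_all
  qed
  also have "... = emeasure A X * (\<integral>\<^sup>+b. \<integral>\<^sup>+c. indicator Y (b, c) \<partial>C \<partial>B)"
   by (simp add: nn_integral_multc)
  also have "(\<integral>\<^sup>+b. \<integral>\<^sup>+c. indicator Y (b, c) \<partial>C \<partial>B) = emeasure (B \<Otimes>\<^sub>M C) Y"
   by (subst C.nn_integral_fst) auto
  finally show "emeasure A X * emeasure (B \<Otimes>\<^sub>M C) Y = emeasure (distr ((A \<Otimes>\<^sub>M B) \<Otimes>\<^sub>M C) (A \<Otimes>\<^sub>M (B \<Otimes>\<^sub>M C)) ?h) (X \<times> Y)" by simp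
 qed (simp_all add: A.sigma_finite_measure_axioms BC.sigma_finite_measure_axioms)
 thus "distr ((A \<Otimes>\<^sub>M B) \<Otimes>\<^sub>M C) (A \<Otimes>\<^sub>M (B \<Otimes>\<^sub>M C)) ?h = A \<Otimes>\<^sub>M (B \<Otimes>\<^sub>M C)" by simp
qed

definition esig :: "nat \<times> nat => (nat => real) \<times> (nat => real) => real"
 where "esig p w = fst w (fst p) * snd w (snd p)"

definition csig :: "real => nat \<times> nat => (nat => real) \<times> (nat => real) => real"
 where "csig K p w = clip K (fst w (fst p)) * clip K (snd w (snd p))"

context clipped_model
begin

abbreviation "Iz \<equiv> {..<n} \<times> {..<m}"

lemma integral_two:
 fixes f g :: "real => real"
 assumes i: "i < n" "j < m" and f: "integrable PU f" and g: "integrable PV g"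
 shows "integrable Om (%w. f (fst w i) * g (snd w j))" (is ?C1) "(LINT w|Om. f (fst w i) * g (snd w j)) = (LINT x|PU. f x) * (LINT x|PV. g x)" (is ?C2)
proof -
 have d1: "distr UU PU (%u. u i) = PU" "distr VV PV (%u. u j) = PV"
  using distr_PiM_component[of "{..<n}" "%_. PU" i] distr_PiM_component[of "{..<m}" "%_. PV" j] i U.prob_space_axioms V.prob_space_axioms by auto
 have m: "(%u. u i) \<in> measurable UU PU" "(%u. u j) \<in> measurable VV PV"
  using i by (auto intro!: measurable_component_singleton)
 have fm: "f \<in> borel_measurable PU" "g \<in> borel_measurable PV" using f g by auto
 have fi: "integrable UU (%u. f (u i))" "(LINT u|UU. f (u i)) = (LINT x|PU. f x)"
  using f integrable_distr_eq[OF m(1) fm(1)] integral_distr[OF m(1) fm(1)] unfolding d1 by auto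
 have gi: "integrable VV (%u. g (u j))" "(LINT u|VV. g (u j)) = (LINT x|PV. g x)"
  using g integrable_distr_eq[OF m(2) fm(2)] integral_distr[OF m(2) fm(2)] unfolding d1 by auto
 show I: ?C1
 proof (rule UV.Fubini_integrable)
  have [measurable]: "(%u. f (u i)) \<in> borel_measurable UU" "(%v. g (v j)) \<in> borel_measurable VV" using fi(1) gi(1) by auto
  have "(%w. (%u. f (u i)) (fst w) * (%v. g (v j)) (snd w)) \<in> borel_measurable Om" by measurable
  thus "(%w. f (fst w i) * g (snd w j)) \<in> borel_measurable Om" by simp
  show "integrable UU (%u. LINT v|VV. norm (f (fst (u, v) i) * g (snd (u, v) j)))"
   using fi(1) by (simp add: abs_mult)
  show "AE u in UU. integrable VV (%v. f (fst (u, v) i) * g (snd (u, v) j))" using gi(1) by simp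
 qed
 from UV.integral_fst'[OF this] show ?C2
  using fi gi by simp
qed

lemma comp_meas:
 "i < n ==> (%w. fst w i) \<in> borel_measurable Om" "j < m ==> (%w. snd w j) \<in> borel_measurable Om"
 using fst_component(1) snd_component(1) by (auto simp: measurable_cong_sets[OF refl U.events_eq_borel] measurable_cong_sets[OF refl V.events_eq_borel])

lemma esig_meas: "p \<in> Iz ==> esig p \<in> borel_measurable Om"
 unfolding esig_def[abs_def] by (intro borel_measurable_times comp_meas) auto

lemma csig_meas: "p \<in> Iz ==> csig L p \<in> borel_measurable Om"
 unfolding csig_def[abs_def] by (intro borel_measurable_times measurable_compose[OF _ clip_meas] comp_meas) auto

lemma snr_esig: "snr Om Iz esig"
 by (intro snr.intro snr_axioms.intro UV.prob_space_axioms esig_meas) auto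

lemma bsnr_csig: "0 <= L ==> L <= B ==> bsnr Om Iz (csig L) (B * B)"
proof (intro bsnr.intro snr.intro snr_axioms.intro bsnr_axioms.intro UV.prob_space_axioms csig_meas)
 assume L: "0 <= L" "L <= B"
 show "0 <= B * B" by simp
 show "\<bar>csig L p w\<bar> <= B * B" for p w
  unfolding csig_def abs_mult using L clip_bound[OF L(1)] by (intro mult_mono order_trans[OF clip_bound[OF L(1)] L(2)]) auto
qed auto

lemma esig_sq: "p \<in> Iz ==> integrable Om (%w. (esig p w)^2)"
 and esig_sq_integral: "p \<in> Iz ==> (LINT w|Om. (esig p w)^2) = U.E2 * V.E2"
 unfolding esig_def power_mult_distrib using integral_two[OF _ _ U.sq V.sq] by (cases p, auto)+

lemma csig_le: "0 <= L ==> \<bar>csig L p w\<bar> <= \<bar>esig p w\<bar>"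
 unfolding csig_def esig_def abs_mult by (intro mult_mono clip_le_self) auto

lemma F_eq_ent:
 assumes T: "0 <= T"
 shows "F T 0 0 = ent Om Iz (amp (csig K) (%_. T / n)) / n"
proof -
 have "Phi (msnr n T 0 0) = ent Om Iz (amp (csig K) (%_. T / n))" unfolding Phi_def
 proof (rule ent_reindex[where io=Inl, OF channel_amp])
  show "channel Om Iz (amp (csig K) (%_. T / real n))" by (rule snr.channel_amp[OF bsnr.axioms(1)[OF bsnr_csig[of K K]]]) (use K in auto)
  show "amp (msig K) (msnr n T 0 0) k w = 0" if "k \<in> Ix" "k \<notin> Inl ` Iz" for k w
   using that by (cases rule: midx_cases) (auto simp: amp_def)
 qed (auto simp: midx_def amp_def csig_def)
 thus ?thesis by (simp add: F_def)
qed

text \<open>The Hamiltonian is the logarithm of the likelihood at the planted observation, signal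
  plus \<open>Z\<close>; averaging over the disorder therefore averages over the law of the
  observation.\<close>

lemma free_energy_eq:
 assumes T: "0 <= T"
 shows "free_energy PU PV n m T = ent Om Iz (amp esig (%_. T / n)) / n"
proof -
 interpret S: snr Om Iz esig by (rule snr_esig)
 let ?f = "amp esig (%_. T / real n)"
 interpret C: channel Om Iz ?f by (rule S.channel_amp)
 let ?G = "std_gauss Iz"
 note as = pair_assoc_distr[OF UU.prob_space_axioms VV.prob_space_axioms prob_space_std_gauss]
 define h where "h = (%q. ln (partf Om Iz ?f (\<lambda>p\<in>Iz. snd (snd q) p + ?f p (fst q, fst (snd q)))))"
 have hm: "h \<in> borel_measurable (UU \<Otimes>\<^sub>M (VV \<Otimes>\<^sub>M ?G))"
 proof -
  have b: "(%q. ((fst q, fst (snd q)), snd (snd q))) \<in> measurable (UU \<Otimes>\<^sub>M (VV \<Otimes>\<^sub>M ?G)) (Om \<Otimes>\<^sub>M ?G)" by measurable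
  have "(%p. ln (partf Om Iz ?f p)) \<in> borel_measurable ?G" by measurable
  from measurable_compose[OF b measurable_compose[OF C.shift_meas this]] show ?thesis unfolding h_def by simp
 qed
 have "(LINT q|(UU \<Otimes>\<^sub>M (VV \<Otimes>\<^sub>M ?G)). h q) = (LINT p|(Om \<Otimes>\<^sub>M ?G). h (fst (fst p), snd (fst p), snd p))"
  by (rule trans[OF arg_cong[OF as(2), of "%M. integral\<^sup>L M h", symmetric] integral_distr[OF as(1) hm]])
 also have "... = ent Om Iz ?f"
  unfolding ent_def h_def by (subst C.integral_planted(1)) auto
 finally have I: "(LINT q|(UU \<Otimes>\<^sub>M (VV \<Otimes>\<^sub>M ?G)). h q) = ent Om Iz ?f" .
 have "(LINT (u, v)|Om. exp (hamiltonian n m T X Y Z u v)) = partf Om Iz ?f (\<lambda>p\<in>Iz. Z p + ?f p (X, Y))" for X Y Z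
  unfolding partf_def
 proof (rule Bochner_Integration.integral_cong[OF refl])
  fix w :: "(nat => real) \<times> (nat => real)"
  obtain u v where w: "w = (u, v)" by (cases w)
  have s: "sqrt (T / n) * sqrt (T / n) = T / n" using T by simp
  have tm: "sqrt (T / n) * u i * v j * Z (i, j) + T / n * u i * X i * v j * Y j - T / (2 * real n) * (u i)^2 * (v j)^2
   = ?f (i, j) w * (Z (i, j) + ?f (i, j) (X, Y)) - (?f (i, j) w)^2 / 2" for i j
  proof -
   have "?f (i, j) w * ?f (i, j) (X, Y) = (sqrt (T / n) * sqrt (T / n)) * (u i * v j * (X i * Y j))"
    by (simp only: amp_def esig_def w fst_conv snd_conv mult_ac)
   moreover have "(?f (i, j) w)^2 = (sqrt (T / n) * sqrt (T / n)) * ((u i)^2 * (v j)^2)"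
    by (simp only: amp_def esig_def w fst_conv snd_conv power2_eq_square mult_ac)
   ultimately show ?thesis unfolding s distrib_left by (simp add: amp_def esig_def w mult_ac abs_of_nonneg[OF T])
  qed
  have "hamiltonian n m T X Y Z u v = (\<Sum>p\<in>Iz. ?f p w * (Z p + ?f p (X, Y)) - (?f p w)^2 / 2)"
   unfolding hamiltonian_def tm by (subst sum.cartesian_product) (auto intro: sum.cong)
  thus "(case w of (u, v) => exp (hamiltonian n m T X Y Z u v)) = lik Iz ?f (\<lambda>p\<in>Iz. Z p + ?f p (X, Y)) w"
   by (simp add: w lik_def)
 qed
 hence "free_energy PU PV n m T = 1 / n * (LINT q|(UU \<Otimes>\<^sub>M (VV \<Otimes>\<^sub>M ?G)). h q)"
  unfolding free_energy_def disorder_def h_def by (simp add: case_prod_unfold)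
 thus ?thesis unfolding I by simp
qed

text \<open>\<open>ent_path_bound\<close> over the \<open>n * m\<close> entries, each of ratio
  \<open>T / n\<close>; after division by \<open>n\<close> only the factor \<open>ratio * T\<close>
  remains, so the bound is uniform in \<open>n\<close>. By independence, the mean squares of
  difference and sum of two clipped products reduce to scalar tails and second moments.\<close>

lemma free_energy_truncation:
 assumes T: "0 <= T" and tau: "0 < tau"
 shows "\<bar>free_energy PU PV n m T - F T 0 0\<bar>
  <= ratio * (T * (2 * (U.E2 * V.tail K + V.E2 * U.tail K) / (2 * tau) + tau / 2 * (4 * (U.E2 * V.E2))) / 2)" (is "_ <= ?R")
proof -
 let ?d = "2 * (U.E2 * V.tail K + V.E2 * U.tail K)" and ?s = "4 * (U.E2 * V.E2)"
 let ?g = "%_::nat \<times> nat. T / real n"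
 interpret S: snr Om Iz esig by (rule snr_esig)
 have lim: "(%k. ent Om Iz (amp (csig (real (Suc k))) ?g)) \<longlonglongrightarrow> ent Om Iz (amp esig ?g)"
 proof -
  have e: "S.fs (%k. csig (real (Suc k))) (%_. ?g) k = amp (csig (real (Suc k))) ?g" for k
   by (rule S.fs_def[where b="T / n" and g="?g"])
    (use esig_sq csig_meas csig_le T in \<open>auto simp: csig_def esig_def simp del: of_nat_Suc intro!: tendsto_mult clip_tendsto\<close>)
  show ?thesis unfolding e[symmetric]
   by (rule S.ent_lim[where b="T / n"])
    (use esig_sq csig_meas csig_le T in \<open>auto simp: csig_def esig_def simp del: of_nat_Suc intro!: tendsto_mult clip_tendsto\<close>)
 qed
 have pb: "(LINT w|Om. (csig K' p w - csig K p w)^2) <= ?d \<and> (LINT w|Om. (csig K' p w + csig K p w)^2) <= ?s"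
  if K': "K <= K'" and p: "p \<in> Iz" for K' p
 proof -
  obtain i j where ij: "p = (i, j)" "i < n" "j < m" using p by auto
  have K0: "0 <= K" "0 <= K'" using K K' by auto
  have cm: "csig K p \<in> borel_measurable Om" "csig K' p \<in> borel_measurable Om" by (rule csig_meas[OF p])+
  have d: "(csig K' p w - csig K p w)^2 <= 2 * ((fst w i)^2 * (snd w j - clip K (snd w j))^2 + (fst w i - clip K (fst w i))^2 * (snd w j)^2)" for w
  proof -
   let ?u = "fst w i" and ?v = "snd w j"
   have "csig K' p w - csig K p w = clip K' ?u * (clip K' ?v - clip K ?v) + (clip K' ?u - clip K ?u) * clip K ?v"
    by (simp add: csig_def ij algebra_simps)
   moreover have "(a + b)^2 <= 2 * (a^2 + b^2)" for a b :: real
    using zero_le_power2[of "a - b"] by (simp add: power2_sum power2_diff)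
   ultimately have "(csig K' p w - csig K p w)^2 <= 2 * ((clip K' ?u)^2 * (clip K' ?v - clip K ?v)^2 + (clip K' ?u - clip K ?u)^2 * (clip K ?v)^2)"
    unfolding power_mult_distrib[symmetric] by simp
   also have "... <= 2 * (?u^2 * (?v - clip K ?v)^2 + (?u - clip K ?u)^2 * ?v^2)"
    by (intro mult_left_mono add_mono mult_mono abs_le_square_iff[THEN iffD1] clip_dist clip_le_self K0 K') auto
   finally show ?thesis .
  qed
  note t1 = integral_two[OF ij(2,3) U.sq V.tail_integrable[OF K0(1)]] and t2 = integral_two[OF ij(2,3) U.tail_integrable[OF K0(1)] V.sq]
  have di: "integrable Om (%w. 2 * ((fst w i)^2 * (snd w j - clip K (snd w j))^2 + (fst w i - clip K (fst w i))^2 * (snd w j)^2))"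
   using t1(1) t2(1) by simp
  have "integrable Om (%w. (csig K' p w - csig K p w)^2)"
   by (rule Bochner_Integration.integrable_bound[OF di]) (use cm d in \<open>auto intro!: AE_I2 intro: order_trans[OF _ abs_ge_self]\<close>)
  hence "(LINT w|Om. (csig K' p w - csig K p w)^2) <= (LINT w|Om. 2 * ((fst w i)^2 * (snd w j - clip K (snd w j))^2 + (fst w i - clip K (fst w i))^2 * (snd w j)^2))"
   by (intro integral_mono di d)
  also have "... = ?d" using t1 t2 by (simp add: U.tail_def V.tail_def mult.commute)
  finally have 1: "(LINT w|Om. (csig K' p w - csig K p w)^2) <= ?d" .
  have s: "(csig K' p w + csig K p w)^2 <= 4 * (esig p w)^2" for w
  proof -
   have "\<bar>csig K' p w + csig K p w\<bar> <= \<bar>2 * esig p w\<bar>"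
    using csig_le[OF K0(1), of p w] csig_le[OF K0(2), of p w] by linarith
   hence "(csig K' p w + csig K p w)^2 <= (2 * esig p w)^2" by (rule abs_le_square_iff[THEN iffD1])
   thus ?thesis by (simp add: power_mult_distrib)
  qed
  have si: "integrable Om (%w. 4 * (esig p w)^2)" using esig_sq[OF p] by simp
  have "integrable Om (%w. (csig K' p w + csig K p w)^2)"
   by (rule Bochner_Integration.integrable_bound[OF si]) (use cm s in \<open>auto intro!: AE_I2 intro: order_trans[OF _ abs_ge_self]\<close>)
  hence "(LINT w|Om. (csig K' p w + csig K p w)^2) <= (LINT w|Om. 4 * (esig p w)^2)" by (intro integral_mono si s)
  also have "... = ?s" using esig_sq_integral[OF p] by simp
  finally show ?thesis using 1 by simp
 qed
 have bd: "\<bar>ent Om Iz (amp (csig K') ?g) - ent Om Iz (amp (csig K) ?g)\<bar> <= n * ?R" if K': "K <= K'" for K'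
 proof -
  have b: "bsnr Om Iz (csig K) (K' * K')" "bsnr Om Iz (csig K') (K' * K')" using K K' by (auto intro!: bsnr_csig)
  have g0: "\<forall>p\<in>Iz. 0 <= ?g p" using T by simp
  have card: "(\<Sum>p\<in>Iz. ?g p * (?d / (2 * tau) + tau / 2 * ?s)) / 2 = n * ?R"
   using n0 by (simp add: ratio_def)
  have le: "(\<Sum>p\<in>Iz. ?g p * ((LINT w|Om. (csig K' p w - csig K p w)^2) / (2 * tau) + tau / 2 * (LINT w|Om. (csig K' p w + csig K p w)^2))) / 2 <= n * ?R"
   unfolding card[symmetric] using pb[OF K'] T tau by (intro divide_right_mono sum_mono mult_left_mono add_mono) auto
  have "ent Om Iz (amp (csig K') ?g) - ent Om Iz (amp (csig K) ?g) <= n * ?R"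
   by (rule order_trans[OF ent_path_bound[OF b g0 tau] le])
  moreover have "ent Om Iz (amp (csig K) ?g) - ent Om Iz (amp (csig K') ?g) <= n * ?R"
  proof (rule order_trans[OF ent_path_bound[OF b(2,1) g0 tau]])
   show "(\<Sum>p\<in>Iz. ?g p * ((LINT w|Om. (csig K p w - csig K' p w)^2) / (2 * tau) + tau / 2 * (LINT w|Om. (csig K p w + csig K' p w)^2))) / 2 <= n * ?R"
    using le by (simp only: power2_commute[of "csig K _ _"] add.commute[of "csig K _ _"])
  qed
  ultimately show ?thesis by linarith
 qed
 have "\<bar>ent Om Iz (amp esig ?g) - ent Om Iz (amp (csig K) ?g)\<bar> <= n * ?R"
 proof (rule LIMSEQ_le_const2)
  show "(%k. \<bar>ent Om Iz (amp (csig (real (Suc k))) ?g) - ent Om Iz (amp (csig K) ?g)\<bar>) \<longlonglongrightarrow> \<bar>ent Om Iz (amp esig ?g) - ent Om Iz (amp (csig K) ?g)\<bar>"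
   by (intro tendsto_intros lim)
  obtain N :: nat where N: "K <= real N" using reals_Archimedean2[of K] less_imp_le by blast
  have "K <= real (Suc k)" if "N <= k" for k using N that by simp
  thus "\<exists>N. \<forall>k\<ge>N. \<bar>ent Om Iz (amp (csig (real (Suc k))) ?g) - ent Om Iz (amp (csig K) ?g)\<bar> <= n * ?R"
   using bd by blast
 qed
 hence "\<bar>(ent Om Iz (amp esig ?g) - ent Om Iz (amp (csig K) ?g)) / n\<bar> <= ?R"
  using n0 by (simp add: abs_divide pos_divide_le_eq mult.commute)
 thus ?thesis unfolding free_energy_eq[OF T] F_eq_ent[OF T] by (simp add: diff_divide_distrib)
qed

end

section \<open>The variational problem\<close>

text \<open>The variational problem only needs that \<open>u\<close> and \<open>v\<close> are convex with half-derivatives \<open>A\<close> and \<open>W\<close>.\<close>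

locale rs_pair =
 fixes u v A W :: "real => real" and MU al lam :: real
 assumes u_inc: "!!g d. 0 <= g ==> 0 <= d ==> d * A g / 2 <= u (g + d) - u g \<and> u (g + d) - u g <= d * A (g + d) / 2"
  and v_inc: "!!g d. 0 <= g ==> 0 <= d ==> d * W g / 2 <= v (g + d) - v g \<and> v (g + d) - v g <= d * W (g + d) / 2"
  and W_cont: "continuous_on {0..} W"
  and A_strict: "!!g d. 0 <= g ==> 0 < d ==> A g < A (g + d)"
  and W_strict: "!!g d. 0 <= g ==> 0 < d ==> W g < W (g + d)"
  and A_bounds: "!!g. 0 <= A g" "!!g. A g <= MU"
  and W_nonneg: "!!g. 0 <= W g"
  and pos: "0 < al" "0 < lam"
begin

definition "Pot qu qv = u (lam * al * qv) + al * v (lam * qu) - lam * al / 2 * qu * qv"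

text \<open>\<open>stat qu qv\<close> is the first-order condition for \<open>qu\<close> to minimise \<open>Pot _ qv\<close>.\<close>

definition "stat qu qv \<longleftrightarrow> 0 <= qu \<and> (qv = W (lam * qu) \<or> (qu = 0 \<and> qv <= W 0))"

lemma sub_u: "0 <= s ==> 0 <= s' ==> u s + A s * (s' - s) / 2 <= u s'"
 using u_inc[of s "s' - s"] u_inc[of s' "s - s'"] by (cases "s <= s'") (auto simp: algebra_simps diff_divide_distrib)

lemma sub_v: "0 <= s ==> 0 <= s' ==> v s + W s * (s' - s) / 2 <= v s'"
 using v_inc[of s "s' - s"] v_inc[of s' "s - s'"] by (cases "s <= s'") (auto simp: algebra_simps diff_divide_distrib)

lemma u_lip: "0 <= s ==> s <= s' ==> u s <= u s' \<and> u s' - u s <= (s' - s) * MU / 2"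
proof -
 assume s: "0 <= s" "s <= s'"
 have "0 <= (s' - s) * A s / 2" using s A_bounds(1)[of s] by simp
 moreover have "(s' - s) * A s' <= (s' - s) * MU" using s A_bounds(2) by (intro mult_left_mono) auto
 ultimately show ?thesis using u_inc[of s "s' - s"] s by auto
qed

lemma W_less: "0 <= s ==> s < s' ==> W s < W s'"
 using W_strict[of s "s' - s"] by simp

text \<open>The subgradient inequality for the convex \<open>v\<close>. At \<open>qu = 0\<close>
  only larger values compete, so \<open>qv <= W 0\<close> is enough there.\<close>

lemma stat_min:
 assumes "stat qu qv" "0 <= q"
 shows "Pot qu qv <= Pot q qv"
proof -
 have qu: "0 <= qu" using assms by (simp add: stat_def)
 have "0 <= (W (lam * qu) - qv) * (q - qu)" using assms by (auto simp: stat_def)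
 moreover have "0 <= al * lam / 2" using pos by simp
 ultimately have "0 <= al * lam / 2 * ((W (lam * qu) - qv) * (q - qu))" by (rule mult_nonneg_nonneg[rotated])
 moreover have "al * (v (lam * qu) + W (lam * qu) * (lam * q - lam * qu) / 2) <= al * v (lam * q)"
  using pos qu assms(2) by (intro mult_left_mono sub_v) auto
 ultimately show ?thesis unfolding Pot_def by (simp add: algebra_simps diff_divide_distrib add_divide_distrib)
qed

text \<open>Comparison with points to the right gives \<open>qv <= W (lam * qu)\<close> and with
  points to the left the reverse, both after a limit by continuity of \<open>W\<close>. At
  \<open>qu = 0\<close> only the first comparison is available, which is the second case of
  \<open>stat\<close>.\<close>

lemma min_stat:
 assumes qu: "0 <= qu" and mn: "!!q. 0 <= q ==> Pot qu qv <= Pot q qv"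
 shows "stat qu qv"
proof -
 have dv: "lam * (q - qu) * qv / 2 <= v (lam * q) - v (lam * qu)" if "0 <= q" for q
 proof -
  have "al * (lam * (q - qu) * qv / 2) <= al * (v (lam * q) - v (lam * qu))"
   using mn[OF that] unfolding Pot_def by (simp add: algebra_simps diff_divide_distrib)
  thus ?thesis using pos(1) by simp
 qed
 have lim: "(%k. W (lam * s k)) \<longlonglongrightarrow> W (lam * qu)" if "s \<longlonglongrightarrow> qu" "!!k. 0 <= s k" for s
  by (rule continuous_on_tendsto_compose[OF W_cont]) (use that qu pos in \<open>auto intro!: tendsto_intros\<close>)
 have up: "qv <= W (lam * q)" if q: "qu < q" for q
 proof -
  have e: "lam * qu + lam * (q - qu) = lam * q" by (simp add: algebra_simps)
  have "v (lam * q) - v (lam * qu) <= lam * (q - qu) * W (lam * q) / 2"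
   using v_inc[of "lam * qu" "lam * (q - qu)", unfolded e] qu q pos by auto
  hence "lam * (q - qu) * qv <= lam * (q - qu) * W (lam * q)" using dv[of q] qu q by linarith
  thus ?thesis by (rule mult_left_le_imp_le) (use q pos in simp)
 qed
 have qW: "qv <= W (lam * qu)"
 proof (rule LIMSEQ_le_const[OF lim[of "%k. qu + inverse (real (Suc k))"]])
  show "(%k. qu + inverse (real (Suc k))) \<longlonglongrightarrow> qu" using tendsto_add[OF tendsto_const LIMSEQ_inverse_real_of_nat, of qu] by simp
  show "\<exists>N. \<forall>k\<ge>N. qv <= W (lam * (qu + inverse (real (Suc k))))" by (intro exI[of _ 0] allI impI up) simp
 qed (use qu in auto)
 show ?thesis
 proof (cases "qu = 0")
  case True thus ?thesis using qW by (simp add: stat_def)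
 next
  case False
  hence q0: "0 < qu" using qu by simp
  have dn: "W (lam * q) <= qv" if q: "0 <= q" "q < qu" for q
  proof -
   have e: "lam * q + lam * (qu - q) = lam * qu" by (simp add: algebra_simps)
   have "lam * (qu - q) * W (lam * q) / 2 <= v (lam * qu) - v (lam * q)"
    using v_inc[of "lam * q" "lam * (qu - q)", unfolded e] q pos by auto
   moreover have "lam * (q - qu) * qv = - (lam * (qu - q) * qv)" by (simp add: algebra_simps)
   ultimately have "lam * (qu - q) * W (lam * q) <= lam * (qu - q) * qv" using dv[of q] q by linarith
   thus ?thesis by (rule mult_left_le_imp_le) (use q pos in simp)
  qed
  have "W (lam * qu) <= qv"
  \<comment> \<open>The approximating points are \<open>qu\<close> times a factor in
    \<open>(0, 1)\<close>, so they stay nonnegative.\<close>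
  proof (rule LIMSEQ_le_const2[OF lim[of "%k. qu - qu * inverse (real (Suc (Suc k)))"]])
   have "(%k. inverse (real (Suc (Suc k)))) \<longlonglongrightarrow> 0" by (rule LIMSEQ_Suc[OF LIMSEQ_inverse_real_of_nat])
   from tendsto_diff[OF tendsto_const tendsto_mult[OF tendsto_const this], of qu qu]
   show "(%k. qu - qu * inverse (real (Suc (Suc k)))) \<longlonglongrightarrow> qu" by simp
   have nn: "0 <= qu - qu * inverse (real (Suc (Suc k)))" for k
   proof -
    have "inverse (real (Suc (Suc k))) <= 1" by (simp add: inverse_le_1_iff)
    hence "qu * inverse (real (Suc (Suc k))) <= qu * 1" using qu by (intro mult_left_mono)
    thus ?thesis by simp
   qed
   show "0 <= qu - qu * inverse (real (Suc (Suc k)))" for k by (rule nn)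
   show "\<exists>N. \<forall>k\<ge>N. W (lam * (qu - qu * inverse (real (Suc (Suc k))))) <= qv"
    using q0 by (intro exI[of _ 0] allI impI dn nn) simp
  qed
  thus ?thesis using qW qu by (simp add: stat_def)
 qed
qed

lemma stat_W: "0 <= s ==> stat s (W (lam * s))"
 by (simp add: stat_def)

text \<open>The couple is compared with the points \<open>(s, W (lam * s))\<close> of the curve of
  inner minimisers. Optimality bounds the change of \<open>u\<close> by the linear term with slope
  \<open>s\<close>, and convexity of \<open>u\<close> bounds it below with slope \<open>A\<close>;
  taking \<open>s\<close> above and below \<open>qu\<close> squeezes
  \<open>A (lam * al * qv)\<close> onto \<open>qu\<close>. If \<open>qu = 0\<close> and
  \<open>qv < W 0\<close>, the minimiser stays at \<open>0\<close> up to \<open>W 0\<close> while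
  \<open>u\<close> gains strictly, against optimality.\<close>

lemma optimal_fixed_point:
 assumes st: "stat qu qv" and qv: "0 <= qv" and mx: "!!s. 0 <= s ==> Pot s (W (lam * s)) <= Pot qu qv"
 shows "qu = A (lam * al * qv)" (is ?C1) "qv = W (lam * qu)" (is ?C2)
proof -
 have qu: "0 <= qu" using st by (simp add: stat_def)
 have la: "0 < lam * al" using pos by simp
 have diff: "u (lam * al * q') - u (lam * al * qv) <= lam * al / 2 * (s * (q' - qv))" if s: "0 <= s" and q': "q' = W (lam * s)" for s q'
  using mx[OF s] stat_min[OF st s] unfolding q'[symmetric] Pot_def by (simp add: algebra_simps diff_divide_distrib)
 have key: "(q' - qv) * A (lam * al * qv) <= (q' - qv) * s" if s: "0 <= s" and q': "q' = W (lam * s)" for s q'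
 proof -
  have q0: "0 <= q'" unfolding q' by (rule W_nonneg)
  have "A (lam * al * qv) * (lam * al * q' - lam * al * qv) / 2 <= u (lam * al * q') - u (lam * al * qv)"
   using sub_u[of "lam * al * qv" "lam * al * q'"] la qv q0 by simp
  hence "lam * al / 2 * ((q' - qv) * A (lam * al * qv)) <= lam * al / 2 * ((q' - qv) * s)"
   using diff[OF s q'] by (simp add: algebra_simps diff_divide_distrib)
  thus ?thesis by (rule mult_left_le_imp_le) (use la in simp)
 qed
 have "A (lam * al * qv) <= qu"
 proof (rule dense_ge)
  fix s assume s: "qu < s"
  have "W (lam * qu) < W (lam * s)" using s qu pos by (intro W_less) auto
  hence "qv < W (lam * s)" using st by (auto simp: stat_def)
  thus "A (lam * al * qv) <= s" using key[OF _ refl, of s] s qu by simp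
 qed
 moreover have "qu <= A (lam * al * qv)"
 proof (rule dense_le)
  fix s assume s: "s < qu"
  show "s <= A (lam * al * qv)"
  proof (cases "0 <= s")
   case True
   hence ?C2 using st s by (auto simp: stat_def)
   hence "W (lam * s) < qv" using s True pos by (auto intro: W_less)
   hence "(qv - W (lam * s)) * s <= (qv - W (lam * s)) * A (lam * al * qv)" using key[OF True refl] by (simp add: algebra_simps)
   thus ?thesis using \<open>W (lam * s) < qv\<close> by simp
  next
   case False thus ?thesis using A_bounds(1)[of "lam * al * qv"] by linarith
  qed
 qed
 ultimately show fp: ?C1 by simp
 show ?C2
 proof (rule ccontr)
  assume ne: "qv \<noteq> W (lam * qu)"
  hence q: "qu = 0" "qv < W 0" using st by (auto simp: stat_def)
  define a where "a = lam * al * qv"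
  define d where "d = lam * al * (W 0 - qv) / 2"
  have a: "0 <= a" and d: "0 < d" using la qv q by (auto simp: a_def d_def)
  have "0 < A (a + d)" using A_strict[OF a d] A_bounds(1)[of a] by linarith
  hence "0 < d * A (a + d) / 2" using d by simp
  also have "... <= u (a + d + d) - u (a + d)" using u_inc[of "a + d" d] a d by simp
  also have "... <= u (a + d + d) - u a" using u_lip[of a "a + d"] a d by simp
  also have "a + d + d = lam * al * W 0" by (simp add: a_def d_def algebra_simps)
  finally show False using diff[of 0 "W 0"] by (simp add: a_def)
 qed
qed

text \<open>For \<open>qv <= qm\<close> a stationary \<open>qu\<close> in \<open>[0, sm]\<close>
  exists by the intermediate value theorem, or is \<open>0\<close> when \<open>qv <= W 0\<close>.
  The selected minimum is Lipschitz in \<open>qv\<close>, hence attains its maximum. Beyond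
  \<open>qm\<close> the test point \<open>sm = MU + 1\<close> exceeds the largest slope of
  \<open>u\<close>, so the potential there decreases in \<open>qv\<close>.\<close>

lemma exists_optimal:
 obtains qu qv where "stat qu qv" "0 <= qv" "!!q. 0 <= q ==> \<exists>s\<ge>0. Pot s q <= Pot qu qv"
proof -
 have MU0: "0 <= MU" using A_bounds[of 0] by linarith
 have la: "0 < lam * al" using pos by simp
 define sm where "sm = MU + 1"
 define qm where "qm = W (lam * sm)"
 have sm: "0 < sm" using MU0 by (simp add: sm_def)
 have qm0: "0 <= qm" unfolding qm_def by (rule W_nonneg)
 have "\<exists>s. 0 <= s \<and> s <= sm \<and> stat s q" if q: "q \<in> {0..qm}" for q
 proof (cases "q <= W 0")
  case True thus ?thesis using sm by (intro exI[of _ 0]) (auto simp: stat_def)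
 next
  case False
  have "\<exists>s\<ge>0. s <= lam * sm \<and> W s = q"
   by (rule IVT') (use False q sm pos in \<open>auto simp: qm_def intro: continuous_on_subset[OF W_cont]\<close>)
  then obtain s where s: "0 <= s" "s <= lam * sm" "W s = q" by blast
  thus ?thesis using pos by (intro exI[of _ "s / lam"]) (auto simp: stat_def pos_divide_le_eq mult.commute)
 qed
 then obtain sel where sel: "!!q. q \<in> {0..qm} ==> 0 <= sel q \<and> sel q <= sm \<and> stat (sel q) q" by metis
 define ph where "ph = (%q. Pot (sel q) q)"
 define L where "L = lam * al * (MU + sm)"
 have shift: "Pot s q' - Pot s q <= L * \<bar>q' - q\<bar>" if q: "0 <= q" "0 <= q'" and s: "0 <= s" "s <= sm" for q q' s
 proof -
  have "u (lam * al * q') - u (lam * al * q) <= \<bar>lam * al * q' - lam * al * q\<bar> * MU"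
  proof (cases "q <= q'")
   case True
   hence le: "lam * al * q <= lam * al * q'" using la by (intro mult_left_mono) auto
   have "0 <= (lam * al * q' - lam * al * q) * MU" using le MU0 by simp
   thus ?thesis using u_lip[OF _ le] le la q by simp
  next
   case False
   hence le: "lam * al * q' <= lam * al * q" using la by (intro mult_left_mono) auto
   have "0 <= \<bar>lam * al * q' - lam * al * q\<bar> * MU" using MU0 by simp
   thus ?thesis using u_lip[OF _ le] la q by simp
  qed
  also have "\<bar>lam * al * q' - lam * al * q\<bar> = lam * al * \<bar>q' - q\<bar>"
   using pos by (simp add: right_diff_distrib[symmetric] abs_mult)
  finally have 1: "u (lam * al * q') - u (lam * al * q) <= lam * al * \<bar>q' - q\<bar> * MU" .
  have "s * (q - q') <= s * \<bar>q' - q\<bar>" using s by (intro mult_left_mono) auto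
  also have "... <= sm * \<bar>q' - q\<bar>" using s by (intro mult_right_mono) auto
  finally have "s * (q - q') <= sm * \<bar>q' - q\<bar>" .
  hence 2: "lam * al / 2 * (s * (q - q')) <= lam * al / 2 * (sm * \<bar>q' - q\<bar>)" using la by (intro mult_left_mono) auto
  have 3: "0 <= lam * al / 2 * (sm * \<bar>q' - q\<bar>)" using la sm by (intro mult_nonneg_nonneg) auto
  have "Pot s q' - Pot s q = (u (lam * al * q') - u (lam * al * q)) + lam * al / 2 * (s * (q - q'))"
   by (simp add: Pot_def algebra_simps diff_divide_distrib)
  also have "... <= lam * al * \<bar>q' - q\<bar> * MU + 2 * (lam * al / 2 * (sm * \<bar>q' - q\<bar>))" using 1 2 3 by linarith
  also have "... = L * \<bar>q' - q\<bar>" by (simp add: L_def algebra_simps)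
  finally show ?thesis .
 qed
 have L0: "0 <= L" unfolding L_def using pos MU0 sm by simp
 have one: "ph q' - ph q <= L * \<bar>q' - q\<bar>" if q: "q \<in> {0..qm}" "q' \<in> {0..qm}" for q q'
 proof -
  have "ph q' <= Pot (sel q) q'" unfolding ph_def using sel[OF q(1)] sel[OF q(2)] by (intro stat_min) auto
  also have "... <= ph q + L * \<bar>q' - q\<bar>" unfolding ph_def using shift[of q q' "sel q"] sel[OF q(1)] q by auto
  finally show ?thesis by simp
 qed
 have "L-lipschitz_on {0..qm} ph"
 proof (rule lipschitz_onI[OF _ L0])
  fix q q' assume "q \<in> {0..qm}" "q' \<in> {0..qm}"
  thus "dist (ph q) (ph q') <= L * dist q q'"
   using one[of q q'] one[of q' q] by (simp add: dist_real_def abs_le_iff abs_minus_commute)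
 qed
 hence "continuous_on {0..qm} ph" by (rule lipschitz_on_continuous_on)
 then obtain qv where qv: "qv \<in> {0..qm}" and mx: "!!q. q \<in> {0..qm} ==> ph q <= ph qv"
  using continuous_attains_sup[of "{0..qm}" ph] qm0 by auto
 show thesis
 proof (rule that[of "sel qv" qv])
  show "stat (sel qv) qv" "0 <= qv" using sel[OF qv] qv by auto
  fix q :: real assume q: "0 <= q"
  show "\<exists>s\<ge>0. Pot s q <= Pot (sel qv) qv"
  proof (cases "q <= qm")
   case True
   thus ?thesis using mx[of q] sel[of q] q by (intro exI[of _ "sel q"]) (auto simp: ph_def)
  next
   case False
   have la': "lam * al * qm <= lam * al * q" using False la by (intro mult_left_mono) auto
   have "u (lam * al * q) - u (lam * al * qm) <= (lam * al * q - lam * al * qm) * MU / 2"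
    using u_lip[OF _ la'] la qm0 by simp
   moreover have "0 <= lam * al / 2 * (q - qm)" using la False by (intro mult_nonneg_nonneg) auto
   ultimately have "Pot sm q <= Pot sm qm" by (simp add: Pot_def sm_def algebra_simps diff_divide_distrib add_divide_distrib)
   also have "... <= ph qm" unfolding ph_def using stat_min[OF stat_W, of sm "sel qm"] sel[of qm] qm0 sm by (simp add: qm_def)
   also have "... <= ph qv" using qm0 by (intro mx) auto
   finally show ?thesis using sm by (intro exI[of _ sm]) (auto simp: ph_def)
  qed
 qed
qed

text \<open>Beyond \<open>lam * qu\<close> the slope \<open>W\<close> strictly exceeds
  \<open>qv\<close>, so the convex function on the right grows without bound. The point
  \<open>B\<close> is the end of the interval in \<open>liminf_bound\<close>, where the deficit has
  to vanish.\<close>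

lemma coercive:
 assumes st: "stat qu qv"
 obtains B where "0 < B" "c <= al * v B - al * qv * B / 2"
proof -
 have qu: "0 <= qu" using st by (simp add: stat_def)
 define s where "s = lam * (qu + 1)"
 have s: "0 < s" using qu pos by (simp add: s_def)
 have "W (lam * qu) < W s" using qu pos by (intro W_less) (auto simp: s_def)
 hence W: "0 < W s - qv" using st by (auto simp: stat_def)
 define d where "d = c / al"
 define k where "k = d - v s + W s * s / 2"
 define B where "B = max s (2 * k / (W s - qv))"
 have B: "0 < B" "s <= B" "2 * k / (W s - qv) <= B" using s by (auto simp: B_def)
 have "k <= (W s - qv) * B / 2" using B(3) W by (simp add: pos_divide_le_eq mult.commute)
 hence a1: "k <= W s * B / 2 - qv * B / 2" by (simp add: left_diff_distrib diff_divide_distrib)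
 have "v s + W s * (B - s) / 2 <= v B" using s B by (intro sub_v) auto
 hence a2: "v s + (W s * B / 2 - W s * s / 2) <= v B" by (simp add: right_diff_distrib diff_divide_distrib)
 have alg: "k' <= x - y ==> p + (x - z) <= w ==> k' = r - p + z ==> r <= w - y" for k' x y p z w r :: real
  by linarith
 have "d <= v B - qv * B / 2" by (rule alg[OF a1 a2 k_def])
 hence "c / al <= v B - qv * B / 2" by (simp only: d_def)
 hence "c <= al * (v B - qv * B / 2)" using pos by (simp add: pos_divide_le_eq mult.commute)
 thus thesis using B(1) by (intro that[of B]) (auto simp: algebra_simps)
qed

end

section \<open>Uniform truncation and the limit of the free energy\<close>

context prior
begin

text \<open>In \<open>scal_truncation\<close>, \<open>tau\<close> is chosen first, to make the
  moment term small on \<open>[0, B]\<close>; then the tail is small against \<open>tau\<close> for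
  all high levels.\<close>

lemma scal_uniform:
 assumes eps: "0 < eps" and B: "0 <= B"
 shows "\<forall>\<^sub>F k in sequentially. \<forall>g\<in>{0..B}. \<bar>scal P (%x. x) g - scal P (clip (real (Suc k))) g\<bar> <= eps"
proof -
 have "0 <= B * E2" using B by simp
 from exists_small[OF this, of "eps / 2" 1] eps obtain tau where tau: "0 < tau" "B * E2 * tau <= eps / 2" by auto
 have "(%k. B / (4 * tau) * tail (real (Suc k))) \<longlonglongrightarrow> B / (4 * tau) * 0" by (intro tendsto_mult tendsto_const tail_tendsto)
 hence "(%k. B / (4 * tau) * tail (real (Suc k))) \<longlonglongrightarrow> 0" by (simp only: mult_zero_right)
 hence "\<forall>\<^sub>F k in sequentially. B / (4 * tau) * tail (real (Suc k)) < eps / 2"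
  by (rule order_tendstoD(2)) (use eps in simp)
 thus ?thesis
 proof eventually_elim
  case (elim k)
  show ?case
  proof
   fix g assume g: "g \<in> {0..B}"
   define t where "t = tail (real (Suc k))"
   have t0: "0 <= t" unfolding t_def tail_def by simp
   have K0: "0 <= real (Suc k)" by simp
   have "\<bar>scal P (%x. x) g - scal P (clip (real (Suc k))) g\<bar> <= g * (t / (2 * tau) + tau / 2 * (4 * E2)) / 2"
    using g unfolding t_def by (intro scal_truncation[OF K0 _ tau(1)]) auto
   also have "... <= B * (t / (2 * tau) + tau / 2 * (4 * E2)) / 2"
    using g t0 tau by (intro divide_right_mono mult_right_mono add_nonneg_nonneg) auto
   also have "... = B / (4 * tau) * t + B * E2 * tau" by (simp add: algebra_simps add_divide_distrib)
   also have "... <= eps" using elim tau(2) unfolding t_def by linarith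
   finally show "\<bar>scal P (%x. x) g - scal P (clip (real (Suc k))) g\<bar> <= eps" .
  qed
 qed
qed

end

lemma free_energy_uniform:
 assumes PU: "prior PU" and PV: "prior PV" and eps: "0 < eps" and T: "0 <= T"
 shows "\<forall>\<^sub>F k in sequentially. \<forall>n\<ge>1. \<forall>m. \<bar>free_energy PU PV n m T - clipped_model.F PU PV n m (real (Suc k)) T 0 0\<bar> <= real m / real n * eps"
proof -
 interpret U: prior PU by fact
 interpret V: prior PV by fact
 have "0 <= T * (U.E2 * V.E2)" using T by simp
 from exists_small[OF this, of "eps / 2" 1] eps obtain tau where tau: "0 < tau" "T * (U.E2 * V.E2) * tau <= eps / 2" by auto
 have "(%k. T / (2 * tau) * (U.E2 * V.tail (real (Suc k)) + V.E2 * U.tail (real (Suc k)))) \<longlonglongrightarrow> T / (2 * tau) * (U.E2 * 0 + V.E2 * 0)"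
  by (intro tendsto_mult tendsto_add tendsto_const U.tail_tendsto V.tail_tendsto)
 hence "(%k. T / (2 * tau) * (U.E2 * V.tail (real (Suc k)) + V.E2 * U.tail (real (Suc k)))) \<longlonglongrightarrow> 0"
  by (simp only: mult_zero_right add_0_left)
 hence "\<forall>\<^sub>F k in sequentially. T / (2 * tau) * (U.E2 * V.tail (real (Suc k)) + V.E2 * U.tail (real (Suc k))) < eps / 2"
  by (rule order_tendstoD(2)) (use eps in simp)
 thus ?thesis
 proof (eventually_elim, intro allI impI)
  fix k n m :: nat
  assume small: "T / (2 * tau) * (U.E2 * V.tail (real (Suc k)) + V.E2 * U.tail (real (Suc k))) < eps / 2" and n: "1 <= n"
  interpret M: clipped_model PU PV n m "real (Suc k)"
   by (intro clipped_model.intro clipped_model_axioms.intro PU PV n) simp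
  define t where "t = U.E2 * V.tail (real (Suc k)) + V.E2 * U.tail (real (Suc k))"
  have "\<bar>free_energy PU PV n m T - M.F T 0 0\<bar> <= M.ratio * (T * (2 * t / (2 * tau) + tau / 2 * (4 * (U.E2 * V.E2))) / 2)"
   unfolding t_def by (rule M.free_energy_truncation[OF T tau(1)])
  also have "T * (2 * t / (2 * tau) + tau / 2 * (4 * (U.E2 * V.E2))) / 2 = T / (2 * tau) * t + T * (U.E2 * V.E2) * tau"
   by (simp add: algebra_simps add_divide_distrib)
  also have "M.ratio * ... <= M.ratio * eps" using small tau(2) M.ratio0 unfolding t_def[symmetric] by (intro mult_left_mono) auto
  finally show "\<bar>free_energy PU PV n m T - M.F T 0 0\<bar> <= real m / real n * eps" unfolding M.ratio_def .
 qed
qed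

locale rs_limit = U: prior PU + V: prior PV for PU PV :: "real measure" +
 fixes m :: "nat => nat" and al lam :: real
 assumes varU: "0 < U.var" and varV: "0 < V.var" and al: "0 < al" and lam: "0 < lam"
  and ratio: "(%n. real (m n) / real n) \<longlonglongrightarrow> al"
begin

abbreviation "SU \<equiv> scal PU (%x. x)"
abbreviation "SV \<equiv> scal PV (%x. x)"
abbreviation "OU \<equiv> ovl PU (%x. x)"
abbreviation "OV \<equiv> ovl PV (%x. x)"

sublocale R: rs_pair SU SV OU OV U.E2 al lam
proof
 show "d * OU g / 2 <= SU (g + d) - SU g \<and> SU (g + d) - SU g <= d * OU (g + d) / 2" if "0 <= g" "0 <= d" for g d
  using U.scal_increment[OF that] by simp
 show "d * OV g / 2 <= SV (g + d) - SV g \<and> SV (g + d) - SV g <= d * OV (g + d) / 2" if "0 <= g" "0 <= d" for g d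
  using V.scal_increment[OF that] by simp
qed (use V.ovl_continuous U.ovl_strict_mono[OF varU] V.ovl_strict_mono[OF varV] U.ovl_bounds V.ovl_bounds(1) al lam in auto)

lemma clipped: "clipped_seq PU PV m al (real (Suc k))"
 by (intro clipped_seq.intro clipped_seq_axioms.intro U.prior_axioms V.prior_axioms al ratio) simp

text \<open>For the upper bound the velocity is \<open>x y = al * OV (lam * y)\<close>: the value
  along the line of \<open>y\<close> is then the potential at \<open>(y, OV (lam * y))\<close>,
  which is at most the optimum. For the lower bound the velocity is \<open>al * qv\<close> with the
  optimal \<open>qv\<close>, and the required inequality in \<open>b\<close> says that
  \<open>qu\<close> minimises the potential for this \<open>qv\<close>, tested at
  \<open>b / lam\<close>.\<close>

lemma free_energy_tendsto:
 assumes st: "R.stat qu qv" and qv: "0 <= qv" and mx: "!!q. 0 <= q ==> \<exists>s\<ge>0. R.Pot s q <= R.Pot qu qv"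
 shows "(%n. free_energy PU PV n (m n) lam) \<longlonglongrightarrow> R.Pot qu qv"
proof -
 define L where "L = R.Pot qu qv"
 have below: "R.Pot s (OV (lam * s)) <= L" if s: "0 <= s" for s
 proof -
  obtain s' where s': "0 <= s'" "R.Pot s' (OV (lam * s)) <= L" using mx[OF R.W_nonneg[of "lam * s"]] by (auto simp: L_def)
  thus ?thesis using R.stat_min[OF R.stat_W[OF s] s'(1)] by linarith
 qed
 obtain B where B: "0 < B" "L <= al * SV B - al * qv * B / 2" using R.coercive[OF st] by blast
 have EV: "OV g <= V.E2" for g by (rule V.ovl_bounds(2))
 have main: "\<forall>\<^sub>F n in sequentially. L - eps <= free_energy PU PV n (m n) lam \<and> free_energy PU PV n (m n) lam <= L + eps" if eps: "0 < eps" for eps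
 proof -
  define eps1 where "eps1 = eps / (4 * (1 + al))"
  have e1: "0 < eps1" using eps al by (simp add: eps1_def)
  have "eps1 * (1 + al) = eps / 4"
  proof -
   have cancel: "x / (4 * y) * y = x / 4" if "y \<noteq> 0" for x y :: real using that by simp
   show ?thesis unfolding eps1_def by (rule cancel) (use al in simp)
  qed
  hence e2: "eps1 + al * eps1 = eps / 4" by (simp add: algebra_simps)
  define X where "X = al * V.E2"
  have X0: "0 <= X" using al by (simp add: X_def)
  have BU: "0 <= lam * X + lam * al * qv" and BV: "0 <= lam * U.E2 + B" using lam al qv X0 B by auto
  \<comment> \<open>A single clipping level serves both bounds and the matrix model; it is fixed
    before \<open>n\<close> grows.\<close>
  obtain k where kU: "!!g. 0 <= g ==> g <= lam * X + lam * al * qv ==> \<bar>SU g - scal PU (clip (real (Suc k))) g\<bar> <= eps1"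
   and kV: "!!g. 0 <= g ==> g <= lam * U.E2 + B ==> \<bar>SV g - scal PV (clip (real (Suc k))) g\<bar> <= eps1"
   and kF: "!!n m. 1 <= n ==> \<bar>free_energy PU PV n m lam - clipped_model.F PU PV n m (real (Suc k)) lam 0 0\<bar> <= real m / real n * eps1"
  proof -
   note ev = eventually_conj[OF U.scal_uniform[OF e1 BU]
     eventually_conj[OF V.scal_uniform[OF e1 BV] free_energy_uniform[OF U.prior_axioms V.prior_axioms e1 less_imp_le[OF lam]]]]
   obtain k where k: "\<forall>g\<in>{0..lam * X + lam * al * qv}. \<bar>SU g - scal PU (clip (real (Suc k))) g\<bar> <= eps1"
    "\<forall>g\<in>{0..lam * U.E2 + B}. \<bar>SV g - scal PV (clip (real (Suc k))) g\<bar> <= eps1"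
    "\<forall>n\<ge>1. \<forall>m. \<bar>free_energy PU PV n m lam - clipped_model.F PU PV n m (real (Suc k)) lam 0 0\<bar> <= real m / real n * eps1"
    using eventually_happens'[OF sequentially_bot ev] by blast
   show thesis by (rule that[of k]) (use k in \<open>simp_all only: atLeastAtMost_iff Ball_def simp_thms\<close>)
  qed
  interpret C: clipped_seq PU PV m al "real (Suc k)" by (rule clipped)
  have up: "\<forall>\<^sub>F n in sequentially. C.FF n lam 0 0 <= (L + eps / 4) + eps / 4"
  proof (rule C.limsup_bound[where x="%y. al * OV (lam * y)" and X=X])
   show "0 <= al * OV (lam * y) \<and> al * OV (lam * y) <= X" for y
    using al R.W_nonneg EV by (auto simp: X_def)
   fix y assume y: "y \<in> {0..U.E2}"
   let ?x = "al * OV (lam * y)"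
   have x: "0 <= ?x" "?x <= X" using al R.W_nonneg EV by (auto simp: X_def)
   have "0 <= lam * ?x" "lam * ?x <= lam * X + lam * al * qv"
    using x lam al qv mult_left_mono[OF x(2), of lam] by (auto intro: add_increasing2)
   from kU[OF this] have 1: "scal PU (clip (real (Suc k))) (lam * ?x) <= SU (lam * ?x) + eps1" by linarith
   have "0 <= lam * y" "lam * y <= lam * U.E2 + B"
    using y lam B mult_left_mono[of y U.E2 lam] by (auto intro: add_increasing2)
   from kV[OF this] have "scal PV (clip (real (Suc k))) (lam * y) <= SV (lam * y) + eps1" by linarith
   hence 2: "al * scal PV (clip (real (Suc k))) (lam * y) <= al * (SV (lam * y) + eps1)" using al by (intro mult_left_mono) auto
   have "R.Pot y (OV (lam * y)) <= L" using y by (intro below) auto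
   thus "scal PU (clip (real (Suc k))) (lam * ?x) + al * scal PV (clip (real (Suc k))) (lam * y) - lam * ?x * y / 2 <= L + eps / 4"
    using 1 2 e2 unfolding R.Pot_def by (simp add: algebra_simps)
  qed (use lam eps in auto)
  have lo: "\<forall>\<^sub>F n in sequentially. (L - eps / 4) - eps / 4 <= C.FF n lam 0 0"
  proof (rule C.liminf_bound[where x="al * qv" and B=B])
   show "L - eps / 4 <= scal PU (clip (real (Suc k))) (lam * (al * qv)) + al * scal PV (clip (real (Suc k))) b - al * qv * b / 2" if b: "b \<in> {0..B}" for b
   proof -
    have "\<bar>SU (lam * (al * qv)) - scal PU (clip (real (Suc k))) (lam * (al * qv))\<bar> <= eps1"
     using lam al qv X0 by (intro kU) (auto simp: mult.assoc)
    moreover have "\<bar>SV b - scal PV (clip (real (Suc k))) b\<bar> <= eps1" using b lam by (intro kV) (auto intro: add_increasing)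
    hence "al * (SV b - eps1) <= al * scal PV (clip (real (Suc k))) b" using al by (intro mult_left_mono) auto
    moreover have "L <= R.Pot (b / lam) qv" unfolding L_def using b lam by (intro R.stat_min[OF st]) auto
    moreover have "R.Pot (b / lam) qv = SU (lam * (al * qv)) + al * SV b - al * qv * b / 2"
    proof -
     have e: "lam * (b / lam) = b" "lam * al / 2 * (b / lam) * qv = al * qv * b / 2" using lam by simp_all
     show ?thesis unfolding R.Pot_def e by (simp only: mult.assoc)
    qed
    ultimately show ?thesis using e2 by (simp add: right_diff_distrib abs_le_iff)
   qed
   show "L - eps / 4 <= al * scal PV (clip (real (Suc k))) B - al * qv * B / 2"
   proof -
    have "\<bar>SV B - scal PV (clip (real (Suc k))) B\<bar> <= eps1" using B lam by (intro kV) (auto intro: add_increasing)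
    hence "al * (SV B - eps1) <= al * scal PV (clip (real (Suc k))) B" using al by (intro mult_left_mono) auto
    thus ?thesis using B(2) e1 e2 by (simp add: right_diff_distrib)
   qed
  qed (use lam eps al qv B in auto)
  have tr: "\<forall>\<^sub>F n in sequentially. real (m n) / real n < al + 1" using order_tendstoD(2)[OF ratio, of "al + 1"] by simp
  show ?thesis using up lo tr eventually_ge_at_top[of 1]
  proof eventually_elim
   case (elim n)
   have "real (m n) / real n * eps1 <= (al + 1) * eps1" using elim e1 by (intro mult_right_mono) auto
   also have "... = eps / 4" using e2 by (simp add: algebra_simps)
   finally have "\<bar>free_energy PU PV n (m n) lam - C.FF n lam 0 0\<bar> <= eps / 4" using kF[OF elim(4), of "m n"] by linarith
   thus ?case using elim(1,2) eps by linarith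
  qed
 qed
 show ?thesis unfolding L_def[symmetric]
 proof (rule tendstoI)
  fix e :: real assume e: "0 < e"
  hence "\<forall>\<^sub>F n in sequentially. L - e / 2 <= free_energy PU PV n (m n) lam \<and> free_energy PU PV n (m n) lam <= L + e / 2" by (intro main) simp
  thus "\<forall>\<^sub>F n in sequentially. dist (free_energy PU PV n (m n) lam) L < e"
  proof eventually_elim
   case (elim n)
   thus ?case using e unfolding dist_real_def by linarith
  qed
 qed
qed

lemma rs_potential_eq: "0 <= qu ==> 0 <= qv ==> rs_potential PU PV lam al qu qv = R.Pot qu qv"
 unfolding rs_potential_def R.Pot_def using al lam by (simp add: U.psi_eq_scal V.psi_eq_scal)

lemma Gamma_iff: "(qu, qv) \<in> Gamma_set PU PV lam al \<longleftrightarrow> 0 <= qu \<and> 0 <= qv \<and> qu = OU (lam * al * qv) \<and> qv = OV (lam * qu)"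
 unfolding Gamma_set_def by (simp add: U.overlap_eq_ovl V.overlap_eq_ovl)

lemma inf_le: "0 <= qu ==> 0 <= qv ==> inf_potential PU PV lam al qv <= ereal (R.Pot qu qv)"
 unfolding inf_potential_def rs_potential_eq[symmetric] by (rule INF_lower) simp

lemma inf_stat: "R.stat qu qv ==> 0 <= qv ==> inf_potential PU PV lam al qv = ereal (R.Pot qu qv)"
proof (rule antisym)
 assume st: "R.stat qu qv" and qv: "0 <= qv"
 show "inf_potential PU PV lam al qv <= ereal (R.Pot qu qv)" using st qv by (intro inf_le) (auto simp: R.stat_def)
 show "ereal (R.Pot qu qv) <= inf_potential PU PV lam al qv"
  unfolding inf_potential_def using R.stat_min[OF st] qv by (intro INF_greatest) (auto simp: rs_potential_eq)
qed

text \<open>The common value \<open>L\<close> is that of an optimal stationary couple. Every couple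
  of \<open>Gamma_set\<close> is stationary, so its potential equals \<open>inf_potential\<close>
  there and is at most \<open>L\<close>. Conversely, a couple attaining both extrema is stationary
  by \<open>min_stat\<close> and a fixed point by \<open>optimal_fixed_point\<close>.\<close>

lemma conclusion:
 "(%n. ereal (free_energy PU PV n (m n) lam)) \<longlonglongrightarrow> sup_Gamma PU PV lam al
  \<and> sup_Gamma PU PV lam al = sup_inf PU PV lam al
  \<and> (\<exists>(qu, qv) \<in> Gamma_set PU PV lam al. ereal (rs_potential PU PV lam al qu qv) = sup_Gamma PU PV lam al)
  \<and> (\<forall>qu \<ge> 0. \<forall>qv \<ge> 0.
    (qu, qv) \<in> Gamma_set PU PV lam al \<and> ereal (rs_potential PU PV lam al qu qv) = sup_Gamma PU PV lam al
    \<longleftrightarrow> inf_potential PU PV lam al qv = sup_inf PU PV lam al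
     \<and> ereal (rs_potential PU PV lam al qu qv) = inf_potential PU PV lam al qv)"
proof -
 obtain au av where st: "R.stat au av" and av: "0 <= av" and mx: "!!q. 0 <= q ==> \<exists>s\<ge>0. R.Pot s q <= R.Pot au av"
  using R.exists_optimal by blast
 define L where "L = R.Pot au av"
 have inf_L: "inf_potential PU PV lam al q <= ereal L" if q: "0 <= q" for q
 proof -
  obtain s where "0 <= s" "R.Pot s q <= L" using mx[OF q] by (auto simp: L_def)
  thus ?thesis using inf_le[of s q] q order_trans by fastforce
 qed
 have si: "sup_inf PU PV lam al = ereal L" unfolding sup_inf_def
 proof (rule antisym)
  show "(SUP qv\<in>{0..}. inf_potential PU PV lam al qv) <= ereal L" using inf_L by (intro SUP_least) auto
  have "ereal L = inf_potential PU PV lam al av" using inf_stat[OF st av] by (simp add: L_def)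
  also have "... <= (SUP qv\<in>{0..}. inf_potential PU PV lam al qv)" using av by (intro SUP_upper) auto
  finally show "ereal L <= (SUP qv\<in>{0..}. inf_potential PU PV lam al qv)" .
 qed
 have opt: "(qu, qv) \<in> Gamma_set PU PV lam al" if s: "R.stat qu qv" and qv: "0 <= qv" and e: "R.Pot qu qv = L" for qu qv
 proof -
  have "R.Pot s (OV (lam * s)) <= R.Pot qu qv" if "0 <= s" for s
   using inf_L[OF R.W_nonneg[of "lam * s"]] inf_stat[OF R.stat_W[OF that] R.W_nonneg] e by simp
  from R.optimal_fixed_point[OF s qv this] show ?thesis using s qv unfolding Gamma_iff R.stat_def by blast
 qed
 have GS: "R.stat qu qv \<and> 0 <= qu \<and> 0 <= qv" if "(qu, qv) \<in> Gamma_set PU PV lam al" for qu qv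
  using that unfolding Gamma_iff R.stat_def by blast
 have ain: "(au, av) \<in> Gamma_set PU PV lam al" by (rule opt[OF st av]) (simp add: L_def)
 have aL: "rs_potential PU PV lam al au av = L" using st av by (simp add: rs_potential_eq L_def R.stat_def)
 have sG: "sup_Gamma PU PV lam al = ereal L" unfolding sup_Gamma_def
 proof (rule antisym)
  show "(SUP (qu, qv)\<in>Gamma_set PU PV lam al. ereal (rs_potential PU PV lam al qu qv)) <= ereal L"
  proof (rule SUP_least, clarify)
   fix qu qv assume G: "(qu, qv) \<in> Gamma_set PU PV lam al"
   show "ereal (rs_potential PU PV lam al qu qv) <= ereal L"
    using GS[OF G] inf_L[of qv] inf_stat[of qu qv] by (simp add: rs_potential_eq)
  qed
  show "ereal L <= (SUP (qu, qv)\<in>Gamma_set PU PV lam al. ereal (rs_potential PU PV lam al qu qv))"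
   using SUP_upper[OF ain, of "%(qu, qv). ereal (rs_potential PU PV lam al qu qv)"] aL by simp
 qed
 have lim: "(%n. ereal (free_energy PU PV n (m n) lam)) \<longlonglongrightarrow> ereal L"
  unfolding L_def by (intro tendsto_intros free_energy_tendsto[OF st av mx])
 have iff: "(qu, qv) \<in> Gamma_set PU PV lam al \<and> ereal (rs_potential PU PV lam al qu qv) = ereal L
   \<longleftrightarrow> inf_potential PU PV lam al qv = ereal L \<and> ereal (rs_potential PU PV lam al qu qv) = inf_potential PU PV lam al qv"
  if q: "0 <= qu" "0 <= qv" for qu qv
 proof
  assume G: "(qu, qv) \<in> Gamma_set PU PV lam al \<and> ereal (rs_potential PU PV lam al qu qv) = ereal L"
  hence "R.stat qu qv" using GS by blast
  from inf_stat[OF this q(2)] show "inf_potential PU PV lam al qv = ereal L \<and> ereal (rs_potential PU PV lam al qu qv) = inf_potential PU PV lam al qv"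
   using G by (simp add: rs_potential_eq[OF q])
 next
  assume I: "inf_potential PU PV lam al qv = ereal L \<and> ereal (rs_potential PU PV lam al qu qv) = inf_potential PU PV lam al qv"
  hence "ereal (rs_potential PU PV lam al qu qv) = ereal L" by metis
  hence e: "R.Pot qu qv = L" by (simp add: rs_potential_eq[OF q])
  have "R.Pot qu qv <= R.Pot s qv" if "0 <= s" for s
   using inf_le[OF that q(2)] I e by simp
  from R.min_stat[OF q(1) this] have "R.stat qu qv" .
  from opt[OF this q(2) e] show "(qu, qv) \<in> Gamma_set PU PV lam al \<and> ereal (rs_potential PU PV lam al qu qv) = ereal L"
   using I by simp
 qed
 show ?thesis unfolding sG si using lim ain aL iff by auto
qed

end

theorem theorem1:
  fixes PU PV :: "real measure" and alpha lam :: real and m :: "nat \<Rightarrow> nat"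
  assumes "real_distribution PU" and "real_distribution PV"
    and "integrable PU (\<lambda>x. x\<^sup>2)" and "integrable PV (\<lambda>x. x\<^sup>2)"
    and "prob_space.variance PU (\<lambda>x. x) > 0" and "prob_space.variance PV (\<lambda>x. x) > 0"
    and "alpha > 0"
    and "\<And>n. n \<ge> 1 \<Longrightarrow> m n \<ge> 1"
    and "(\<lambda>n. real (m n) / real n) \<longlonglongrightarrow> alpha"
    and "lam > 0"
  shows "(\<lambda>n. ereal (free_energy PU PV n (m n) lam)) \<longlonglongrightarrow> sup_Gamma PU PV lam alpha
    \<and> sup_Gamma PU PV lam alpha = sup_inf PU PV lam alpha
    \<and> (\<exists>(qu, qv) \<in> Gamma_set PU PV lam alpha.
         ereal (rs_potential PU PV lam alpha qu qv) = sup_Gamma PU PV lam alpha)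
    \<and> (\<forall>qu \<ge> 0. \<forall>qv \<ge> 0.
         (qu, qv) \<in> Gamma_set PU PV lam alpha
           \<and> ereal (rs_potential PU PV lam alpha qu qv) = sup_Gamma PU PV lam alpha
         \<longleftrightarrow>
         inf_potential PU PV lam alpha qv = sup_inf PU PV lam alpha
           \<and> ereal (rs_potential PU PV lam alpha qu qv) = inf_potential PU PV lam alpha qv)"
proof -
 interpret U: prior PU by (rule prior.intro) fact+
 interpret V: prior PV by (rule prior.intro) fact+
 interpret rs_limit PU PV m alpha lam
 proof
  show "0 < U.var" "0 < V.var" using assms(5,6) by (simp_all add: U.var_def V.var_def)
 qed fact+
 show ?thesis by (rule conclusion)
qed

end
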